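(* Let $M\ge1$, $\sigma_1,\dots,\sigma_M>0$, $a_1,\dots,a_M\in[0,1]$ with $\sum_i a_i=1$, and work in dimension one. Let $V_1,\dots,V_M:\mathbb{R}\to\mathbb{R}$ satisfy: (H1) each $V_i$ is twice continuously differentiable; (H2) for each $i$, $\lim_{|x|\to+\infty}V_i''(x)=+\infty$; (H3) there exist an integer $p\ge2$ and $C>0$ such that $\sum_{i=1}^M|V_i'(x)|\le C(1+|x|^{2p-1})$ for all $x\in\mathbb{R}$. Let $F_{ij}(x)=\frac{\alpha_{ij}}2x^2$ with $\alpha_{ij}=\alpha_{ji}\in\mathbb{R}$ for $1\le i,j\le M$ and $\alpha_{ii}>0$ for all $i$. Let $\mu_t=(\mu_t^1,\dots,\mu_t^M)$, $t\ge0$, be the solution of $$\partial_t\mu^i_t=\partial_x\Big[\Big(V_i'+\sum_{j=1}^M a_j F_{ij}'*\mu_t^j\Big)\mu_t^i\Big]+\frac{\sigma_i^2}2\partial_x^2\mu_t^i,\qquad i=1,\dots,M,$$ on $\mathbb{R}$, with initial data as described in the context. Then there exist a stationary state $(\mu_\infty^1,\dots,\mu_\infty^M)$ and a sequence $(t_k)_{k\in\mathbb{N}}$ tending to infinity such that, for any $1\le\ell\le M$, $\mu^\ell_{t_k}$ converges weakly to $\mu_\infty^\ell$ as $k\to+\infty$.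
   Context: Standing assumptions: the initial probability measures $\mu_0^i$ on $\mathbb{R}$ are absolutely continuous with respect to Lebesgue measure, with finite entropy and finite moments of order $8p^2$ (so that the $\mu^i_t$ have densities, still denoted $\mu^i_t$, and their moments of order $8p^2$ are bounded uniformly in time). A stationary state is an $M$-tuple of probability measures solving the stationary version ($\partial_t\mu^i=0$) of the PDE system. Convention: "weak convergence" refers to convergence of densities in the norm $\mathcal N(f)=\int_{\mathbb{R}}(1+|x|^{8p^2})|f(x)|\,dx$. *)

theory Defs
  imports "HOL-Probability.Probability"
begin

definition C2 :: "(real \<Rightarrow> real) \<Rightarrow> bool" where
  "C2 f \<longleftrightarrow>
     (\<forall>x. f differentiable (at x)) \<and>
     (\<forall>x. deriv f differentiable (at x)) \<and>
     continuous_on UNIV (deriv (deriv f))"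

definition test_function :: "(real \<Rightarrow> real) \<Rightarrow> bool" where
  "test_function \<phi> \<longleftrightarrow> C2 \<phi> \<and> compact (closure {x. \<phi> x \<noteq> 0})"

definition probability_on_reals :: "real measure \<Rightarrow> bool" where
  "probability_on_reals \<nu> \<longleftrightarrow> prob_space \<nu> \<and> sets \<nu> = sets borel"

definition convolve :: "(real \<Rightarrow> real) \<Rightarrow> real measure \<Rightarrow> real \<Rightarrow> real" where
  "convolve f \<nu> x = (\<integral>y. f (x - y) \<partial>\<nu>)"

definition drift ::
  "nat \<Rightarrow> (nat \<Rightarrow> real) \<Rightarrow> (nat \<Rightarrow> real \<Rightarrow> real) \<Rightarrow> (nat \<Rightarrow> nat \<Rightarrow> real \<Rightarrow> real) \<Rightarrow>
   (nat \<Rightarrow> real measure) \<Rightarrow> nat \<Rightarrow> real \<Rightarrow> real" where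
  "drift M a V F \<nu> i x =
     deriv (V i) x + (\<Sum>j = 1..M. a j * convolve (deriv (F i j)) (\<nu> j) x)"

text \<open>
  The right-hand side of the \<open>i\<close>-th equation, evaluated at the tuple \<open>\<nu>\<close> and paired with a
  test function \<open>\<phi>\<close>: all derivatives have been moved onto \<open>\<phi>\<close> by integration by parts.
\<close>

definition weak_rhs ::
  "nat \<Rightarrow> (nat \<Rightarrow> real) \<Rightarrow> (nat \<Rightarrow> real) \<Rightarrow> (nat \<Rightarrow> real \<Rightarrow> real) \<Rightarrow>
   (nat \<Rightarrow> nat \<Rightarrow> real \<Rightarrow> real) \<Rightarrow> (nat \<Rightarrow> real measure) \<Rightarrow> nat \<Rightarrow> (real \<Rightarrow> real) \<Rightarrow> real" where
  "weak_rhs M \<sigma> a V F \<nu> i \<phi> =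
     (\<integral>x. (\<sigma> i)\<^sup>2 / 2 * deriv (deriv \<phi>) x - drift M a V F \<nu> i x * deriv \<phi> x \<partial>(\<nu> i))"

text \<open>
  Weak (distributional) solutions on \<open>[0, \<infinity>)\<close>; the values \<open>\<mu> t\<close> for \<open>t < 0\<close> are irrelevant.
  First moments are required to be bounded on compact time intervals, so that the convolutions
  with the affine functions \<open>F\<^sub>i\<^sub>j'\<close> are genuine integrals.  Integrability in time is
  stated explicitly because the integral of a non-integrable function is zero by convention.
\<close>

definition solution ::
  "nat \<Rightarrow> (nat \<Rightarrow> real) \<Rightarrow> (nat \<Rightarrow> real) \<Rightarrow> (nat \<Rightarrow> real \<Rightarrow> real) \<Rightarrow>
   (nat \<Rightarrow> nat \<Rightarrow> real \<Rightarrow> real) \<Rightarrow> (real \<Rightarrow> nat \<Rightarrow> real measure) \<Rightarrow> bool" where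
  "solution M \<sigma> a V F \<mu> \<longleftrightarrow>
     (\<forall>t\<ge>0. \<forall>i\<in>{1..M}. probability_on_reals (\<mu> t i)) \<and>
     (\<forall>T\<ge>0. \<exists>B. \<forall>t\<in>{0..T}. \<forall>i\<in>{1..M}.
        integrable (\<mu> t i) (\<lambda>x. \<bar>x\<bar>) \<and> (\<integral>x. \<bar>x\<bar> \<partial>(\<mu> t i)) \<le> B) \<and>
     (\<forall>i\<in>{1..M}. \<forall>\<phi>. test_function \<phi> \<longrightarrow> (\<forall>t\<ge>0.
        set_integrable lborel {0..t} (\<lambda>s. weak_rhs M \<sigma> a V F (\<mu> s) i \<phi>) \<and>
        (\<integral>x. \<phi> x \<partial>(\<mu> t i)) =
          (\<integral>x. \<phi> x \<partial>(\<mu> 0 i)) + (LBINT s:{0..t}. weak_rhs M \<sigma> a V F (\<mu> s) i \<phi>)))"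

definition stationary_state ::
  "nat \<Rightarrow> (nat \<Rightarrow> real) \<Rightarrow> (nat \<Rightarrow> real) \<Rightarrow> (nat \<Rightarrow> real \<Rightarrow> real) \<Rightarrow>
   (nat \<Rightarrow> nat \<Rightarrow> real \<Rightarrow> real) \<Rightarrow> (nat \<Rightarrow> real measure) \<Rightarrow> bool" where
  "stationary_state M \<sigma> a V F \<nu> \<longleftrightarrow>
     (\<forall>i\<in>{1..M}. probability_on_reals (\<nu> i) \<and> integrable (\<nu> i) (\<lambda>x. \<bar>x\<bar>)) \<and>
     (\<forall>i\<in>{1..M}. \<forall>\<phi>. test_function \<phi> \<longrightarrow> weak_rhs M \<sigma> a V F \<nu> i \<phi> = 0)"

definition is_density :: "(real \<Rightarrow> real) \<Rightarrow> real measure \<Rightarrow> bool" where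
  "is_density u \<nu> \<longleftrightarrow>
     u \<in> borel_measurable borel \<and> (\<forall>x. 0 \<le> u x) \<and> \<nu> = density lborel (\<lambda>x. ennreal (u x))"

text \<open>Since \<open>ln 0 = 0\<close>, the integrand below follows the convention \<open>0 log 0 = 0\<close>.\<close>

definition finite_entropy :: "real measure \<Rightarrow> bool" where
  "finite_entropy \<nu> \<longleftrightarrow> (\<exists>u. is_density u \<nu> \<and> integrable lborel (\<lambda>x. u x * ln (u x)))"

text \<open>The weighted norm, with value \<open>\<infinity>\<close> when the integral diverges.\<close>

definition weighted_norm :: "nat \<Rightarrow> (real \<Rightarrow> real) \<Rightarrow> ennreal" where
  "weighted_norm p f = (\<integral>\<^sup>+x. ennreal ((1 + \<bar>x\<bar> ^ (8 * p\<^sup>2)) * \<bar>f x\<bar>) \<partial>lborel)"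

text \<open>
  Convergence of densities in the weighted norm.  The existence of the densities is part of the
  assertion; as they are unique almost everywhere, their choice does not matter.
\<close>

definition converges_weakly :: "nat \<Rightarrow> (nat \<Rightarrow> real measure) \<Rightarrow> real measure \<Rightarrow> bool" where
  "converges_weakly p \<nu>s \<nu> \<longleftrightarrow>
     (\<exists>us u. (\<forall>k. is_density (us k) (\<nu>s k)) \<and> is_density u \<nu> \<and>
        (\<lambda>k. weighted_norm p (\<lambda>x. us k x - u x)) \<longlonglongrightarrow> 0)"

end

theory Submission imports Defs "HOL-Real_Asymp.Real_Asymp" begin

text \<open>Since every \<open>F i j\<close> is quadratic, the equations are coupled only through the means: the \<open>i\<close>-th
  component solves a linear Fokker--Planck equation with drift term \<open>b i x - h i t\<close>, where \<open>b i\<close> is the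
  derivative of a confining potential \<open>W i\<close> and \<open>h i\<close> is a linear combination of the means.  The free
  energy, weighted by \<open>a i\<close>, is a Lyapunov function because the interaction matrix is symmetric.
  A weak solution is too rough to differentiate its entropy, so the solution is mollified first.  The
  kernel has polynomial tails: it dominates its own derivatives, and the logarithm of the mollified
  density grows slower than the available moments.  The dissipation \<open>J\<^sup>2 / u\<close> controls
  the flux tested against bounded functions, and this dual bound survives the limit of vanishing
  mollification.

  The energy bound makes \<open>h i\<close> bounded with square integrable derivative.  Hence the dissipation of
  each component is \<open>o(T)\<close> on \<open>{0..T}\<close>, and a Lyapunov estimate for \<open>wt x ^ Q\<close> bounds the time
  average of the integral of a function growing faster than \<open>wt x ^ Q\<close>.  Along suitable times the
  dissipations tend to zero, these integrals stay bounded and the mean fields converge.  A small flux means that the quotient of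
  the solution and the Gibbs density for the current mean field is almost constant, uniformly on
  compact sets, so the densities converge to Gibbs densities in the weighted norm.  The means of
  these limits are the limits of the means, which makes them a stationary state.\<close>

section \<open>Polynomial weights\<close>

text \<open>No dissipation is ever assigned to the solution itself. Each scale \<open>n\<close> of
  the mollifier has its own dissipation, continuous in time, and only bounds valid for infinitely
  many \<open>n\<close> are carried over. Hence the shape of the statements: for a fixed horizon a
  time integral is bounded for all large \<open>n\<close>, at a fixed time a value is bounded
  frequently in \<open>n\<close>, and the dual estimate of the flux asks for no more. Mollification
  leaves a commutator between multiplication by the drift and convolution. Growth is controlled for
  the drift but not for its derivative, so the commutator carries no rate in the scale; a weighted
  modulus of continuity makes it small once the horizon is fixed. This is harmless because the
  constants of the energy estimate do not depend on the horizon, only the threshold for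
  \<open>n\<close> does. Densities at the selected times do not come from regularity theory: a
  measure with finite flux compares with multiples of the Gibbs density on bounded Borel sets, which
  gives absolute continuity and convergence at once.\<close>

definition wt :: "real \<Rightarrow> real" where "wt x = 1 + x\<^sup>2"

lemma wt_ge_1 [simp]: "1 \<le> wt x" and wt_pos [simp]: "0 < wt x" and wt_nonneg [simp]: "0 \<le> wt x"
  and wt_nonzero [simp]: "wt x \<noteq> 0"
  by (auto simp: wt_def add_nonneg_eq_0_iff intro: add_pos_nonneg)

lemma wt_pow_ge_1 [simp]: "1 \<le> wt x ^ n"
  by simp

lemma wt_pow_mono: "i \<le> j \<Longrightarrow> wt x ^ i \<le> wt x ^ j"
  by (rule power_increasing) auto

lemma wt_even [simp]: "wt (- x) = wt x"
  by (simp add: wt_def)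

lemma wt_measurable [measurable]: "wt \<in> borel_measurable borel"
  unfolding wt_def by measurable

lemma continuous_on_wt [continuous_intros]:
  "continuous_on A f \<Longrightarrow> continuous_on A (\<lambda>x. wt (f x))"
  unfolding wt_def by (intro continuous_intros)

lemma wt_deriv [derivative_intros]:
  "(f has_real_derivative f') (at x within A) \<Longrightarrow>
    ((\<lambda>x. wt (f x)) has_real_derivative 2 * f x * f') (at x within A)"
  unfolding wt_def by (auto intro!: derivative_eq_intros)

text \<open>The difference of the two sides is a sum of nonnegative terms. The estimate splits a
  weight at \<open>x + y\<close> into a part paid by moments of the solution and a part paid by the
  decay of the kernel.\<close>

lemma wt_peetre: "wt (x + y) \<le> 2 * wt x * wt y"
proof -
  have "0 \<le> (x - y)\<^sup>2" "0 \<le> x\<^sup>2 * y\<^sup>2" by auto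
  moreover have "2 * wt x * wt y - wt (x + y) = 1 + (x - y)\<^sup>2 + 2 * (x\<^sup>2 * y\<^sup>2)"
    by (simp add: wt_def power2_eq_square algebra_simps)
  ultimately show ?thesis by linarith
qed

lemma wt_peetre_pow: "wt (x + y) ^ n \<le> 2 ^ n * wt x ^ n * wt y ^ n"
  using power_mono[OF wt_peetre, of x y n] by (simp add: power_mult_distrib)

lemma abs_le_wt: "\<bar>x\<bar> \<le> wt x"
proof -
  have "0 \<le> (\<bar>x\<bar> - 1)\<^sup>2 + x\<^sup>2" by simp
  then show ?thesis by (simp add: wt_def power2_eq_square algebra_simps abs_if split: if_splits)
qed

lemma square_le_wt: "x\<^sup>2 \<le> wt x"
  by (simp add: wt_def)

lemma integrable_inverse_wt: "integrable lborel (\<lambda>x. 1 / wt x)"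
  using integrable_inverse_1_plus_square
  by (simp add: set_integrable_def wt_def divide_inverse)

lemma integrable_wt_bound:
  assumes "f \<in> borel_measurable borel" "\<And>x. \<bar>f x\<bar> \<le> C / wt x"
  shows "integrable lborel f"
proof (rule Bochner_Integration.integrable_bound)
  show "integrable lborel (\<lambda>x. C * (1 / wt x))"
    by (intro integrable_mult_right integrable_inverse_wt)
  show "AE x in lborel. norm (f x) \<le> norm (C * (1 / wt x))"
  proof (rule AE_I2)
    fix x
    have "\<bar>f x\<bar> \<le> C * (1 / wt x)" using assms(2) by simp
    also have "\<dots> \<le> norm (C * (1 / wt x))" unfolding real_norm_def by (rule abs_ge_self)
    finally show "norm (f x) \<le> norm (C * (1 / wt x))" by simp
  qed
qed (use assms in auto)

lemma wt_div_pow_le: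
  assumes "i + 1 \<le> j"
  shows "wt x ^ i / wt x ^ j \<le> 1 / wt x"
proof -
  have "wt x ^ i * wt x \<le> wt x ^ j"
    using wt_pow_mono[OF assms, of x] by (simp add: mult.commute)
  then show ?thesis by (simp add: divide_simps ac_simps)
qed

section \<open>Parameter integrals\<close>

text \<open>The mean value inequality bounds the difference quotients by \<open>g\<close>, and
  dominated convergence applies along sequences. The derivative is taken within a convex set so that
  \<open>{0..T}\<close> is covered up to its end points.\<close>

lemma has_real_derivative_integral_dominated:
  fixes f :: "real \<Rightarrow> 'a \<Rightarrow> real"
  assumes S: "convex S" "t \<in> S"
    and int: "\<And>t. t \<in> S \<Longrightarrow> integrable M (f t)"
    and der: "\<And>t x. t \<in> S \<Longrightarrow> x \<in> space M \<Longrightarrow>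
      ((\<lambda>t. f t x) has_real_derivative f' t x) (at t within S)"
    and bd: "\<And>t x. t \<in> S \<Longrightarrow> x \<in> space M \<Longrightarrow> \<bar>f' t x\<bar> \<le> g x"
    and g: "integrable M g"
    and meas: "f' t \<in> borel_measurable M"
  shows "((\<lambda>t. \<integral>x. f t x \<partial>M) has_real_derivative (\<integral>x. f' t x \<partial>M)) (at t within S)"
  unfolding has_field_derivative_iff tendsto_at_iff_sequentially comp_def
proof (intro allI impI)
  fix X assume X: "\<forall>i::nat. X i \<in> S - {t}" and lim: "X \<longlonglongrightarrow> t"
  have lip: "\<bar>f y x - f t x\<bar> \<le> g x * \<bar>y - t\<bar>" if "y \<in> S" "x \<in> space M" for y x
    using field_differentiable_bound[OF S(1), of "\<lambda>t. f t x" "\<lambda>t. f' t x" "g x" y t] der bd S(2) that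
    by auto
  have "(\<lambda>i. \<integral>x. (f (X i) x - f t x) / (X i - t) \<partial>M) \<longlonglongrightarrow> (\<integral>x. f' t x \<partial>M)"
  proof (rule integral_dominated_convergence[where w = g])
    show "f' t \<in> borel_measurable M" by (rule meas)
    show "(\<lambda>x. (f (X i) x - f t x) / (X i - t)) \<in> borel_measurable M" for i
      using int[of t] int[of "X i"] X S(2)
      by (intro borel_measurable_divide borel_measurable_diff) auto
    show "AE x in M. (\<lambda>i. (f (X i) x - f t x) / (X i - t)) \<longlonglongrightarrow> f' t x"
    proof (rule AE_I2)
      fix x assume "x \<in> space M"
      from der[OF S(2) this] show "(\<lambda>i. (f (X i) x - f t x) / (X i - t)) \<longlonglongrightarrow> f' t x"
        unfolding has_field_derivative_iff tendsto_at_iff_sequentially comp_def using X lim by blast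
    qed
    show "AE x in M. norm ((f (X i) x - f t x) / (X i - t)) \<le> g x" for i
    proof (rule AE_I2)
      fix x assume x: "x \<in> space M"
      have "X i \<in> S" "X i \<noteq> t" using X by auto
      then show "norm ((f (X i) x - f t x) / (X i - t)) \<le> g x"
        using lip[OF _ x, of "X i"] by (simp add: abs_divide divide_le_eq)
    qed
  qed (rule g)
  moreover have "(\<integral>x. (f (X i) x - f t x) / (X i - t) \<partial>M)
      = ((\<integral>x. f (X i) x \<partial>M) - (\<integral>x. f t x \<partial>M)) / (X i - t)" for i
  proof -
    have "X i \<in> S" "X i \<noteq> t" using X by auto
    then show ?thesis using int[of t] int[of "X i"] S(2) by (simp add: Bochner_Integration.integral_diff)
  qed
  ultimately show "(\<lambda>i. ((\<integral>x. f (X i) x \<partial>M) - (\<integral>x. f t x \<partial>M)) / (X i - t))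
      \<longlonglongrightarrow> (\<integral>x. f' t x \<partial>M)" by (simp only:)
qed

lemma continuous_on_integral_dominated:
  fixes f :: "'b::metric_space \<Rightarrow> 'a \<Rightarrow> real"
  assumes "\<And>x. x \<in> space M \<Longrightarrow> continuous_on S (\<lambda>t. f t x)"
    and "\<And>t x. t \<in> S \<Longrightarrow> x \<in> space M \<Longrightarrow> \<bar>f t x\<bar> \<le> g x"
    and "integrable M g"
    and "\<And>t. t \<in> S \<Longrightarrow> f t \<in> borel_measurable M"
  shows "continuous_on S (\<lambda>t. \<integral>x. f t x \<partial>M)"
proof (rule continuous_on_sequentiallyI)
  fix X and t
  assume X: "\<forall>n. X n \<in> S" "t \<in> S" "X \<longlonglongrightarrow> t"
  show "(\<lambda>n. \<integral>x. f (X n) x \<partial>M) \<longlonglongrightarrow> (\<integral>x. f t x \<partial>M)"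
  proof (rule integral_dominated_convergence[where w = g])
    show "AE x in M. (\<lambda>n. f (X n) x) \<longlonglongrightarrow> f t x"
    proof (rule AE_I2)
      fix x assume "x \<in> space M"
      from assms(1)[OF this] X show "(\<lambda>n. f (X n) x) \<longlonglongrightarrow> f t x"
        using continuous_on_tendsto_compose[of S "\<lambda>t. f t x" X t sequentially] by auto
    qed
  qed (use assms X in auto)
qed

text \<open>The form in which integration by parts on the line is used, with a product for
  \<open>f\<close>: decay like \<open>1 / wt\<close> removes the boundary terms, while integrability
  of \<open>f'\<close> has to come from elsewhere.\<close>

lemma integral_deriv_eq_0:
  fixes f :: "real \<Rightarrow> real"
  assumes der: "\<And>x. (f has_real_derivative f' x) (at x)"
    and cont: "continuous_on UNIV f'" and int: "integrable lborel f'"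
    and bd: "\<And>x. \<bar>f x\<bar> \<le> C / wt x"
  shows "(\<integral>x. f' x \<partial>lborel) = 0"
proof -
  have lim0: "((\<lambda>x. C / wt x) \<longlongrightarrow> 0) at_top" "((\<lambda>x. C / wt x) \<longlongrightarrow> 0) at_bot"
    unfolding wt_def by real_asymp+
  have lim: "(f \<longlongrightarrow> 0) at_top" "(f \<longlongrightarrow> 0) at_bot"
    by (rule Lim_null_comparison[OF _ lim0(1)], use bd in simp)
       (rule Lim_null_comparison[OF _ lim0(2)], use bd in simp)
  have "(LBINT x=-\<infinity>..\<infinity>. f' x) = 0 - 0"
  proof (rule interval_integral_FTC_integrable[where F = f])
    show "((f \<circ> real_of_ereal) \<longlongrightarrow> 0) (at_right (-\<infinity>))"
      using lim(2) by (simp add: ereal_tendsto_simps)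
    show "((f \<circ> real_of_ereal) \<longlongrightarrow> 0) (at_left \<infinity>)"
      using lim(1) by (simp add: ereal_tendsto_simps)
  qed (use der cont int in \<open>auto simp: has_real_derivative_iff_has_vector_derivative
        continuous_on_eq_continuous_at set_integrable_def\<close>)
  then show ?thesis
    by (simp add: interval_lebesgue_integral_def set_lebesgue_integral_def)
qed

text \<open>The integral of \<open>(r * f + l)\<^sup>2 * k\<close> is a nonnegative quadratic form
  in \<open>r\<close> and \<open>l\<close>; its discriminant gives the inequality. Keeping
  \<open>k\<close> as a weight serves both the kernel under the solution and the mollified density
  under Lebesgue measure.\<close>

lemma Cauchy_Schwarz_integral:
  fixes f :: "'a \<Rightarrow> real"
  assumes f: "f \<in> borel_measurable M" and k: "integrable M k" "\<And>x. x \<in> space M \<Longrightarrow> 0 \<le> k x"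
    and f2: "integrable M (\<lambda>x. (f x)\<^sup>2 * k x)"
  shows "integrable M (\<lambda>x. f x * k x)"
    "(\<integral>x. f x * k x \<partial>M)\<^sup>2 \<le> (\<integral>x. (f x)\<^sup>2 * k x \<partial>M) * (\<integral>x. k x \<partial>M)"
proof -
  have [measurable]: "f \<in> borel_measurable M" "k \<in> borel_measurable M" using f k by auto
  show int: "integrable M (\<lambda>x. f x * k x)"
  proof (rule Bochner_Integration.integrable_bound[of _ "\<lambda>x. (f x)\<^sup>2 * k x + k x"])
    show "AE x in M. norm (f x * k x) \<le> norm ((f x)\<^sup>2 * k x + k x)"
    proof (rule AE_I2)
      fix x assume x: "x \<in> space M"
      have "\<bar>f x\<bar> \<le> (f x)\<^sup>2 + 1" using abs_le_wt[of "f x"] by (simp add: wt_def)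
      then have "\<bar>f x\<bar> * k x \<le> ((f x)\<^sup>2 + 1) * k x" using k(2)[OF x] by (rule mult_right_mono)
      then show "norm (f x * k x) \<le> norm ((f x)\<^sup>2 * k x + k x)"
        using k(2)[OF x] by (simp add: abs_mult algebra_simps)
    qed
  qed (use k f2 in auto)
  define a b c where "a = (\<integral>x. (f x)\<^sup>2 * k x \<partial>M)" and "b = (\<integral>x. f x * k x \<partial>M)"
    and "c = (\<integral>x. k x \<partial>M)"
  have pos: "0 \<le> r\<^sup>2 * a + 2 * r * l * b + l\<^sup>2 * c" for r l
  proof -
    have "0 \<le> (\<integral>x. (r * f x + l)\<^sup>2 * k x \<partial>M)" by (rule Bochner_Integration.integral_nonneg) (use k in auto)
    also have "\<dots> = (\<integral>x. r\<^sup>2 * ((f x)\<^sup>2 * k x) + 2 * r * l * (f x * k x) + l\<^sup>2 * k x \<partial>M)"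
      by (intro Bochner_Integration.integral_cong) (auto simp: power2_eq_square algebra_simps)
    also have "\<dots> = r\<^sup>2 * a + 2 * r * l * b + l\<^sup>2 * c"
      using int f2 k by (simp add: a_def b_def c_def Bochner_Integration.integral_add)
    finally show ?thesis .
  qed
  have c0: "0 \<le> c" unfolding c_def by (rule Bochner_Integration.integral_nonneg) (use k in auto)
  have "b\<^sup>2 \<le> a * c"
  proof (cases "c = 0")
    \<comment> \<open>A vanishing mass leaves an expression affine in \<open>l\<close>; unless
      \<open>b = 0\<close>, the chosen value of \<open>l\<close> makes it equal to -1.\<close>
    case True
    have "0 \<le> (a + 1) * (b\<^sup>2) * 0 + (a - 2 * l * b)" for l
      using pos[of 1 "- l"] True by simp
    from this[of "(a + 1) / (2 * b)"] True show ?thesis by (cases "b = 0") auto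
  next
    case False
    have "0 \<le> c * (a * c - b\<^sup>2)"
      using pos[of c "- b"] by (simp add: power2_eq_square algebra_simps)
    then show ?thesis using False c0 by (simp add: zero_le_mult_iff)
  qed
  then show "(\<integral>x. f x * k x \<partial>M)\<^sup>2 \<le> (\<integral>x. (f x)\<^sup>2 * k x \<partial>M) * (\<integral>x. k x \<partial>M)"
    by (simp add: a_def b_def c_def)
qed

section \<open>Convolution of a weighted measure with a kernel\<close>

text \<open>Convolution of the signed measure with density \<open>f\<close> with respect to
  \<open>M\<close>. With \<open>f = 1\<close> it mollifies the solution, with \<open>f = b\<close>
  the drift term, so that one set of lemmas covers both.\<close>

definition cv :: "real measure \<Rightarrow> (real \<Rightarrow> real) \<Rightarrow> (real \<Rightarrow> real) \<Rightarrow> real \<Rightarrow> real" where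
  "cv M f k x = (\<integral>y. f y * k (x - y) \<partial>M)"

lemma
  assumes M: "sigma_finite_measure M" "sets M = sets borel"
    and f: "integrable M f" and k: "integrable lborel k"
  shows integrable_cv: "integrable lborel (cv M f k)"
    and integral_cv: "(\<integral>x. cv M f k x \<partial>lborel) = (\<integral>y. f y \<partial>M) * (\<integral>z. k z \<partial>lborel)"
proof -
  interpret M: sigma_finite_measure M by fact
  interpret pair_sigma_finite M lborel ..
  have [measurable_cong]: "sets M = sets borel" by fact
  have [measurable]: "f \<in> borel_measurable M" "k \<in> borel_measurable borel" using f k by auto
  have [measurable]: "(\<lambda>(y, x). f y * k (x - y)) \<in> borel_measurable (M \<Otimes>\<^sub>M lborel)" by measurable
  have shift: "integrable lborel (\<lambda>x. k (x - y))" "(\<integral>x. k (x - y) \<partial>lborel) = (\<integral>z. k z \<partial>lborel)"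
    "(\<integral>x. \<bar>k (x - y)\<bar> \<partial>lborel) = (\<integral>z. \<bar>k z\<bar> \<partial>lborel)" for y
    using lborel_integrable_real_affine[of k 1 "- y"] k lborel_integral_real_affine[of 1 k "- y"]
      lborel_integral_real_affine[of 1 "\<lambda>x. \<bar>k x\<bar>" "- y"] by simp_all
  have int: "integrable (M \<Otimes>\<^sub>M lborel) (\<lambda>(y, x). f y * k (x - y))"
  proof (rule Fubini_integrable)
    have "(\<lambda>y. \<integral>x. norm (case (y, x) of (y, x) \<Rightarrow> f y * k (x - y)) \<partial>lborel)
        = (\<lambda>y. \<bar>f y\<bar> * (\<integral>z. \<bar>k z\<bar> \<partial>lborel))"
      by (simp add: abs_mult shift)
    then show "integrable M (\<lambda>y. \<integral>x. norm (case (y, x) of (y, x) \<Rightarrow> f y * k (x - y)) \<partial>lborel)"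
      using f by simp
    show "AE y in M. integrable lborel (\<lambda>x. case (y, x) of (y, x) \<Rightarrow> f y * k (x - y))"
      using shift(1) by simp
  qed simp
  show "integrable lborel (cv M f k)"
    using integrable_snd[OF int] by (simp add: cv_def[abs_def])
  have "(\<integral>x. cv M f k x \<partial>lborel) = (\<integral>y. \<integral>x. f y * k (x - y) \<partial>lborel \<partial>M)"
    using Fubini_integral[of "\<lambda>y x. f y * k (x - y)"] int by (simp add: cv_def[abs_def])
  also have "\<dots> = (\<integral>y. f y \<partial>M) * (\<integral>z. k z \<partial>lborel)"
    by (simp add: shift)
  finally show "(\<integral>x. cv M f k x \<partial>lborel) = (\<integral>y. f y \<partial>M) * (\<integral>z. k z \<partial>lborel)" .
qed

lemma integrable_mult_bounded:
  fixes f :: "'a \<Rightarrow> real"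
  assumes "integrable M f" "k \<in> borel_measurable M" "\<And>z. \<bar>k z\<bar> \<le> B"
  shows "integrable M (\<lambda>y. f y * k y)"
proof (rule Bochner_Integration.integrable_bound[of _ "\<lambda>y. B * f y"])
  have "0 \<le> B" using assms(3)[of undefined] by linarith
  then show "AE x in M. norm (f x * k x) \<le> norm (B * f x)"
    using assms(3) by (auto simp: abs_mult mult.commute[of B] intro!: AE_I2 mult_left_mono)
qed (use assms in auto)

lemma cv_has_real_derivative:
  assumes M: "sets M = sets borel" and f: "integrable M f"
    and k: "\<And>z. (k has_real_derivative k' z) (at z)" "continuous_on UNIV k'"
    and bd: "\<And>z. \<bar>k z\<bar> \<le> B" "\<And>z. \<bar>k' z\<bar> \<le> B"
  shows "(cv M f k has_real_derivative cv M f k' x) (at x)"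
proof -
  have [measurable_cong]: "sets M = sets borel" by fact
  have [measurable]: "f \<in> borel_measurable M" using f by auto
  have [measurable]: "k' \<in> borel_measurable borel"
    by (rule borel_measurable_continuous_onI) fact
  have "continuous_on UNIV k"
    using k(1) by (meson DERIV_isCont continuous_at_imp_continuous_on)
  then have [measurable]: "k \<in> borel_measurable borel"
    by (rule borel_measurable_continuous_onI)
  show ?thesis unfolding cv_def
  proof (rule has_real_derivative_integral_dominated[where g = "\<lambda>y. \<bar>f y\<bar> * B"])
    show "integrable M (\<lambda>y. f y * k (t - y))" for t
      by (rule integrable_mult_bounded[OF f _ bd(1)]) measurable
    show "((\<lambda>t. f y * k (t - y)) has_real_derivative f y * k' (t - y)) (at t)" for t y
      using DERIV_shift[of k "k' (t - y)" t "- y"] k(1)[of "t - y"]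
      by (intro DERIV_cmult) simp
    show "\<bar>f y * k' (t - y)\<bar> \<le> \<bar>f y\<bar> * B" for t y
      using bd(2) by (auto simp: abs_mult intro!: mult_left_mono)
  qed (use f in auto)
qed

section \<open>Cutoff functions\<close>

text \<open>Powers of a positive part replace smooth bump functions as cutoffs: a cube is twice
  continuously differentiable, enough for a test function, and its derivatives are explicit. The
  exponent \<open>Suc (Suc n)\<close> keeps that of the derivative positive, hence the derivative
  continuous across zero.\<close>

lemma max_power_deriv [derivative_intros]:
  assumes "(f has_real_derivative f') (at x within A)"
  shows "((\<lambda>x. max 0 (f x) ^ Suc (Suc n)) has_real_derivative
    real (Suc (Suc n)) * max 0 (f x) ^ Suc n * f') (at x within A)"
proof -
  have *: "((\<lambda>z::real. max 0 z ^ Suc (Suc n)) has_real_derivative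
      real (Suc (Suc n)) * max 0 z ^ Suc n) (at z)" for z
  proof -
    consider "z > 0" | "z < 0" | "z = 0" by linarith
    then show ?thesis
    proof cases
      case 1
      have "((\<lambda>z. z ^ Suc (Suc n)) has_real_derivative real (Suc (Suc n)) * z ^ Suc n) (at z)"
        using DERIV_pow[of "Suc (Suc n)" z] by simp
      then have "((\<lambda>z::real. max 0 z ^ Suc (Suc n)) has_real_derivative
          real (Suc (Suc n)) * z ^ Suc n) (at z)"
        by (rule has_field_derivative_transform_within_open[of _ _ _ "{0<..}"]) (use 1 in auto)
      with 1 show ?thesis by (simp add: max_def)
    next
      case 2
      have "((\<lambda>z::real. 0) has_real_derivative 0) (at z)" by simp
      then have "((\<lambda>z::real. max 0 z ^ Suc (Suc n)) has_real_derivative 0) (at z)"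
        by (rule has_field_derivative_transform_within_open[of _ _ _ "{..<0}"]) (use 2 in auto)
      with 2 show ?thesis by (simp add: max_def)
    next
      case 3
      have "((\<lambda>y::real. max 0 y ^ Suc (Suc n) / y) \<longlongrightarrow> 0) (at 0)"
      proof (rule Lim_null_comparison)
        show "\<forall>\<^sub>F y::real in at 0. norm (max 0 y ^ Suc (Suc n) / y) \<le> \<bar>y\<bar> ^ Suc n"
        proof (intro always_eventually allI)
          fix y :: real
          show "norm (max 0 y ^ Suc (Suc n) / y) \<le> \<bar>y\<bar> ^ Suc n"
          proof (cases "0 \<le> y")
            case False
            then have "norm (max 0 y ^ Suc (Suc n) / y) = 0" by (simp add: max_absorb1)
            also have "0 \<le> \<bar>y\<bar> ^ Suc n" by (rule zero_le_power) (rule abs_ge_zero)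
            finally show ?thesis .
          qed (simp add: max_absorb2 abs_mult)
        qed
        have "((\<lambda>y::real. \<bar>y\<bar> ^ Suc n) \<longlongrightarrow> \<bar>0\<bar> ^ Suc n) (at 0)"
          by (intro tendsto_intros)
        then show "((\<lambda>y::real. \<bar>y\<bar> ^ Suc n) \<longlongrightarrow> 0) (at 0)" by simp
      qed
      with 3 show ?thesis by (simp add: has_field_derivative_iff)
    qed
  qed
  show ?thesis using DERIV_chain'[OF assms *] by (simp add: mult.commute)
qed

lemma test_functionI:
  assumes d: "\<And>x. (\<phi> has_real_derivative \<phi>1 x) (at x)"
      "\<And>x. (\<phi>1 has_real_derivative \<phi>2 x) (at x)"
    and c: "continuous_on UNIV \<phi>2" and supp: "\<And>x. R < \<bar>x\<bar> \<Longrightarrow> \<phi> x = 0"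
  shows "test_function \<phi>" "deriv \<phi> = \<phi>1" "deriv \<phi>1 = \<phi>2"
proof -
  show d1: "deriv \<phi> = \<phi>1" and d2: "deriv \<phi>1 = \<phi>2"
    using d by (auto intro!: ext DERIV_imp_deriv)
  have "{x. \<phi> x \<noteq> 0} \<subseteq> cball 0 R" using supp by (force simp: not_less)
  then have "bounded {x. \<phi> x \<noteq> 0}" by (rule bounded_subset[OF bounded_cball])
  then have "compact (closure {x. \<phi> x \<noteq> 0})" by (simp add: compact_eq_bounded_closed bounded_closure)
  then show "test_function \<phi>"
    unfolding test_function_def C2_def d1 d2 using d c
    by (auto simp: real_differentiable_def)
qed

lemma continuous_compact_support_bounded:
  fixes f :: "real \<Rightarrow> real"
  assumes "continuous_on UNIV f" "\<And>x. R < \<bar>x\<bar> \<Longrightarrow> f x = 0"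
  obtains B where "\<And>x. \<bar>f x\<bar> \<le> B"
proof -
  have "compact (f ` {-R..R})"
    by (intro compact_continuous_image continuous_on_subset[OF assms(1)]) auto
  then obtain B where B: "B > 0" "\<forall>y\<in>f ` {-R..R}. norm y \<le> B"
    using compact_imp_bounded bounded_pos by blast
  have "\<bar>f x\<bar> \<le> B" for x
  proof (cases "R < \<bar>x\<bar>")
    case False
    then have "x \<in> {-R..R}" by auto
    with B(2) show ?thesis by simp
  qed (use B(1) assms(2)[of x] in simp)
  then show thesis by (rule that)
qed

lemma continuous_on_uniform_approx:
  fixes f :: "'a::metric_space \<Rightarrow> real"
  assumes "\<And>e. e > 0 \<Longrightarrow> \<exists>g. continuous_on S g \<and> (\<forall>x\<in>S. \<bar>f x - g x\<bar> \<le> e)"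
  shows "continuous_on S f"
  unfolding continuous_on_iff
proof (intro ballI allI impI)
  fix x and e :: real assume x: "x \<in> S" and e: "e > 0"
  from assms[of "e / 4"] e obtain g where g: "continuous_on S g" "\<And>x. x \<in> S \<Longrightarrow> \<bar>f x - g x\<bar> \<le> e / 4"
    by auto
  from g(1) x e obtain d where d: "d > 0" "\<And>y. y \<in> S \<Longrightarrow> dist y x < d \<Longrightarrow> dist (g y) (g x) < e / 4"
    unfolding continuous_on_iff by (metis zero_less_divide_iff zero_less_numeral)
  show "\<exists>d>0. \<forall>x'\<in>S. dist x' x < d \<longrightarrow> dist (f x') (f x) < e"
  proof (intro exI[of _ d] conjI ballI impI)
    fix y assume y: "y \<in> S" "dist y x < d"
    show "dist (f y) (f x) < e"
      using g(2)[OF y(1)] g(2)[OF x] d(2)[OF y] e unfolding dist_real_def by linarith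
  qed (rule d)
qed

text \<open>For \<open>y\<close> up to \<open>c\<close> both factors are at most the corresponding
  powers of \<open>c\<close>, beyond it the left side is not positive. This is how a lower power of
  the weight is absorbed by the next one.\<close>

lemma power_mult_diff_le:
  fixes y c :: real
  assumes "0 \<le> y" "0 \<le> c"
  shows "y ^ n * (c - y) \<le> c ^ Suc n"
proof (cases "y \<le> c")
  case True
  then show ?thesis using assms by (auto intro!: mult_mono power_mono simp: mult.commute[of c])
next
  case False
  then have "y ^ n * (c - y) \<le> 0" using assms by (intro mult_nonneg_nonpos) auto
  then show ?thesis using assms by (smt (verit) zero_le_power)
qed

section \<open>Weak solutions of a scalar Fokker--Planck equation: moments and time continuity\<close>

locale weak_fp =
  fixes s Cb :: real and W b h :: "real \<Rightarrow> real" and \<mu> :: "real \<Rightarrow> real measure" and p Q :: nat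
  assumes s_pos: "0 < s"
    and W_deriv: "\<And>x. (W has_real_derivative b x) (at x)"
    and b_cont: "continuous_on UNIV b"
    and b_growth: "\<And>x. \<bar>b x\<bar> \<le> Cb * wt x ^ p"
    and b_coercive: "\<And>K. \<exists>R. \<forall>x. R \<le> \<bar>x\<bar> \<longrightarrow> K * x\<^sup>2 \<le> x * b x"
    and Q_ge: "4 * p + 4 \<le> Q"
    and prob: "\<And>t. 0 \<le> t \<Longrightarrow> prob_space (\<mu> t)"
    and sets_mu: "\<And>t. 0 \<le> t \<Longrightarrow> sets (\<mu> t) = sets borel"
    and init: "integrable (\<mu> 0) (\<lambda>x. wt x ^ Q)"
    and h_bounded: "\<And>T. \<exists>H. \<forall>t\<in>{0..T}. \<bar>h t\<bar> \<le> H"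
    and weak: "\<And>\<phi> t. test_function \<phi> \<Longrightarrow> 0 \<le> t \<Longrightarrow>
      set_integrable lborel {0..t}
        (\<lambda>r. \<integral>x. s * deriv (deriv \<phi>) x - (b x - h r) * deriv \<phi> x \<partial>\<mu> r) \<and>
      (\<integral>x. \<phi> x \<partial>\<mu> t) = (\<integral>x. \<phi> x \<partial>\<mu> 0) +
        (LBINT r:{0..t}. (\<integral>x. s * deriv (deriv \<phi>) x - (b x - h r) * deriv \<phi> x \<partial>\<mu> r))"
begin

text \<open>The derivatives of the test function are passed as arguments, which keeps
  \<open>deriv\<close> out of all computations.\<close>

definition gen :: "real \<Rightarrow> (real \<Rightarrow> real) \<Rightarrow> (real \<Rightarrow> real) \<Rightarrow> real \<Rightarrow> real" where
  "gen r \<phi>1 \<phi>2 x = s * \<phi>2 x - (b x - h r) * \<phi>1 x"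

lemma b_measurable [measurable]: "b \<in> borel_measurable borel"
  by (rule borel_measurable_continuous_onI) (rule b_cont)

lemma Cb_nonneg: "0 \<le> Cb"
  using order_trans[OF abs_ge_zero b_growth[of 0]] by (simp add: wt_def)

lemma measurable_mu: "0 \<le> t \<Longrightarrow> f \<in> borel_measurable borel \<Longrightarrow> f \<in> borel_measurable (\<mu> t)"
  using measurable_cong_sets[OF sets_mu] by blast

lemma cont_measurable_mu: "0 \<le> t \<Longrightarrow> continuous_on UNIV f \<Longrightarrow> f \<in> borel_measurable (\<mu> t)"
  by (intro measurable_mu borel_measurable_continuous_onI)

lemma integrable_bounded_mu:
  fixes f :: "real \<Rightarrow> real"
  assumes "0 \<le> t" "f \<in> borel_measurable borel" "\<And>x. \<bar>f x\<bar> \<le> B"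
  shows "integrable (\<mu> t) f"
proof -
  interpret prob_space "\<mu> t" using prob assms by simp
  show ?thesis
    by (rule integrable_const_bound[where B = B]) (use assms measurable_mu in auto)
qed

lemma integrable_compact_support_mu:
  fixes f :: "real \<Rightarrow> real"
  assumes "0 \<le> t" "continuous_on UNIV f" "\<And>x. R < \<bar>x\<bar> \<Longrightarrow> f x = 0"
  shows "integrable (\<mu> t) f"
  by (rule continuous_compact_support_bounded[OF assms(2,3)])
     (auto intro!: integrable_bounded_mu borel_measurable_continuous_onI assms(1,2))

text \<open>The weak formulation with explicit derivatives, and with the Henstock-Kurzweil integral
  in time in place of the Lebesgue one: the fundamental theorem and the convergence theorems used
  below are stated for it.\<close>

lemma weak_HK:
  assumes d: "\<And>x. (\<phi> has_real_derivative \<phi>1 x) (at x)"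
      "\<And>x. (\<phi>1 has_real_derivative \<phi>2 x) (at x)"
    and c: "continuous_on UNIV \<phi>2" and supp: "\<And>x. R < \<bar>x\<bar> \<Longrightarrow> \<phi> x = 0"
    and t: "0 \<le> t"
  shows "(\<lambda>r. \<integral>x. gen r \<phi>1 \<phi>2 x \<partial>\<mu> r) integrable_on {0..t}"
    and "(\<integral>x. \<phi> x \<partial>\<mu> t) = (\<integral>x. \<phi> x \<partial>\<mu> 0) + integral {0..t} (\<lambda>r. \<integral>x. gen r \<phi>1 \<phi>2 x \<partial>\<mu> r)"
proof -
  have tf: "test_function \<phi>" "deriv \<phi> = \<phi>1" "deriv \<phi>1 = \<phi>2"
    by (rule test_functionI[OF d c], erule supp)+
  have w: "set_integrable lborel {0..t} (\<lambda>r. \<integral>x. gen r \<phi>1 \<phi>2 x \<partial>\<mu> r)"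
    "(\<integral>x. \<phi> x \<partial>\<mu> t) = (\<integral>x. \<phi> x \<partial>\<mu> 0) + (LBINT r:{0..t}. (\<integral>x. gen r \<phi>1 \<phi>2 x \<partial>\<mu> r))"
    using weak[OF tf(1) t] unfolding tf(2,3) gen_def by auto
  show "(\<lambda>r. \<integral>x. gen r \<phi>1 \<phi>2 x \<partial>\<mu> r) integrable_on {0..t}"
    by (rule set_borel_integral_eq_integral(1)[OF w(1)])
  show "(\<integral>x. \<phi> x \<partial>\<mu> t) = (\<integral>x. \<phi> x \<partial>\<mu> 0) + integral {0..t} (\<lambda>r. \<integral>x. gen r \<phi>1 \<phi>2 x \<partial>\<mu> r)"
    using w(2) set_borel_integral_eq_integral(2)[OF w(1)] by simp
qed

text \<open>Outside a large ball \<open>x * b x\<close> dominates every multiple of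
  \<open>x\<^sup>2\<close>; inside, everything is bounded and goes into \<open>C\<close>. The last
  conclusion says that \<open>x * b x\<close> is nonnegative up to a constant.\<close>

lemma coercive:
  obtains C where "0 \<le> C" "\<And>x. K * wt x \<le> x * b x + C" "\<And>x. \<bar>x * b x\<bar> \<le> x * b x + C"
proof -
  define K' where "K' = max K 0"
  obtain R0 where R0: "\<And>x. R0 \<le> \<bar>x\<bar> \<Longrightarrow> K' * x\<^sup>2 \<le> x * b x"
    using b_coercive[of K'] by auto
  define R where "R = max R0 0"
  have R: "K' * x\<^sup>2 \<le> x * b x" if "R \<le> \<bar>x\<bar>" for x
    using R0[of x] that by (auto simp: R_def)
  \<comment> \<open>Twice the bound of \<open>x * b x\<close> on the ball covers the case of a
    negative sign; \<open>K' * wt R\<close> covers the weight on the ball and its summand 1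
    outside.\<close>
  define C where "C = 2 * (R * (Cb * wt R ^ p)) + K' * wt R"
  have [simp]: "0 \<le> K'" "0 \<le> R" "K \<le> K'" by (auto simp: K'_def R_def)
  have C0: "0 \<le> R * (Cb * wt R ^ p)" using Cb_nonneg by simp
  have KW: "0 \<le> K' * wt R" by simp
  have KC: "K' \<le> K' * wt R" using mult_left_mono[of 1 "wt R" K'] by simp
  have main: "K' * wt x \<le> x * b x + C \<and> \<bar>x * b x\<bar> \<le> x * b x + C" for x
  proof (cases "R \<le> \<bar>x\<bar>")
    case True
    have "0 \<le> K' * x\<^sup>2" by simp
    with R[OF True] have "0 \<le> x * b x" by linarith
    moreover have "K' * wt x = K' * x\<^sup>2 + K'" by (simp add: wt_def algebra_simps)
    ultimately show ?thesis using R[OF True] C0 KC unfolding C_def by auto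
  next
    case False
    then have "\<bar>x\<bar>\<^sup>2 \<le> R\<^sup>2" by (intro power_mono) auto
    then have wx: "wt x \<le> wt R" by (simp add: wt_def)
    have "\<bar>x * b x\<bar> \<le> R * (Cb * wt R ^ p)"
      unfolding abs_mult using False wx Cb_nonneg
      by (intro mult_mono order_trans[OF b_growth] power_mono mult_left_mono) auto
    moreover have "K' * wt x \<le> K' * wt R" using wx by (intro mult_left_mono) auto
    ultimately show ?thesis using C0 KC KW unfolding C_def by (intro conjI) linarith+
  qed
  have KK: "K * wt x \<le> K' * wt x" for x by (intro mult_right_mono) auto
  show thesis
    by (rule that[of C], use KW C0 in \<open>simp add: C_def\<close>, use main order_trans[OF KK] in blast, use main in blast)
qed

text \<open>Up to the factor \<open>2 * Q\<close>, the absolute value of the contribution of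
  \<open>b\<close> when the generator acts on \<open>wt x ^ Q\<close>. By superlinearity of
  \<open>b\<close> it outgrows \<open>wt x ^ Q\<close>, so that a bound on its integral gives
  uniform integrability of the top moment.\<close>

definition P :: "real \<Rightarrow> real" where "P x = \<bar>x * b x\<bar> * wt x ^ (Q - 1)"

lemma P_nonneg [simp]: "0 \<le> P x"
  by (simp add: P_def)

lemma continuous_P: "continuous_on UNIV P"
  unfolding P_def by (intro continuous_intros b_cont)

lemma P_superlinear:
  obtains C where "0 \<le> C" "\<And>x. K * wt x ^ Q \<le> P x + C"
proof -
  obtain C where C: "0 \<le> C" "\<And>x. (K + 1) * wt x \<le> x * b x + C" "\<And>x. \<bar>x * b x\<bar> \<le> x * b x + C"
    using coercive by metis
  have Qs: "Q = Suc (Q - 1)" using Q_ge by simp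
  show thesis
  proof (rule that[of "C ^ Suc (Q - 1)"])
    fix x
    have "(K + 1) * wt x - C \<le> \<bar>x * b x\<bar>" using C(2)[of x] by linarith
    then have "((K + 1) * wt x - C) * wt x ^ (Q - 1) \<le> P x"
      unfolding P_def by (rule mult_right_mono) simp
    moreover have "wt x ^ (Q - 1) * (C - wt x) \<le> C ^ Suc (Q - 1)"
      by (rule power_mult_diff_le) (use C in auto)
    \<comment> \<open>The spare multiple of \<open>wt x\<close> hidden in \<open>K + 1\<close>
      supplies the negative leading power in the last term.\<close>
    moreover have "K * wt x ^ Q = ((K + 1) * wt x - C) * wt x ^ (Q - 1) + wt x ^ (Q - 1) * (C - wt x)"
      by (subst Qs) (simp add: algebra_simps)
    ultimately show "K * wt x ^ Q \<le> P x + C ^ Suc (Q - 1)" by linarith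
  qed (use C in simp)
qed

section \<open>The Lyapunov inequality for the top moment\<close>

definition g1 :: "real \<Rightarrow> real" where "g1 x = real Q * wt x ^ (Q - 1) * (2 * x)"
definition g2 :: "real \<Rightarrow> real" where
  "g2 x = real Q * (2 * wt x ^ (Q - 1) + 4 * real (Q - 1) * x\<^sup>2 * wt x ^ (Q - 2))"

lemma g_derivs:
  "((\<lambda>x. wt x ^ Q) has_real_derivative g1 x) (at x)"
  "(g1 has_real_derivative g2 x) (at x)"
  unfolding g1_def[abs_def] g2_def using Q_ge
  by (auto intro!: derivative_eq_intros simp: power2_eq_square algebra_simps eval_nat_numeral)

text \<open>The drift contributes \<open>- 2 * Q * (x * b x)\<close> times
  \<open>wt x ^ (Q - 1)\<close>. One copy of \<open>x * b x\<close> is kept as \<open>P\<close>;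
  coercivity of the remaining \<open>2 * Q - 1\<close> copies absorbs the diffusion and the mean
  field and still leaves \<open>- wt x ^ Q\<close>. The mean field enters the constant through
  \<open>H\<close> only, so the constant does not depend on time.\<close>

lemma lyapunov:
  obtains C where "0 \<le> C"
    "\<And>x r. \<bar>h r\<bar> \<le> H \<Longrightarrow> s * g2 x - (b x - h r) * g1 x \<le> C - P x"
proof -
  define H' where "H' = max H 0"
  define n where "n = Q - 1"
  have Qn: "Q = Suc n" "n = Suc (Q - 2)" using Q_ge by (auto simp: n_def)
  obtain C where C: "0 \<le> C" "\<And>x. (2 * real Q * H' + 1) * wt x \<le> x * b x + C"
    "\<And>x. \<bar>x * b x\<bar> \<le> x * b x + C"
    using coercive by metis
  define c1 where "c1 = s * real Q * (2 + 4 * real n)"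
  define c2 where "c2 = c1 + 2 * real Q * C"
  have c1: "0 \<le> c1" using s_pos by (simp add: c1_def)
  have c2: "0 \<le> c2" using c1 C by (simp add: c2_def)
  show thesis
  proof (rule that[of "c2 ^ Suc n"])
    fix x r assume hr: "\<bar>h r\<bar> \<le> H"
    define y where "y = wt x"
    have y: "1 \<le> y" by (simp add: y_def)
    have yn: "0 \<le> y ^ n" using y by simp
    have "x\<^sup>2 * wt x ^ (Q - 2) \<le> wt x * wt x ^ (Q - 2)"
      by (intro mult_right_mono square_le_wt) simp
    then have "x\<^sup>2 * wt x ^ (Q - 2) \<le> y ^ n" using Qn(2) by (simp add: y_def)
    then have "real n * (x\<^sup>2 * wt x ^ (Q - 2)) \<le> real n * y ^ n"
      by (intro mult_left_mono) auto
    then have "2 * y ^ n + 4 * real n * x\<^sup>2 * wt x ^ (Q - 2) \<le> (2 + 4 * real n) * y ^ n"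
      by (simp add: algebra_simps)
    then have "s * (real Q * (2 * y ^ n + 4 * real n * x\<^sup>2 * wt x ^ (Q - 2)))
        \<le> s * (real Q * ((2 + 4 * real n) * y ^ n))"
      using s_pos by (intro mult_left_mono) auto
    then have A1: "s * g2 x \<le> c1 * y ^ n"
      unfolding g2_def c1_def y_def by (simp only: n_def[symmetric] mult.assoc)
    have "h r * x \<le> \<bar>h r\<bar> * \<bar>x\<bar>" by (metis abs_ge_self abs_mult)
    also have "\<dots> \<le> H' * y"
      using hr abs_le_wt[of x] by (intro mult_mono) (auto simp: H'_def y_def)
    finally have A2: "h r * x \<le> H' * y" .
    have "(2 * real Q - 1) * ((2 * real Q * H' + 1) * y - C) \<le> (2 * real Q - 1) * (x * b x)"
      using C(2)[of x] Qn(1) by (intro mult_left_mono) (auto simp: y_def)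
    moreover have "1 * ((2 * real Q * H' + 1) * y) \<le> (2 * real Q - 1) * ((2 * real Q * H' + 1) * y)"
      using Qn(1) y by (intro mult_right_mono) (auto simp: H'_def)
    ultimately have A3: "(2 * real Q * H' + 1) * y - (2 * real Q - 1) * C \<le> (2 * real Q - 1) * (x * b x)"
      by (simp add: algebra_simps)
    have "2 * real Q * (h r * x) \<le> 2 * real Q * (H' * y)"
      using A2 by (intro mult_left_mono) auto
    with A3 C(3)[of x] have A4: "c1 + 2 * real Q * (h r * x) - 2 * real Q * (x * b x) + \<bar>x * b x\<bar> \<le> c2 - y"
      unfolding c2_def by (simp add: algebra_simps)
    have "s * g2 x - (b x - h r) * g1 x + P x
        \<le> (c1 + 2 * real Q * (h r * x) - 2 * real Q * (x * b x) + \<bar>x * b x\<bar>) * y ^ n"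
      using A1 unfolding g1_def P_def y_def n_def[symmetric] by (simp add: algebra_simps)
    also have "\<dots> \<le> (c2 - y) * y ^ n" using A4 yn by (rule mult_right_mono)
    also have "\<dots> \<le> c2 ^ Suc n" using power_mult_diff_le[of y c2 n] y c2 by (simp add: mult.commute)
    finally show "s * g2 x - (b x - h r) * g1 x \<le> c2 ^ Suc n - P x" by simp
  qed (use c2 in simp)
qed

text \<open>\<open>R / 3 + \<Phi> R\<close> increases to \<open>wt ^ Q\<close> as \<open>R\<close> tends to infinity.  It is a concave function of
  \<open>wt ^ Q\<close>, which is why the generator acting on it is controlled by the generator acting on
  \<open>wt ^ Q\<close>.\<close>

definition q :: "real \<Rightarrow> real \<Rightarrow> real" where "q R x = max 0 (1 - wt x ^ Q / R)"
definition \<Phi> :: "real \<Rightarrow> real \<Rightarrow> real" where "\<Phi> R x = - (R / 3) * q R x ^ 3"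
definition \<Phi>1 :: "real \<Rightarrow> real \<Rightarrow> real" where "\<Phi>1 R x = q R x ^ 2 * g1 x"
definition \<Phi>2 :: "real \<Rightarrow> real \<Rightarrow> real" where
  "\<Phi>2 R x = q R x ^ 2 * g2 x - 2 / R * q R x * (g1 x)\<^sup>2"

lemma q_props:
  assumes "0 < R"
  shows "0 \<le> q R x" "q R x \<le> 1" "R < \<bar>x\<bar> \<Longrightarrow> q R x = 0" "continuous_on UNIV (q R)"
proof -
  show "0 \<le> q R x" by (simp add: q_def)
  show "q R x \<le> 1" using assms by (simp add: q_def)
  show "continuous_on UNIV (q R)" unfolding q_def[abs_def] using assms by (auto intro!: continuous_intros)
  assume "R < \<bar>x\<bar>"
  also have "\<bar>x\<bar> \<le> wt x ^ 1" using abs_le_wt by simp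
  also have "\<dots> \<le> wt x ^ Q" by (rule wt_pow_mono) (use Q_ge in simp)
  finally show "q R x = 0" using assms by (simp add: q_def max_def)
qed

lemma continuous_g: "continuous_on UNIV g1" "continuous_on UNIV g2"
  unfolding g1_def[abs_def] g2_def[abs_def] by (intro continuous_intros)+

lemma \<Phi>_derivs:
  assumes R: "0 < R"
  shows "(\<Phi> R has_real_derivative \<Phi>1 R x) (at x)" "(\<Phi>1 R has_real_derivative \<Phi>2 R x) (at x)"
proof -
  have d: "((\<lambda>x. 1 - wt x ^ Q / R) has_real_derivative (- g1 x / R)) (at x)"
    using DERIV_diff[OF DERIV_const DERIV_cdivide[OF g_derivs(1)]] by simp
  from max_power_deriv[OF d, of 1] have d3: "((\<lambda>x. q R x ^ 3) has_real_derivative 3 * q R x ^ 2 * (- g1 x / R)) (at x)"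
    by (simp add: q_def[abs_def] numeral_eq_Suc)
  from max_power_deriv[OF d, of 0] have d2: "((\<lambda>x. q R x ^ 2) has_real_derivative 2 * q R x * (- g1 x / R)) (at x)"
    by (simp add: q_def[abs_def] numeral_eq_Suc)
  have "((\<lambda>x. - (R / 3) * q R x ^ 3) has_real_derivative - (R / 3) * (3 * q R x ^ 2 * (- g1 x / R))) (at x)"
    by (rule DERIV_cmult[OF d3])
  then show "(\<Phi> R has_real_derivative \<Phi>1 R x) (at x)"
    unfolding \<Phi>_def[abs_def] \<Phi>1_def using R by (simp add: field_simps)
  have "((\<lambda>x. q R x ^ 2 * g1 x) has_real_derivative q R x ^ 2 * g2 x + 2 * q R x * (- g1 x / R) * g1 x) (at x)"
    by (rule DERIV_mult'[OF d2 g_derivs(2)])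
  then show "(\<Phi>1 R has_real_derivative \<Phi>2 R x) (at x)"
    unfolding \<Phi>1_def[abs_def] \<Phi>2_def by (simp add: power2_eq_square algebra_simps)
qed

text \<open>Concavity of the truncation contributes
  \<open>- (2 / R * q R x * (g1 x)\<^sup>2)\<close>, which has the good sign and is dropped. The
  second claim presupposes that the truncated integral of \<open>P\<close> is continuous in time;
  this becomes available once continuity of moments has been proved.\<close>

lemma truncated_moment:
  assumes R: "0 < R" and t: "0 \<le> t" and C: "0 \<le> C"
    and bd: "\<And>x r. 0 \<le> r \<Longrightarrow> r \<le> t \<Longrightarrow> s * g2 x - (b x - h r) * g1 x \<le> C - P x"
  shows "(\<integral>x. R / 3 + \<Phi> R x \<partial>\<mu> t) \<le> (\<integral>x. wt x ^ Q \<partial>\<mu> 0) + C * t" (is ?A)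
    and "continuous_on {0..t} (\<lambda>r. \<integral>x. (q R x)\<^sup>2 * P x \<partial>\<mu> r) \<Longrightarrow>
      integral {0..t} (\<lambda>r. \<integral>x. (q R x)\<^sup>2 * P x \<partial>\<mu> r) \<le> (\<integral>x. wt x ^ Q \<partial>\<mu> 0) + C * t" (is "_ \<Longrightarrow> ?B")
proof -
  let ?L = "\<lambda>r. \<integral>x. gen r (\<Phi>1 R) (\<Phi>2 R) x \<partial>\<mu> r"
  let ?G = "\<lambda>r. \<integral>x. (q R x)\<^sup>2 * P x \<partial>\<mu> r"
  have supp: "R < \<bar>x\<bar> \<Longrightarrow> \<Phi> R x = 0" for x using q_props(3)[OF R] by (simp add: \<Phi>_def)
  have cont: "continuous_on UNIV (\<Phi> R)" "continuous_on UNIV (\<Phi>1 R)" "continuous_on UNIV (\<Phi>2 R)"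
    unfolding \<Phi>_def[abs_def] \<Phi>1_def[abs_def] \<Phi>2_def[abs_def]
    by (intro continuous_intros q_props R continuous_g)+
  have w: "?L integrable_on {0..t}"
    "(\<integral>x. \<Phi> R x \<partial>\<mu> t) = (\<integral>x. \<Phi> R x \<partial>\<mu> 0) + integral {0..t} ?L"
    by (rule weak_HK[OF \<Phi>_derivs[OF R] cont(3) _ t], erule supp)+
  have int\<Phi>: "integrable (\<mu> r) (\<Phi> R)" if "0 \<le> r" for r
    by (rule integrable_compact_support_mu[OF that cont(1) supp])
  have intG: "integrable (\<mu> r) (\<lambda>x. (q R x)\<^sup>2 * P x)" if "0 \<le> r" for r
    by (rule integrable_compact_support_mu[OF that, of _ R])
       (use q_props[OF R] in \<open>auto intro!: continuous_intros continuous_P\<close>)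
  have L: "?L r \<le> C - ?G r" if r: "0 \<le> r" "r \<le> t" for r
  proof -
    interpret prob_space "\<mu> r" using prob r by simp
    have "gen r (\<Phi>1 R) (\<Phi>2 R) x \<le> C - (q R x)\<^sup>2 * P x" for x
    proof -
      have "gen r (\<Phi>1 R) (\<Phi>2 R) x
          = (q R x)\<^sup>2 * (s * g2 x - (b x - h r) * g1 x) - s * (2 / R * q R x * (g1 x)\<^sup>2)"
        by (simp add: gen_def \<Phi>1_def \<Phi>2_def algebra_simps)
      also have "\<dots> \<le> (q R x)\<^sup>2 * (C - P x) - 0"
        by (intro diff_mono mult_left_mono bd r) (use s_pos R q_props[OF R] in auto)
      also have "\<dots> \<le> C - (q R x)\<^sup>2 * P x"
        using mult_right_mono[OF power_le_one[OF q_props(1,2)[OF R, of x]], of C 2] C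
        by (simp add: algebra_simps)
      finally show ?thesis .
    qed
    moreover have "integrable (\<mu> r) (gen r (\<Phi>1 R) (\<Phi>2 R))"
      by (rule integrable_compact_support_mu[OF r(1), of _ R])
         (use q_props[OF R] cont in \<open>auto intro!: continuous_intros b_cont simp: gen_def[abs_def] \<Phi>1_def \<Phi>2_def\<close>)
    ultimately have "?L r \<le> (\<integral>x. C - (q R x)\<^sup>2 * P x \<partial>\<mu> r)"
      using intG r by (intro integral_mono) auto
    then show ?thesis using intG r by (simp add: prob_space)
  qed
  have G0: "0 \<le> ?G r" for r by (intro Bochner_Integration.integral_nonneg) simp
  \<comment> \<open>After scaling by \<open>R\<close> this is
    \<open>1 - (1 - v) ^ 3 \<le> 3 * v\<close>, a tangent inequality at zero.\<close>
  have wt: "R / 3 + \<Phi> R x \<le> wt x ^ Q" for x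
  proof -
    define v where "v = wt x ^ Q / R"
    have v: "0 \<le> v" using R by (simp add: v_def)
    have "1 - max 0 (1 - v) ^ 3 \<le> 3 * v"
    proof (cases "v \<le> 1")
      case True
      have "0 \<le> v\<^sup>2 * (3 - v)" using True by simp
      then show ?thesis using True by (simp add: max_def power3_eq_cube power2_eq_square algebra_simps)
    qed simp
    then have "R / 3 * (1 - max 0 (1 - v) ^ 3) \<le> R / 3 * (3 * v)" using R by (intro mult_left_mono) auto
    then show ?thesis using R by (simp add: v_def \<Phi>_def q_def algebra_simps)
  qed
  interpret P0: prob_space "\<mu> 0" using prob by simp
  interpret Pt: prob_space "\<mu> t" using prob t by simp
  have i0: "(\<integral>x. R / 3 + \<Phi> R x \<partial>\<mu> 0) \<le> (\<integral>x. wt x ^ Q \<partial>\<mu> 0)"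
    using init int\<Phi>[of 0] wt by (intro integral_mono) auto
  have "(\<integral>x. R / 3 + \<Phi> R x \<partial>\<mu> t) = R / 3 + (\<integral>x. \<Phi> R x \<partial>\<mu> t)"
    using int\<Phi>[OF t] by (simp add: Pt.prob_space)
  also have "\<dots> = R / 3 + (\<integral>x. \<Phi> R x \<partial>\<mu> 0) + integral {0..t} ?L"
    using w(2) by simp
  also have "R / 3 + (\<integral>x. \<Phi> R x \<partial>\<mu> 0) = (\<integral>x. R / 3 + \<Phi> R x \<partial>\<mu> 0)"
    using int\<Phi>[of 0] by (simp add: P0.prob_space)
  finally have eq: "(\<integral>x. R / 3 + \<Phi> R x \<partial>\<mu> t) \<le> (\<integral>x. wt x ^ Q \<partial>\<mu> 0) + integral {0..t} ?L"
    using i0 by simp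
  have "integral {0..t} ?L \<le> integral {0..t} (\<lambda>r. C)"
    by (intro integral_le w t) (use L G0 in \<open>auto intro: order_trans[OF L]\<close>)
  with eq show ?A using t by (simp add: mult.commute)
  assume c: "continuous_on {0..t} ?G"
  have "integral {0..t} ?L \<le> integral {0..t} (\<lambda>r. C - ?G r)"
    by (intro integral_le w t integrable_continuous_real continuous_intros c) (use L in auto)
  also have "\<dots> = C * t - integral {0..t} ?G"
    using integral_diff[OF integrable_const_ivl integrable_continuous_real[OF c], of C] t
    by (simp add: mult.commute)
  finally have "(\<integral>x. R / 3 + \<Phi> R x \<partial>\<mu> t) \<le> (\<integral>x. wt x ^ Q \<partial>\<mu> 0) + C * t - integral {0..t} ?G"
    using eq by simp
  moreover have "0 \<le> (\<integral>x. R / 3 + \<Phi> R x \<partial>\<mu> t)"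
  proof (rule Bochner_Integration.integral_nonneg)
    show "0 \<le> R / 3 + \<Phi> R x" for x
      using R power_le_one[OF q_props(1,2)[OF R, of x], of 3] by (simp add: \<Phi>_def field_simps)
  qed
  ultimately show ?B by simp
qed

text \<open>Fatou's lemma along \<open>R = Suc n\<close> removes the truncation.\<close>

lemma moments:
  assumes t: "0 \<le> t" and C: "0 \<le> C"
    and bd: "\<And>x r. 0 \<le> r \<Longrightarrow> r \<le> t \<Longrightarrow> s * g2 x - (b x - h r) * g1 x \<le> C - P x"
  shows "integrable (\<mu> t) (\<lambda>x. wt x ^ Q)" "(\<integral>x. wt x ^ Q \<partial>\<mu> t) \<le> (\<integral>x. wt x ^ Q \<partial>\<mu> 0) + C * t"
proof -
  define B where "B = (\<integral>x. wt x ^ Q \<partial>\<mu> 0) + C * t"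
  define F where "F n x = real (Suc n) / 3 + \<Phi> (real (Suc n)) x" for n x
  interpret Pt: prob_space "\<mu> t" using prob t by simp
  have F0: "0 \<le> F n x" for n x
    using mult_left_mono[OF power_le_one[OF q_props(1,2)[of "real (Suc n)" x], of 3], of "real (Suc n) / 3"]
    by (simp add: F_def \<Phi>_def)
  have contF: "continuous_on UNIV (F n)" for n
    unfolding F_def[abs_def] \<Phi>_def by (intro continuous_intros q_props) auto
  have "integrable (\<mu> t) (\<Phi> (real (Suc n)))" for n
    by (rule integrable_compact_support_mu[OF t, of _ "real (Suc n)"])
       (use q_props in \<open>auto simp: \<Phi>_def[abs_def] intro!: continuous_intros\<close>)
  then have int: "integrable (\<mu> t) (F n)" for n
    by (simp add: F_def[abs_def])
  have le: "(\<integral>\<^sup>+x. ennreal (F n x) \<partial>\<mu> t) \<le> ennreal B" for n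
    using truncated_moment(1)[of "real (Suc n)" t C] t C bd
    by (subst nn_integral_eq_integral[OF int])
       (use F0 in \<open>auto simp: B_def F_def[abs_def] simp del: ennreal_plus intro!: ennreal_leI\<close>)
  have lim: "(\<lambda>n. F n x) \<longlonglongrightarrow> wt x ^ Q" for x
  proof -
    define g where "g = wt x ^ Q"
    \<comment> \<open>For \<open>R \<ge> g\<close> the truncated weight
      \<open>R / 3 * (1 - (1 - g / R) ^ 3)\<close> is this polynomial in
      \<open>1 / R\<close>.\<close>
    have "(\<lambda>n. g - g\<^sup>2 / real (Suc n) + g ^ 3 / (3 * (real (Suc n))\<^sup>2)) \<longlonglongrightarrow> g"
      by real_asymp
    moreover have "\<forall>\<^sub>F n in sequentially. g - g\<^sup>2 / real (Suc n) + g ^ 3 / (3 * (real (Suc n))\<^sup>2) = F n x"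
    proof (rule eventually_sequentiallyI[of "nat \<lceil>g\<rceil>"])
      fix n assume n: "nat \<lceil>g\<rceil> \<le> n"
      define r where "r = real (Suc n)"
      have "g \<le> r" "0 < r" using n unfolding r_def by linarith+
      then have "1 - g / r \<ge> 0" by simp
      then show "g - g\<^sup>2 / real (Suc n) + g ^ 3 / (3 * (real (Suc n))\<^sup>2) = F n x"
        unfolding F_def \<Phi>_def q_def g_def[symmetric] r_def[symmetric] using \<open>0 < r\<close>
        by (simp add: max_def field_simps power3_eq_cube power2_eq_square)
    qed
    ultimately show ?thesis unfolding g_def by (rule Lim_transform_eventually)
  qed
  have meas: "F n \<in> borel_measurable (\<mu> t)" for n by (rule cont_measurable_mu[OF t contF])
  have "(\<integral>\<^sup>+x. ennreal (wt x ^ Q) \<partial>\<mu> t) = (\<integral>\<^sup>+x. liminf (\<lambda>n. ennreal (F n x)) \<partial>\<mu> t)"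
    by (intro nn_integral_cong lim_imp_Liminf[symmetric] tendsto_ennrealI lim) simp
  also have "\<dots> \<le> liminf (\<lambda>n. \<integral>\<^sup>+x. ennreal (F n x) \<partial>\<mu> t)"
    by (rule nn_integral_liminf) (use meas in measurable)
  also have "\<dots> \<le> ennreal B"
    by (intro Liminf_le always_eventually allI le) simp
  finally have fin: "(\<integral>\<^sup>+x. ennreal (wt x ^ Q) \<partial>\<mu> t) \<le> ennreal B" .
  show "integrable (\<mu> t) (\<lambda>x. wt x ^ Q)"
    by (rule integrableI_nonneg)
       (use fin t in \<open>auto intro!: cont_measurable_mu continuous_intros intro: le_less_trans\<close>)
  have B: "0 \<le> B"
    using C t by (auto simp: B_def intro!: add_nonneg_nonneg Bochner_Integration.integral_nonneg)
  have "ennreal (\<integral>x. wt x ^ Q \<partial>\<mu> t) \<le> ennreal B"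
    using fin nn_integral_eq_integral[OF \<open>integrable (\<mu> t) (\<lambda>x. wt x ^ Q)\<close>] by simp
  then show "(\<integral>x. wt x ^ Q \<partial>\<mu> t) \<le> (\<integral>x. wt x ^ Q \<partial>\<mu> 0) + C * t"
    using B by (simp add: B_def)
qed

lemma moments_local:
  obtains B where "0 \<le> B" "\<And>t. 0 \<le> t \<Longrightarrow> t \<le> T \<Longrightarrow> integrable (\<mu> t) (\<lambda>x. wt x ^ Q)"
    "\<And>t. 0 \<le> t \<Longrightarrow> t \<le> T \<Longrightarrow> (\<integral>x. wt x ^ Q \<partial>\<mu> t) \<le> B"
proof -
  obtain H where H: "\<And>t. t \<in> {0..T} \<Longrightarrow> \<bar>h t\<bar> \<le> H" using h_bounded by blast
  obtain C where C: "0 \<le> C" "\<And>x r. \<bar>h r\<bar> \<le> H \<Longrightarrow> s * g2 x - (b x - h r) * g1 x \<le> C - P x"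
    using lyapunov by blast
  define B where "B = (\<integral>x. wt x ^ Q \<partial>\<mu> 0) + C * \<bar>T\<bar>"
  show thesis
  proof (rule that[of B])
    show "0 \<le> B" unfolding B_def using C by (intro add_nonneg_nonneg) auto
    fix t assume t: "0 \<le> t" "t \<le> T"
    have *: "s * g2 x - (b x - h r) * g1 x \<le> C - P x" if "0 \<le> r" "r \<le> t" for x r
      by (rule C(2)) (use H that t in auto)
    show "integrable (\<mu> t) (\<lambda>x. wt x ^ Q)" by (rule moments(1)[OF t(1) C(1) *])
    have "C * t \<le> C * \<bar>T\<bar>" using C t by (intro mult_left_mono) auto
    then show "(\<integral>x. wt x ^ Q \<partial>\<mu> t) \<le> B" unfolding B_def
      using moments(2)[OF t(1) C(1) *] by simp
  qed
qed

lemma integrable_growth: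
  assumes t: "0 \<le> t" and f: "f \<in> borel_measurable borel" and bd: "\<And>x. \<bar>f x\<bar> \<le> C * wt x ^ k" and k: "k \<le> Q"
  shows "integrable (\<mu> t) f"
proof -
  obtain B where "integrable (\<mu> t) (\<lambda>x. wt x ^ Q)" using moments_local[of t] t by auto
  then have "integrable (\<mu> t) (\<lambda>x. C * wt x ^ Q)" by simp
  then show ?thesis
  proof (rule Bochner_Integration.integrable_bound)
    have C: "0 \<le> C" using order_trans[OF abs_ge_zero bd[of 0]] by (simp add: wt_def)
    show "AE x in \<mu> t. norm (f x) \<le> norm (C * wt x ^ Q)"
      using C bd by (auto intro!: AE_I2 order_trans[OF bd] mult_left_mono wt_pow_mono[OF k] simp: abs_mult)
  qed (use f t measurable_mu in auto)
qed

lemma integral_growth_le: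
  assumes t: "0 \<le> t" and f: "f \<in> borel_measurable borel" and bd: "\<And>x. \<bar>f x\<bar> \<le> C * wt x ^ k" and k: "k \<le> Q"
  shows "\<bar>\<integral>x. f x \<partial>\<mu> t\<bar> \<le> C * (\<integral>x. wt x ^ k \<partial>\<mu> t)"
proof -
  have "\<bar>\<integral>x. f x \<partial>\<mu> t\<bar> \<le> (\<integral>x. \<bar>f x\<bar> \<partial>\<mu> t)" by (rule integral_abs_bound)
  also have "\<dots> \<le> (\<integral>x. C * wt x ^ k \<partial>\<mu> t)"
    by (intro integral_mono integrable_abs integrable_growth[OF t f bd k]
        Bochner_Integration.integrable_mult_right bd integrable_growth[OF t, of _ 1 k]) (use k in auto)
  finally show ?thesis by simp
qed

lemma moments_local_le:
  assumes k: "k \<le> Q"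
  obtains B where "0 < B" "\<And>t. 0 \<le> t \<Longrightarrow> t \<le> T \<Longrightarrow> (\<integral>x. wt x ^ k \<partial>\<mu> t) \<le> B"
proof -
  obtain B where B: "0 \<le> B" "\<And>t. 0 \<le> t \<Longrightarrow> t \<le> T \<Longrightarrow> integrable (\<mu> t) (\<lambda>x. wt x ^ Q)"
    "\<And>t. 0 \<le> t \<Longrightarrow> t \<le> T \<Longrightarrow> (\<integral>x. wt x ^ Q \<partial>\<mu> t) \<le> B" using moments_local[of T] by blast
  show thesis
  proof (rule that[of "B + 1"])
    fix t assume t: "0 \<le> t" "t \<le> T"
    have "(\<integral>x. wt x ^ k \<partial>\<mu> t) \<le> (\<integral>x. wt x ^ Q \<partial>\<mu> t)"
      by (intro integral_mono integrable_growth[OF t(1), of _ 1 k] B t wt_pow_mono k) (use k in auto)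
    then show "(\<integral>x. wt x ^ k \<partial>\<mu> t) \<le> B + 1" using B(3)[OF t] by simp
  qed (use B in auto)
qed

end

section \<open>Cutoff functions and continuity of moments in time\<close>

definition cutoff :: "real \<Rightarrow> real \<Rightarrow> real" where "cutoff R x = max 0 (1 - wt x / R) ^ 3"
definition cutoff1 :: "real \<Rightarrow> real \<Rightarrow> real" where
  "cutoff1 R x = 3 * max 0 (1 - wt x / R) ^ 2 * (- (2 * x) / R)"
definition cutoff2 :: "real \<Rightarrow> real \<Rightarrow> real" where
  "cutoff2 R x = 6 * max 0 (1 - wt x / R) * (2 * x / R)\<^sup>2 - 6 / R * max 0 (1 - wt x / R) ^ 2"

lemma cutoff_derivs:
  assumes R: "0 < R"
  shows "(cutoff R has_real_derivative cutoff1 R x) (at x)"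
    "(cutoff1 R has_real_derivative cutoff2 R x) (at x)"
proof -
  have d: "((\<lambda>x. 1 - wt x / R) has_real_derivative (- (2 * x) / R)) (at x)"
    using R by (auto intro!: derivative_eq_intros)
  from max_power_deriv[OF d, of 1] show "(cutoff R has_real_derivative cutoff1 R x) (at x)"
    by (simp add: cutoff_def[abs_def] cutoff1_def numeral_eq_Suc)
  have d1: "((\<lambda>x. - (2 * x) / R) has_real_derivative (- 2 / R)) (at x)"
    using R by (auto intro!: derivative_eq_intros)
  from max_power_deriv[OF d, of 0] have d2: "((\<lambda>x. 3 * max 0 (1 - wt x / R) ^ 2) has_real_derivative
      3 * (2 * max 0 (1 - wt x / R) * (- (2 * x) / R))) (at x)"
    by (intro DERIV_cmult) (simp add: numeral_eq_Suc)
  have "(cutoff1 R has_real_derivative 3 * max 0 (1 - wt x / R) ^ 2 * (- 2 / R) +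
      3 * (2 * max 0 (1 - wt x / R) * (- (2 * x) / R)) * (- (2 * x) / R)) (at x)"
    unfolding cutoff1_def[abs_def] by (rule DERIV_mult'[OF d2 d1])
  moreover have "3 * max 0 (1 - wt x / R) ^ 2 * (- 2 / R) +
      3 * (2 * max 0 (1 - wt x / R) * (- (2 * x) / R)) * (- (2 * x) / R) = cutoff2 R x"
    by (simp add: cutoff2_def power2_eq_square algebra_simps)
  ultimately show "(cutoff1 R has_real_derivative cutoff2 R x) (at x)" by simp
qed

text \<open>Since the cutoff is a function of \<open>wt x / R\<close>, the errors
  \<open>1 - cutoff R x\<close>, \<open>cutoff1 R x\<close> and \<open>cutoff2 R x\<close> are all
  of order \<open>wt x / R\<close>: removing the cutoff costs a single power of the weight.\<close>

lemma cutoff_bounds: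
  assumes R: "1 \<le> R"
  shows "0 \<le> cutoff R x" "cutoff R x \<le> 1" "1 - cutoff R x \<le> 3 * wt x / R"
    "\<bar>cutoff1 R x\<bar> \<le> 6 * wt x / R" "\<bar>cutoff2 R x\<bar> \<le> 30 * wt x / R"
    "R < \<bar>x\<bar> \<Longrightarrow> cutoff R x = 0"
    "continuous_on UNIV (cutoff R)" "continuous_on UNIV (cutoff1 R)" "continuous_on UNIV (cutoff2 R)"
proof -
  define v m where "v = wt x / R" and "m = max 0 (1 - v)"
  have v: "0 \<le> v" using R by (simp add: v_def)
  have m: "0 \<le> m" "m \<le> 1" "m ^ 2 \<le> 1" using v by (auto simp: m_def power_le_one)
  have c: "cutoff R x = m ^ 3" by (simp add: cutoff_def m_def v_def)
  show "0 \<le> cutoff R x" "cutoff R x \<le> 1" using m by (auto simp: c power_le_one)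
  have "1 - m ^ 3 \<le> 3 * v"
  proof (cases "v \<le> 1")
    case True
    have "0 \<le> v\<^sup>2 * (3 - v)" using True by simp
    then show ?thesis using True by (simp add: m_def max_def power3_eq_cube power2_eq_square algebra_simps)
  qed (simp add: m_def)
  then show "1 - cutoff R x \<le> 3 * wt x / R" by (simp add: c v_def)
  have xR: "\<bar>x\<bar> / R \<le> wt x / R" using R abs_le_wt by (simp add: divide_right_mono)
  have "\<bar>cutoff1 R x\<bar> = m\<^sup>2 * (6 * (\<bar>x\<bar> / R))"
    using R m by (simp add: cutoff1_def m_def v_def abs_mult abs_divide)
  also have "\<dots> \<le> 1 * (6 * (wt x / R))"
    using m xR R by (intro mult_mono) auto
  finally show "\<bar>cutoff1 R x\<bar> \<le> 6 * wt x / R" by simp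
  have "x\<^sup>2 / R\<^sup>2 \<le> wt x / R"
  proof -
    have "x\<^sup>2 / R\<^sup>2 \<le> wt x / R\<^sup>2" using square_le_wt by (simp add: divide_right_mono)
    also have "\<dots> \<le> wt x / R" using R by (intro divide_left_mono) (auto simp: power2_eq_square)
    finally show ?thesis .
  qed
  then have "m * (x\<^sup>2 / R\<^sup>2) \<le> 1 * v"
    unfolding v_def using m R by (intro mult_mono) auto
  then have 1: "m * (x\<^sup>2 / R\<^sup>2) \<le> v" by simp
  have 2: "m\<^sup>2 * (1 / R) \<le> 1 * v"
    unfolding v_def using m R by (intro mult_mono divide_right_mono) auto
  have 3: "cutoff2 R x = 24 * (m * (x\<^sup>2 / R\<^sup>2)) - 6 * (m\<^sup>2 * (1 / R))"
    by (simp add: cutoff2_def m_def v_def power_divide power_mult_distrib)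
  have 4: "0 \<le> m * (x\<^sup>2 / R\<^sup>2)" "0 \<le> m\<^sup>2 * (1 / R)"
    using m R by auto
  have "\<bar>24 * A - 6 * B\<bar> \<le> 30 * v" if "A \<le> v" "B \<le> 1 * v" "0 \<le> A" "0 \<le> B" for A B
    using that v by linarith
  from this[OF 1 2 4] have "\<bar>cutoff2 R x\<bar> \<le> 30 * v" unfolding 3 .
  then show "\<bar>cutoff2 R x\<bar> \<le> 30 * wt x / R" by (simp add: v_def)
  show "cutoff R x = 0" if "R < \<bar>x\<bar>"
    using that abs_le_wt[of x] R by (simp add: cutoff_def max_def)
  show "continuous_on UNIV (cutoff R)" "continuous_on UNIV (cutoff1 R)" "continuous_on UNIV (cutoff2 R)"
    unfolding cutoff_def[abs_def] cutoff1_def[abs_def] cutoff2_def[abs_def]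
    using R by (auto intro!: continuous_intros)
qed

lemma C2_continuous:
  assumes "\<And>x. ((\<phi>::real\<Rightarrow>real) has_real_derivative \<phi>1 x) (at x)"
      "\<And>x. (\<phi>1 has_real_derivative \<phi>2 x) (at x)"
  shows "continuous_on UNIV \<phi>" "continuous_on UNIV \<phi>1"
  using assms by (meson DERIV_isCont continuous_at_imp_continuous_on)+

context weak_fp begin

lemma weak_cutoff:
  assumes d: "\<And>x. (\<phi> has_real_derivative \<phi>1 x) (at x)"
      "\<And>x. (\<phi>1 has_real_derivative \<phi>2 x) (at x)"
    and c: "continuous_on UNIV \<phi>2" and t: "0 \<le> t" and R: "1 \<le> R"
  defines "G \<equiv> \<lambda>r. \<integral>x. gen r (\<lambda>x. \<phi> x * cutoff1 R x + \<phi>1 x * cutoff R x)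
      (\<lambda>x. \<phi> x * cutoff2 R x + 2 * \<phi>1 x * cutoff1 R x + \<phi>2 x * cutoff R x) x \<partial>\<mu> r"
  shows "G integrable_on {0..t}"
    and "(\<integral>x. \<phi> x * cutoff R x \<partial>\<mu> t) = (\<integral>x. \<phi> x * cutoff R x \<partial>\<mu> 0) + integral {0..t} G"
proof -
  have R0: "0 < R" using R by simp
  have d1: "((\<lambda>x. \<phi> x * cutoff R x) has_real_derivative \<phi> x * cutoff1 R x + \<phi>1 x * cutoff R x) (at x)" for x
    by (rule DERIV_mult'[OF d(1) cutoff_derivs(1)[OF R0]])
  have d2: "((\<lambda>x. \<phi> x * cutoff1 R x + \<phi>1 x * cutoff R x) has_real_derivative
      \<phi> x * cutoff2 R x + 2 * \<phi>1 x * cutoff1 R x + \<phi>2 x * cutoff R x) (at x)" for x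
    using DERIV_add[OF DERIV_mult'[OF d(1) cutoff_derivs(2)[OF R0]] DERIV_mult'[OF d(2) cutoff_derivs(1)[OF R0]], of x]
    by (simp add: algebra_simps)
  have co: "continuous_on UNIV (\<lambda>x. \<phi> x * cutoff2 R x + 2 * \<phi>1 x * cutoff1 R x + \<phi>2 x * cutoff R x)"
    by (intro continuous_intros cutoff_bounds R c C2_continuous[OF d])
  have su: "\<phi> x * cutoff R x = 0" if "R < \<bar>x\<bar>" for x
    using cutoff_bounds(6)[OF R that] by simp
  show "G integrable_on {0..t}" unfolding G_def
    by (rule weak_HK(1)[OF d1 d2 co _ t]) (erule su)
  show "(\<integral>x. \<phi> x * cutoff R x \<partial>\<mu> t) = (\<integral>x. \<phi> x * cutoff R x \<partial>\<mu> 0) + integral {0..t} G"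
    unfolding G_def by (rule weak_HK(2)[OF d1 d2 co _ t]) (erule su)
qed

text \<open>As \<open>f\<close> is only continuous, it is replaced by a polynomial times a cutoff:
  Stone-Weierstrass controls the error on \<open>{-R..R}\<close>, the integral of
  \<open>wt x ^ Suc k\<close> controls it outside, and the product is a test function, whose
  integral is continuous by the weak formulation.\<close>

lemma continuous_integral:
  assumes f: "continuous_on UNIV f" and bd: "\<And>x. \<bar>f x\<bar> \<le> C * wt x ^ k" and k: "k < Q"
  shows "continuous_on {0..T} (\<lambda>t. \<integral>x. f x \<partial>\<mu> t)"
proof (rule continuous_on_uniform_approx)
  fix e :: real assume e: "e > 0"
  have C: "0 \<le> C" using order_trans[OF abs_ge_zero bd[of 0]] by (simp add: wt_def)
  have fm: "f \<in> borel_measurable borel" using f by (rule borel_measurable_continuous_onI)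
  obtain B where B: "0 < B" "\<And>t. 0 \<le> t \<Longrightarrow> t \<le> T \<Longrightarrow> (\<integral>x. wt x ^ Suc k \<partial>\<mu> t) \<le> B"
    using moments_local_le[of "Suc k" T] k by (auto simp: Suc_le_eq)
  define R where "R = max 1 (6 * C * B / e)"
  have R: "1 \<le> R" "0 < R" by (auto simp: R_def)
  have "6 * C * B / e \<le> R" by (simp add: R_def)
  then have Re: "3 * C / R * B \<le> e / 2" using e R by (simp add: field_simps)
  obtain pol where pol: "real_polynomial_function pol" "\<And>x. x \<in> {-R..R} \<Longrightarrow> \<bar>f x - pol x\<bar> < e / 2"
    using Stone_Weierstrass_real_polynomial_function[of "{-R..R}" f "e / 2"] continuous_on_subset[OF f] e
    by auto
  obtain pol1 where pol1: "real_polynomial_function pol1" "\<And>x. (pol has_real_derivative pol1 x) (at x)"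
    using has_real_derivative_polynomial_function[OF pol(1)] by blast
  obtain pol2 where pol2: "real_polynomial_function pol2" "\<And>x. (pol1 has_real_derivative pol2 x) (at x)"
    using has_real_derivative_polynomial_function[OF pol1(1)] by blast
  have c2: "continuous_on UNIV pol2"
    using pol2(1) by (intro continuous_on_polymonial_function) (simp add: real_polynomial_function_eq)
  have c0: "continuous_on UNIV pol" by (rule C2_continuous[OF pol1(2) pol2(2)])
  let ?g = "\<lambda>t. \<integral>x. pol x * cutoff R x \<partial>\<mu> t"
  define G where "G = (\<lambda>r. \<integral>x. gen r (\<lambda>x. pol x * cutoff1 R x + pol1 x * cutoff R x)
      (\<lambda>x. pol x * cutoff2 R x + 2 * pol1 x * cutoff1 R x + pol2 x * cutoff R x) x \<partial>\<mu> r)"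
  show "\<exists>g. continuous_on {0..T} g \<and> (\<forall>t\<in>{0..T}. \<bar>(\<integral>x. f x \<partial>\<mu> t) - g t\<bar> \<le> e)"
  proof (intro exI[of _ ?g] conjI ballI)
    show "continuous_on {0..T} ?g"
    proof (cases "0 \<le> T")
      case True
      have "continuous_on {0..T} (\<lambda>t. (\<integral>x. pol x * cutoff R x \<partial>\<mu> 0) + integral {0..t} G)"
        unfolding G_def
        by (intro continuous_intros indefinite_integral_continuous_1 weak_cutoff(1)[OF pol1(2) pol2(2) c2 True R(1)])
      then show ?thesis
      proof (rule continuous_on_eq)
        fix t assume "t \<in> {0..T}"
        then have t: "0 \<le> t" by simp
        show "(\<integral>x. pol x * cutoff R x \<partial>\<mu> 0) + integral {0..t} G = ?g t"
          unfolding G_def by (rule weak_cutoff(2)[OF pol1(2) pol2(2) c2 t R(1), symmetric])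
      qed
    qed simp
    fix t assume "t \<in> {0..T}"
    then have t: "0 \<le> t" "t \<le> T" by auto
    interpret prob_space "\<mu> t" using prob t by simp
    have int1: "integrable (\<mu> t) f"
      by (rule integrable_growth[OF t(1) fm bd]) (use k in simp)
    have int2: "integrable (\<mu> t) (\<lambda>x. pol x * cutoff R x)"
    proof (rule integrable_compact_support_mu[OF t(1), of _ R])
      show "continuous_on UNIV (\<lambda>x. pol x * cutoff R x)"
        by (intro continuous_on_mult c0 cutoff_bounds(7) R(1))
      show "R < \<bar>x\<bar> \<Longrightarrow> pol x * cutoff R x = 0" for x
        using cutoff_bounds(6)[OF R(1), of x] by simp
    qed
    have int3: "integrable (\<mu> t) (\<lambda>x. wt x ^ Suc k)"
      by (rule integrable_growth[OF t(1), of _ 1 "Suc k"]) (use k in auto)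
    have pt: "\<bar>f x - pol x * cutoff R x\<bar> \<le> 3 * C / R * wt x ^ Suc k + e / 2" for x
    proof -
      have "\<bar>f x * (1 - cutoff R x)\<bar> \<le> (C * wt x ^ k) * (3 * wt x / R)"
        unfolding abs_mult using cutoff_bounds(1-3)[OF R(1), of x] C
        by (intro mult_mono bd) auto
      moreover have "\<bar>(f x - pol x) * cutoff R x\<bar> \<le> e / 2"
      proof (cases "R < \<bar>x\<bar>")
        case False
        then have "x \<in> {-R..R}" by auto
        then have "\<bar>f x - pol x\<bar> \<le> e / 2" using pol(2)[of x] by simp
        then have "\<bar>f x - pol x\<bar> * \<bar>cutoff R x\<bar> \<le> (e / 2) * 1"
          using cutoff_bounds(1-2)[OF R(1), of x] e by (intro mult_mono) auto
        then show ?thesis by (simp add: abs_mult)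
      qed (use cutoff_bounds(6)[OF R(1), of x] e in simp)
      moreover have "f x - pol x * cutoff R x = f x * (1 - cutoff R x) + (f x - pol x) * cutoff R x"
        by (simp add: algebra_simps)
      moreover have "(C * wt x ^ k) * (3 * wt x / R) = 3 * C / R * wt x ^ Suc k" by simp
      ultimately show ?thesis by linarith
    qed
    have "\<bar>(\<integral>x. f x \<partial>\<mu> t) - ?g t\<bar> = \<bar>\<integral>x. f x - pol x * cutoff R x \<partial>\<mu> t\<bar>"
      using int1 int2 by simp
    also have "\<dots> \<le> (\<integral>x. \<bar>f x - pol x * cutoff R x\<bar> \<partial>\<mu> t)" by (rule integral_abs_bound)
    also have "\<dots> \<le> (\<integral>x. 3 * C / R * wt x ^ Suc k + e / 2 \<partial>\<mu> t)"
      using int1 int2 int3 pt by (intro integral_mono) auto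
    also have "\<dots> = 3 * C / R * (\<integral>x. wt x ^ Suc k \<partial>\<mu> t) + e / 2"
      using int3 by (simp add: prob_space)
    also have "\<dots> \<le> 3 * C / R * B + e / 2"
      using B(2)[OF t] C R by (intro add_right_mono mult_left_mono) auto
    finally show "\<bar>(\<integral>x. f x \<partial>\<mu> t) - ?g t\<bar> \<le> e" using Re by linarith
  qed
qed

end

text \<open>Continuity of \<open>h\<close> depends on the means of all components, each of which is
  handled by \<open>weak_fp\<close>; adding it in a second stage avoids a circular
  assumption.\<close>

locale weak_fp_cont = weak_fp +
  assumes h_cont: "\<And>T. continuous_on {0..T} h"
begin

section \<open>Time derivatives of integrals with growing integrands\<close>

lemma gen_integral:
  assumes d: "\<And>x. (\<phi> has_real_derivative \<phi>1 x) (at x)"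
      "\<And>x. (\<phi>1 has_real_derivative \<phi>2 x) (at x)"
    and c: "continuous_on UNIV \<phi>2"
    and bd: "\<And>x. \<bar>\<phi>1 x\<bar> \<le> B * wt x" "\<And>x. \<bar>\<phi>2 x\<bar> \<le> B * wt x"
  shows "0 \<le> t \<Longrightarrow> (\<integral>x. gen t \<phi>1 \<phi>2 x \<partial>\<mu> t) =
      s * (\<integral>x. \<phi>2 x \<partial>\<mu> t) - (\<integral>x. b x * \<phi>1 x \<partial>\<mu> t) + h t * (\<integral>x. \<phi>1 x \<partial>\<mu> t)"
    and "continuous_on {0..T} (\<lambda>t. \<integral>x. gen t \<phi>1 \<phi>2 x \<partial>\<mu> t)"
proof -
  have B: "0 \<le> B" using order_trans[OF abs_ge_zero bd(1)[of 0]] by (simp add: wt_def)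
  have bd3: "\<bar>b x * \<phi>1 x\<bar> \<le> Cb * B * wt x ^ Suc p" for x
  proof -
    have "\<bar>b x * \<phi>1 x\<bar> \<le> (Cb * wt x ^ p) * (B * wt x)"
      unfolding abs_mult using Cb_nonneg by (intro mult_mono b_growth bd) auto
    then show ?thesis by (simp add: ac_simps)
  qed
  have bd': "\<bar>\<phi>1 x\<bar> \<le> B * wt x ^ 1" "\<bar>\<phi>2 x\<bar> \<le> B * wt x ^ 1" for x using bd by auto
  have c': "continuous_on UNIV \<phi>1" "continuous_on UNIV (\<lambda>x. b x * \<phi>1 x)"
    by (intro continuous_intros b_cont C2_continuous[OF d])+
  have eq: "(\<integral>x. gen t \<phi>1 \<phi>2 x \<partial>\<mu> t) =
      s * (\<integral>x. \<phi>2 x \<partial>\<mu> t) - (\<integral>x. b x * \<phi>1 x \<partial>\<mu> t) + h t * (\<integral>x. \<phi>1 x \<partial>\<mu> t)" if t: "0 \<le> t" for t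
  proof -
    have i: "integrable (\<mu> t) \<phi>1" "integrable (\<mu> t) \<phi>2" "integrable (\<mu> t) (\<lambda>x. b x * \<phi>1 x)"
      by (rule integrable_growth[OF t _ bd'(1)] integrable_growth[OF t _ bd'(2)] integrable_growth[OF t _ bd3],
          use Q_ge c c' in \<open>auto intro: borel_measurable_continuous_onI\<close>)+
    have "(\<integral>x. gen t \<phi>1 \<phi>2 x \<partial>\<mu> t) = (\<integral>x. s * \<phi>2 x - b x * \<phi>1 x + h t * \<phi>1 x \<partial>\<mu> t)"
      by (simp add: gen_def algebra_simps)
    then show ?thesis using i by simp
  qed
  then show "0 \<le> t \<Longrightarrow> (\<integral>x. gen t \<phi>1 \<phi>2 x \<partial>\<mu> t) =
      s * (\<integral>x. \<phi>2 x \<partial>\<mu> t) - (\<integral>x. b x * \<phi>1 x \<partial>\<mu> t) + h t * (\<integral>x. \<phi>1 x \<partial>\<mu> t)" .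
  have "continuous_on {0..T} (\<lambda>t. s * (\<integral>x. \<phi>2 x \<partial>\<mu> t) - (\<integral>x. b x * \<phi>1 x \<partial>\<mu> t) + h t * (\<integral>x. \<phi>1 x \<partial>\<mu> t))"
    using Q_ge by (intro continuous_intros h_cont continuous_integral[OF c bd'(2)]
        continuous_integral[OF c'(1) bd'(1)] continuous_integral[OF c'(2) bd3]) auto
  then show "continuous_on {0..T} (\<lambda>t. \<integral>x. gen t \<phi>1 \<phi>2 x \<partial>\<mu> t)"
    by (rule continuous_on_eq) (simp add: eq)
qed

text \<open>Cutoffs extend the weak formulation to integrands growing like \<open>wt\<close>, in
  particular to \<open>x\<close>, \<open>x\<^sup>2\<close> and shifted kernels. As the integral of
  the generator is continuous in time, the integral identity can be differentiated.\<close>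

lemma weak_derivative:
  assumes d: "\<And>x. (\<phi> has_real_derivative \<phi>1 x) (at x)"
      "\<And>x. (\<phi>1 has_real_derivative \<phi>2 x) (at x)"
    and c: "continuous_on UNIV \<phi>2"
    and bd: "\<And>x. \<bar>\<phi> x\<bar> \<le> B * wt x" "\<And>x. \<bar>\<phi>1 x\<bar> \<le> B * wt x" "\<And>x. \<bar>\<phi>2 x\<bar> \<le> B * wt x"
    and t: "t \<in> {0..T}"
  shows "((\<lambda>t. \<integral>x. \<phi> x \<partial>\<mu> t) has_real_derivative (\<integral>x. gen t \<phi>1 \<phi>2 x \<partial>\<mu> t)) (at t within {0..T})"
proof -
  have B: "0 \<le> B" using order_trans[OF abs_ge_zero bd(1)[of 0]] by (simp add: wt_def)
  note cont = C2_continuous[OF d]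
  define \<psi>1 where "\<psi>1 n x = \<phi> x * cutoff1 (real (Suc n)) x + \<phi>1 x * cutoff (real (Suc n)) x" for n x
  define \<psi>2 where "\<psi>2 n x = \<phi> x * cutoff2 (real (Suc n)) x + 2 * \<phi>1 x * cutoff1 (real (Suc n)) x
    + \<phi>2 x * cutoff (real (Suc n)) x" for n x
  have R: "1 \<le> real (Suc n)" for n by simp
  have lim_cut: "(\<lambda>n. cutoff (real (Suc n)) x) \<longlonglongrightarrow> 1"
    "(\<lambda>n. cutoff1 (real (Suc n)) x) \<longlonglongrightarrow> 0" "(\<lambda>n. cutoff2 (real (Suc n)) x) \<longlonglongrightarrow> 0" for x
  proof -
    have z: "(\<lambda>n. K * wt x / real (Suc n)) \<longlonglongrightarrow> 0" for K by real_asymp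
    have "(\<lambda>n. 1 - 3 * wt x / real (Suc n)) \<longlonglongrightarrow> 1 - 0" by (intro tendsto_intros z)
    then have "(\<lambda>n. 1 - 3 * wt x / real (Suc n)) \<longlonglongrightarrow> 1" by simp
    then show "(\<lambda>n. cutoff (real (Suc n)) x) \<longlonglongrightarrow> 1"
    proof (rule tendsto_sandwich[rotated 2])
      show "\<forall>\<^sub>F n in sequentially. 1 - 3 * wt x / real (Suc n) \<le> cutoff (real (Suc n)) x"
        using cutoff_bounds(3)[OF R, where x = x] by (intro always_eventually allI) (simp add: algebra_simps)
      show "\<forall>\<^sub>F n in sequentially. cutoff (real (Suc n)) x \<le> 1"
        using cutoff_bounds(2)[OF R, where x = x] by (intro always_eventually allI)
    qed simp_all
    show "(\<lambda>n. cutoff1 (real (Suc n)) x) \<longlonglongrightarrow> 0"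
      by (rule Lim_null_comparison[OF _ z[of 6]]) (use cutoff_bounds(4)[OF R] in simp)
    show "(\<lambda>n. cutoff2 (real (Suc n)) x) \<longlonglongrightarrow> 0"
      by (rule Lim_null_comparison[OF _ z[of 30]]) (use cutoff_bounds(5)[OF R] in simp)
  qed
  have cut_bd: "\<bar>cutoff (real (Suc n)) x\<bar> \<le> 1" "\<bar>cutoff1 (real (Suc n)) x\<bar> \<le> 6 * wt x"
    "\<bar>cutoff2 (real (Suc n)) x\<bar> \<le> 30 * wt x" for n x
  proof -
    have "K * wt x / real (Suc n) \<le> K * wt x" if "0 \<le> K" for K
      using that divide_left_mono[of 1 "real (Suc n)" "K * wt x"] by simp
    from this[of 6] this[of 30] show "\<bar>cutoff1 (real (Suc n)) x\<bar> \<le> 6 * wt x"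
      "\<bar>cutoff2 (real (Suc n)) x\<bar> \<le> 30 * wt x" "\<bar>cutoff (real (Suc n)) x\<bar> \<le> 1"
      using cutoff_bounds(1,2,4,5)[OF R[of n], of x] by linarith+
  qed
  have w1: "wt x \<le> wt x ^ 2" for x using wt_pow_mono[of 1 2 x] by simp
  have bd\<psi>0: "\<bar>\<phi> x * cutoff (real (Suc n)) x\<bar> \<le> B * wt x ^ 1" for n x
    using mult_mono[OF bd(1)[of x] cut_bd(1)[of n x]] B by (simp add: abs_mult)
  have bd\<psi>1: "\<bar>\<psi>1 n x\<bar> \<le> 7 * B * wt x ^ 2" for n x
  proof -
    have "\<bar>\<phi> x * cutoff1 (real (Suc n)) x\<bar> \<le> (B * wt x) * (6 * wt x)"
      unfolding abs_mult by (intro mult_mono bd cut_bd) (use B in auto)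
    moreover have "\<bar>\<phi>1 x * cutoff (real (Suc n)) x\<bar> \<le> (B * wt x) * 1"
      unfolding abs_mult by (intro mult_mono bd cut_bd) (use B in auto)
    moreover have "B * wt x \<le> B * wt x ^ 2" using w1 B by (intro mult_left_mono) auto
    ultimately show ?thesis unfolding \<psi>1_def by (simp add: power2_eq_square algebra_simps)
  qed
  \<comment> \<open>The coefficient is 30 + 2 * 6 + 1, from the bounds of the three cutoff
    factors.\<close>
  have bd\<psi>2: "\<bar>\<psi>2 n x\<bar> \<le> 43 * B * wt x ^ 2" for n x
  proof -
    have "\<bar>\<phi> x * cutoff2 (real (Suc n)) x\<bar> \<le> (B * wt x) * (30 * wt x)"
      unfolding abs_mult by (intro mult_mono bd cut_bd) (use B in auto)
    moreover have "\<bar>\<phi>1 x * cutoff1 (real (Suc n)) x\<bar> \<le> (B * wt x) * (6 * wt x)"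
      unfolding abs_mult by (intro mult_mono bd cut_bd) (use B in auto)
    moreover have "\<bar>\<phi>2 x * cutoff (real (Suc n)) x\<bar> \<le> (B * wt x) * 1"
      unfolding abs_mult by (intro mult_mono bd cut_bd) (use B in auto)
    moreover have "B * wt x \<le> B * wt x ^ 2" using w1 B by (intro mult_left_mono) auto
    ultimately show ?thesis unfolding \<psi>2_def by (simp add: power2_eq_square algebra_simps)
  qed
  have cont\<psi>: "continuous_on UNIV (\<psi>1 n)" "continuous_on UNIV (\<psi>2 n)" for n
    unfolding \<psi>1_def[abs_def] \<psi>2_def[abs_def]
    by (intro continuous_intros cont c cutoff_bounds R)+
  define L where "L r = (\<integral>x. gen r \<phi>1 \<phi>2 x \<partial>\<mu> r)" for r
  have contL: "continuous_on {0..T} L" for T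
    unfolding L_def[abs_def] by (rule gen_integral(2)[OF d c bd(2,3)])
  have eq: "(\<integral>x. \<phi> x \<partial>\<mu> t) = (\<integral>x. \<phi> x \<partial>\<mu> 0) + integral {0..t} L" if t: "0 \<le> t" for t
  proof -
    obtain H where H: "\<And>r. r \<in> {0..t} \<Longrightarrow> \<bar>h r\<bar> \<le> H" using h_bounded by blast
    have H0: "0 \<le> H" using H[of 0] t by auto
    define K where "K = s * (43 * B) + (Cb + H) * (7 * B)"
    have K0: "0 \<le> K" using s_pos B H0 Cb_nonneg by (simp add: K_def)
    have gbd: "\<bar>gen r (\<psi>1 n) (\<psi>2 n) x\<bar> \<le> K * wt x ^ (p + 2)" if "r \<in> {0..t}" for r n x
    proof -
      have "\<bar>b x - h r\<bar> \<le> Cb * wt x ^ p + H * 1"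
        using b_growth[of x] H[OF that] by linarith
      also have "\<dots> \<le> Cb * wt x ^ p + H * wt x ^ p"
        using H0 by (intro add_left_mono mult_left_mono) auto
      finally have "\<bar>(b x - h r) * \<psi>1 n x\<bar> \<le> ((Cb + H) * wt x ^ p) * (7 * B * wt x ^ 2)"
        unfolding abs_mult using H0 Cb_nonneg by (intro mult_mono bd\<psi>1) (auto simp: algebra_simps)
      moreover have "\<bar>s * \<psi>2 n x\<bar> \<le> s * (43 * B * wt x ^ (p + 2))"
        unfolding abs_mult using s_pos B
        by (intro mult_mono order_trans[OF bd\<psi>2] mult_left_mono wt_pow_mono) auto
      moreover have "((Cb + H) * wt x ^ p) * (7 * B * wt x ^ 2) + s * (43 * B * wt x ^ (p + 2)) = K * wt x ^ (p + 2)"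
        by (simp add: K_def power_add power2_eq_square algebra_simps)
      ultimately show ?thesis unfolding gen_def by linarith
    qed
    have meas: "gen r (\<psi>1 n) (\<psi>2 n) \<in> borel_measurable borel" for r n
      unfolding gen_def[abs_def]
      by (intro borel_measurable_continuous_onI continuous_intros cont\<psi> b_cont)
    have meas2: "gen r \<phi>1 \<phi>2 \<in> borel_measurable borel" for r
      unfolding gen_def[abs_def]
      by (intro borel_measurable_continuous_onI continuous_intros cont c b_cont)
    obtain M where M: "0 < M" "\<And>r. 0 \<le> r \<Longrightarrow> r \<le> t \<Longrightarrow> (\<integral>x. wt x ^ (p + 2) \<partial>\<mu> r) \<le> M"
      using moments_local_le[of "p + 2" t] Q_ge by auto
    have lim\<psi>: "(\<lambda>n. \<psi>1 n x) \<longlonglongrightarrow> \<phi> x * 0 + \<phi>1 x * 1" "(\<lambda>n. \<psi>2 n x) \<longlonglongrightarrow> \<phi> x * 0 + 2 * \<phi>1 x * 0 + \<phi>2 x * 1" for x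
      unfolding \<psi>1_def \<psi>2_def by (intro tendsto_intros lim_cut)+
    have lim1: "(\<lambda>n. \<integral>x. gen r (\<psi>1 n) (\<psi>2 n) x \<partial>\<mu> r) \<longlonglongrightarrow> L r" if r: "r \<in> {0..t}" for r
      unfolding L_def
    proof (rule integral_dominated_convergence[where w = "\<lambda>x. K * wt x ^ (p + 2)"])
      have r0: "0 \<le> r" using r by simp
      show "integrable (\<mu> r) (\<lambda>x. K * wt x ^ (p + 2))"
        by (rule integrable_growth[OF r0, of _ K "p + 2"]) (use Q_ge K0 in auto)
      show "AE x in \<mu> r. (\<lambda>n. gen r (\<psi>1 n) (\<psi>2 n) x) \<longlonglongrightarrow> gen r \<phi>1 \<phi>2 x"
        unfolding gen_def using lim\<psi> by (intro AE_I2 tendsto_intros) simp_all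
      show "AE x in \<mu> r. norm (gen r (\<psi>1 n) (\<psi>2 n) x) \<le> K * wt x ^ (p + 2)" for n
        using gbd[OF r] by simp
    qed (rule measurable_mu[OF _ meas2] measurable_mu[OF _ meas], use r in simp)+
    have lim2: "(\<lambda>n. \<integral>x. \<phi> x * cutoff (real (Suc n)) x \<partial>\<mu> r) \<longlonglongrightarrow> (\<integral>x. \<phi> x \<partial>\<mu> r)" if r: "0 \<le> r" for r
    proof (rule integral_dominated_convergence[where w = "\<lambda>x. B * wt x ^ 1"])
      show "integrable (\<mu> r) (\<lambda>x. B * wt x ^ 1)"
        by (rule integrable_growth[OF r, of _ B 1]) (use Q_ge B in auto)
      show "AE x in \<mu> r. (\<lambda>n. \<phi> x * cutoff (real (Suc n)) x) \<longlonglongrightarrow> \<phi> x"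
        using tendsto_mult_left[OF lim_cut(1)] by (intro AE_I2) fastforce
      show "AE x in \<mu> r. norm (\<phi> x * cutoff (real (Suc n)) x) \<le> B * wt x ^ 1" for n
        using bd\<psi>0 by simp
    qed (intro cont_measurable_mu[OF r] continuous_intros cont cutoff_bounds R)+
    have wc: "(\<lambda>r. \<integral>x. gen r (\<psi>1 n) (\<psi>2 n) x \<partial>\<mu> r) integrable_on {0..t}"
      "(\<integral>x. \<phi> x * cutoff (real (Suc n)) x \<partial>\<mu> t) = (\<integral>x. \<phi> x * cutoff (real (Suc n)) x \<partial>\<mu> 0)
        + integral {0..t} (\<lambda>r. \<integral>x. gen r (\<psi>1 n) (\<psi>2 n) x \<partial>\<mu> r)" for n
      unfolding \<psi>1_def[abs_def] \<psi>2_def[abs_def] by (rule weak_cutoff[OF d c t R])+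
    have "(\<lambda>n. integral {0..t} (\<lambda>r. \<integral>x. gen r (\<psi>1 n) (\<psi>2 n) x \<partial>\<mu> r)) \<longlonglongrightarrow> integral {0..t} L"
    proof (rule dominated_convergence(2)[where h = "\<lambda>r. K * M"])
      show "norm (\<integral>x. gen r (\<psi>1 n) (\<psi>2 n) x \<partial>\<mu> r) \<le> K * M" if r: "r \<in> {0..t}" for r n
      proof -
        have "\<bar>\<integral>x. gen r (\<psi>1 n) (\<psi>2 n) x \<partial>\<mu> r\<bar> \<le> K * (\<integral>x. wt x ^ (p + 2) \<partial>\<mu> r)"
          by (rule integral_growth_le[OF _ meas gbd[OF r]]) (use r Q_ge in auto)
        also have "\<dots> \<le> K * M" using M r K0 by (intro mult_left_mono) auto
        finally show ?thesis by simp
      qed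
    qed (use wc lim1 in auto)
    then have "(\<lambda>n. (\<integral>x. \<phi> x * cutoff (real (Suc n)) x \<partial>\<mu> 0)
        + integral {0..t} (\<lambda>r. \<integral>x. gen r (\<psi>1 n) (\<psi>2 n) x \<partial>\<mu> r)) \<longlonglongrightarrow> (\<integral>x. \<phi> x \<partial>\<mu> 0) + integral {0..t} L"
      by (intro tendsto_add lim2) auto
    with lim2[OF t] show ?thesis unfolding wc(2)[symmetric] by (rule LIMSEQ_unique)
  qed
  have "((\<lambda>t. integral {0..t} L) has_real_derivative L t) (at t within {0..T})"
    by (rule integral_has_real_derivative[OF contL t])
  then have "((\<lambda>t. (\<integral>x. \<phi> x \<partial>\<mu> 0) + integral {0..t} L) has_real_derivative 0 + L t) (at t within {0..T})"
    by (intro DERIV_add DERIV_const)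
  then have "((\<lambda>t. (\<integral>x. \<phi> x \<partial>\<mu> 0) + integral {0..t} L) has_real_derivative L t) (at t within {0..T})"
    by simp
  then show ?thesis
    unfolding L_def[of t, symmetric]
    by (rule has_field_derivative_transform_within[of _ _ _ _ 1]) (use t in \<open>auto intro: eq[symmetric]\<close>)
qed

end

section \<open>Smooth kernels with polynomial tails\<close>

lemma continuous_on_cv:
  assumes M: "sets M = sets borel" and f: "integrable M f" and k: "continuous_on UNIV k"
    and bd: "\<And>z. \<bar>k z\<bar> \<le> B"
  shows "continuous_on UNIV (cv M f k)"
  unfolding cv_def[abs_def]
proof (rule continuous_on_integral_dominated[where g = "\<lambda>y. \<bar>f y\<bar> * B"])
  have [measurable_cong]: "sets M = sets borel" by fact
  have [measurable]: "f \<in> borel_measurable M" using f by auto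
  have [measurable]: "k \<in> borel_measurable borel" by (rule borel_measurable_continuous_onI) fact
  show "continuous_on UNIV (\<lambda>x. f y * k (x - y))" for y
    by (intro continuous_intros continuous_on_compose2[OF k]) auto
  show "\<bar>f y * k (x - y)\<bar> \<le> \<bar>f y\<bar> * B" for x y
    using bd by (auto simp: abs_mult intro!: mult_left_mono)
  show "(\<lambda>y. f y * k (x - y)) \<in> borel_measurable M" for x by measurable
qed (use f in auto)

text \<open>The bounds of the derivatives by \<open>k\<close> itself exclude Gaussians and compactly
  supported kernels; they let numerators be estimated against the density they are divided by. The
  constant \<open>L\<close> may blow up as the kernel concentrates: it serves only to justify
  integrability and differentiation, while errors are measured by moments of
  \<open>k\<close>.\<close>

locale smooth_kernel =
  fixes N :: nat and k k1 k2 :: "real \<Rightarrow> real" and L :: real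
  assumes k_deriv: "\<And>z. (k has_real_derivative k1 z) (at z)"
      "\<And>z. (k1 has_real_derivative k2 z) (at z)"
    and k2_cont: "continuous_on UNIV k2"
    and k_pos: "\<And>z. 0 < k z"
    and k_upper: "\<And>z. k z \<le> L / wt z ^ N"
    and k_lower: "\<And>z. 1 / (L * wt z ^ N) \<le> k z"
    and k1_le: "\<And>z. \<bar>k1 z\<bar> \<le> L * k z" and k2_le: "\<And>z. \<bar>k2 z\<bar> \<le> L * k z"
    and k_integral: "(\<integral>z. k z \<partial>lborel) = 1"
    and k_even: "\<And>z. k (- z) = k z"
begin

lemma L_pos: "0 < L"
  using less_le_trans[OF k_pos k_upper, of 0] by (simp add: wt_def)

lemma k_cont: "continuous_on UNIV k" "continuous_on UNIV k1"
  using C2_continuous[OF k_deriv] .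

lemma k_le_L: "k z \<le> L"
proof -
  have "L / wt z ^ N \<le> L / 1" using L_pos by (intro divide_left_mono) auto
  then show ?thesis using k_upper[of z] by simp
qed

lemma k_measurable [measurable]:
  "k \<in> borel_measurable borel" "k1 \<in> borel_measurable borel" "k2 \<in> borel_measurable borel"
  by (intro borel_measurable_continuous_onI k_cont k2_cont)+

lemma kernel_integrable:
  assumes f: "f \<in> borel_measurable borel" and bd: "\<And>z. \<bar>f z\<bar> \<le> C * wt z ^ j * k z" and j: "j < N"
  shows "integrable lborel f"
proof (rule integrable_wt_bound[OF f])
  fix z
  have "0 \<le> C * wt z ^ j * k z" using order_trans[OF abs_ge_zero bd] .
  moreover have "0 < wt z ^ j * k z" using k_pos by simp
  ultimately have C: "0 \<le> C" unfolding mult.assoc zero_le_mult_iff by linarith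
  have "\<bar>f z\<bar> \<le> C * wt z ^ j * (L / wt z ^ N)"
    by (rule order_trans[OF bd mult_left_mono[OF k_upper]]) (use C in simp)
  also have "\<dots> = C * L * (wt z ^ j / wt z ^ N)" by simp
  also have "\<dots> \<le> C * L * (1 / wt z)" using C L_pos j by (intro mult_left_mono wt_div_pow_le) auto
  finally show "\<bar>f z\<bar> \<le> C * L / wt z" by simp
qed

lemma k_wt_integrable: "j < N \<Longrightarrow> integrable lborel (\<lambda>z. wt z ^ j * k z)"
  by (rule kernel_integrable[where C = 1]) (use k_pos in \<open>auto simp: less_imp_le\<close>)

lemma k_integrable: "0 < N \<Longrightarrow> integrable lborel k"
  using k_wt_integrable[of 0] by simp

text \<open>Peetre's inequality moves the decay of the kernel from \<open>x - y\<close> to \<open>x\<close>.\<close>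

lemma shifted_bound:
  assumes f: "\<bar>f y\<bar> \<le> C * wt y ^ j" and \<kappa>: "\<And>z. \<bar>\<kappa> z\<bar> \<le> L' * k z"
  shows "\<bar>f y * \<kappa> (x - y)\<bar> \<le> (C * L' * L * 2 ^ N / wt x ^ N) * wt y ^ (j + N)"
proof -
  have C: "0 \<le> C * wt y ^ j" using order_trans[OF abs_ge_zero f] .
  have "0 \<le> L' * k 0" using order_trans[OF abs_ge_zero \<kappa>] .
  then have L': "0 \<le> L'" using k_pos[of 0] by (simp add: zero_le_mult_iff not_less)
  have "wt x ^ N \<le> 2 ^ N * wt y ^ N * wt (x - y) ^ N" using wt_peetre_pow[of y "x - y" N] by simp
  then have "1 / wt (x - y) ^ N \<le> 2 ^ N * wt y ^ N / wt x ^ N" by (simp add: field_simps)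
  then have "L / wt (x - y) ^ N \<le> L * (2 ^ N * wt y ^ N / wt x ^ N)"
    using L_pos mult_left_mono[of "1 / wt (x - y) ^ N" "2 ^ N * wt y ^ N / wt x ^ N" L] by simp
  then have "\<bar>\<kappa> (x - y)\<bar> \<le> L' * (L * (2 ^ N * wt y ^ N / wt x ^ N))"
    by (intro order_trans[OF \<kappa>] mult_left_mono L' order_trans[OF k_upper])
  then have "\<bar>f y\<bar> * \<bar>\<kappa> (x - y)\<bar> \<le> (C * wt y ^ j) * (L' * (L * (2 ^ N * wt y ^ N / wt x ^ N)))"
    using C by (intro mult_mono f) auto
  then show ?thesis by (simp add: abs_mult power_add ac_simps)
qed

end

section \<open>The mollified solution\<close>

text \<open>The exponent comes from the commutator estimate: squared increments of \<open>b\<close>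
  cost \<open>wt z ^ (2 * p + 1)\<close>, the factor \<open>z\<^sup>2\<close> costs one more power,
  and one is left for integrability.\<close>

locale fp_kernel = weak_fp_cont + smooth_kernel +
  assumes N_eq: "N = 2 * p + 3"
begin

abbreviation S :: "(real \<Rightarrow> real) \<Rightarrow> (real \<Rightarrow> real) \<Rightarrow> real \<Rightarrow> real \<Rightarrow> real" where
  "S f \<kappa> t x \<equiv> cv (\<mu> t) f \<kappa> x"

lemma S_integrand:
  assumes t: "0 \<le> t" and f: "continuous_on UNIV f" "\<And>x. \<bar>f x\<bar> \<le> C * wt x ^ j" and j: "j \<le> 2 * p + 1"
    and \<kappa>: "continuous_on UNIV \<kappa>" "\<And>z. \<bar>\<kappa> z\<bar> \<le> L' * k z"
  shows "integrable (\<mu> t) (\<lambda>y. f y * \<kappa> (x - y))" "integrable (\<mu> t) f"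
proof -
  have c: "continuous_on UNIV (\<lambda>y. f y * \<kappa> (x - y))"
    by (intro continuous_intros f continuous_on_compose2[OF \<kappa>(1)]) auto
  have sb: "\<bar>f y * \<kappa> (x - y)\<bar> \<le> (C * L' * L * 2 ^ N / wt x ^ N) * wt y ^ (j + N)" for y
    by (rule shifted_bound[of f, OF f(2) \<kappa>(2)])
  have m: "(\<lambda>y. f y * \<kappa> (x - y)) \<in> borel_measurable borel" "f \<in> borel_measurable borel"
    by (intro borel_measurable_continuous_onI c f(1))+
  show "integrable (\<mu> t) (\<lambda>y. f y * \<kappa> (x - y))"
    by (rule integrable_growth[OF t m(1) sb]) (use j Q_ge N_eq in simp)
  show "integrable (\<mu> t) f"
    by (rule integrable_growth[OF t m(2) f(2)]) (use j Q_ge in simp)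
qed

lemma S_continuous_t:
  assumes f: "continuous_on UNIV f" "\<And>x. \<bar>f x\<bar> \<le> C * wt x ^ j" and j: "j \<le> 2 * p"
    and \<kappa>: "continuous_on UNIV \<kappa>" "\<And>z. \<bar>\<kappa> z\<bar> \<le> L' * k z"
  shows "continuous_on {0..T} (\<lambda>t. S f \<kappa> t x)"
proof -
  have c: "continuous_on UNIV (\<lambda>y. f y * \<kappa> (x - y))"
    by (intro continuous_intros f continuous_on_compose2[OF \<kappa>(1)]) auto
  have sb: "\<bar>f y * \<kappa> (x - y)\<bar> \<le> (C * L' * L * 2 ^ N / wt x ^ N) * wt y ^ (j + N)" for y
    by (rule shifted_bound[of f, OF f(2) \<kappa>(2)])
  show ?thesis unfolding cv_def
    by (rule continuous_integral[OF c sb]) (use j Q_ge N_eq in simp)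
qed

lemma S_bound:
  assumes f: "continuous_on UNIV f" "\<And>x. \<bar>f x\<bar> \<le> C * wt x ^ j" and j: "j \<le> 2 * p + 1"
    and \<kappa>: "continuous_on UNIV \<kappa>" "\<And>z. \<bar>\<kappa> z\<bar> \<le> L' * k z"
  obtains D where "0 \<le> D" "\<And>t x. 0 \<le> t \<Longrightarrow> t \<le> T \<Longrightarrow> \<bar>S f \<kappa> t x\<bar> \<le> D / wt x ^ N"
proof -
  have jQ: "j + N \<le> Q" using j Q_ge N_eq by simp
  obtain B where B: "0 < B" "\<And>t. 0 \<le> t \<Longrightarrow> t \<le> T \<Longrightarrow> (\<integral>x. wt x ^ (j + N) \<partial>\<mu> t) \<le> B"
    using moments_local_le[OF jQ, of T] by blast
  have C: "0 \<le> C" using order_trans[OF abs_ge_zero f(2)[of 0]] by (simp add: wt_def)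
  have "0 \<le> L' * k 0" using order_trans[OF abs_ge_zero \<kappa>(2)] .
  then have L': "0 \<le> L'" using k_pos[of 0] by (simp add: zero_le_mult_iff not_less)
  define K where "K = C * L' * L * 2 ^ N"
  have K: "0 \<le> K" using C L' L_pos by (simp add: K_def)
  show thesis
  proof (rule that[of "K * B"])
    show "0 \<le> K * B" using K B by simp
    fix t x :: real assume t: "0 \<le> t" "t \<le> T"
    have c: "continuous_on UNIV (\<lambda>y. f y * \<kappa> (x - y))"
      by (intro continuous_intros f continuous_on_compose2[OF \<kappa>(1)]) auto
    have sb: "\<bar>f y * \<kappa> (x - y)\<bar> \<le> (C * L' * L * 2 ^ N / wt x ^ N) * wt y ^ (j + N)" for y
      by (rule shifted_bound[of f, OF f(2) \<kappa>(2)])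
    have "\<bar>S f \<kappa> t x\<bar> \<le> (K / wt x ^ N) * (\<integral>y. wt y ^ (j + N) \<partial>\<mu> t)"
      unfolding cv_def K_def
      by (rule integral_growth_le[OF t(1) borel_measurable_continuous_onI[OF c] sb jQ])
    also have "\<dots> \<le> (K / wt x ^ N) * B" using K B(2)[OF t] by (intro mult_left_mono) auto
    finally show "\<bar>S f \<kappa> t x\<bar> \<le> K * B / wt x ^ N" by simp
  qed
qed

lemma k_self: "\<bar>k z\<bar> \<le> 1 * k z" using k_pos[of z] by simp

lemma S_deriv_x:
  assumes t: "0 \<le> t" and f: "continuous_on UNIV f" "\<And>x. \<bar>f x\<bar> \<le> C * wt x ^ j" and j: "j \<le> 2 * p + 1"
  shows "(S f k t has_real_derivative S f k1 t x) (at x)"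
    "(S f k1 t has_real_derivative S f k2 t x) (at x)"
    "continuous_on UNIV (S f k2 t)"
proof -
  have i: "integrable (\<mu> t) f" by (rule S_integrand(2)[OF t f j k_cont(1) k_self])
  define B where "B = L * (1 + L)"
  have B: "\<bar>k z\<bar> \<le> B" "\<bar>k1 z\<bar> \<le> B" "\<bar>k2 z\<bar> \<le> B" for z
  proof -
    have "L * k z \<le> L * L" using L_pos k_le_L by (intro mult_left_mono) auto
    moreover have "L \<le> B" "L * L \<le> B" using L_pos by (auto simp: B_def algebra_simps)
    ultimately show "\<bar>k z\<bar> \<le> B" "\<bar>k1 z\<bar> \<le> B" "\<bar>k2 z\<bar> \<le> B"
      using k_le_L[of z] k_pos[of z] k1_le[of z] k2_le[of z] by linarith+
  qed
  show "(S f k t has_real_derivative S f k1 t x) (at x)"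
    by (rule cv_has_real_derivative[OF sets_mu[OF t] i k_deriv(1) k_cont(2) B(1,2)])
  show "(S f k1 t has_real_derivative S f k2 t x) (at x)"
    by (rule cv_has_real_derivative[OF sets_mu[OF t] i k_deriv(2) k2_cont B(2,3)])
  show "continuous_on UNIV (S f k2 t)"
    by (rule continuous_on_cv[OF sets_mu[OF t] i k2_cont B(3)])
qed

section \<open>The mollified density, its flux and its dissipation\<close>

definition u :: "real \<Rightarrow> real \<Rightarrow> real" where "u t x = S (\<lambda>_. 1) k t x"
definition ux :: "real \<Rightarrow> real \<Rightarrow> real" where "ux t x = S (\<lambda>_. 1) k1 t x"
definition bu :: "real \<Rightarrow> real \<Rightarrow> real" where "bu t x = S b k t x"
text \<open>The sign is such that the time derivative of \<open>u\<close> is the space derivative of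
  \<open>J\<close>. The drift enters through \<open>bu\<close>, the mollification of
  \<open>b\<close> times the solution, and not through \<open>b x * u t x\<close>; the difference is
  the commutator.\<close>

definition J :: "real \<Rightarrow> real \<Rightarrow> real" where "J t x = s * ux t x + bu t x - h t * u t x"
definition Jx :: "real \<Rightarrow> real \<Rightarrow> real" where
  "Jx t x = s * S (\<lambda>_. 1) k2 t x + S b k1 t x - h t * ux t x"
definition Diss :: "real \<Rightarrow> real" where "Diss t = (\<integral>x. (J t x)\<^sup>2 / u t x \<partial>lborel)"
definition energy :: "real \<Rightarrow> real" where
  "energy t = (\<integral>x. s * (u t x * ln (u t x)) + W x * u t x \<partial>lborel)"
text \<open>The time derivative of the mean of the solution itself, without mollification; it equals
  minus the integral of \<open>J\<close>.\<close>

definition md :: "real \<Rightarrow> real" where "md t = h t - (\<integral>x. b x \<partial>\<mu> t)"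

lemma one_growth: "continuous_on UNIV (\<lambda>_::real. 1::real)" "\<bar>1::real\<bar> \<le> 1 * wt x ^ 0"
  by auto

lemma u_derivs:
  assumes t: "0 \<le> t"
  shows "(u t has_real_derivative ux t x) (at x)"
    "(J t has_real_derivative Jx t x) (at x)"
    "continuous_on UNIV (u t)" "continuous_on UNIV (ux t)" "continuous_on UNIV (bu t)"
    "continuous_on UNIV (J t)" "continuous_on UNIV (Jx t)"
proof -
  note d1 = S_deriv_x[OF t one_growth, simplified] and db = S_deriv_x[OF t b_cont b_growth, simplified]
  show d: "(u t has_real_derivative ux t x) (at x)" for x
    unfolding u_def[abs_def] ux_def by (rule d1)
  show dJ: "(J t has_real_derivative Jx t x) (at x)" for x
    unfolding J_def[abs_def] Jx_def u_def[abs_def] ux_def bu_def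
    by (intro DERIV_diff DERIV_add DERIV_cmult d1 db)
  show "continuous_on UNIV (u t)" "continuous_on UNIV (J t)"
    using d dJ by (meson DERIV_isCont continuous_at_imp_continuous_on)+
  show cux: "continuous_on UNIV (ux t)"
    unfolding ux_def[abs_def] using d1(2) by (meson DERIV_isCont continuous_at_imp_continuous_on)
  show "continuous_on UNIV (bu t)"
    unfolding bu_def[abs_def] using db(1) by (meson DERIV_isCont continuous_at_imp_continuous_on)
  have "continuous_on UNIV (S b k1 t)"
    using db(2) by (meson DERIV_isCont continuous_at_imp_continuous_on)
  then show "continuous_on UNIV (Jx t)"
    unfolding Jx_def[abs_def] by (intro continuous_intros cux d1(3)) 
qed

lemma continuous_t:
  "continuous_on {0..T} (\<lambda>t. u t x)" "continuous_on {0..T} (\<lambda>t. J t x)" "continuous_on {0..T} (\<lambda>t. Jx t x)"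
proof -
  note c = S_continuous_t[OF one_growth _ k_cont(1) k_self, simplified]
    S_continuous_t[OF one_growth _ k_cont(2) k1_le, simplified]
    S_continuous_t[OF one_growth _ k2_cont k2_le, simplified]
    S_continuous_t[OF b_cont b_growth _ k_cont(1) k_self, simplified]
    S_continuous_t[OF b_cont b_growth _ k_cont(2) k1_le, simplified]
  show "continuous_on {0..T} (\<lambda>t. u t x)" "continuous_on {0..T} (\<lambda>t. J t x)" "continuous_on {0..T} (\<lambda>t. Jx t x)"
    unfolding J_def Jx_def u_def ux_def bu_def by (intro continuous_intros c h_cont)+
qed

text \<open>The solution is tested with \<open>\<lambda>y. k (x - y)\<close>; differentiation in
  \<open>y\<close> reverses the sign of \<open>k1\<close> and not of \<open>k2\<close>.\<close>

lemma u_deriv_t: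
  assumes t: "t \<in> {0..T}"
  shows "((\<lambda>t. u t x) has_real_derivative Jx t x) (at t within {0..T})"
proof -
  have t0: "0 \<le> t" using t by simp
  define B where "B = L * (1 + L)"
  have B: "\<bar>k z\<bar> \<le> B * wt y" "\<bar>- k1 z\<bar> \<le> B * wt y" "\<bar>k2 z\<bar> \<le> B * wt y" for z y
  proof -
    have "L * k z \<le> L * L" using L_pos k_le_L by (intro mult_left_mono) auto
    moreover have "B * 1 \<le> B * wt y" unfolding B_def using L_pos by (intro mult_left_mono) auto
    moreover have "L \<le> B" "L * L \<le> B" using L_pos by (auto simp: B_def algebra_simps)
    ultimately show "\<bar>k z\<bar> \<le> B * wt y" "\<bar>- k1 z\<bar> \<le> B * wt y" "\<bar>k2 z\<bar> \<le> B * wt y"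
      using k_le_L[of z] k_pos[of z] k1_le[of z] k2_le[of z] by linarith+
  qed
  have sh: "((\<lambda>y. x - y) has_real_derivative - 1) (at y)" for y by (auto intro!: derivative_eq_intros)
  have d1: "((\<lambda>y. k (x - y)) has_real_derivative - k1 (x - y)) (at y)" for y
    using DERIV_chain2[OF k_deriv(1) sh, of y] by simp
  have d2: "((\<lambda>y. - k1 (x - y)) has_real_derivative k2 (x - y)) (at y)" for y
    using DERIV_minus[OF DERIV_chain2[OF k_deriv(2) sh, of y]] by simp
  have c: "continuous_on UNIV (\<lambda>y. k2 (x - y))"
    by (intro continuous_intros continuous_on_compose2[OF k2_cont]) auto
  have "((\<lambda>t. \<integral>y. k (x - y) \<partial>\<mu> t) has_real_derivative
      (\<integral>y. gen t (\<lambda>y. - k1 (x - y)) (\<lambda>y. k2 (x - y)) y \<partial>\<mu> t)) (at t within {0..T})"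
    by (rule weak_derivative[OF d1 d2 c B t])
  moreover have "(\<integral>y. gen t (\<lambda>y. - k1 (x - y)) (\<lambda>y. k2 (x - y)) y \<partial>\<mu> t) = Jx t x"
    using gen_integral(1)[OF d1 d2 c B(2,3) t0]
    by (simp add: Jx_def ux_def cv_def Bochner_Integration.integral_minus)
  ultimately show ?thesis by (simp add: u_def cv_def)
qed

text \<open>The lower bound on \<open>u\<close> is what tames the logarithm: between two multiples
  of \<open>1 / wt x ^ N\<close>, its size is of order \<open>ln (wt x)\<close>, and the crude bound
  by a multiple of \<open>wt x\<close> is enough. All constants are uniform on \<open>{0..T}\<close>
  but depend on the kernel.\<close>

lemma u_bounds:
  obtains c D where "0 < c" "0 \<le> D"
    "\<And>t x. 0 \<le> t \<Longrightarrow> t \<le> T \<Longrightarrow> c / wt x ^ N \<le> u t x"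
    "\<And>t x. 0 \<le> t \<Longrightarrow> t \<le> T \<Longrightarrow> u t x \<le> D / wt x ^ N"
    "\<And>t x. 0 \<le> t \<Longrightarrow> t \<le> T \<Longrightarrow> \<bar>J t x\<bar> \<le> D / wt x ^ N"
    "\<And>t x. 0 \<le> t \<Longrightarrow> t \<le> T \<Longrightarrow> \<bar>Jx t x\<bar> \<le> D / wt x ^ N"
    "\<And>t x. 0 \<le> t \<Longrightarrow> t \<le> T \<Longrightarrow> \<bar>ln (u t x)\<bar> \<le> D * wt x"
proof -
  obtain B where B: "0 < B" "\<And>t. 0 \<le> t \<Longrightarrow> t \<le> T \<Longrightarrow> (\<integral>x. wt x ^ N \<partial>\<mu> t) \<le> B"
    using moments_local_le[of N T] N_eq Q_ge by auto
  define c where "c = 1 / (L * 2 ^ N * B)"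
  have c: "0 < c" using L_pos B by (simp add: c_def)
  have low: "c / wt x ^ N \<le> u t x" if t: "0 \<le> t" "t \<le> T" for t x
  proof -
    interpret prob_space "\<mu> t" using prob t by simp
    have int: "integrable (\<mu> t) (\<lambda>y. wt y ^ N)"
      by (rule integrable_growth[OF t(1), of _ 1 N]) (use N_eq Q_ge in auto)
    \<comment> \<open>The tangent of \<open>1 / z\<close> at \<open>z = B\<close> takes the place of
      Jensen's inequality for the integral of \<open>1 / wt y ^ N\<close>.\<close>
    have "1 / (L * 2 ^ N * wt x ^ N) * (2 / B - wt y ^ N / B\<^sup>2) \<le> 1 * k (x - y)" for y
    proof -
      define z where "z = wt y ^ N"
      have z: "0 < z" by (simp add: z_def)
      have "0 \<le> (z - B)\<^sup>2 / (z * B\<^sup>2)" using z by (intro divide_nonneg_pos) (use B in auto)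
      also have "(z - B)\<^sup>2 / (z * B\<^sup>2) = 1 / z - (2 / B - z / B\<^sup>2)"
        using z B by (simp add: field_simps power2_eq_square)
      finally have 1: "2 / B - wt y ^ N / B\<^sup>2 \<le> 1 / wt y ^ N" by (simp add: z_def)
      have 2: "wt (x - y) ^ N \<le> 2 ^ N * wt x ^ N * wt y ^ N" using wt_peetre_pow[of x "- y" N] by simp
      have "1 / (L * 2 ^ N * wt x ^ N) * (2 / B - wt y ^ N / B\<^sup>2) \<le> 1 / (L * 2 ^ N * wt x ^ N) * (1 / wt y ^ N)"
        using L_pos by (intro mult_left_mono 1) auto
      also have "\<dots> = 1 / (L * (2 ^ N * wt x ^ N * wt y ^ N))" by simp
      also have "\<dots> \<le> 1 / (L * wt (x - y) ^ N)"
        using L_pos 2 by (intro divide_left_mono mult_left_mono) auto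
      also have "\<dots> \<le> k (x - y)" by (rule k_lower)
      finally show ?thesis by simp
    qed
    then have "(\<integral>y. 1 / (L * 2 ^ N * wt x ^ N) * (2 / B - wt y ^ N / B\<^sup>2) \<partial>\<mu> t) \<le> u t x"
      unfolding u_def cv_def
      using int S_integrand(1)[OF t(1) one_growth _ k_cont(1) k_self, of x]
      by (intro integral_mono) auto
    moreover have "(\<integral>y. 1 / (L * 2 ^ N * wt x ^ N) * (2 / B - wt y ^ N / B\<^sup>2) \<partial>\<mu> t)
        = 1 / (L * 2 ^ N * wt x ^ N) * (2 / B - (\<integral>y. wt y ^ N \<partial>\<mu> t) / B\<^sup>2)"
      using int by (simp add: prob_space)
    moreover have "1 / (L * 2 ^ N * wt x ^ N) * (1 / B) \<le> 1 / (L * 2 ^ N * wt x ^ N) * (2 / B - (\<integral>y. wt y ^ N \<partial>\<mu> t) / B\<^sup>2)"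
    proof (rule mult_left_mono)
      have "(\<integral>y. wt y ^ N \<partial>\<mu> t) / B\<^sup>2 \<le> B / B\<^sup>2" using B(2)[OF t] by (intro divide_right_mono) auto
      then show "1 / B \<le> 2 / B - (\<integral>y. wt y ^ N \<partial>\<mu> t) / B\<^sup>2" using B(1) by (simp add: power2_eq_square)
    qed (use L_pos in simp)
    moreover have "1 / (L * 2 ^ N * wt x ^ N) * (1 / B) = c / wt x ^ N" by (simp add: c_def)
    ultimately show ?thesis by linarith
  qed
  obtain H where H: "\<And>r. r \<in> {0..T} \<Longrightarrow> \<bar>h r\<bar> \<le> H" using h_bounded by blast
  obtain D1 where D1: "0 \<le> D1" "\<And>t x. 0 \<le> t \<Longrightarrow> t \<le> T \<Longrightarrow> \<bar>S (\<lambda>_. 1) k t x\<bar> \<le> D1 / wt x ^ N"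
    using S_bound[OF one_growth _ k_cont(1) k_self, of T] by auto
  obtain D2 where D2: "0 \<le> D2" "\<And>t x. 0 \<le> t \<Longrightarrow> t \<le> T \<Longrightarrow> \<bar>S (\<lambda>_. 1) k1 t x\<bar> \<le> D2 / wt x ^ N"
    using S_bound[OF one_growth _ k_cont(2) k1_le, of T] by auto
  obtain D3 where D3: "0 \<le> D3" "\<And>t x. 0 \<le> t \<Longrightarrow> t \<le> T \<Longrightarrow> \<bar>S (\<lambda>_. 1) k2 t x\<bar> \<le> D3 / wt x ^ N"
    using S_bound[OF one_growth _ k2_cont k2_le, of T] by auto
  obtain D4 where D4: "0 \<le> D4" "\<And>t x. 0 \<le> t \<Longrightarrow> t \<le> T \<Longrightarrow> \<bar>S b k t x\<bar> \<le> D4 / wt x ^ N"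
    using S_bound[OF b_cont b_growth _ k_cont(1) k_self, of T] by auto
  obtain D5 where D5: "0 \<le> D5" "\<And>t x. 0 \<le> t \<Longrightarrow> t \<le> T \<Longrightarrow> \<bar>S b k1 t x\<bar> \<le> D5 / wt x ^ N"
    using S_bound[OF b_cont b_growth _ k_cont(2) k1_le, of T] by auto
  define D where "D = D1 + (s * D2 + D4 + \<bar>H\<bar> * D1) + (s * D3 + D5 + \<bar>H\<bar> * D2) + (\<bar>ln c\<bar> + real N + \<bar>ln (D1 + 1)\<bar>)"
  have parts: "0 \<le> s * D2 + D4 + \<bar>H\<bar> * D1" "0 \<le> s * D3 + D5 + \<bar>H\<bar> * D2" "0 \<le> \<bar>ln c\<bar> + real N + \<bar>ln (D1 + 1)\<bar>"
    using D1 D2 D3 D4 D5 s_pos by auto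
  have leD: "E / wt x ^ N \<le> D / wt x ^ N" if "E \<le> D" for E x using that by (intro divide_right_mono) auto
  have flux: "\<bar>s * a + d - h t * e\<bar> \<le> D / wt x ^ N"
    if "0 \<le> t" "t \<le> T" "\<bar>a\<bar> \<le> Da / wt x ^ N" "\<bar>d\<bar> \<le> Dd / wt x ^ N" "\<bar>e\<bar> \<le> De / wt x ^ N"
      "s * Da + Dd + \<bar>H\<bar> * De \<le> D" for t x a d e Da Dd De
  proof -
    have "\<bar>h t\<bar> \<le> \<bar>H\<bar>" using H[of t] that by auto
    then have "\<bar>h t * e\<bar> \<le> \<bar>H\<bar> * (De / wt x ^ N)" unfolding abs_mult using that by (intro mult_mono) auto
    moreover have "\<bar>s * a\<bar> \<le> s * (Da / wt x ^ N)" unfolding abs_mult using s_pos that(3)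
      by (intro mult_mono) auto
    ultimately have "\<bar>s * a + d - h t * e\<bar> \<le> s * (Da / wt x ^ N) + Dd / wt x ^ N + \<bar>H\<bar> * (De / wt x ^ N)"
      using that by linarith
    also have "\<dots> = (s * Da + Dd + \<bar>H\<bar> * De) / wt x ^ N" by (simp add: add_divide_distrib)
    finally show ?thesis using leD[OF that(6)] by (rule order_trans)
  qed
  show thesis
  proof (rule that[of c D])
    show "0 \<le> D" using parts D1(1) unfolding D_def by linarith
    fix t x assume t: "0 \<le> t" "t \<le> T"
    have D1D: "D1 \<le> D" using parts unfolding D_def by linarith
    show "u t x \<le> D / wt x ^ N" using D1(2)[OF t, of x] leD[OF D1D, of x] unfolding u_def by linarith
    show "\<bar>J t x\<bar> \<le> D / wt x ^ N" unfolding J_def u_def ux_def bu_def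
      by (rule flux[OF t D2(2)[OF t] D4(2)[OF t] D1(2)[OF t]]) (unfold D_def, use parts D1(1) in linarith)
    show "\<bar>Jx t x\<bar> \<le> D / wt x ^ N" unfolding Jx_def ux_def
      by (rule flux[OF t D3(2)[OF t] D5(2)[OF t] D2(2)[OF t]]) (unfold D_def, use parts D1(1) in linarith)
    have upos: "0 < u t x" using low[OF t, of x] c by (smt (verit) divide_pos_pos wt_pos zero_less_power)
    have "D1 / wt x ^ N \<le> D1 / 1" using D1 by (intro divide_left_mono) auto
    then have "u t x \<le> D1 + 1" using D1(2)[OF t, of x] unfolding u_def by simp
    then have up: "ln (u t x) \<le> ln (D1 + 1)" using upos by simp
    have lw: "ln (wt x) \<le> wt x" using ln_le_minus_one[of "wt x"] by simp
    have "ln (c / wt x ^ N) \<le> ln (u t x)" using low[OF t, of x] upos c by (simp add: divide_pos_pos)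
    moreover have "ln (c / wt x ^ N) = ln c - real N * ln (wt x)"
      using c by (simp add: ln_div ln_realpow)
    moreover have "real N * ln (wt x) \<le> real N * wt x" using lw by (intro mult_left_mono) auto
    ultimately have dn: "- (\<bar>ln c\<bar> + real N * wt x) \<le> ln (u t x)" by linarith
    have "\<bar>ln (u t x)\<bar> \<le> (\<bar>ln c\<bar> + \<bar>ln (D1 + 1)\<bar>) * 1 + real N * wt x"
    proof -
      have gen: "\<bar>z\<bar> \<le> (\<bar>e\<bar> + \<bar>d\<bar>) * 1 + r" if "z \<le> d" "- (\<bar>e\<bar> + r) \<le> z" "0 \<le> r" for z d e r :: real
        using that by (auto simp: abs_if)
      show ?thesis by (rule gen[OF up dn]) simp
    qed
    also have "\<dots> \<le> (\<bar>ln c\<bar> + \<bar>ln (D1 + 1)\<bar>) * wt x + real N * wt x"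
      by (intro add_right_mono mult_left_mono) auto
    also have "\<dots> = (\<bar>ln c\<bar> + real N + \<bar>ln (D1 + 1)\<bar>) * wt x" by (simp add: algebra_simps)
    also have "\<dots> \<le> D * wt x" using parts D1(1) unfolding D_def by (intro mult_right_mono) (linarith, simp)
    finally show "\<bar>ln (u t x)\<bar> \<le> D * wt x" .
  qed (use c low in auto)
qed

lemma u_pos: "0 \<le> t \<Longrightarrow> 0 < u t x"
proof -
  assume t: "0 \<le> t"
  show "0 < u t x"
  proof (rule u_bounds[of t])
    fix c D :: real
    assume c: "0 < c" and "\<And>r x. 0 \<le> r \<Longrightarrow> r \<le> t \<Longrightarrow> c / wt x ^ N \<le> u r x"
    then have "c / wt x ^ N \<le> u t x" using t by simp
    moreover have "0 < c / wt x ^ N" using c by simp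
    ultimately show "0 < u t x" by linarith
  qed
qed

lemma u_integral:
  assumes t: "0 \<le> t"
  shows "integrable lborel (u t)" "(\<integral>x. u t x \<partial>lborel) = 1"
proof -
  interpret prob_space "\<mu> t" using prob t by simp
  have "integrable (\<mu> t) (\<lambda>_. 1 :: real)" by simp
  from integrable_cv[OF sigma_finite_measure_axioms sets_mu[OF t] this k_integrable]
    integral_cv[OF sigma_finite_measure_axioms sets_mu[OF t] this k_integrable]
  show "integrable lborel (u t)" "(\<integral>x. u t x \<partial>lborel) = 1"
    by (auto simp: N_eq k_integral prob_space u_def[abs_def])
qed

lemma J_integral:
  assumes t: "0 \<le> t"
  shows "integrable lborel (J t)" "(\<integral>x. J t x \<partial>lborel) = - md t"
proof -
  interpret prob_space "\<mu> t" using prob t by simp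
  have k1i: "integrable lborel k1"
    by (rule kernel_integrable[where C = L and j = 0]) (use k1_le N_eq in auto)
  have k0: "\<bar>k z\<bar> \<le> L / wt z" for z
  proof -
    have "L / wt z ^ N \<le> L / wt z ^ 1" using L_pos N_eq by (intro divide_left_mono wt_pow_mono) auto
    then show ?thesis using k_upper[of z] k_pos[of z] by simp
  qed
  have k10: "(\<integral>z. k1 z \<partial>lborel) = 0" by (rule integral_deriv_eq_0[OF k_deriv(1) k_cont(2) k1i k0])
  have ib: "integrable (\<mu> t) b" by (rule S_integrand(2)[OF t b_cont b_growth _ k_cont(1) k_self]) simp
  have i1: "integrable (\<mu> t) (\<lambda>_. 1 :: real)" by simp
  note cvs = integrable_cv[OF sigma_finite_measure_axioms sets_mu[OF t]]
    integral_cv[OF sigma_finite_measure_axioms sets_mu[OF t]]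
  have ki: "integrable lborel k" using k_integrable N_eq by simp
  have "integrable lborel (ux t)" "integrable lborel (bu t)" "integrable lborel (u t)"
    "(\<integral>x. ux t x \<partial>lborel) = 0" "(\<integral>x. bu t x \<partial>lborel) = (\<integral>x. b x \<partial>\<mu> t)" "(\<integral>x. u t x \<partial>lborel) = 1"
    using cvs[OF i1 k1i] cvs[OF ib ki] u_integral[OF t]
    by (auto simp: k10 k_integral ux_def[abs_def] bu_def[abs_def])
  then show "integrable lborel (J t)" "(\<integral>x. J t x \<partial>lborel) = - md t"
    unfolding J_def[abs_def] md_def by auto
qed

text \<open>Dividing by the small quantity \<open>u\<close> is safe because \<open>J\<close> is an
  average with the same kernel: its absolute value is at most the integral of
  \<open>C * wt y ^ p * k (x - y)\<close>, and Cauchy-Schwarz with weight \<open>k (x - y)\<close>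
  extracts exactly one factor \<open>u\<close>.\<close>

lemma flux_square_bound:
  obtains D where "0 \<le> D" "\<And>t x. 0 \<le> t \<Longrightarrow> t \<le> T \<Longrightarrow> (J t x)\<^sup>2 / u t x \<le> D / wt x ^ N"
proof -
  obtain H where H: "\<And>r. r \<in> {0..T} \<Longrightarrow> \<bar>h r\<bar> \<le> H" using h_bounded by blast
  define C where "C = s * L + Cb + \<bar>H\<bar>"
  have C: "0 \<le> C" using s_pos L_pos Cb_nonneg by (simp add: C_def)
  have gr: "continuous_on UNIV (\<lambda>x. (C * wt x ^ p)\<^sup>2)" "\<bar>(C * wt x ^ p)\<^sup>2\<bar> \<le> C\<^sup>2 * wt x ^ (2 * p)" for x
    by (auto intro!: continuous_intros simp: power_mult_distrib power_mult[symmetric] mult.commute)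
  obtain D where D: "0 \<le> D" "\<And>t x. 0 \<le> t \<Longrightarrow> t \<le> T \<Longrightarrow> \<bar>S (\<lambda>x. (C * wt x ^ p)\<^sup>2) k t x\<bar> \<le> D / wt x ^ N"
    using S_bound[OF gr _ k_cont(1) k_self, of T] by auto
  show thesis
  proof (rule that[OF D(1)])
    fix t x assume t: "0 \<le> t" "t \<le> T"
    note i1 = S_integrand(1)[OF t(1) one_growth _ k_cont(1) k_self, of x, simplified]
      S_integrand(1)[OF t(1) one_growth _ k_cont(2) k1_le, of x, simplified]
      S_integrand(1)[OF t(1) b_cont b_growth _ k_cont(1) k_self, of x, simplified]
      S_integrand(1)[OF t(1) gr _ k_cont(1) k_self, of x, simplified]
    have cw: "(\<lambda>x. C * wt x ^ p) \<in> borel_measurable (\<mu> t)"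
      by (intro cont_measurable_mu[OF t(1)] continuous_intros)
    have CS: "integrable (\<mu> t) (\<lambda>y. C * wt y ^ p * k (x - y))"
      "(\<integral>y. C * wt y ^ p * k (x - y) \<partial>\<mu> t)\<^sup>2 \<le> S (\<lambda>x. (C * wt x ^ p)\<^sup>2) k t x * u t x"
      using Cauchy_Schwarz_integral[OF cw i1(1) _ i1(4)] k_pos
      by (auto simp: cv_def u_def less_imp_le)
    have "J t x = (\<integral>y. s * k1 (x - y) + b y * k (x - y) - h t * k (x - y) \<partial>\<mu> t)"
      unfolding J_def ux_def bu_def u_def cv_def using i1 by simp
    also have "\<bar>\<dots>\<bar> \<le> (\<integral>y. C * wt y ^ p * k (x - y) \<partial>\<mu> t)"
    proof (rule order_trans[OF integral_abs_bound], rule integral_mono)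
      show "integrable (\<mu> t) (\<lambda>y. \<bar>s * k1 (x - y) + b y * k (x - y) - h t * k (x - y)\<bar>)" using i1 by auto
      fix y
      have "\<bar>s * k1 (x - y)\<bar> \<le> s * (L * k (x - y)) * 1" unfolding abs_mult using s_pos k1_le by simp
      also have "\<dots> \<le> s * (L * k (x - y)) * wt y ^ p"
        using s_pos L_pos k_pos by (intro mult_left_mono) (auto simp: less_imp_le)
      finally have 1: "\<bar>s * k1 (x - y)\<bar> \<le> s * L * wt y ^ p * k (x - y)" by (simp add: ac_simps)
      have 2: "\<bar>b y * k (x - y)\<bar> \<le> Cb * wt y ^ p * k (x - y)"
        unfolding abs_mult using k_pos[of "x - y"] b_growth[of y] by (simp add: mult_right_mono)
      have "\<bar>h t\<bar> * 1 \<le> \<bar>H\<bar> * wt y ^ p" using H[of t] t by (intro mult_mono) auto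
      then have 3: "\<bar>h t * k (x - y)\<bar> \<le> \<bar>H\<bar> * wt y ^ p * k (x - y)"
        unfolding abs_mult using k_pos[of "x - y"] by (simp add: mult_right_mono)
      from 1 2 3 show "\<bar>s * k1 (x - y) + b y * k (x - y) - h t * k (x - y)\<bar> \<le> C * wt y ^ p * k (x - y)"
        unfolding C_def by (simp add: algebra_simps)
    qed (rule CS(1))
    finally have "\<bar>J t x\<bar>\<^sup>2 \<le> (\<integral>y. C * wt y ^ p * k (x - y) \<partial>\<mu> t)\<^sup>2"
      by (rule power_mono) simp
    then have "(J t x)\<^sup>2 \<le> S (\<lambda>x. (C * wt x ^ p)\<^sup>2) k t x * u t x" using CS(2) by simp
    then have "(J t x)\<^sup>2 / u t x \<le> S (\<lambda>x. (C * wt x ^ p)\<^sup>2) k t x"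
      using u_pos[OF t(1), of x] by (simp add: divide_le_eq)
    also have "\<dots> \<le> D / wt x ^ N" using D(2)[OF t, of x] by linarith
    finally show "(J t x)\<^sup>2 / u t x \<le> D / wt x ^ N" .
  qed
qed

lemma div_wt_N_le: "0 \<le> D \<Longrightarrow> D / wt x ^ N \<le> D / wt x"
  using divide_left_mono[OF wt_pow_mono[of 1 N x], of D] N_eq by simp

text \<open>For the last two claims: as \<open>u\<close> has mass one, Cauchy-Schwarz bounds the L1
  norm of the flux by the root of the dissipation, and the velocity \<open>md\<close> of the mean is
  minus the integral of the flux.\<close>

lemma Diss_props:
  shows "continuous_on {0..T} Diss" "0 \<le> Diss t"
    "0 \<le> t \<Longrightarrow> integrable lborel (\<lambda>x. (J t x)\<^sup>2 / u t x)"
    "0 \<le> t \<Longrightarrow> (\<integral>x. \<bar>J t x\<bar> \<partial>lborel)\<^sup>2 \<le> Diss t"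
    "0 \<le> t \<Longrightarrow> (md t)\<^sup>2 \<le> Diss t"
proof -
  have un0: "0 \<le> t \<Longrightarrow> u t x \<noteq> 0" for t x using u_pos by (metis less_irrefl)
  have c: "0 \<le> t \<Longrightarrow> continuous_on UNIV (\<lambda>x. (J t x)\<^sup>2 / u t x)" for t
    by (intro continuous_intros u_derivs) (auto simp: un0)
  show int: "integrable lborel (\<lambda>x. (J t x)\<^sup>2 / u t x)" if t: "0 \<le> t" for t
  proof -
    obtain D where "0 \<le> D" "\<And>r x. 0 \<le> r \<Longrightarrow> r \<le> t \<Longrightarrow> (J r x)\<^sup>2 / u r x \<le> D / wt x ^ N"
      by (rule flux_square_bound[of t]) (rule that)
    then have D: "0 \<le> D" "\<And>x. (J t x)\<^sup>2 / u t x \<le> D / wt x ^ N" using t by auto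
    show ?thesis
      by (rule integrable_wt_bound[OF borel_measurable_continuous_onI[OF c[OF t]], of D])
         (use D u_pos[OF t] div_wt_N_le[OF D(1)] in \<open>auto simp: less_imp_le intro: order_trans\<close>)
  qed
  obtain D where D: "0 \<le> D" "\<And>t x. 0 \<le> t \<Longrightarrow> t \<le> T \<Longrightarrow> (J t x)\<^sup>2 / u t x \<le> D / wt x ^ N"
    using flux_square_bound[of T] by blast
  show "continuous_on {0..T} Diss"
    unfolding Diss_def[abs_def]
  proof (rule continuous_on_integral_dominated[where g = "\<lambda>x. D * (1 / wt x)"])
    show "continuous_on {0..T} (\<lambda>t. (J t x)\<^sup>2 / u t x)" for x
      by (intro continuous_intros continuous_t) (auto simp: un0)
    show "\<bar>(J t x)\<^sup>2 / u t x\<bar> \<le> D * (1 / wt x)" if "t \<in> {0..T}" for t x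
    proof -
      have "0 \<le> (J t x)\<^sup>2 / u t x" using u_pos[of t x] that by (simp add: less_imp_le)
      then show ?thesis using D(2)[of t x] that div_wt_N_le[OF D(1), of x] by simp
    qed
    show "integrable lborel (\<lambda>x. D * (1 / wt x))" by (intro integrable_mult_right integrable_inverse_wt)
    show "(\<lambda>x. (J t x)\<^sup>2 / u t x) \<in> borel_measurable lborel" if "t \<in> {0..T}" for t
      using borel_measurable_continuous_onI[OF c] that by simp
  qed
  show "0 \<le> Diss t"
  proof (cases "0 \<le> t")
    case True
    then show ?thesis unfolding Diss_def
      by (intro Bochner_Integration.integral_nonneg) (simp add: u_pos less_imp_le)
  next
    case False
    show ?thesis unfolding Diss_def
      by (intro Bochner_Integration.integral_nonneg divide_nonneg_nonneg)
         (auto simp: u_def cv_def less_imp_le k_pos intro!: Bochner_Integration.integral_nonneg)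
  qed
  assume t: "0 \<le> t"
  have "(\<lambda>x. \<bar>J t x\<bar> / u t x) \<in> borel_measurable lborel"
    using u_derivs[OF t] by (auto intro!: borel_measurable_continuous_onI continuous_intros simp: un0[OF t])
  from Cauchy_Schwarz_integral(2)[OF this u_integral(1)[OF t] less_imp_le[OF u_pos[OF t]]] int[OF t]
  have "(\<integral>x. \<bar>J t x\<bar> / u t x * u t x \<partial>lborel)\<^sup>2 \<le> (\<integral>x. (\<bar>J t x\<bar> / u t x)\<^sup>2 * u t x \<partial>lborel) * 1"
    using un0[OF t] by (simp add: u_integral[OF t] power_divide power2_eq_square)
  then show L1: "(\<integral>x. \<bar>J t x\<bar> \<partial>lborel)\<^sup>2 \<le> Diss t"
    using un0[OF t] by (simp add: Diss_def power_divide power2_eq_square)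
  have "\<bar>md t\<bar> \<le> (\<integral>x. \<bar>J t x\<bar> \<partial>lborel)"
    using integral_abs_bound[of lborel "J t"] J_integral(2)[OF t] by simp
  then have "\<bar>md t\<bar>\<^sup>2 \<le> (\<integral>x. \<bar>J t x\<bar> \<partial>lborel)\<^sup>2" by (rule power_mono) simp
  then show "(md t)\<^sup>2 \<le> Diss t" using L1 by simp
qed

end

section \<open>Dissipation of the mollified free energy\<close>

context weak_fp begin

lemma W_cont: "continuous_on UNIV W"
  using W_deriv by (meson DERIV_isCont continuous_at_imp_continuous_on)

lemma W_growth:
  obtains C where "0 \<le> C" "\<And>x. \<bar>W x\<bar> \<le> C * wt x ^ (p + 1)"
proof (rule that[of "\<bar>W 0\<bar> + Cb"])
  show "0 \<le> \<bar>W 0\<bar> + Cb" using Cb_nonneg by simp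
  fix x
  have "norm (W x - W 0) \<le> (Cb * wt x ^ p) * norm (x - 0)"
  proof (rule field_differentiable_bound[of "{- \<bar>x\<bar>..\<bar>x\<bar>}" W b])
    show "(W has_field_derivative b z) (at z within {- \<bar>x\<bar>..\<bar>x\<bar>})" for z
      using W_deriv by (rule has_field_derivative_at_within)
    fix z assume "z \<in> {- \<bar>x\<bar>..\<bar>x\<bar>}"
    then have "\<bar>z\<bar> \<le> \<bar>x\<bar>" by auto
    then have "z\<^sup>2 \<le> x\<^sup>2" by (simp add: abs_le_square_iff)
    then have "wt z ^ p \<le> wt x ^ p" by (intro power_mono) (simp_all add: wt_def)
    then show "norm (b z) \<le> Cb * wt x ^ p"
      using b_growth[of z] Cb_nonneg by (auto intro: order_trans mult_left_mono)
  qed auto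
  also have "\<dots> \<le> (Cb * wt x ^ p) * wt x" using abs_le_wt[of x] Cb_nonneg by (intro mult_left_mono) auto
  finally have "\<bar>W x - W 0\<bar> \<le> Cb * wt x ^ (p + 1)" by (simp add: ac_simps)
  moreover have "\<bar>W 0\<bar> * 1 \<le> \<bar>W 0\<bar> * wt x ^ (p + 1)" by (intro mult_left_mono wt_pow_ge_1) simp
  ultimately show "\<bar>W x\<bar> \<le> (\<bar>W 0\<bar> + Cb) * wt x ^ (p + 1)" by (simp only: distrib_right)
qed

text \<open>Beyond a large radius \<open>W x - K * x\<^sup>2\<close> does not decrease away from the
  origin, so its minimum over a compact interval is a global one.\<close>

lemma W_coercive:
  obtains C where "\<And>x. K * x\<^sup>2 \<le> W x + C"
proof -
  obtain R0 where R0: "\<And>x. R0 \<le> \<bar>x\<bar> \<Longrightarrow> 2 * K * x\<^sup>2 \<le> x * b x"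
    using b_coercive[of "2 * K"] by auto
  define R where "R = max R0 1"
  have R: "1 \<le> R" "\<And>x. R \<le> \<bar>x\<bar> \<Longrightarrow> 2 * K * x\<^sup>2 \<le> x * b x" using R0 by (auto simp: R_def)
  define U where "U x = W x - K * x\<^sup>2" for x
  have dU: "(U has_real_derivative b x - 2 * K * x) (at x)" for x
    unfolding U_def[abs_def] by (auto intro!: derivative_eq_intros W_deriv)
  have cU: "continuous_on {-R..R} U"
    using dU by (meson DERIV_isCont continuous_at_imp_continuous_on)
  obtain z where z: "z \<in> {-R..R}" "\<And>x. x \<in> {-R..R} \<Longrightarrow> U z \<le> U x"
    using continuous_attains_inf[OF _ _ cU] R(1) by (metis atLeastAtMost_iff compact_Icc empty_iff
        le_minus_iff linorder_not_le minus_le_iff neg_le_0_iff_le not_one_le_zero order_refl order_trans zero_le_one)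
  have min: "U z \<le> U x" for x
  proof -
    consider "x \<in> {-R..R}" | "R < x" | "x < - R" by fastforce
    then show ?thesis
    proof cases
      case 2
      have "U R \<le> U x"
      proof (rule DERIV_nonneg_imp_nondecreasing[of R x U])
        fix y assume y: "R \<le> y" "y \<le> x"
        then have "y * (2 * K * y) \<le> y * b y" using R(2)[of y] by (simp add: power2_eq_square ac_simps)
        then have "0 \<le> b y - 2 * K * y" using y R(1) by (auto simp: mult_le_cancel_left)
        then show "\<exists>D. DERIV U y :> D \<and> 0 \<le> D" using dU by blast
      qed (use 2 in simp)
      then show ?thesis using z(2)[of R] R(1) by simp
    next
      case 3
      have "U (- R) \<le> U x"
      proof (rule DERIV_nonpos_imp_nonincreasing[of x "- R" U])
        fix y assume y: "x \<le> y" "y \<le> - R"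
        then have "y * (2 * K * y) \<le> y * b y" using R(2)[of y] by (simp add: power2_eq_square ac_simps)
        then have "b y - 2 * K * y \<le> 0" using y R(1) by (auto simp: mult_le_cancel_left)
        then show "\<exists>D. DERIV U y :> D \<and> D \<le> 0" using dU by blast
      qed (use 3 in simp)
      then show ?thesis using z(2)[of "- R"] R(1) by simp
    qed (use z in simp)
  qed
  have "K * x\<^sup>2 \<le> W x + - U z" for x using min[of x] unfolding U_def[of x] by simp
  then show thesis by (rule that)
qed

end

section \<open>Derivative of the mollified free energy\<close>

context fp_kernel begin

text \<open>The first variation of the energy density \<open>s * (u * ln u) + W * u\<close> with
  respect to \<open>u\<close>.\<close>

definition \<Theta> :: "real \<Rightarrow> real \<Rightarrow> real" where "\<Theta> t x = s * (ln (u t x) + 1) + W x"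

lemma wt_frac_le: "j \<le> 2 * p + 2 \<Longrightarrow> 0 \<le> C \<Longrightarrow> C * wt x ^ j / wt x ^ N \<le> C / wt x"
  using mult_left_mono[OF wt_div_pow_le[of j N x], of C] N_eq by simp

lemma \<Theta>_bound:
  obtains K where "0 \<le> K" "\<And>t x. 0 \<le> t \<Longrightarrow> t \<le> T \<Longrightarrow> \<bar>\<Theta> t x * J t x\<bar> \<le> K / wt x"
    "\<And>t x. 0 \<le> t \<Longrightarrow> t \<le> T \<Longrightarrow> \<bar>\<Theta> t x * Jx t x\<bar> \<le> K / wt x"
    "\<And>t x. 0 \<le> t \<Longrightarrow> t \<le> T \<Longrightarrow> \<bar>s * (u t x * ln (u t x)) + W x * u t x\<bar> \<le> K / wt x"
proof -
  obtain CW where CW: "0 \<le> CW" "\<And>x. \<bar>W x\<bar> \<le> CW * wt x ^ (p + 1)" using W_growth by blast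
  show thesis
  proof (rule u_bounds[of T])
    fix c D :: real
    assume c: "0 < c" "0 \<le> D"
      and low: "\<And>t x. 0 \<le> t \<Longrightarrow> t \<le> T \<Longrightarrow> c / wt x ^ N \<le> u t x"
      and up: "\<And>t x. 0 \<le> t \<Longrightarrow> t \<le> T \<Longrightarrow> u t x \<le> D / wt x ^ N"
      and J: "\<And>t x. 0 \<le> t \<Longrightarrow> t \<le> T \<Longrightarrow> \<bar>J t x\<bar> \<le> D / wt x ^ N"
      and Jx: "\<And>t x. 0 \<le> t \<Longrightarrow> t \<le> T \<Longrightarrow> \<bar>Jx t x\<bar> \<le> D / wt x ^ N"
      and ln: "\<And>t x. 0 \<le> t \<Longrightarrow> t \<le> T \<Longrightarrow> \<bar>ln (u t x)\<bar> \<le> D * wt x"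
    define K where "K = s * (D + 1) + CW"
    have K: "0 \<le> K" using s_pos c CW by (simp add: K_def)
    have bd: "\<bar>s * (ln (u t x) + e) + W x\<bar> \<le> K * wt x ^ (p + 1)"
      if t: "0 \<le> t" "t \<le> T" and e: "0 \<le> e" "e \<le> 1" for t x e
    proof -
      have "\<bar>ln (u t x) + e\<bar> \<le> D * wt x + 1 * wt x"
        using ln[OF t, of x] e wt_ge_1[of x] by linarith
      also have "\<dots> \<le> D * wt x ^ (p + 1) + 1 * wt x ^ (p + 1)"
        using wt_pow_mono[of 1 "p + 1" x] c by (intro add_mono mult_left_mono) auto
      finally have "\<bar>s * (ln (u t x) + e)\<bar> \<le> s * (D * wt x ^ (p + 1) + 1 * wt x ^ (p + 1))"
        unfolding abs_mult using s_pos by (intro mult_mono) auto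
      moreover have "s * (D * wt x ^ (p + 1) + 1 * wt x ^ (p + 1)) + CW * wt x ^ (p + 1) = K * wt x ^ (p + 1)"
        unfolding K_def by (simp only: distrib_right distrib_left mult_1_left mult_1_right mult.assoc)
      ultimately show ?thesis using CW(2)[of x] by linarith
    qed
    have prod: "\<bar>a * d\<bar> \<le> (K * D) / wt x" if "\<bar>a\<bar> \<le> K * wt x ^ (p + 1)" "\<bar>d\<bar> \<le> D / wt x ^ N" for a d x
    proof -
      have "\<bar>a * d\<bar> \<le> (K * wt x ^ (p + 1)) * (D / wt x ^ N)"
        unfolding abs_mult using that K by (intro mult_mono) auto
      also have "\<dots> = (K * D) * wt x ^ (p + 1) / wt x ^ N" by simp
      also have "\<dots> \<le> (K * D) / wt x" using K c by (intro wt_frac_le) auto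
      finally show ?thesis .
    qed
    show thesis
    proof (rule that[of "K * D"])
      show "0 \<le> K * D" using K c by simp
      fix t x assume t: "0 \<le> t" "t \<le> T"
      have th: "\<bar>\<Theta> t x\<bar> \<le> K * wt x ^ (p + 1)" unfolding \<Theta>_def by (rule bd[OF t]) auto
      show "\<bar>\<Theta> t x * J t x\<bar> \<le> K * D / wt x" by (rule prod[OF th J[OF t]])
      show "\<bar>\<Theta> t x * Jx t x\<bar> \<le> K * D / wt x" by (rule prod[OF th Jx[OF t]])
      have "\<bar>u t x\<bar> \<le> D / wt x ^ N" using up[OF t, of x] u_pos[OF t(1), of x] by simp
      from prod[OF bd[OF t, of 0 x] this]
      show "\<bar>s * (u t x * ln (u t x)) + W x * u t x\<bar> \<le> K * D / wt x" by (simp add: algebra_simps)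
    qed
  qed
qed

lemma energy_integrable:
  assumes t: "0 \<le> t"
  shows "integrable lborel (\<lambda>x. s * (u t x * ln (u t x)) + W x * u t x)"
proof -
  obtain K where K: "\<And>r x. 0 \<le> r \<Longrightarrow> r \<le> t \<Longrightarrow> \<bar>s * (u r x * ln (u r x)) + W x * u r x\<bar> \<le> K / wt x"
    by (rule \<Theta>_bound[of t]) (rule that)
  have "continuous_on UNIV (\<lambda>x. s * (u t x * ln (u t x)) + W x * u t x)"
    using u_pos[OF t] by (intro continuous_intros u_derivs[OF t] W_cont) (auto simp: less_le)
  then show ?thesis
    by (rule integrable_wt_bound[OF borel_measurable_continuous_onI K[OF t order_refl]])
qed

lemma energy_derivative:
  assumes t: "t \<in> {0..T}"
  shows "(energy has_real_derivative (\<integral>x. \<Theta> t x * Jx t x \<partial>lborel)) (at t within {0..T})"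
proof -
  obtain K where K: "\<And>t x. 0 \<le> t \<Longrightarrow> t \<le> T \<Longrightarrow> \<bar>\<Theta> t x * Jx t x\<bar> \<le> K / wt x"
    by (rule \<Theta>_bound[of T]) (rule that)
  show ?thesis
    unfolding energy_def[abs_def]
  proof (rule has_real_derivative_integral_dominated[where g = "\<lambda>x. K * (1 / wt x)"])
    show "((\<lambda>t. s * (u t x * ln (u t x)) + W x * u t x) has_real_derivative \<Theta> t x * Jx t x) (at t within {0..T})"
      if t: "t \<in> {0..T}" for t x
    proof -
      have "0 < u t x" using u_pos t by simp
      then have "((\<lambda>z. s * (z * ln z) + W x * z) has_real_derivative \<Theta> t x) (at (u t x))"
        unfolding \<Theta>_def by (auto intro!: derivative_eq_intros simp: algebra_simps)
      from DERIV_chain'[OF u_deriv_t[OF t] this] show ?thesis by (simp add: mult.commute)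
    qed
    show "\<bar>\<Theta> t x * Jx t x\<bar> \<le> K * (1 / wt x)" if "t \<in> {0..T}" for t x
      using K[of t x] that by simp
    have "0 \<le> t" using t by simp
    then show "(\<lambda>x. \<Theta> t x * Jx t x) \<in> borel_measurable lborel"
      unfolding \<Theta>_def using u_pos[of t]
      by (simp, intro borel_measurable_continuous_onI continuous_intros u_derivs W_cont) (auto simp: less_le)
    show "integrable lborel (\<lambda>x. s * (u t x * ln (u t x)) + W x * u t x)" if "t \<in> {0..T}" for t
      using energy_integrable that by simp
    show "integrable lborel (\<lambda>x. K * (1 / wt x))"
      by (intro integrable_mult_right integrable_inverse_wt)
  qed (use t in auto)
qed

text \<open>After integration by parts the integrand is \<open>- (\<Theta>x x * J t x)\<close>, and
  \<open>\<Theta>x\<close> equals \<open>J / u + h\<close> plus the commutator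
  \<open>b * u - bu\<close> divided by \<open>u\<close>. Half of the dissipation absorbs the
  commutator, whose square over \<open>u\<close> is bounded by \<open>r\<close>; the term with
  \<open>h\<close> integrates to the work \<open>h t * md t\<close>.\<close>

lemma energy_dissipation:
  assumes t: "0 \<le> t" and \<delta>: "0 \<le> \<delta>" "0 \<le> C"
    and modulus: "\<And>x y. (b x - b y)\<^sup>2 \<le> (\<delta> + C * (x - y)\<^sup>2) * wt y ^ (2 * p + 1) * wt (x - y) ^ (2 * p + 1)"
  shows "(\<integral>x. \<Theta> t x * Jx t x \<partial>lborel) \<le> h t * md t - Diss t / 2 +
    (\<integral>x. wt x ^ (2 * p + 1) \<partial>\<mu> t) *
      (\<delta> * (\<integral>z. wt z ^ (2 * p + 1) * k z \<partial>lborel) + C * (\<integral>z. z\<^sup>2 * wt z ^ (2 * p + 1) * k z \<partial>lborel)) / 2"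
proof -
  interpret prob_space "\<mu> t" using prob t by simp
  let ?a = "2 * p + 1"
  define \<kappa> where "\<kappa> z = (\<delta> + C * z\<^sup>2) * wt z ^ ?a * k z" for z
  have \<kappa>_le: "\<bar>\<kappa> z\<bar> \<le> (\<delta> + C) * wt z ^ (2 * p + 2) * k z" for z
  proof -
    have "\<delta> * 1 \<le> \<delta> * wt z" "C * z\<^sup>2 \<le> C * wt z"
      using \<delta> square_le_wt[of z] by (intro mult_left_mono; simp)+
    then have "(\<delta> + C * z\<^sup>2) * (wt z ^ ?a * k z) \<le> ((\<delta> + C) * wt z) * (wt z ^ ?a * k z)"
      using k_pos[of z] by (intro mult_right_mono) (auto simp: distrib_right)
    then show ?thesis using \<delta> k_pos[of z] by (simp add: \<kappa>_def abs_mult ac_simps less_imp_le)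
  qed
  have \<kappa>m [measurable]: "\<kappa> \<in> borel_measurable borel" unfolding \<kappa>_def[abs_def] by measurable
  have \<kappa>i: "integrable lborel \<kappa>"
    by (rule kernel_integrable[OF \<kappa>m \<kappa>_le]) (simp add: N_eq)
  have m0: "integrable lborel (\<lambda>z. wt z ^ ?a * k z)" using k_wt_integrable[of ?a] N_eq by simp
  have m2: "integrable lborel (\<lambda>z. z\<^sup>2 * wt z ^ ?a * k z)"
    by (rule kernel_integrable[where C = 1 and j = "2 * p + 2"])
       (use k_pos square_le_wt in \<open>auto simp: N_eq abs_mult less_imp_le intro!: mult_right_mono\<close>)
  have \<kappa>int: "(\<integral>z. \<kappa> z \<partial>lborel) = \<delta> * (\<integral>z. wt z ^ ?a * k z \<partial>lborel) + C * (\<integral>z. z\<^sup>2 * wt z ^ ?a * k z \<partial>lborel)"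
  proof -
    have "\<kappa> = (\<lambda>z. \<delta> * (wt z ^ ?a * k z) + C * (z\<^sup>2 * wt z ^ ?a * k z))"
      by (rule ext) (simp add: \<kappa>_def algebra_simps)
    then show ?thesis using m0 m2 by simp
  qed
  have wi: "integrable (\<mu> t) (\<lambda>x. wt x ^ ?a)"
    by (rule integrable_growth[OF t, of _ 1 ?a]) (use Q_ge in auto)
  define r where "r = cv (\<mu> t) (\<lambda>x. wt x ^ ?a) \<kappa>"
  have ri: "integrable lborel r" unfolding r_def
    by (rule integrable_cv[OF sigma_finite_measure_axioms sets_mu[OF t] wi \<kappa>i])
  have rint: "(\<integral>x. r x \<partial>lborel) = (\<integral>x. wt x ^ ?a \<partial>\<mu> t) * (\<integral>z. \<kappa> z \<partial>lborel)" unfolding r_def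
    by (rule integral_cv[OF sigma_finite_measure_axioms sets_mu[OF t] wi \<kappa>i])
  have \<kappa>bd: "\<bar>\<kappa> z\<bar> \<le> (\<delta> + C) * L" for z
  proof -
    have "wt z ^ (2 * p + 2) * k z \<le> wt z ^ (2 * p + 2) * (L / wt z ^ N)"
      using k_upper by (intro mult_left_mono) auto
    also have "\<dots> = L * (wt z ^ (2 * p + 2) / wt z ^ N)" by simp
    also have "\<dots> \<le> L * 1" using L_pos wt_pow_mono[of "2 * p + 2" N z] N_eq
      by (intro mult_left_mono) auto
    finally have "(\<delta> + C) * (wt z ^ (2 * p + 2) * k z) \<le> (\<delta> + C) * L" using \<delta> by (intro mult_left_mono) auto
    then show ?thesis using \<kappa>_le[of z] by (simp add: ac_simps)
  qed
  have [measurable_cong]: "sets (\<mu> t) = sets borel" using sets_mu t by simp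
  \<comment> \<open>Cauchy-Schwarz against \<open>k (x - y)\<close> once more cancels the division
    by \<open>u\<close>; \<open>modulus\<close> then bounds the squared increment of
    \<open>b\<close>.\<close>
  have defect: "(b x * u t x - bu t x)\<^sup>2 / u t x \<le> r x" for x
  proof -
    have bound_i: "integrable (\<mu> t) (\<lambda>y. wt y ^ ?a * \<kappa> (x - y))"
      by (rule integrable_mult_bounded[OF wi _ \<kappa>bd]) measurable
    have le: "(b x - b y)\<^sup>2 * k (x - y) \<le> wt y ^ ?a * \<kappa> (x - y)" for y
      using mult_right_mono[OF modulus[of x y], of "k (x - y)"] k_pos[of "x - y"]
      by (simp add: \<kappa>_def ac_simps)
    have i2: "integrable (\<mu> t) (\<lambda>y. (b x - b y)\<^sup>2 * k (x - y))"
    proof (rule Bochner_Integration.integrable_bound[OF bound_i])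
      show "(\<lambda>y. (b x - b y)\<^sup>2 * k (x - y)) \<in> borel_measurable (\<mu> t)" by measurable
      show "AE y in \<mu> t. norm ((b x - b y)\<^sup>2 * k (x - y)) \<le> norm (wt y ^ ?a * \<kappa> (x - y))"
      proof (rule AE_I2)
        fix y
        have "norm ((b x - b y)\<^sup>2 * k (x - y)) = (b x - b y)\<^sup>2 * k (x - y)"
          using k_pos by (simp add: abs_mult less_imp_le)
        also note le[of y]
        also have "wt y ^ ?a * \<kappa> (x - y) \<le> norm (wt y ^ ?a * \<kappa> (x - y))" by simp
        finally show "norm ((b x - b y)\<^sup>2 * k (x - y)) \<le> norm (wt y ^ ?a * \<kappa> (x - y))" .
      qed
    qed
    have ik: "integrable (\<mu> t) (\<lambda>y. k (x - y))" "integrable (\<mu> t) (\<lambda>y. b y * k (x - y))"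
      using S_integrand(1)[OF t one_growth _ k_cont(1) k_self, of x]
        S_integrand(1)[OF t b_cont b_growth _ k_cont(1) k_self, of x] by auto
    have bm: "(\<lambda>y. b x - b y) \<in> borel_measurable (\<mu> t)" by measurable
    have "b x * u t x - bu t x = (\<integral>y. (b x - b y) * k (x - y) \<partial>\<mu> t)"
      using ik by (simp add: u_def bu_def cv_def left_diff_distrib)
    then have "(b x * u t x - bu t x)\<^sup>2 \<le> (\<integral>y. (b x - b y)\<^sup>2 * k (x - y) \<partial>\<mu> t) * u t x"
      using Cauchy_Schwarz_integral(2)[OF bm ik(1) _ i2] k_pos by (simp add: u_def cv_def less_imp_le)
    also have "\<dots> \<le> r x * u t x"
      unfolding r_def cv_def using u_pos[OF t, of x]
      by (intro mult_right_mono integral_mono i2 bound_i le) auto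
    finally show ?thesis using u_pos[OF t, of x] by (simp add: divide_le_eq)
  qed
  define \<Theta>x where "\<Theta>x x = s * (ux t x / u t x) + b x" for x
  have d\<Theta>: "(\<Theta> t has_real_derivative \<Theta>x x) (at x)" for x
    unfolding \<Theta>_def[abs_def] \<Theta>x_def using u_pos[OF t, of x]
    by (auto intro!: derivative_eq_intros u_derivs[OF t] W_deriv)
  have c: "continuous_on UNIV (\<Theta> t)" "continuous_on UNIV \<Theta>x"
    using u_pos[OF t] d\<Theta> unfolding \<Theta>x_def[abs_def]
    by (meson DERIV_isCont continuous_at_imp_continuous_on,
        intro continuous_intros u_derivs[OF t] b_cont, auto simp: less_le)
  have pt: "- (\<Theta>x x * J t x) \<le> - ((J t x)\<^sup>2 / u t x) / 2 - h t * J t x + r x / 2"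
    and pt2: "\<bar>\<Theta>x x * J t x\<bar> \<le> 2 * ((J t x)\<^sup>2 / u t x) + \<bar>h t * J t x\<bar> + r x" for x
  proof -
    define j U w where "j = J t x" and "U = u t x" and "w = b x * u t x - bu t x"
    have U: "0 < U" using u_pos[OF t] by (simp add: U_def)
    have "s * ux t x = j - bu t x + h t * U" by (simp add: j_def J_def U_def)
    then have th: "\<Theta>x x = (j - bu t x + h t * U) / U + b x" by (simp add: \<Theta>x_def U_def)
    define A B' C' where "A = j\<^sup>2 / U" and "B' = w\<^sup>2 / U" and "C' = w * j / U"
    have eq: "\<Theta>x x * j = A + h t * j + C'"
      unfolding th A_def C'_def using U by (simp add: w_def U_def[symmetric] field_simps power2_eq_square)
    have "0 \<le> (j + w)\<^sup>2 / U" "0 \<le> (j - w)\<^sup>2 / U" using U by auto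
    moreover have "(j + w)\<^sup>2 / U = A + B' + 2 * C'" "(j - w)\<^sup>2 / U = A + B' - 2 * C'"
      by (simp_all add: A_def B'_def C'_def power2_sum power2_diff add_divide_distrib diff_divide_distrib ac_simps)
    ultimately have sq: "- (A + B') \<le> 2 * C'" "2 * C' \<le> A + B'" by linarith+
    have dw: "B' \<le> r x" using defect[of x] by (simp add: w_def U_def B'_def)
    have nn: "0 \<le> A" "0 \<le> B'" using U by (auto simp: A_def B'_def)
    have "- (\<Theta>x x * j) \<le> - A / 2 - h t * j + r x / 2"
      unfolding eq using sq dw by linarith
    then show "- (\<Theta>x x * J t x) \<le> - ((J t x)\<^sup>2 / u t x) / 2 - h t * J t x + r x / 2"
      unfolding A_def j_def U_def .
    have "\<bar>\<Theta>x x * j\<bar> \<le> 2 * A + \<bar>h t * j\<bar> + r x"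
      unfolding eq using sq dw nn by linarith
    then show "\<bar>\<Theta>x x * J t x\<bar> \<le> 2 * ((J t x)\<^sup>2 / u t x) + \<bar>h t * J t x\<bar> + r x"
      unfolding A_def j_def U_def .
  qed
  have Ji: "integrable lborel (J t)" "(\<integral>x. J t x \<partial>lborel) = - md t" by (rule J_integral[OF t])+
  have Di: "integrable lborel (\<lambda>x. (J t x)\<^sup>2 / u t x)" by (rule Diss_props(3)[OF t])
  have i1: "integrable lborel (\<lambda>x. \<Theta>x x * J t x)"
  proof (rule Bochner_Integration.integrable_bound)
    show "integrable lborel (\<lambda>x. 2 * ((J t x)\<^sup>2 / u t x) + \<bar>h t * J t x\<bar> + r x)"
      by (intro Bochner_Integration.integrable_add integrable_mult_right integrable_abs Ji Di ri)
    show "(\<lambda>x. \<Theta>x x * J t x) \<in> borel_measurable lborel"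
      by (simp, intro borel_measurable_continuous_onI continuous_intros c u_derivs t)
    show "AE x in lborel. norm (\<Theta>x x * J t x) \<le> norm (2 * ((J t x)\<^sup>2 / u t x) + \<bar>h t * J t x\<bar> + r x)"
      using pt2 by (intro AE_I2) (simp add: order_trans[OF _ abs_ge_self])
  qed
  show ?thesis
  proof (rule \<Theta>_bound[of t])
    fix K
    assume K: "\<And>r x. 0 \<le> r \<Longrightarrow> r \<le> t \<Longrightarrow> \<bar>\<Theta> r x * J r x\<bar> \<le> K / wt x"
      "\<And>r x. 0 \<le> r \<Longrightarrow> r \<le> t \<Longrightarrow> \<bar>\<Theta> r x * Jx r x\<bar> \<le> K / wt x"
    have cx: "continuous_on UNIV (\<lambda>x. \<Theta> t x * Jx t x)" "continuous_on UNIV (\<lambda>x. \<Theta>x x * J t x + \<Theta> t x * Jx t x)"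
      by (intro continuous_intros c u_derivs t)+
    have i2: "integrable lborel (\<lambda>x. \<Theta> t x * Jx t x)"
      by (rule integrable_wt_bound[OF borel_measurable_continuous_onI[OF cx(1)] K(2)[OF t order_refl]])
    have "((\<lambda>x. \<Theta> t x * J t x) has_real_derivative \<Theta>x x * J t x + \<Theta> t x * Jx t x) (at x)" for x
      using DERIV_mult[OF d\<Theta> u_derivs(2)[OF t], of x] by (simp add: algebra_simps)
    then have "(\<integral>x. \<Theta>x x * J t x + \<Theta> t x * Jx t x \<partial>lborel) = 0"
      by (rule integral_deriv_eq_0[OF _ cx(2) _ K(1)[OF t order_refl]]) (use i1 i2 in auto)
    then have "(\<integral>x. \<Theta> t x * Jx t x \<partial>lborel) = (\<integral>x. - (\<Theta>x x * J t x) \<partial>lborel)"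
      using i1 i2 by simp
    also have "\<dots> \<le> - Diss t / 2 - h t * (- md t) + (\<integral>x. r x \<partial>lborel) / 2"
    proof -
      define e where "e x = (J t x)\<^sup>2 / u t x" for x
      have e: "integrable lborel e" "(\<integral>x. e x \<partial>lborel) = Diss t"
        using Di by (simp_all add: e_def[abs_def] Diss_def)
      have "(\<integral>x. - (\<Theta>x x * J t x) \<partial>lborel) \<le> (\<integral>x. - e x / 2 - h t * J t x + r x / 2 \<partial>lborel)"
        using i1 Ji e ri by (intro integral_mono pt[folded e_def]) auto
      also have "\<dots> = - Diss t / 2 - h t * (- md t) + (\<integral>x. r x \<partial>lborel) / 2"
        using Ji e ri by simp
      finally show ?thesis .
    qed
    finally show ?thesis unfolding rint \<kappa>int by simp
  qed
qed

lemma md_continuous: "continuous_on {0..T} md"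
  unfolding md_def[abs_def] using Q_ge
  by (intro continuous_intros h_cont continuous_integral[OF b_cont b_growth]) auto

lemma energy_inequality:
  assumes T: "0 \<le> T" and \<delta>: "0 \<le> \<delta>" "0 \<le> C"
    and modulus: "\<And>x y. (b x - b y)\<^sup>2 \<le> (\<delta> + C * (x - y)\<^sup>2) * wt y ^ (2 * p + 1) * wt (x - y) ^ (2 * p + 1)"
    and B: "\<And>t. 0 \<le> t \<Longrightarrow> t \<le> T \<Longrightarrow> (\<integral>x. wt x ^ (2 * p + 1) \<partial>\<mu> t) \<le> B"
    and m: "(\<integral>z. wt z ^ (2 * p + 1) * k z \<partial>lborel) \<le> m0" "(\<integral>z. z\<^sup>2 * wt z ^ (2 * p + 1) * k z \<partial>lborel) \<le> m2"
  shows "energy T - energy 0 \<le> integral {0..T} (\<lambda>t. h t * md t) - integral {0..T} Diss / 2 + T * (B * (\<delta> * m0 + C * m2) / 2)"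
proof -
  have hi: "((\<lambda>t. \<integral>x. \<Theta> t x * Jx t x \<partial>lborel) has_integral (energy T - energy 0)) {0..T}"
    by (rule fundamental_theorem_of_calculus[OF T])
       (use energy_derivative in \<open>simp add: has_real_derivative_iff_has_vector_derivative\<close>)
  define c where "c = B * (\<delta> * m0 + C * m2) / 2"
  have ci: "(\<lambda>t. h t * md t) integrable_on {0..T}" "Diss integrable_on {0..T}"
    by (intro integrable_continuous_real continuous_intros h_cont md_continuous Diss_props)+
  have "((\<lambda>t. h t * md t - Diss t / 2 + c) has_integral
      (integral {0..T} (\<lambda>t. h t * md t) - integral {0..T} Diss / 2 + T * c)) {0..T}"
    using has_integral_const_real[of c 0 T] T
    by (intro has_integral_add has_integral_diff has_integral_divide integrable_integral ci) simp
  moreover have "(\<integral>x. \<Theta> t x * Jx t x \<partial>lborel) \<le> h t * md t - Diss t / 2 + c" if t: "t \<in> {0..T}" for t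
  proof -
    have t0: "0 \<le> t" using t by simp
    let ?m0 = "\<integral>z. wt z ^ (2 * p + 1) * k z \<partial>lborel" and ?m2 = "\<integral>z. z\<^sup>2 * wt z ^ (2 * p + 1) * k z \<partial>lborel"
    have m_nonneg: "0 \<le> ?m0" "0 \<le> ?m2"
      using k_pos by (auto intro!: Bochner_Integration.integral_nonneg simp: less_imp_le)
    have "(\<integral>x. wt x ^ (2 * p + 1) \<partial>\<mu> t) * (\<delta> * ?m0 + C * ?m2) \<le> B * (\<delta> * m0 + C * m2)"
    proof (rule mult_mono[OF B])
      show "\<delta> * ?m0 + C * ?m2 \<le> \<delta> * m0 + C * m2" using \<delta> m by (intro add_mono mult_left_mono)
      have "0 \<le> (\<integral>x. wt x ^ (2 * p + 1) \<partial>\<mu> t)" by (intro Bochner_Integration.integral_nonneg) simp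
      also have "\<dots> \<le> B" using B t by simp
      finally show "0 \<le> B" .
      show "0 \<le> \<delta> * ?m0 + C * ?m2" using \<delta> m_nonneg by simp
    qed (use t in auto)
    then show ?thesis
      using energy_dissipation[OF t0 \<delta> modulus] unfolding c_def by linarith
  qed
  ultimately show ?thesis unfolding c_def[symmetric] using has_integral_le[OF hi] by blast
qed

end

section \<open>A weighted modulus of continuity of the drift\<close>

context weak_fp begin

text \<open>Growth alone gives the crude bound
  \<open>K\<^sup>2 * (wt y ^ (2 * p) * wt (x - y) ^ (2 * p))\<close>. The spare power of the weight
  in the claim absorbs it into \<open>\<delta>\<close> for large \<open>y\<close>, the term
  \<open>C * (x - y)\<^sup>2\<close> covers distant points, and uniform continuity covers close
  points in a compact set.\<close>

lemma b_modulus: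
  assumes \<delta>: "0 < \<delta>"
  obtains C where "0 \<le> C"
    "\<And>x y. (b x - b y)\<^sup>2 \<le> (\<delta> + C * (x - y)\<^sup>2) * wt y ^ (2 * p + 1) * wt (x - y) ^ (2 * p + 1)"
proof -
  define K where "K = Cb * (2 ^ p + 1)"
  have K: "0 \<le> K" using Cb_nonneg by (simp add: K_def)
  have crude: "(b x - b y)\<^sup>2 \<le> K\<^sup>2 * (wt y ^ (2 * p) * wt (x - y) ^ (2 * p))" for x y
  proof -
    have "Cb * wt x ^ p \<le> Cb * (2 ^ p * wt y ^ p * wt (x - y) ^ p)"
      using wt_peetre_pow[of y "x - y" p] Cb_nonneg by (intro mult_left_mono) auto
    moreover have "Cb * (wt y ^ p * 1) \<le> Cb * (wt y ^ p * wt (x - y) ^ p)"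
      using Cb_nonneg by (intro mult_left_mono wt_pow_ge_1) auto
    moreover have "Cb * (2 ^ p * wt y ^ p * wt (x - y) ^ p) + Cb * (wt y ^ p * wt (x - y) ^ p)
        = K * (wt y ^ p * wt (x - y) ^ p)" by (simp add: K_def algebra_simps)
    ultimately have "\<bar>b x - b y\<bar> \<le> K * (wt y ^ p * wt (x - y) ^ p)"
      using b_growth[of x] b_growth[of y] by linarith
    then have "\<bar>b x - b y\<bar>\<^sup>2 \<le> (K * (wt y ^ p * wt (x - y) ^ p))\<^sup>2" by (rule power_mono) simp
    then show ?thesis by (simp add: power_mult_distrib power_mult[symmetric] mult.commute)
  qed
  \<comment> \<open>Where \<open>wt y \<ge> Y\<close>, the spare factor \<open>wt y\<close> lifts
    \<open>\<delta>\<close> to at least the crude constant \<open>K\<^sup>2\<close>.\<close>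
  define Y where "Y = K\<^sup>2 / \<delta> + 1"
  have Y: "1 \<le> Y" "K\<^sup>2 \<le> \<delta> * Y" using \<delta> by (auto simp: Y_def field_simps)
  have "uniformly_continuous_on {- (Y + 1)..Y + 1} b"
    by (intro compact_uniformly_continuous continuous_on_subset[OF b_cont]) auto
  then obtain z0 where z0: "0 < z0" "\<And>x y. x \<in> {- (Y + 1)..Y + 1} \<Longrightarrow> y \<in> {- (Y + 1)..Y + 1} \<Longrightarrow>
      dist x y < z0 \<Longrightarrow> dist (b x) (b y) < sqrt \<delta>"
    unfolding uniformly_continuous_on_def using \<delta> by (metis real_sqrt_gt_0_iff)
  define z1 where "z1 = min z0 1"
  have z1: "0 < z1" "z1 \<le> 1" "z1 \<le> z0" using z0 by (auto simp: z1_def)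
  define C where "C = K\<^sup>2 / z1\<^sup>2"
  have C: "0 \<le> C" by (simp add: C_def)
  show thesis
  proof (rule that[OF C])
    fix x y
    let ?wy = "wt y ^ (2 * p)" and ?wz = "wt (x - y) ^ (2 * p)"
    define wy wz where "wy = ?wy" and "wz = ?wz"
    have w: "1 \<le> wy" "1 \<le> wz" by (auto simp: wy_def wz_def)
    have target: "(\<delta> + C * (x - y)\<^sup>2) * wt y ^ (2 * p + 1) * wt (x - y) ^ (2 * p + 1)
        = (\<delta> + C * (x - y)\<^sup>2) * (wt y * wt (x - y)) * (wy * wz)" by (simp add: wy_def wz_def ac_simps)
    have cr: "(b x - b y)\<^sup>2 \<le> K\<^sup>2 * (wy * wz)" using crude by (simp add: wy_def wz_def)
    have ww: "wt y \<le> wt y * wt (x - y)" "1 \<le> wt y * wt (x - y)"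
      using mult_mono[of 1 "wt y" 1 "wt (x - y)"] mult_left_mono[of 1 "wt (x - y)" "wt y"] by auto
    have ge: "E * (wy * wz) \<le> (\<delta> + C * (x - y)\<^sup>2) * (wt y * wt (x - y)) * (wy * wz)"
      if "E \<le> (\<delta> + C * (x - y)\<^sup>2) * (wt y * wt (x - y))" for E
      using that w by (intro mult_right_mono) auto
    have dC: "0 \<le> \<delta> + C * (x - y)\<^sup>2" using \<delta> C by simp
    show "(b x - b y)\<^sup>2 \<le> (\<delta> + C * (x - y)\<^sup>2) * wt y ^ (2 * p + 1) * wt (x - y) ^ (2 * p + 1)"
    proof (cases "\<bar>x - y\<bar> < z1")
      case False
      then have "z1\<^sup>2 \<le> (x - y)\<^sup>2" using z1 power_mono[of z1 "\<bar>x - y\<bar>" 2] by simp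
      then have "K\<^sup>2 / z1\<^sup>2 * z1\<^sup>2 \<le> C * (x - y)\<^sup>2" unfolding C_def by (intro mult_left_mono) auto
      then have "K\<^sup>2 \<le> (\<delta> + C * (x - y)\<^sup>2) * 1" using z1 \<delta> by simp
      also have "\<dots> \<le> (\<delta> + C * (x - y)\<^sup>2) * (wt y * wt (x - y))" using ww dC by (intro mult_left_mono) auto
      finally show ?thesis unfolding target using ge cr by (meson order_trans)
    next
      case near: True
      show ?thesis
      proof (cases "Y \<le> wt y")
        case True
        have "K\<^sup>2 \<le> \<delta> * wt y" using Y(2) mult_left_mono[OF True less_imp_le[OF \<delta>]] by (rule order_trans)
        also have "\<dots> \<le> (\<delta> + C * (x - y)\<^sup>2) * (wt y * wt (x - y))"
          using \<delta> C ww by (intro mult_mono) auto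
        finally show ?thesis unfolding target using ge cr by (meson order_trans)
      next
        case False
        then have "\<bar>y\<bar> < Y" using abs_le_wt[of y] by linarith
        then have "dist (b x) (b y) < sqrt \<delta>"
          using near z1 by (intro z0(2)) (auto simp: dist_real_def abs_if split: if_splits)
        then have "\<bar>b x - b y\<bar>\<^sup>2 \<le> (sqrt \<delta>)\<^sup>2" by (intro power_mono) (auto simp: dist_real_def)
        then have "(b x - b y)\<^sup>2 \<le> \<delta> * 1 * 1" using \<delta> by simp
        also have "\<dots> \<le> (\<delta> + C * (x - y)\<^sup>2) * (wt y * wt (x - y)) * (wy * wz)"
          using \<delta> C ww w mult_mono[OF w] by (intro mult_mono) auto
        finally show ?thesis unfolding target .
      qed
    qed
  qed
qed

end

section \<open>Bounds of the mollified energy and duality for the flux\<close>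

context fp_kernel begin

text \<open>The negative part of the entropy is controlled by comparison with
  \<open>1 / wt x ^ 2\<close>: up to \<open>1 / wt x\<close> it costs
  \<open>2 * x\<^sup>2 * u\<close>, which explains the \<open>2 * s\<close> added to
  \<open>K\<close>. Second moments pass from \<open>u\<close> to the solution because mollification
  with an even kernel can only increase them.\<close>

lemma energy_lower:
  assumes t: "0 \<le> t" and K: "0 \<le> K" and W: "\<And>x. (K + 2 * s) * x\<^sup>2 \<le> W x + C"
  shows "K * (\<integral>x. x\<^sup>2 \<partial>\<mu> t) - (C + s * (\<integral>x. 1 / wt x \<partial>lborel)) \<le> energy t"
proof -
  interpret prob_space "\<mu> t" using prob t by simp
  define k0 where "k0 z = z * k z" for z
  define kk where "kk z = z\<^sup>2 * k z" for z
  have k0i: "integrable lborel k0" unfolding k0_def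
    by (rule kernel_integrable[where C = 1 and j = 1])
       (use k_pos abs_le_wt in \<open>auto simp: N_eq abs_mult less_imp_le intro!: mult_right_mono\<close>)
  have kki: "integrable lborel kk" unfolding kk_def
    by (rule kernel_integrable[where C = 1 and j = 1])
       (use k_pos square_le_wt in \<open>auto simp: N_eq abs_mult less_imp_le intro!: mult_right_mono\<close>)
  have ki: "integrable lborel k" using k_integrable N_eq by simp
  have k00: "(\<integral>z. k0 z \<partial>lborel) = 0"
  proof -
    have "(\<integral>z. k0 z \<partial>lborel) = (\<integral>z. k0 (- z) \<partial>lborel)"
      using lborel_integral_real_affine[of "- 1" k0 0] by simp
    also have "\<dots> = - (\<integral>z. k0 z \<partial>lborel)" by (simp add: k0_def k_even)
    finally show ?thesis by simp
  qed
  have kk0: "0 \<le> (\<integral>z. kk z \<partial>lborel)"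
    using k_pos by (intro Bochner_Integration.integral_nonneg) (simp add: kk_def less_imp_le)
  have mi: "integrable (\<mu> t) (\<lambda>x. x\<^sup>2)" "integrable (\<mu> t) (\<lambda>x. 2 * x)" "integrable (\<mu> t) (\<lambda>_. 1 :: real)"
    by (rule integrable_growth[OF t, of _ 1 1] integrable_growth[OF t, of _ 2 1] integrable_growth[OF t, of _ 1 1],
        use abs_le_wt square_le_wt Q_ge in \<open>auto simp: abs_mult\<close>)+
  \<comment> \<open>Expansion of \<open>x\<^sup>2\<close> around \<open>y\<close>; the mixed term
    will integrate to zero because \<open>k\<close> is even.\<close>
  have x2u: "x\<^sup>2 * u t x = cv (\<mu> t) (\<lambda>y. y\<^sup>2) k x + cv (\<mu> t) (\<lambda>y. 2 * y) k0 x + cv (\<mu> t) (\<lambda>_. 1) kk x" for x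
  proof -
    have gr: "\<bar>y\<^sup>2\<bar> \<le> 1 * wt y ^ 1" "\<bar>2 * y\<bar> \<le> 2 * wt y ^ 1" for y :: real
      using abs_le_wt[of y] square_le_wt[of y] by (auto simp: abs_mult)
    have c2: "continuous_on UNIV (\<lambda>y::real. y\<^sup>2)" by (intro continuous_intros)
    have i: "integrable (\<mu> t) (\<lambda>y. y\<^sup>2 * k (x - y))" "integrable (\<mu> t) (\<lambda>y. 2 * y * k (x - y))"
      "integrable (\<mu> t) (\<lambda>y. k (x - y))"
      using S_integrand(1)[OF t c2 gr(1) _ k_cont(1) k_self, of x] S_integrand(1)[OF t _ gr(2) _ k_cont(1) k_self, of x]
        S_integrand(1)[OF t one_growth _ k_cont(1) k_self, of x]
      by (auto intro!: continuous_intros)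
    have e1: "(\<lambda>y. 2 * y * k0 (x - y)) = (\<lambda>y. x * (2 * y * k (x - y)) - 2 * (y\<^sup>2 * k (x - y)))"
      and e2: "(\<lambda>y. kk (x - y)) = (\<lambda>y. x\<^sup>2 * k (x - y) - x * (2 * y * k (x - y)) + y\<^sup>2 * k (x - y))"
      by (auto simp: k0_def kk_def power2_eq_square algebra_simps)
    show ?thesis unfolding cv_def u_def mult_1 e1 e2 using i by simp
  qed
  have x2i: "integrable lborel (\<lambda>x. x\<^sup>2 * u t x)" and x2: "(\<integral>x. x\<^sup>2 \<partial>\<mu> t) \<le> (\<integral>x. x\<^sup>2 * u t x \<partial>lborel)"
    unfolding x2u using mi ki kki k0i k00 kk0
    by (simp_all add: integrable_cv[OF sigma_finite_measure_axioms sets_mu[OF t]]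
        integral_cv[OF sigma_finite_measure_axioms sets_mu[OF t]] k_integral prob_space)
  have iw: "integrable lborel (\<lambda>x. 1 / wt x)" by (rule integrable_inverse_wt)
  have pt: "K * (x\<^sup>2 * u t x) - C * u t x - s * (1 / wt x) \<le> s * (u t x * ln (u t x)) + W x * u t x" for x
  proof -
    define U where "U = u t x"
    have U: "0 < U" using u_pos[OF t] by (simp add: U_def)
    have "ln (1 / (wt x ^ 2 * U)) \<le> 1 / (wt x ^ 2 * U) - 1" using U by (intro ln_le_minus_one) simp
    moreover have "ln (1 / (wt x ^ 2 * U)) = - 2 * ln (wt x) - ln U"
      using U by (simp add: ln_div ln_mult ln_realpow)
    ultimately have "1 - 1 / (wt x ^ 2 * U) - 2 * ln (wt x) \<le> ln U" by simp
    moreover have "ln (wt x) \<le> x\<^sup>2" using ln_le_minus_one[OF wt_pos[of x]] by (simp add: wt_def[of x])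
    ultimately have "- (1 / (wt x ^ 2 * U)) - 2 * x\<^sup>2 \<le> ln U" by simp
    then have "U * (- (1 / (wt x ^ 2 * U)) - 2 * x\<^sup>2) \<le> U * ln U" using U by (intro mult_left_mono) auto
    moreover have "U * (- (1 / (wt x ^ 2 * U)) - 2 * x\<^sup>2) = - (1 / wt x ^ 2) - 2 * (x\<^sup>2 * U)"
      using U by (simp add: field_simps)
    moreover have "1 / wt x ^ 2 \<le> 1 / wt x" using wt_div_pow_le[of 0 2 x]
      by simp
    ultimately have "- (1 / wt x) - 2 * (x\<^sup>2 * U) \<le> U * ln U" by linarith
    then have "s * (- (1 / wt x) - 2 * (x\<^sup>2 * U)) \<le> s * (U * ln U)" using s_pos by (intro mult_left_mono) auto
    moreover have "((K + 2 * s) * x\<^sup>2) * U \<le> (W x + C) * U" using W U by (intro mult_right_mono) auto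
    ultimately show ?thesis unfolding U_def[symmetric] by (simp add: algebra_simps)
  qed
  have "K * (\<integral>x. x\<^sup>2 * u t x \<partial>lborel) - C - s * (\<integral>x. 1 / wt x \<partial>lborel)
      = (\<integral>x. K * (x\<^sup>2 * u t x) - C * u t x - s * (1 / wt x) \<partial>lborel)"
    using x2i u_integral[OF t] iw by (simp del: times_divide_eq_right mult_1_right)
  also have "\<dots> \<le> energy t" unfolding energy_def
    using x2i u_integral[OF t] iw
    by (intro integral_mono pt energy_integrable t Bochner_Integration.integrable_diff integrable_mult_right)
  finally have "K * (\<integral>x. x\<^sup>2 * u t x \<partial>lborel) - C - s * (\<integral>x. 1 / wt x \<partial>lborel) \<le> energy t" .
  moreover have "K * (\<integral>x. x\<^sup>2 \<partial>\<mu> t) \<le> K * (\<integral>x. x\<^sup>2 * u t x \<partial>lborel)" using x2 K by (rule mult_left_mono)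
  ultimately show ?thesis by linarith
qed

text \<open>Jensen's inequality: mollification does not increase the entropy.\<close>

lemma energy_0_upper:
  assumes f0: "is_density f0 (\<mu> 0)" "integrable lborel (\<lambda>x. f0 x * ln (f0 x))"
    and CW: "0 \<le> CW" "\<And>x. \<bar>W x\<bar> \<le> CW * wt x ^ (p + 1)"
    and m0: "(\<integral>z. wt z ^ (2 * p + 1) * k z \<partial>lborel) \<le> m0"
  shows "energy 0 \<le> s * (\<integral>x. f0 x * ln (f0 x) \<partial>lborel) + CW * 2 ^ (p + 1) * (\<integral>x. wt x ^ (p + 1) \<partial>\<mu> 0) * m0"
proof -
  interpret prob_space "\<mu> 0" using prob by simp
  have [measurable]: "f0 \<in> borel_measurable borel" and f0_nonneg: "\<And>x. 0 \<le> f0 x"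
    and mu0: "\<mu> 0 = density lborel (\<lambda>x. ennreal (f0 x))" using f0(1) by (auto simp: is_density_def)
  have ki: "integrable lborel k" using k_integrable N_eq by simp
  define r where "r = cv lborel (\<lambda>x. f0 x * ln (f0 x)) k"
  have r: "integrable lborel r" "(\<integral>x. r x \<partial>lborel) = (\<integral>x. f0 x * ln (f0 x) \<partial>lborel)"
    unfolding r_def
    using integrable_cv[OF lborel.sigma_finite_measure_axioms sets_lborel f0(2) ki]
      integral_cv[OF lborel.sigma_finite_measure_axioms sets_lborel f0(2) ki] k_integral by auto
  have f0k: "integrable lborel (\<lambda>y. f0 y * k (x - y))" "u 0 x = (\<integral>y. f0 y * k (x - y) \<partial>lborel)" for x
  proof -
    have "integrable (\<mu> 0) (\<lambda>y. k (x - y))"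
      using S_integrand(1)[OF _ one_growth _ k_cont(1) k_self, of 0 x] by simp
    then show "integrable lborel (\<lambda>y. f0 y * k (x - y))"
      unfolding mu0 by (subst (asm) integrable_density) (auto simp: f0_nonneg)
    show "u 0 x = (\<integral>y. f0 y * k (x - y) \<partial>lborel)"
      unfolding u_def cv_def mu0 by (subst integral_density) (auto simp: f0_nonneg)
  qed
  have kx: "integrable lborel (\<lambda>y. k (x - y))" "(\<integral>y. k (x - y) \<partial>lborel) = 1" for x
    using lborel_integrable_real_affine[OF ki, of "- 1" x] lborel_integral_real_affine[of "- 1" k x]
    by (auto simp: k_integral)
  have kb: "\<bar>k z\<bar> \<le> L" for z using k_le_L[of z] k_pos[of z] by simp
  have jensen: "u 0 x * ln (u 0 x) \<le> r x" for x
  proof -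
    define U where "U = u 0 x"
    have U: "0 < U" using u_pos[of 0 x] by (simp add: U_def)
    \<comment> \<open>The tangent of \<open>v * ln v\<close> at \<open>U\<close>. With
      \<open>v = f0 y\<close> and integrated in \<open>y\<close> against \<open>k (x - y)\<close>,
      whose mass is one, its left side becomes \<open>U * ln U\<close>.\<close>
    have tangent: "v * ln U + v - U \<le> v * ln v" if v: "0 \<le> v" for v
    proof (cases "v = 0")
      case False
      then have v: "0 < v" using v by simp
      have "ln (U / v) \<le> U / v - 1" using U v by (intro ln_le_minus_one) simp
      then have "v * (ln U - ln v) \<le> v * (U / v - 1)" using U v by (simp add: ln_div)
      then show ?thesis using v by (simp add: algebra_simps)
    qed (use U in simp)
    have int: "integrable lborel (\<lambda>y. (f0 y * ln (f0 y)) * k (x - y))"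
      by (rule integrable_mult_bounded[OF f0(2) _ kb]) measurable
    have "U * ln U + U - U * 1 = (\<integral>y. (ln U + 1) * (f0 y * k (x - y)) - U * k (x - y) \<partial>lborel)"
    proof -
      have "(\<integral>y. (ln U + 1) * (f0 y * k (x - y)) - U * k (x - y) \<partial>lborel)
          = (ln U + 1) * (\<integral>y. f0 y * k (x - y) \<partial>lborel) - U * (\<integral>y. k (x - y) \<partial>lborel)"
        using f0k(1)[of x] kx(1)[of x] by simp
      then show ?thesis unfolding f0k(2)[symmetric] kx(2) U_def[symmetric] by (simp add: algebra_simps)
    qed
    also have "\<dots> \<le> (\<integral>y. (f0 y * ln (f0 y)) * k (x - y) \<partial>lborel)"
    proof (rule integral_mono[OF _ int])
      show "integrable lborel (\<lambda>y. (ln U + 1) * (f0 y * k (x - y)) - U * k (x - y))"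
        using f0k(1) kx(1) by (intro Bochner_Integration.integrable_diff integrable_mult_right) 
      show "(ln U + 1) * (f0 y * k (x - y)) - U * k (x - y) \<le> (f0 y * ln (f0 y)) * k (x - y)" for y
        using mult_right_mono[OF tangent[OF f0_nonneg, of y], of "k (x - y)"] k_pos[of "x - y"]
        by (simp add: algebra_simps)
    qed
    finally show ?thesis by (simp add: r_def cv_def U_def)
  qed
  define \<kappa> where "\<kappa> z = wt z ^ (p + 1) * k z" for z
  have \<kappa>: "integrable lborel \<kappa>" unfolding \<kappa>_def using k_wt_integrable[of "p + 1"] N_eq by simp
  have wi: "integrable (\<mu> 0) (\<lambda>x. wt x ^ (p + 1))"
    by (rule integrable_growth[of 0 _ 1 "p + 1"]) (use Q_ge in auto)
  define w where "w = cv (\<mu> 0) (\<lambda>x. wt x ^ (p + 1)) \<kappa>"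
  have w: "integrable lborel w" "(\<integral>x. w x \<partial>lborel) = (\<integral>x. wt x ^ (p + 1) \<partial>\<mu> 0) * (\<integral>z. \<kappa> z \<partial>lborel)"
    unfolding w_def using integrable_cv[OF sigma_finite_measure_axioms sets_mu[OF order_refl] wi \<kappa>]
      integral_cv[OF sigma_finite_measure_axioms sets_mu[OF order_refl] wi \<kappa>] by auto
  have "(\<integral>z. \<kappa> z \<partial>lborel) \<le> (\<integral>z. wt z ^ (2 * p + 1) * k z \<partial>lborel)"
    unfolding \<kappa>_def using \<kappa>[unfolded \<kappa>_def] k_wt_integrable[of "2 * p + 1"] N_eq k_pos
    by (intro integral_mono mult_right_mono wt_pow_mono) (auto simp: less_imp_le)
  then have \<kappa>m: "(\<integral>z. \<kappa> z \<partial>lborel) \<le> m0" using m0 by simp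
  \<comment> \<open>The potential is treated by its growth: Peetre's inequality gives a bound by
    initial moments, uniform over the kernels whose moment is at most \<open>m0\<close>.\<close>
  have Wu: "W x * u 0 x \<le> CW * 2 ^ (p + 1) * w x" for x
  proof -
    have sm: "sets (\<mu> 0) = sets borel" by (rule sets_mu) simp
    note [measurable_cong] = sm
    have pt: "W x * k (x - y) \<le> CW * 2 ^ (p + 1) * (wt y ^ (p + 1) * \<kappa> (x - y))" for y
    proof -
      have "W x \<le> CW * (2 ^ (p + 1) * wt y ^ (p + 1) * wt (x - y) ^ (p + 1))"
        using CW(2)[of x] mult_left_mono[OF wt_peetre_pow[of y "x - y" "p + 1"] CW(1)] by simp
      from mult_right_mono[OF this, of "k (x - y)"] show ?thesis
        using k_pos[of "x - y"] by (simp add: \<kappa>_def ac_simps)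
    qed
    have \<kappa>b: "\<bar>\<kappa> z\<bar> \<le> L" for z
    proof -
      have "wt z ^ (p + 1) * k z \<le> wt z ^ (p + 1) * (L / wt z ^ N)" by (intro mult_left_mono k_upper) simp
      also have "\<dots> = L * (wt z ^ (p + 1) / wt z ^ N)" by simp
      also have "\<dots> \<le> L * 1" using L_pos wt_pow_mono[of "p + 1" N z] N_eq by (intro mult_left_mono) auto
      finally show ?thesis using k_pos[of z] by (simp add: \<kappa>_def abs_mult less_imp_le)
    qed
    have \<kappa>meas: "\<kappa> \<in> borel_measurable borel" unfolding \<kappa>_def[abs_def] by measurable
    have i1: "integrable (\<mu> 0) (\<lambda>y. wt y ^ (p + 1) * \<kappa> (x - y))"
      by (rule integrable_mult_bounded[OF wi _ \<kappa>b]) (use \<kappa>meas in measurable)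
    have i2: "integrable (\<mu> 0) (\<lambda>y. k (x - y))"
      using S_integrand(1)[OF _ one_growth _ k_cont(1) k_self, of 0 x] by simp
    have "W x * u 0 x = (\<integral>y. W x * k (x - y) \<partial>\<mu> 0)" using i2 by (simp add: u_def cv_def)
    also have "\<dots> \<le> (\<integral>y. CW * 2 ^ (p + 1) * (wt y ^ (p + 1) * \<kappa> (x - y)) \<partial>\<mu> 0)"
      using i1 i2 by (intro integral_mono pt integrable_mult_right)
    also have "\<dots> = CW * 2 ^ (p + 1) * w x" using i1 by (simp add: w_def cv_def)
    finally show ?thesis .
  qed
  have "energy 0 \<le> (\<integral>x. s * r x + CW * 2 ^ (p + 1) * w x \<partial>lborel)"
    unfolding energy_def
  proof (rule integral_mono)
    show "integrable lborel (\<lambda>x. s * (u 0 x * ln (u 0 x)) + W x * u 0 x)" by (rule energy_integrable) simp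
    show "integrable lborel (\<lambda>x. s * r x + CW * 2 ^ (p + 1) * w x)" using r w by simp
    show "s * (u 0 x * ln (u 0 x)) + W x * u 0 x \<le> s * r x + CW * 2 ^ (p + 1) * w x" for x
      using s_pos by (intro add_mono mult_left_mono jensen Wu) auto
  qed
  also have "\<dots> = s * (\<integral>x. f0 x * ln (f0 x) \<partial>lborel) + CW * 2 ^ (p + 1) * ((\<integral>x. wt x ^ (p + 1) \<partial>\<mu> 0) * (\<integral>z. \<kappa> z \<partial>lborel))"
    using r w by simp
  also have "\<dots> \<le> s * (\<integral>x. f0 x * ln (f0 x) \<partial>lborel) + CW * 2 ^ (p + 1) * ((\<integral>x. wt x ^ (p + 1) \<partial>\<mu> 0) * m0)"
    using CW(1) \<kappa>m by (intro add_left_mono mult_left_mono Bochner_Integration.integral_nonneg) auto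
  finally show ?thesis by (simp add: ac_simps)
qed

text \<open>A modulus of the form \<open>e + C * (x - y)\<^sup>2\<close> expresses uniform
  continuity in such a way that only the mass of the kernel and a moment with the factor
  \<open>z\<^sup>2\<close> enter the error.\<close>

lemma cv_approx:
  assumes t: "0 \<le> t" and f: "integrable (\<mu> t) f"
    and \<phi>: "continuous_on UNIV \<phi>" "\<And>x. \<bar>\<phi> x\<bar> \<le> A" "\<And>x y. \<bar>\<phi> x - \<phi> y\<bar> \<le> e + C * (x - y)\<^sup>2"
    and e: "0 \<le> e" "0 \<le> C" and m2: "(\<integral>z. z\<^sup>2 * wt z ^ (2 * p + 1) * k z \<partial>lborel) \<le> m2"
  shows "integrable lborel (\<lambda>x. \<phi> x * cv (\<mu> t) f k x)"
    "\<bar>(\<integral>x. \<phi> x * cv (\<mu> t) f k x \<partial>lborel) - (\<integral>x. f x * \<phi> x \<partial>\<mu> t)\<bar> \<le> (\<integral>x. \<bar>f x\<bar> \<partial>\<mu> t) * (e + C * m2)"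
proof -
  interpret prob_space "\<mu> t" using prob t by simp
  have sm: "sets (\<mu> t) = sets borel" by (rule sets_mu[OF t])
  note [measurable_cong] = sm
  note cvs = integrable_cv[OF sigma_finite_measure_axioms sm] integral_cv[OF sigma_finite_measure_axioms sm]
  have \<phi>m [measurable]: "\<phi> \<in> borel_measurable borel" using \<phi>(1) by (rule borel_measurable_continuous_onI)
  have ki: "integrable lborel k" using k_integrable N_eq by simp
  define \<kappa> where "\<kappa> z = e * k z + C * (z\<^sup>2 * k z)" for z
  have zi: "integrable lborel (\<lambda>z. z\<^sup>2 * k z)"
    by (rule kernel_integrable[where C = 1 and j = 1])
       (use k_pos square_le_wt in \<open>auto simp: N_eq abs_mult less_imp_le intro!: mult_right_mono\<close>)
  have zi2: "integrable lborel (\<lambda>z. z\<^sup>2 * wt z ^ (2 * p + 1) * k z)"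
    by (rule kernel_integrable[where C = 1 and j = "2 * p + 2"])
       (use k_pos square_le_wt in \<open>auto simp: N_eq abs_mult less_imp_le intro!: mult_right_mono\<close>)
  have \<kappa>i: "integrable lborel \<kappa>" unfolding \<kappa>_def[abs_def] using ki zi by simp
  have "(\<integral>z. z\<^sup>2 * k z \<partial>lborel) \<le> (\<integral>z. z\<^sup>2 * wt z ^ (2 * p + 1) * k z \<partial>lborel)"
  proof (rule integral_mono[OF zi zi2])
    fix z
    have "z\<^sup>2 * k z * 1 \<le> z\<^sup>2 * k z * wt z ^ (2 * p + 1)"
      using k_pos[of z] by (intro mult_left_mono wt_pow_ge_1) auto
    then show "z\<^sup>2 * k z \<le> z\<^sup>2 * wt z ^ (2 * p + 1) * k z" by (simp add: ac_simps)
  qed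
  then have zm: "(\<integral>z. z\<^sup>2 * k z \<partial>lborel) \<le> m2" using m2 by simp
  have \<kappa>int: "(\<integral>z. \<kappa> z \<partial>lborel) \<le> e + C * m2"
    unfolding \<kappa>_def[abs_def] using ki zi zm e by (simp add: k_integral mult_left_mono)
  have fm [measurable]: "f \<in> borel_measurable (\<mu> t)" using f by auto
  have i\<phi>: "integrable (\<mu> t) (\<lambda>y. f y * \<phi> y)" by (rule integrable_mult_bounded[OF f _ \<phi>(2)]) measurable
  have ci: "integrable lborel (cv (\<mu> t) f k)" by (rule cvs(1)[OF f ki])
  show i1: "integrable lborel (\<lambda>x. \<phi> x * cv (\<mu> t) f k x)"
    using integrable_mult_bounded[OF ci _ \<phi>(2)] by (simp add: mult.commute)
  define r where "r = cv (\<mu> t) (\<lambda>y. \<bar>f y\<bar>) \<kappa>"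
  have r: "integrable lborel r" "(\<integral>x. r x \<partial>lborel) = (\<integral>x. \<bar>f x\<bar> \<partial>\<mu> t) * (\<integral>z. \<kappa> z \<partial>lborel)"
    unfolding r_def using cvs(1)[OF integrable_abs[OF f] \<kappa>i] cvs(2)[OF integrable_abs[OF f] \<kappa>i] by auto
  have kb: "\<bar>k z\<bar> \<le> L" for z using k_le_L[of z] k_pos[of z] by simp
  have \<kappa>b: "\<bar>\<kappa> z\<bar> \<le> (e + C) * L" for z
  proof -
    have "z\<^sup>2 * k z \<le> wt z * (L / wt z ^ N)"
      using square_le_wt k_upper k_pos[of z] by (intro mult_mono) auto
    also have "\<dots> = L * (wt z ^ 1 / wt z ^ N)" by simp
    also have "\<dots> \<le> L * 1" using L_pos wt_pow_mono[of 1 N z] N_eq by (intro mult_left_mono) auto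
    finally have "C * (z\<^sup>2 * k z) \<le> C * L" using e by (intro mult_left_mono) auto
    moreover have "e * k z \<le> e * L" using e k_le_L by (intro mult_left_mono) auto
    moreover have "0 \<le> C * (z\<^sup>2 * k z)" "0 \<le> e * k z" using e k_pos[of z] by auto
    ultimately show ?thesis by (simp add: \<kappa>_def distrib_right)
  qed
  have \<kappa>m: "\<kappa> \<in> borel_measurable borel" unfolding \<kappa>_def[abs_def] by measurable
  have pt: "\<bar>\<phi> x * cv (\<mu> t) f k x - cv (\<mu> t) (\<lambda>y. f y * \<phi> y) k x\<bar> \<le> r x" for x
  proof -
    have i: "integrable (\<mu> t) (\<lambda>y. f y * k (x - y))" "integrable (\<mu> t) (\<lambda>y. f y * \<phi> y * k (x - y))"
      "integrable (\<mu> t) (\<lambda>y. \<bar>f y\<bar> * \<kappa> (x - y))"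
      using \<kappa>m integrable_mult_bounded[OF f _ kb, of "\<lambda>y. x - y"]
      by (auto intro!: integrable_mult_bounded[OF f _ kb] integrable_mult_bounded[OF i\<phi> _ kb]
          integrable_mult_bounded[OF integrable_abs[OF f] _ \<kappa>b])
    have "\<phi> x * cv (\<mu> t) f k x - cv (\<mu> t) (\<lambda>y. f y * \<phi> y) k x
        = (\<integral>y. \<phi> x * (f y * k (x - y)) - f y * \<phi> y * k (x - y) \<partial>\<mu> t)"
      unfolding cv_def using i by simp
    also have "\<bar>\<dots>\<bar> \<le> (\<integral>y. \<bar>f y\<bar> * \<kappa> (x - y) \<partial>\<mu> t)"
    proof (rule order_trans[OF integral_abs_bound], rule integral_mono)
      show "integrable (\<mu> t) (\<lambda>y. \<bar>\<phi> x * (f y * k (x - y)) - f y * \<phi> y * k (x - y)\<bar>)"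
        using i by (intro integrable_abs Bochner_Integration.integrable_diff integrable_mult_right)
      fix y
      have "\<bar>\<phi> x * (f y * k (x - y)) - f y * \<phi> y * k (x - y)\<bar> = \<bar>(\<phi> x - \<phi> y) * (f y * k (x - y))\<bar>"
        by (simp add: algebra_simps)
      also have "\<dots> = \<bar>\<phi> x - \<phi> y\<bar> * (\<bar>f y\<bar> * k (x - y))" using k_pos[of "x - y"] by (simp add: abs_mult)
      also have "\<dots> \<le> (e + C * (x - y)\<^sup>2) * (\<bar>f y\<bar> * k (x - y))"
        using k_pos[of "x - y"] by (intro mult_right_mono \<phi>) auto
      finally show "\<bar>\<phi> x * (f y * k (x - y)) - f y * \<phi> y * k (x - y)\<bar> \<le> \<bar>f y\<bar> * \<kappa> (x - y)"
        by (simp add: \<kappa>_def algebra_simps)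
    qed (rule i)
    finally show ?thesis by (simp add: r_def cv_def)
  qed
  have c2: "integrable lborel (cv (\<mu> t) (\<lambda>y. f y * \<phi> y) k)"
    "(\<integral>x. cv (\<mu> t) (\<lambda>y. f y * \<phi> y) k x \<partial>lborel) = (\<integral>x. f x * \<phi> x \<partial>\<mu> t)"
    using cvs(1)[OF i\<phi> ki] cvs(2)[OF i\<phi> ki] by (auto simp: k_integral)
  have "\<bar>(\<integral>x. \<phi> x * cv (\<mu> t) f k x \<partial>lborel) - (\<integral>x. f x * \<phi> x \<partial>\<mu> t)\<bar>
      = \<bar>\<integral>x. \<phi> x * cv (\<mu> t) f k x - cv (\<mu> t) (\<lambda>y. f y * \<phi> y) k x \<partial>lborel\<bar>"
    using i1 c2 by simp
  also have "\<dots> \<le> (\<integral>x. \<bar>\<phi> x * cv (\<mu> t) f k x - cv (\<mu> t) (\<lambda>y. f y * \<phi> y) k x\<bar> \<partial>lborel)"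
    by (rule integral_abs_bound)
  also have "\<dots> \<le> (\<integral>x. r x \<partial>lborel)" using i1 c2 r pt by (intro integral_mono) auto
  also have "\<dots> \<le> (\<integral>x. \<bar>f x\<bar> \<partial>\<mu> t) * (e + C * m2)"
    unfolding r(2) using \<kappa>int by (intro mult_left_mono Bochner_Integration.integral_nonneg) auto
  finally show "\<bar>(\<integral>x. \<phi> x * cv (\<mu> t) f k x \<partial>lborel) - (\<integral>x. f x * \<phi> x \<partial>\<mu> t)\<bar> \<le> (\<integral>x. \<bar>f x\<bar> \<partial>\<mu> t) * (e + C * m2)" .
qed

text \<open>The left side contains neither \<open>u\<close> nor \<open>J\<close>. It is compared
  with the integral of \<open>J * \<phi>\<close> through integration by parts and two applications
  of \<open>cv_approx\<close>; the dissipation enters through the L1 norm of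
  \<open>J\<close>.\<close>

lemma flux_duality:
  assumes t: "0 \<le> t"
    and \<phi>: "\<And>x. (\<phi> has_real_derivative \<phi>1 x) (at x)" "continuous_on UNIV \<phi>1" "\<And>x. R < \<bar>x\<bar> \<Longrightarrow> \<phi> x = 0"
      "\<And>x. \<bar>\<phi> x\<bar> \<le> A" "\<And>x. \<bar>\<phi>1 x\<bar> \<le> A1"
    and mod: "\<And>x y. \<bar>\<phi> x - \<phi> y\<bar> \<le> e + C * (x - y)\<^sup>2" "\<And>x y. \<bar>\<phi>1 x - \<phi>1 y\<bar> \<le> e + C * (x - y)\<^sup>2"
    and e: "0 \<le> e" "0 \<le> C" and m2: "(\<integral>z. z\<^sup>2 * wt z ^ (2 * p + 1) * k z \<partial>lborel) \<le> m2"
  shows "\<bar>\<integral>x. s * \<phi>1 x - (b x - h t) * \<phi> x \<partial>\<mu> t\<bar>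
    \<le> A * sqrt (Diss t) + (s + (\<integral>x. \<bar>b x - h t\<bar> \<partial>\<mu> t)) * (e + C * m2)"
proof -
  interpret prob_space "\<mu> t" using prob t by simp
  have c\<phi>: "continuous_on UNIV \<phi>" using \<phi>(1) by (meson DERIV_isCont continuous_at_imp_continuous_on)
  have bi: "integrable (\<mu> t) b" by (rule S_integrand(2)[OF t b_cont b_growth _ k_cont(1) k_self]) simp
  have ib: "integrable (\<mu> t) (\<lambda>x. b x - h t)" using bi by simp
  have i1: "integrable (\<mu> t) (\<lambda>_. 1 :: real)" by simp
  note a1 = cv_approx[OF t i1 \<phi>(2) \<phi>(5) mod(2) e m2] and a2 = cv_approx[OF t ib c\<phi> \<phi>(4) mod(1) e m2]
  have cvb: "cv (\<mu> t) (\<lambda>x. b x - h t) k x = bu t x - h t * u t x" for x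
    using S_integrand(1)[OF t one_growth _ k_cont(1) k_self, of x]
      S_integrand(1)[OF t b_cont b_growth _ k_cont(1) k_self, of x]
    by (simp add: cv_def bu_def u_def left_diff_distrib)
  have Ji: "integrable lborel (J t)" by (rule J_integral[OF t])
  have \<phi>m: "\<phi> \<in> borel_measurable lborel" "\<phi>1 \<in> borel_measurable lborel"
    using c\<phi> \<phi>(2) by (auto intro: borel_measurable_continuous_onI)
  have iJ: "integrable lborel (\<lambda>x. J t x * \<phi> x)" by (rule integrable_mult_bounded[OF Ji \<phi>m(1) \<phi>(4)])
  have A: "0 \<le> A" using order_trans[OF abs_ge_zero \<phi>(4)] .
  have J\<phi>: "\<bar>\<integral>x. J t x * \<phi> x \<partial>lborel\<bar> \<le> A * sqrt (Diss t)"
  proof -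
    have "\<bar>\<integral>x. J t x * \<phi> x \<partial>lborel\<bar> \<le> (\<integral>x. \<bar>J t x * \<phi> x\<bar> \<partial>lborel)" by (rule integral_abs_bound)
    also have "\<dots> \<le> (\<integral>x. A * \<bar>J t x\<bar> \<partial>lborel)"
    proof (rule integral_mono)
      show "integrable lborel (\<lambda>x. \<bar>J t x * \<phi> x\<bar>)" "integrable lborel (\<lambda>x. A * \<bar>J t x\<bar>)"
        using iJ Ji by simp_all
      show "\<bar>J t x * \<phi> x\<bar> \<le> A * \<bar>J t x\<bar>" for x
        using mult_left_mono[OF \<phi>(4), of "\<bar>J t x\<bar>" x] by (simp add: abs_mult mult.commute)
    qed
    also have "\<dots> \<le> A * sqrt (Diss t)"
      using Diss_props(4)[OF t] A by (auto intro!: mult_left_mono real_le_rsqrt)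
    finally show ?thesis .
  qed
  have cu: "cv (\<mu> t) (\<lambda>_. 1) k x = u t x" for x by (simp add: u_def)
  have dz: "(\<integral>x. ux t x * \<phi> x + u t x * \<phi>1 x \<partial>lborel) = 0" and iux: "integrable lborel (\<lambda>x. ux t x * \<phi> x)"
  proof -
    have uxi: "integrable lborel (ux t)"
    proof -
      have k1i: "integrable lborel k1"
        by (rule kernel_integrable[where C = L and j = 0]) (use k1_le N_eq in auto)
      show ?thesis unfolding ux_def[abs_def]
        by (rule integrable_cv[OF sigma_finite_measure_axioms sets_mu[OF t] i1 k1i])
    qed
    show iux: "integrable lborel (\<lambda>x. ux t x * \<phi> x)" by (rule integrable_mult_bounded[OF uxi \<phi>m(1) \<phi>(4)])
    have c: "continuous_on UNIV (\<lambda>x. u t x * \<phi> x)" by (intro continuous_intros u_derivs t c\<phi>)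
    have "continuous_on UNIV (\<lambda>x. u t x * \<phi> x * wt x)" by (intro continuous_intros c)
    from continuous_compact_support_bounded[OF this, of R] \<phi>(3)
    obtain B where B: "\<And>x. \<bar>u t x * \<phi> x * wt x\<bar> \<le> B" by auto
    show "(\<integral>x. ux t x * \<phi> x + u t x * \<phi>1 x \<partial>lborel) = 0"
    proof (rule integral_deriv_eq_0)
      show "((\<lambda>x. u t x * \<phi> x) has_real_derivative ux t x * \<phi> x + u t x * \<phi>1 x) (at x)" for x
        using DERIV_mult[OF u_derivs(1)[OF t] \<phi>(1), of x] by (simp add: algebra_simps)
      show "continuous_on UNIV (\<lambda>x. ux t x * \<phi> x + u t x * \<phi>1 x)"
        by (intro continuous_intros u_derivs t c\<phi> \<phi>(2))
      show "integrable lborel (\<lambda>x. ux t x * \<phi> x + u t x * \<phi>1 x)"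
        using iux a1(1) by (simp add: cu mult.commute[of "\<phi>1 _"])
      show "\<bar>u t x * \<phi> x\<bar> \<le> B / wt x" for x
        using B[of x] by (simp add: abs_mult pos_le_divide_eq)
    qed
  qed
  have iu1: "integrable lborel (\<lambda>x. \<phi>1 x * u t x)" using a1(1) by (simp add: cu)
  have ib2: "integrable lborel (\<lambda>x. \<phi> x * (bu t x - h t * u t x))" using a2(1) by (simp add: cvb)
  have split: "(\<integral>x. J t x * \<phi> x \<partial>lborel)
      = - s * (\<integral>x. \<phi>1 x * u t x \<partial>lborel) + (\<integral>x. \<phi> x * (bu t x - h t * u t x) \<partial>lborel)"
  proof -
    have "(\<integral>x. J t x * \<phi> x \<partial>lborel) = (\<integral>x. s * (ux t x * \<phi> x) + \<phi> x * (bu t x - h t * u t x) \<partial>lborel)"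
      by (rule Bochner_Integration.integral_cong) (simp_all add: J_def algebra_simps)
    also have "\<dots> = s * (\<integral>x. ux t x * \<phi> x \<partial>lborel) + (\<integral>x. \<phi> x * (bu t x - h t * u t x) \<partial>lborel)"
      using iux ib2 by simp
    also have "(\<integral>x. ux t x * \<phi> x \<partial>lborel) = - (\<integral>x. \<phi>1 x * u t x \<partial>lborel)"
      using dz iux iu1 by (simp add: mult.commute[of "u t _"])
    finally show ?thesis by simp
  qed
  have e1: "\<bar>(\<integral>x. \<phi>1 x * u t x \<partial>lborel) - (\<integral>x. \<phi>1 x \<partial>\<mu> t)\<bar> \<le> e + C * m2"
    using a1(2) by (simp add: cu prob_space)
  have e2: "\<bar>(\<integral>x. \<phi> x * (bu t x - h t * u t x) \<partial>lborel) - (\<integral>x. (b x - h t) * \<phi> x \<partial>\<mu> t)\<bar>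
      \<le> (\<integral>x. \<bar>b x - h t\<bar> \<partial>\<mu> t) * (e + C * m2)"
    using a2(2) by (simp add: cvb)
  have i\<phi>1: "integrable (\<mu> t) \<phi>1"
    by (rule integrable_bounded_mu[OF t _ \<phi>(5)]) (use \<phi>m in simp)
  have ib\<phi>: "integrable (\<mu> t) (\<lambda>x. (b x - h t) * \<phi> x)"
    by (rule integrable_mult_bounded[OF ib _ \<phi>(4)]) (rule cont_measurable_mu[OF t c\<phi>])
  have "(\<integral>x. s * \<phi>1 x - (b x - h t) * \<phi> x \<partial>\<mu> t) = s * (\<integral>x. \<phi>1 x \<partial>\<mu> t) - (\<integral>x. (b x - h t) * \<phi> x \<partial>\<mu> t)"
    using i\<phi>1 ib\<phi> by simp
  moreover have "\<bar>s * ((\<integral>x. \<phi>1 x * u t x \<partial>lborel) - (\<integral>x. \<phi>1 x \<partial>\<mu> t))\<bar> \<le> s * (e + C * m2)"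
    unfolding abs_mult using s_pos e1 by (simp add: mult_left_mono)
  ultimately show ?thesis using J\<phi> e2 unfolding split by (simp add: algebra_simps)
qed

end

section \<open>A concrete approximate identity\<close>

definition ker_mass :: "nat \<Rightarrow> real" where "ker_mass N = (\<integral>z. 1 / wt z ^ N \<partial>lborel)"
text \<open>Dilations of a normalised power of \<open>1 / wt\<close>, that is of a Student density.
  The scale \<open>Suc n\<close> is at least one, so that undoing the dilation never increases the
  weight.\<close>

definition ker :: "nat \<Rightarrow> nat \<Rightarrow> real \<Rightarrow> real" where
  "ker N n z = (real (Suc n) / ker_mass N) * (1 / wt (real (Suc n) * z) ^ N)"
definition ker1 :: "nat \<Rightarrow> nat \<Rightarrow> real \<Rightarrow> real" where
  "ker1 N n z = (real (Suc n) ^ 2 / ker_mass N) * (- 2 * real N * (real (Suc n) * z) / wt (real (Suc n) * z) ^ (N + 1))"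
definition ker2 :: "nat \<Rightarrow> nat \<Rightarrow> real \<Rightarrow> real" where
  "ker2 N n z = (real (Suc n) ^ 3 / ker_mass N) * (- 2 * real N / wt (real (Suc n) * z) ^ (N + 1)
    + 4 * real N * real (N + 1) * (real (Suc n) * z)\<^sup>2 / wt (real (Suc n) * z) ^ (N + 2))"
text \<open>The four summands serve, in this order, the upper bound, the lower bound and the bounds
  of the first and the second derivative.\<close>

definition ker_const :: "nat \<Rightarrow> nat \<Rightarrow> real" where
  "ker_const N n = real (Suc n) / ker_mass N + ker_mass N * real (Suc n) ^ (2 * N) + 2 * real N * real (Suc n)
    + real (Suc n) ^ 2 * (2 * real N + 4 * real N * real (N + 1))"

lemma inverse_wt_pow_deriv:
  "((\<lambda>z. 1 / wt z ^ m) has_real_derivative - 2 * real m * z / wt z ^ (m + 1)) (at z)"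
proof (cases m)
  case (Suc j)
  have "((\<lambda>z. 1 / wt z ^ m) has_real_derivative - (real m * wt z ^ j * (2 * z)) / (wt z ^ m * wt z ^ m)) (at z)"
  proof -
    have "(wt has_real_derivative 2 * z) (at z)" unfolding wt_def by (auto intro!: derivative_eq_intros)
    from DERIV_power[OF this, of m] have "((\<lambda>z. wt z ^ m) has_real_derivative real m * wt z ^ j * (2 * z)) (at z)"
      unfolding Suc by (simp only: diff_Suc_Suc diff_zero ac_simps)
    from DERIV_divide[OF DERIV_const[of 1] this] show ?thesis by simp
  qed
  moreover have "- (real m * wt z ^ j * (2 * z)) / (wt z ^ m * wt z ^ m) = - 2 * real m * z / wt z ^ (m + 1)"
    unfolding Suc by (simp add: field_simps)
  ultimately show ?thesis by simp
qed simp

lemma inverse_wt_integrable: "0 < N \<Longrightarrow> integrable lborel (\<lambda>z. 1 / wt z ^ N)"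
  by (rule integrable_wt_bound[where C = 1]) (use wt_div_pow_le[of 0 N] in auto)

lemma ker_mass_pos:
  assumes N: "0 < N"
  shows "0 < ker_mass N"
proof -
  have "(\<integral>z. indicator {0..1::real} z * (1 / 2 ^ N) \<partial>lborel) \<le> ker_mass N"
    unfolding ker_mass_def
  proof (rule integral_mono[OF _ inverse_wt_integrable[OF N]])
    show "integrable lborel (\<lambda>z::real. indicator {0..1} z * (1 / 2 ^ N :: real))" by simp
    fix z :: real
    show "indicator {0..1} z * (1 / 2 ^ N) \<le> 1 / wt z ^ N"
    proof (cases "z \<in> {0..1}")
      case True
      then have "z\<^sup>2 \<le> 1" by (simp add: power_le_one)
      then have "wt z ^ N \<le> 2 ^ N" by (intro power_mono) (auto simp: wt_def)
      then show ?thesis using True by (simp add: frac_le)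
    qed simp
  qed
  moreover have "(\<integral>z. indicator {0..1::real} z * (1 / 2 ^ N) \<partial>lborel) = (1 / 2 ^ N :: real)" by simp
  ultimately show ?thesis by (smt (verit) zero_less_divide_1_iff zero_less_power)
qed

lemma smooth_kernel_ker:
  assumes N: "0 < N"
  shows "smooth_kernel N (ker N n) (ker1 N n) (ker2 N n) (ker_const N n)"
proof -
  define r c where "r = real (Suc n)" and "c = ker_mass N"
  have r: "1 \<le> r" and c: "0 < c" using ker_mass_pos[OF N] by (auto simp: r_def c_def)
  note defs = ker_def[abs_def] ker1_def[abs_def] ker2_def[abs_def] r_def[symmetric] c_def[symmetric]
  have kN: "ker N n z = (r / c) * (1 / wt (r * z) ^ N)" for z unfolding defs by (rule refl)
  define L1 L2 L3 L4 where "L1 = r / c" and "L2 = c * r ^ (2 * N)" and "L3 = 2 * real N * r"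
    and "L4 = r ^ 2 * (2 * real N + 4 * real N * real (N + 1))"
  have L: "ker_const N n = L1 + L2 + L3 + L4"
    by (simp add: ker_const_def L1_def L2_def L3_def L4_def r_def c_def)
  have Lp: "0 \<le> L1" "0 < L2" "0 \<le> L3" "0 \<le> L4"
    using r c by (auto simp: L1_def L2_def L3_def L4_def intro!: mult_pos_pos)
  have k_pos: "0 < ker N n z" for z using r c by (simp add: kN)
  have lin: "((\<lambda>z. r * z) has_real_derivative r) (at z)" for z by (auto intro!: derivative_eq_intros)
  show ?thesis
  proof
    fix z
    let ?w = "wt (r * z)"
    have "((\<lambda>z. (r / c) * (1 / wt (r * z) ^ N)) has_real_derivative
        (r / c) * ((- 2 * real N * (r * z) / ?w ^ (N + 1)) * r)) (at z)"
      by (rule DERIV_cmult[OF DERIV_chain2[OF inverse_wt_pow_deriv lin]])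
    then show "(ker N n has_real_derivative ker1 N n z) (at z)"
      unfolding defs by (simp add: power2_eq_square ac_simps)
    have "((\<lambda>z. (r ^ 2 / c) * ((- 2 * real N * (r * z)) * (1 / wt (r * z) ^ (N + 1)))) has_real_derivative
        (r ^ 2 / c) * ((- 2 * real N * (r * z)) * ((- 2 * real (N + 1) * (r * z) / ?w ^ (N + 1 + 1)) * r)
          + (- 2 * real N * r) * (1 / ?w ^ (N + 1)))) (at z)"
      by (rule DERIV_cmult[OF DERIV_mult'[OF DERIV_cmult[OF lin] DERIV_chain2[OF inverse_wt_pow_deriv lin]]])
    moreover have "(r ^ 2 / c) * ((- 2 * real N * (r * z)) * ((- 2 * real (N + 1) * (r * z) / ?w ^ (N + 1 + 1)) * r)
          + (- 2 * real N * r) * (1 / ?w ^ (N + 1))) = ker2 N n z"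
      unfolding defs by (simp add: power2_eq_square power3_eq_cube algebra_simps)
    ultimately show "(ker1 N n has_real_derivative ker2 N n z) (at z)"
      unfolding ker1_def[abs_def] r_def[symmetric] c_def[symmetric] by simp
    have "1 / ?w ^ N \<le> 1 / wt z ^ N"
    proof (rule divide_left_mono)
      have "1 * z\<^sup>2 \<le> r\<^sup>2 * z\<^sup>2" using r by (intro mult_right_mono) auto
      then show "wt z ^ N \<le> ?w ^ N" by (intro power_mono) (auto simp: wt_def power_mult_distrib)
    qed auto
    then have "L1 * (1 / ?w ^ N) \<le> L1 * (1 / wt z ^ N)" using Lp by (intro mult_left_mono) auto
    also have "\<dots> \<le> ker_const N n * (1 / wt z ^ N)" unfolding L using Lp by (intro mult_right_mono) auto
    finally show "ker N n z \<le> ker_const N n / wt z ^ N" by (simp add: kN L1_def)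
    show "1 / (ker_const N n * wt z ^ N) \<le> ker N n z"
    proof -
      have "wt (r * z) \<le> r\<^sup>2 * wt z" using r by (simp add: wt_def power_mult_distrib algebra_simps)
      then have "?w ^ N \<le> (r\<^sup>2 * wt z) ^ N" by (intro power_mono) auto
      then have w: "?w ^ N \<le> r ^ (2 * N) * wt z ^ N" by (simp add: power_mult_distrib power_mult)
      have "1 / (ker_const N n * wt z ^ N) \<le> 1 / (L2 * wt z ^ N)"
        unfolding L using Lp by (intro divide_left_mono mult_right_mono mult_pos_pos) auto
      also have "\<dots> = (1 / c) * (1 / (r ^ (2 * N) * wt z ^ N))" by (simp add: L2_def)
      also have "\<dots> \<le> (r / c) * (1 / ?w ^ N)"
        using r c w by (intro mult_mono divide_right_mono divide_left_mono) auto
      finally show ?thesis by (simp only: kN)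
    qed
    have xw: "\<bar>r * z\<bar> \<le> ?w" "(r * z)\<^sup>2 \<le> ?w" using abs_le_wt square_le_wt by auto
    have "\<bar>ker1 N n z\<bar> = L3 * ((r / c) * (1 / ?w ^ N)) * (\<bar>r * z\<bar> / ?w)"
      unfolding defs using r c by (simp add: L3_def abs_mult abs_divide power2_eq_square ac_simps)
    also have "\<dots> \<le> L3 * ((r / c) * (1 / ?w ^ N)) * 1"
      using xw(1) Lp r c by (intro mult_left_mono) auto
    also have "\<dots> \<le> ker_const N n * ((r / c) * (1 / ?w ^ N))"
      unfolding L mult_1_right using Lp r c by (intro mult_right_mono) auto
    finally show "\<bar>ker1 N n z\<bar> \<le> ker_const N n * ker N n z" by (simp only: kN)
    have "ker2 N n z = r\<^sup>2 * ((r / c) * (1 / ?w ^ N)) * (- 2 * real N * (1 / ?w)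
        + 4 * real N * real (N + 1) * ((r * z)\<^sup>2 / ?w) * (1 / ?w))"
      unfolding defs using c by (simp add: power2_eq_square power3_eq_cube field_simps)
    also have "\<bar>\<dots>\<bar> = r\<^sup>2 * ((r / c) * (1 / ?w ^ N)) * \<bar>- 2 * real N * (1 / ?w)
        + 4 * real N * real (N + 1) * ((r * z)\<^sup>2 / ?w) * (1 / ?w)\<bar>"
      using r c by (simp add: abs_mult)
    also have "\<dots> \<le> r\<^sup>2 * ((r / c) * (1 / ?w ^ N)) * (2 * real N + 4 * real N * real (N + 1))"
    proof (rule mult_left_mono)
      define A B where "A = real N * (1 / ?w)" and "B = real N * real (N + 1) * ((r * z)\<^sup>2 / ?w) * (1 / ?w)"
      have 1: "1 / ?w \<le> 1" by simp
      have "A \<le> real N * 1" unfolding A_def using 1 by (intro mult_left_mono) auto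
      moreover have "B \<le> real N * real (N + 1) * 1 * 1" unfolding B_def
        using 1 xw(2) by (intro mult_mono) auto
      moreover have "0 \<le> A" "0 \<le> B" by (auto simp: A_def B_def)
      ultimately have le: "\<bar>- 2 * A + 4 * B\<bar> \<le> 2 * real N + 4 * real N * real (N + 1)" by simp
      have "- 2 * real N * (1 / ?w) + 4 * real N * real (N + 1) * ((r * z)\<^sup>2 / ?w) * (1 / ?w) = - 2 * A + 4 * B"
        unfolding A_def B_def by (simp only: mult.assoc)
      then show "\<bar>- 2 * real N * (1 / ?w) + 4 * real N * real (N + 1) * ((r * z)\<^sup>2 / ?w) * (1 / ?w)\<bar>
          \<le> 2 * real N + 4 * real N * real (N + 1)" using le by simp
    qed (use r c in simp)
    also have "\<dots> = L4 * ((r / c) * (1 / ?w ^ N))" by (simp add: L4_def)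
    also have "\<dots> \<le> ker_const N n * ((r / c) * (1 / ?w ^ N))"
      unfolding L using Lp r c by (intro mult_right_mono) auto
    finally show "\<bar>ker2 N n z\<bar> \<le> ker_const N n * ker N n z" by (simp only: kN)
    show "ker N n (- z) = ker N n z" by (simp add: ker_def)
  next
    show "continuous_on UNIV (ker2 N n)" unfolding defs by (intro continuous_intros) auto
    have "(\<integral>z. ker N n z \<partial>lborel) = (1 / r) * (\<integral>z. ker N n (0 + (1 / r) * z) \<partial>lborel)"
      using lborel_integral_real_affine[of "1 / r" "ker N n" 0] r by simp
    also have "\<dots> = (1 / r) * (\<integral>z. (r / c) * (1 / wt z ^ N) \<partial>lborel)" using r by (simp add: kN)
    also have "\<dots> = 1"
      using r c unfolding integral_mult_right_zero by (simp add: c_def ker_mass_def[symmetric])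
    finally show "(\<integral>z. ker N n z \<partial>lborel) = 1" .
  qed (use k_pos in auto)
qed

text \<open>Substituting \<open>z / r\<close> with \<open>r = Suc n\<close> and using
  \<open>wt (z / r) \<le> wt z\<close> gives a bound independent of \<open>n\<close>; an extra
  \<open>z\<^sup>2\<close> yields the factor \<open>1 / r\<^sup>2\<close>. This gain is the only
  place where the scale of the kernel makes an error small.\<close>

lemma ker_moments:
  assumes N: "a + 2 \<le> N"
  defines "M0 \<equiv> (\<integral>z. wt z ^ (a + 1) / wt z ^ N \<partial>lborel) / ker_mass N"
  shows "0 \<le> M0" "(\<integral>z. wt z ^ a * ker N n z \<partial>lborel) \<le> M0"
    "(\<integral>z. z\<^sup>2 * wt z ^ a * ker N n z \<partial>lborel) \<le> M0 / (real (Suc n))\<^sup>2"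
proof -
  define r c where "r = real (Suc n)" and "c = ker_mass N"
  have r: "1 \<le> r" and c: "0 < c" using ker_mass_pos[of N] N by (auto simp: r_def c_def)
  have kN: "ker N n z = (r / c) * (1 / wt (r * z) ^ N)" for z unfolding ker_def r_def c_def by (rule refl)
  have int: "integrable lborel (\<lambda>z. wt z ^ (a + 1) / wt z ^ N)"
    by (rule integrable_wt_bound[where C = 1]) (use wt_div_pow_le[of "a + 1" N] N in auto)
  have wr: "wt (z / r) \<le> wt z" for z
  proof -
    have "z\<^sup>2 / r\<^sup>2 \<le> z\<^sup>2 / 1" using r by (intro divide_left_mono) auto
    then show ?thesis by (simp add: wt_def power_divide)
  qed
  show "0 \<le> M0" unfolding M0_def c_def[symmetric] using c
    by (intro divide_nonneg_nonneg Bochner_Integration.integral_nonneg) auto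
  have sub: "(\<integral>z. f z * ker N n z \<partial>lborel) = (1 / c) * (\<integral>z. f (z / r) * (1 / wt z ^ N) \<partial>lborel)" for f
  proof -
    have "(\<integral>z. f z * ker N n z \<partial>lborel) = (1 / r) * (\<integral>z. f (0 + (1 / r) * z) * ker N n (0 + (1 / r) * z) \<partial>lborel)"
      using lborel_integral_real_affine[of "1 / r" "\<lambda>z. f z * ker N n z" 0] r by simp
    also have "\<dots> = (1 / r) * (\<integral>z. (r / c) * (f (z / r) * (1 / wt z ^ N)) \<partial>lborel)"
      using r by (simp add: kN ac_simps)
    also have "\<dots> = (1 / c) * (\<integral>z. f (z / r) * (1 / wt z ^ N) \<partial>lborel)"
      unfolding integral_mult_right_zero using r by simp
    finally show ?thesis .
  qed
  have le: "(1 / c) * (\<integral>z. f z \<partial>lborel) \<le> C * M0"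
    if f: "f \<in> borel_measurable borel" "\<And>z. \<bar>f z\<bar> \<le> C * (wt z ^ (a + 1) / wt z ^ N)" for f C
  proof -
    have "(\<integral>z. f z \<partial>lborel) \<le> (\<integral>z. C * (wt z ^ (a + 1) / wt z ^ N) \<partial>lborel)"
    proof (rule integral_mono)
      show i: "integrable lborel (\<lambda>z. C * (wt z ^ (a + 1) / wt z ^ N))" by (rule integrable_mult_right[OF int])
      show "integrable lborel f"
      proof (rule Bochner_Integration.integrable_bound[OF i])
        show "AE z in lborel. norm (f z) \<le> norm (C * (wt z ^ (a + 1) / wt z ^ N))"
        proof (rule AE_I2)
          fix z
          show "norm (f z) \<le> norm (C * (wt z ^ (a + 1) / wt z ^ N))"
            using f(2)[of z] unfolding real_norm_def by (rule order_trans[OF _ abs_ge_self])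
        qed
      qed (use f in simp)
      show "f z \<le> C * (wt z ^ (a + 1) / wt z ^ N)" for z using f(2)[of z] by linarith
    qed
    then have "(1 / c) * (\<integral>z. f z \<partial>lborel) \<le> (1 / c) * (\<integral>z. C * (wt z ^ (a + 1) / wt z ^ N) \<partial>lborel)"
      using c by (intro mult_left_mono) auto
    also have "\<dots> = C * M0" unfolding integral_mult_right_zero M0_def c_def[symmetric] by simp
    finally show ?thesis .
  qed
  have b0: "wt (z / r) ^ a \<le> wt z ^ a" for z using wr by (intro power_mono) auto
  have "(1 / c) * (\<integral>z. wt (z / r) ^ a * (1 / wt z ^ N) \<partial>lborel) \<le> 1 * M0"
  proof (rule le)
    fix z
    have "wt (z / r) ^ a * (1 / wt z ^ N) \<le> wt z ^ (a + 1) * (1 / wt z ^ N)"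
      by (intro mult_right_mono order_trans[OF b0 wt_pow_mono]) auto
    then show "\<bar>wt (z / r) ^ a * (1 / wt z ^ N)\<bar> \<le> 1 * (wt z ^ (a + 1) / wt z ^ N)" by (simp add: abs_mult)
  qed measurable
  then show "(\<integral>z. wt z ^ a * ker N n z \<partial>lborel) \<le> M0" using sub[of "\<lambda>z. wt z ^ a"] by simp
  have "(1 / c) * (\<integral>z. (z / r)\<^sup>2 * wt (z / r) ^ a * (1 / wt z ^ N) \<partial>lborel) \<le> (1 / r\<^sup>2) * M0"
  proof (rule le)
    fix z
    have "(z / r)\<^sup>2 * wt (z / r) ^ a * (1 / wt z ^ N) = (1 / r\<^sup>2) * (z\<^sup>2 * wt (z / r) ^ a * (1 / wt z ^ N))"
      by (simp add: power_divide)
    also have "\<dots> \<le> (1 / r\<^sup>2) * (wt z * wt z ^ a * (1 / wt z ^ N))"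
      using b0[of z] square_le_wt[of z] by (intro mult_left_mono mult_right_mono mult_mono) auto
    finally show "\<bar>(z / r)\<^sup>2 * wt (z / r) ^ a * (1 / wt z ^ N)\<bar> \<le> (1 / r\<^sup>2) * (wt z ^ (a + 1) / wt z ^ N)"
      by (simp add: abs_mult)
  qed measurable
  then show "(\<integral>z. z\<^sup>2 * wt z ^ a * ker N n z \<partial>lborel) \<le> M0 / (real (Suc n))\<^sup>2"
    using sub[of "\<lambda>z. z\<^sup>2 * wt z ^ a"] by (simp add: r_def)
qed

text \<open>Points closer than \<open>z1\<close> are treated by uniform continuity on a
  neighbourhood of the support, all others by the quadratic term with coefficient
  \<open>2 * B / z1\<^sup>2\<close>. As \<open>z1 \<le> 1\<close>, close points lie either both in
  that neighbourhood or both off the support.\<close>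

lemma compact_support_modulus:
  fixes f :: "real \<Rightarrow> real"
  assumes f: "continuous_on UNIV f" "\<And>x. R < \<bar>x\<bar> \<Longrightarrow> f x = 0" and e: "0 < e"
  obtains C where "0 \<le> C" "\<And>x y. \<bar>f x - f y\<bar> \<le> e + C * (x - y)\<^sup>2"
proof -
  obtain B where B: "\<And>x. \<bar>f x\<bar> \<le> B" using continuous_compact_support_bounded[OF f] by auto
  have B0: "0 \<le> B" using order_trans[OF abs_ge_zero B] .
  have "uniformly_continuous_on {- (R + 1)..R + 1} f"
    by (intro compact_uniformly_continuous continuous_on_subset[OF f(1)]) auto
  then obtain z0 where z0: "0 < z0" "\<And>x y. x \<in> {- (R + 1)..R + 1} \<Longrightarrow> y \<in> {- (R + 1)..R + 1} \<Longrightarrow>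
      dist x y < z0 \<Longrightarrow> dist (f x) (f y) < e"
    unfolding uniformly_continuous_on_def using e by metis
  define z1 where "z1 = min z0 1"
  have z1: "0 < z1" "z1 \<le> 1" "z1 \<le> z0" using z0 by (auto simp: z1_def)
  show thesis
  proof (rule that[of "2 * B / z1\<^sup>2"])
    show C: "0 \<le> 2 * B / z1\<^sup>2" using B0 by simp
    fix x y
    have C2: "0 \<le> 2 * B / z1\<^sup>2 * (x - y)\<^sup>2" by (rule mult_nonneg_nonneg[OF C]) simp
    show "\<bar>f x - f y\<bar> \<le> e + 2 * B / z1\<^sup>2 * (x - y)\<^sup>2"
    proof (cases "\<bar>x - y\<bar> < z1")
      case False
      then have "z1\<^sup>2 \<le> (x - y)\<^sup>2" using z1 power_mono[of z1 "\<bar>x - y\<bar>" 2] by simp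
      then have "2 * B / z1\<^sup>2 * z1\<^sup>2 \<le> 2 * B / z1\<^sup>2 * (x - y)\<^sup>2" using C by (rule mult_left_mono)
      then have "2 * B \<le> 2 * B / z1\<^sup>2 * (x - y)\<^sup>2" using z1 by simp
      then show ?thesis using B[of x] B[of y] e by linarith
    next
      case True
      show ?thesis
      proof (cases "x \<in> {- (R + 1)..R + 1} \<and> y \<in> {- (R + 1)..R + 1}")
        case T: True
        then have "dist (f x) (f y) < e" using True z1 by (intro z0(2)) (auto simp: dist_real_def)
        then show ?thesis using C2 by (simp add: dist_real_def)
      next
        case False
        then have "R < \<bar>x\<bar>" "R < \<bar>y\<bar>" using True z1 by auto
        then show ?thesis using f(2) C2 e by simp
      qed
    qed
  qed
qed

section \<open>Estimates uniform in the mollification\<close>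

context weak_fp_cont begin

definition diss :: "nat \<Rightarrow> real \<Rightarrow> real" where
  "diss n = fp_kernel.Diss s b h \<mu> (ker (2 * p + 3) n) (ker1 (2 * p + 3) n)"

text \<open>The quantity \<open>md\<close> of \<open>fp_kernel\<close> does not involve the kernel;
  this copy makes its independence of \<open>n\<close> visible.\<close>

definition mdot :: "real \<Rightarrow> real" where "mdot t = h t - (\<integral>x. b x \<partial>\<mu> t)"

lemma fp_kernel_ker: "fp_kernel s Cb W b h \<mu> p Q (2 * p + 3)
    (ker (2 * p + 3) n) (ker1 (2 * p + 3) n) (ker2 (2 * p + 3) n) (ker_const (2 * p + 3) n)"
  by (intro fp_kernel.intro smooth_kernel_ker fp_kernel_axioms.intro weak_fp_cont_axioms) simp_all

lemma diss_props:
  "continuous_on {0..T} (diss n)" "0 \<le> diss n t" "0 \<le> t \<Longrightarrow> (mdot t)\<^sup>2 \<le> diss n t"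
proof -
  interpret K: fp_kernel s Cb W b h \<mu> p Q "2 * p + 3" "ker (2 * p + 3) n" "ker1 (2 * p + 3) n"
    "ker2 (2 * p + 3) n" "ker_const (2 * p + 3) n" by (rule fp_kernel_ker)
  show "continuous_on {0..T} (diss n)" "0 \<le> diss n t"
    unfolding diss_def by (rule K.Diss_props)+
  show "0 \<le> t \<Longrightarrow> (mdot t)\<^sup>2 \<le> diss n t"
    using K.Diss_props(5)[of t] by (simp add: diss_def mdot_def K.md_def)
qed

lemma mdot_continuous: "continuous_on {0..T} mdot"
  unfolding mdot_def[abs_def] using Q_ge
  by (intro continuous_intros h_cont continuous_integral[OF b_cont b_growth]) auto

lemma mean_derivative:
  assumes t: "t \<in> {0..T}"
  shows "((\<lambda>t. \<integral>x. x \<partial>\<mu> t) has_real_derivative mdot t) (at t within {0..T})"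
proof -
  interpret prob_space "\<mu> t" using prob t by simp
  have d: "((\<lambda>x::real. x) has_real_derivative 1) (at x)" "((\<lambda>x::real. 1) has_real_derivative 0) (at x)" for x :: real
    by (auto intro!: derivative_eq_intros)
  have bd: "\<bar>x\<bar> \<le> 1 * wt x" "\<bar>1 :: real\<bar> \<le> 1 * wt x" "\<bar>0 :: real\<bar> \<le> 1 * wt x" for x
    using abs_le_wt by auto
  have c: "continuous_on UNIV (\<lambda>_::real. 0 :: real)" by simp
  have t0: "0 \<le> t" using t by simp
  have "(\<integral>x. gen t (\<lambda>_. 1) (\<lambda>_. 0) x \<partial>\<mu> t) = mdot t"
    using gen_integral(1)[OF d c bd(2,3) t0] by (simp add: mdot_def prob_space)
  then show ?thesis using weak_derivative[OF d c bd t] by simp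
qed

text \<open>The constant \<open>C\<close> is chosen before \<open>T\<close>: it collects bounds for
  the initial energy and for the negative part of the final one. Only the commutator depends on the
  horizon, through \<open>B\<close>, and it is brought below \<open>e\<close> by taking first
  \<open>\<delta>\<close> small and then \<open>n\<close> large. The factor \<open>K\<close> stays
  free so that the second moment can outweigh boundary terms later.\<close>

lemma energy_estimate:
  assumes ent: "finite_entropy (\<mu> 0)" and K: "0 \<le> K"
  obtains C where "\<And>T e. 0 \<le> T \<Longrightarrow> 0 < e \<Longrightarrow> \<forall>\<^sub>F n in sequentially.
    K * (\<integral>x. x\<^sup>2 \<partial>\<mu> T) + integral {0..T} (diss n) / 2 \<le> C + integral {0..T} (\<lambda>t. h t * mdot t) + e"
proof -
  let ?N = "2 * p + 3"
  obtain f0 where f0: "is_density f0 (\<mu> 0)" "integrable lborel (\<lambda>x. f0 x * ln (f0 x))"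
    using ent by (auto simp: finite_entropy_def)
  obtain CW where CW: "0 \<le> CW" "\<And>x. \<bar>W x\<bar> \<le> CW * wt x ^ (p + 1)" using W_growth by blast
  obtain Cl where Cl: "\<And>x. (K + 2 * s) * x\<^sup>2 \<le> W x + Cl" using W_coercive by blast
  define M0 where "M0 = (\<integral>z. wt z ^ (2 * p + 1 + 1) / wt z ^ ?N \<partial>lborel) / ker_mass ?N"
  have "2 * p + 1 + 2 \<le> ?N" by simp
  note M0 = ker_moments[OF this, folded M0_def]
  define C where "C = s * (\<integral>x. f0 x * ln (f0 x) \<partial>lborel) + CW * 2 ^ (p + 1) * (\<integral>x. wt x ^ (p + 1) \<partial>\<mu> 0) * M0
    + (Cl + s * (\<integral>x. 1 / wt x \<partial>lborel))"
  show thesis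
  proof (rule that[of C])
    fix T e :: real assume T: "0 \<le> T" and e: "0 < e"
    obtain B where B: "0 < B" "\<And>t. 0 \<le> t \<Longrightarrow> t \<le> T \<Longrightarrow> (\<integral>x. wt x ^ (2 * p + 1) \<partial>\<mu> t) \<le> B"
      using moments_local_le[of "2 * p + 1" T] Q_ge by auto
    define X where "X = T * B * M0"
    have X: "0 \<le> X" using T B M0 by (simp add: X_def)
    \<comment> \<open>Adding one keeps the denominator positive, as \<open>X\<close> may
      vanish.\<close>
    define \<delta> where "\<delta> = e / (X + 1)"
    have \<delta>: "0 < \<delta>" using e X by (simp add: \<delta>_def)
    have "e * X \<le> e * (X + 1)" using e by simp
    then have X\<delta>: "X * \<delta> \<le> e" using X by (simp add: \<delta>_def divide_le_eq mult.commute)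
    obtain C1 where C1: "0 \<le> C1"
      "\<And>x y. (b x - b y)\<^sup>2 \<le> (\<delta> + C1 * (x - y)\<^sup>2) * wt y ^ (2 * p + 1) * wt (x - y) ^ (2 * p + 1)"
      using b_modulus[OF \<delta>] by blast
    have "(\<lambda>n. X * C1 / (real (Suc n))\<^sup>2) \<longlonglongrightarrow> 0" by real_asymp
    then have "\<forall>\<^sub>F n in sequentially. X * C1 / (real (Suc n))\<^sup>2 < e" using e by (rule order_tendstoD)
    then show "\<forall>\<^sub>F n in sequentially. K * (\<integral>x. x\<^sup>2 \<partial>\<mu> T) + integral {0..T} (diss n) / 2
        \<le> C + integral {0..T} (\<lambda>t. h t * mdot t) + e"
    proof eventually_elim
      case (elim n)
      interpret K: fp_kernel s Cb W b h \<mu> p Q ?N "ker ?N n" "ker1 ?N n" "ker2 ?N n" "ker_const ?N n"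
        by (rule fp_kernel_ker)
      have md: "K.md = mdot" by (rule ext) (simp add: K.md_def mdot_def)
      have D: "K.Diss = diss n" by (simp add: diss_def)
      have "T * (B * (\<delta> * M0 + C1 * (M0 / (real (Suc n))\<^sup>2)) / 2) = (X * \<delta> + X * C1 / (real (Suc n))\<^sup>2) / 2"
        by (simp add: X_def algebra_simps)
      also have "\<dots> \<le> e" using X\<delta> elim by simp
      finally have err: "T * (B * (\<delta> * M0 + C1 * (M0 / (real (Suc n))\<^sup>2)) / 2) \<le> e" .
      have 1: "K.energy T - K.energy 0 \<le> integral {0..T} (\<lambda>t. h t * mdot t) - integral {0..T} (diss n) / 2
          + T * (B * (\<delta> * M0 + C1 * (M0 / (real (Suc n))\<^sup>2)) / 2)"
        using K.energy_inequality[OF T less_imp_le[OF \<delta>] C1 B(2) M0(2,3)] unfolding md D .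
      have 2: "K * (\<integral>x. x\<^sup>2 \<partial>\<mu> T) - (Cl + s * (\<integral>x. 1 / wt x \<partial>lborel)) \<le> K.energy T"
        by (rule K.energy_lower[OF T K Cl])
      have 3: "K.energy 0 \<le> s * (\<integral>x. f0 x * ln (f0 x) \<partial>lborel) + CW * 2 ^ (p + 1) * (\<integral>x. wt x ^ (p + 1) \<partial>\<mu> 0) * M0"
        by (rule K.energy_0_upper[OF f0 CW M0(2)])
      show ?case using 1 2 3 err unfolding C_def by linarith
    qed
  qed
qed

text \<open>A single \<open>n\<close> with small mollification error and
  \<open>diss n t \<le> d\<close> suffices for each tolerance, so it is enough that the bound holds
  for infinitely many \<open>n\<close>.\<close>

lemma flux_duality_limit:
  assumes t: "0 \<le> t"
    and \<phi>: "\<And>x. (\<phi> has_real_derivative \<phi>1 x) (at x)" "continuous_on UNIV \<phi>1"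
      "\<And>x. R < \<bar>x\<bar> \<Longrightarrow> \<phi> x = 0" "\<And>x. R < \<bar>x\<bar> \<Longrightarrow> \<phi>1 x = 0" "\<And>x. \<bar>\<phi> x\<bar> \<le> A"
    and d: "\<exists>\<^sub>F n in sequentially. diss n t \<le> d"
  shows "\<bar>\<integral>x. s * \<phi>1 x - (b x - h t) * \<phi> x \<partial>\<mu> t\<bar> \<le> A * sqrt d"
proof (rule field_le_epsilon)
  let ?N = "2 * p + 3"
  fix e' :: real assume e': "0 < e'"
  define K where "K = s + (\<integral>x. \<bar>b x - h t\<bar> \<partial>\<mu> t)"
  have K: "0 < K" unfolding K_def using s_pos by (intro add_pos_nonneg Bochner_Integration.integral_nonneg) auto
  \<comment> \<open>Two errors of size \<open>e\<close>, one from the modulus and one from the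
    second moment of the kernel, are multiplied by \<open>K\<close>.\<close>
  define e where "e = e' / (2 * K)"
  have e: "0 < e" using e' K by (simp add: e_def)
  define M0 where "M0 = (\<integral>z. wt z ^ (2 * p + 1 + 1) / wt z ^ ?N \<partial>lborel) / ker_mass ?N"
  have "2 * p + 1 + 2 \<le> ?N" by simp
  note M0 = ker_moments[OF this, folded M0_def]
  have c\<phi>: "continuous_on UNIV \<phi>" using \<phi>(1) by (meson DERIV_isCont continuous_at_imp_continuous_on)
  obtain C1 where C1: "0 \<le> C1" "\<And>x y. \<bar>\<phi> x - \<phi> y\<bar> \<le> e + C1 * (x - y)\<^sup>2"
    using compact_support_modulus[OF c\<phi> \<phi>(3) e] by auto
  obtain C2 where C2: "0 \<le> C2" "\<And>x y. \<bar>\<phi>1 x - \<phi>1 y\<bar> \<le> e + C2 * (x - y)\<^sup>2"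
    using compact_support_modulus[OF \<phi>(2) \<phi>(4) e] by auto
  obtain A1 where A1: "\<And>x. \<bar>\<phi>1 x\<bar> \<le> A1" using continuous_compact_support_bounded[OF \<phi>(2,4)] by auto
  define C where "C = C1 + C2"
  have C: "0 \<le> C" "\<And>x y. \<bar>\<phi> x - \<phi> y\<bar> \<le> e + C * (x - y)\<^sup>2" "\<And>x y. \<bar>\<phi>1 x - \<phi>1 y\<bar> \<le> e + C * (x - y)\<^sup>2"
  proof -
    show "0 \<le> C" using C1 C2 by (simp add: C_def)
    fix x y :: real
    have "C1 * (x - y)\<^sup>2 \<le> C * (x - y)\<^sup>2" "C2 * (x - y)\<^sup>2 \<le> C * (x - y)\<^sup>2"
      using C1 C2 by (auto simp: C_def intro!: mult_right_mono)
    then show "\<bar>\<phi> x - \<phi> y\<bar> \<le> e + C * (x - y)\<^sup>2" "\<bar>\<phi>1 x - \<phi>1 y\<bar> \<le> e + C * (x - y)\<^sup>2"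
      using C1(2)[of x y] C2(2)[of x y] by linarith+
  qed
  have "(\<lambda>n. C * (M0 / (real (Suc n))\<^sup>2)) \<longlonglongrightarrow> 0" by real_asymp
  then have "\<forall>\<^sub>F n in sequentially. C * (M0 / (real (Suc n))\<^sup>2) < e" using e by (rule order_tendstoD)
  with d have "\<exists>\<^sub>F n in sequentially. diss n t \<le> d \<and> C * (M0 / (real (Suc n))\<^sup>2) < e"
    by (rule frequently_eventually_frequently)
  then obtain n where n: "diss n t \<le> d" "C * (M0 / (real (Suc n))\<^sup>2) < e" by (auto dest: frequently_ex)
  interpret K: fp_kernel s Cb W b h \<mu> p Q ?N "ker ?N n" "ker1 ?N n" "ker2 ?N n" "ker_const ?N n"
    by (rule fp_kernel_ker)
  have A: "0 \<le> A" using order_trans[OF abs_ge_zero \<phi>(5)] .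
  have "\<bar>\<integral>x. s * \<phi>1 x - (b x - h t) * \<phi> x \<partial>\<mu> t\<bar>
      \<le> A * sqrt (K.Diss t) + (s + (\<integral>x. \<bar>b x - h t\<bar> \<partial>\<mu> t)) * (e + C * (M0 / (real (Suc n))\<^sup>2))"
    by (rule K.flux_duality[OF t \<phi>(1,2) _ \<phi>(5) A1 C(2,3) less_imp_le[OF e] C(1) M0(3)]) (erule \<phi>(3))
  also have "\<dots> \<le> A * sqrt d + K * (e + e)"
    unfolding K_def[symmetric] using n A K by (intro add_mono mult_left_mono) (auto simp: diss_def)
  also have "K * (e + e) = e'" using K by (simp add: e_def)
  finally show "\<bar>\<integral>x. s * \<phi>1 x - (b x - h t) * \<phi> x \<partial>\<mu> t\<bar> \<le> A * sqrt d + e'" .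
qed

section \<open>Time averages of moments\<close>

lemma mean_square_le:
  assumes t: "0 \<le> t"
  shows "(\<integral>x. x \<partial>\<mu> t)\<^sup>2 \<le> (\<integral>x. x\<^sup>2 \<partial>\<mu> t)"
proof -
  interpret prob_space "\<mu> t" using prob t by simp
  have i: "integrable (\<mu> t) (\<lambda>x. x\<^sup>2)" "integrable (\<mu> t) (\<lambda>x. x)"
    by (rule integrable_growth[OF t, of _ 1 1], use abs_le_wt square_le_wt Q_ge in auto)+
  have "0 \<le> variance (\<lambda>x. x)" by simp
  also have "\<dots> = (\<integral>x. x\<^sup>2 \<partial>\<mu> t) - (\<integral>x. x \<partial>\<mu> t)\<^sup>2" using i by (intro variance_eq)
  finally show ?thesis by simp
qed

lemma second_moment_continuous: "continuous_on {0..T} (\<lambda>t. \<integral>x. x\<^sup>2 \<partial>\<mu> t)"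
  by (rule continuous_integral[where C = 1 and k = 1]) (use square_le_wt Q_ge in \<open>auto intro!: continuous_intros\<close>)

text \<open>The generator applied to \<open>x\<^sup>2\<close> is at most
  \<open>C1 - x\<^sup>2\<close>, so the second moment is bounded on average in time, with a constant
  governed by the bound of the mean field.\<close>

lemma second_moment_integral:
  assumes H: "\<And>t. 0 \<le> t \<Longrightarrow> \<bar>h t\<bar> \<le> H"
  obtains C where "0 \<le> C" "\<And>T. 0 \<le> T \<Longrightarrow> integral {0..T} (\<lambda>t. \<integral>x. x\<^sup>2 \<partial>\<mu> t) \<le> C * (1 + T)"
proof -
  have H0: "0 \<le> H" using H[of 0] by auto
  obtain C where C: "0 \<le> C" "\<And>x. (H + 1) * wt x \<le> x * b x + C"
    using coercive[of "H + 1"] by metis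
  define C1 where "C1 = 2 * s + 2 * C"
  have C1: "0 \<le> C1" using s_pos C by (simp add: C1_def)
  let ?m = "\<lambda>t. \<integral>x. x\<^sup>2 \<partial>\<mu> t"
  have d: "((\<lambda>x::real. x\<^sup>2) has_real_derivative 2 * x) (at x)" "((\<lambda>x::real. 2 * x) has_real_derivative 2) (at x)" for x :: real
    by (auto intro!: derivative_eq_intros)
  have bd: "\<bar>x\<^sup>2\<bar> \<le> 2 * wt x" "\<bar>2 * x\<bar> \<le> 2 * wt x" "\<bar>2 :: real\<bar> \<le> 2 * wt x" for x
    using abs_le_wt[of x] square_le_wt[of x] wt_ge_1[of x] by (auto simp: abs_mult)
  have c: "continuous_on UNIV (\<lambda>_::real. 2 :: real)" by simp
  have genle: "(\<integral>x. gen t (\<lambda>x. 2 * x) (\<lambda>_. 2) x \<partial>\<mu> t) \<le> C1 - ?m t" if t: "0 \<le> t" for t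
  proof -
    interpret prob_space "\<mu> t" using prob t by simp
    have i2: "integrable (\<mu> t) (\<lambda>x. x\<^sup>2)"
      by (rule integrable_growth[OF t, of _ 2 1]) (use bd(1) Q_ge in auto)
    have gr: "\<bar>(b x - h t) * (2 * x)\<bar> \<le> ((Cb + H) * 2) * wt x ^ (p + 1)" for x
    proof -
      have "\<bar>b x - h t\<bar> \<le> Cb * wt x ^ p + H * 1" using b_growth[of x] H[OF t] by linarith
      also have "\<dots> \<le> (Cb + H) * wt x ^ p"
        using H0 mult_left_mono[OF wt_pow_ge_1, of H x p] by (simp add: distrib_right)
      finally have "\<bar>b x - h t\<bar> * \<bar>2 * x\<bar> \<le> ((Cb + H) * wt x ^ p) * (2 * wt x)"
        using bd(2) Cb_nonneg H0 by (intro mult_mono) auto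
      also have "((Cb + H) * wt x ^ p) * (2 * wt x) = ((Cb + H) * 2) * wt x ^ (p + 1)" by simp
      finally show ?thesis by (simp only: abs_mult)
    qed
    have i: "integrable (\<mu> t) (\<lambda>x. (b x - h t) * (2 * x))"
      by (rule integrable_growth[OF t _ gr]) (use Q_ge in auto)
    have "(\<integral>x. gen t (\<lambda>x. 2 * x) (\<lambda>_. 2) x \<partial>\<mu> t) \<le> (\<integral>x. C1 - x\<^sup>2 \<partial>\<mu> t)"
    proof (rule integral_mono)
      show "integrable (\<mu> t) (gen t (\<lambda>x. 2 * x) (\<lambda>_. 2))" unfolding gen_def[abs_def] using i by simp
      show "integrable (\<mu> t) (\<lambda>x. C1 - x\<^sup>2)" using i2 by simp
      fix x
      have "h t * x \<le> H * wt x"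
        using mult_mono[OF H[OF t] abs_le_wt[of x]] H0 by (simp add: abs_mult[symmetric])
      then have "2 * (h t * x) + x\<^sup>2 \<le> 2 * (H * wt x) + wt x" using square_le_wt[of x] by linarith
      then show "gen t (\<lambda>x. 2 * x) (\<lambda>_. 2) x \<le> C1 - x\<^sup>2"
      proof -
        have "gen t (\<lambda>x. 2 * x) (\<lambda>_. 2) x = 2 * s - 2 * (x * b x) + 2 * (h t * x)"
          by (simp add: gen_def algebra_simps)
        moreover have "H * wt x + wt x \<le> x * b x + C" using C(2)[of x] by (simp add: distrib_right)
        ultimately show ?thesis
          using \<open>2 * (h t * x) + x\<^sup>2 \<le> 2 * (H * wt x) + wt x\<close> wt_ge_1[of x] unfolding C1_def by linarith
      qed
    qed
    also have "\<dots> = C1 - ?m t" using i2 by (simp add: prob_space)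
    finally show ?thesis .
  qed
  have m0: "0 \<le> ?m t" for t by simp
  show thesis
  proof (rule that[of "?m 0 + C1"])
    show "0 \<le> ?m 0 + C1" using C1 m0 by simp
    fix T :: real assume T: "0 \<le> T"
    have hi: "((\<lambda>t. \<integral>x. gen t (\<lambda>x. 2 * x) (\<lambda>_. 2) x \<partial>\<mu> t) has_integral (?m T - ?m 0)) {0..T}"
      by (rule fundamental_theorem_of_calculus[OF T])
         (use weak_derivative[OF d c bd] in \<open>simp add: has_real_derivative_iff_has_vector_derivative\<close>)
    have "((\<lambda>t. C1 - ?m t) has_integral (T * C1 - integral {0..T} ?m)) {0..T}"
      using has_integral_const_real[of C1 0 T] T
      by (intro has_integral_diff integrable_integral integrable_continuous_real second_moment_continuous) simp
    from has_integral_le[OF hi this] genle have "?m T - ?m 0 \<le> T * C1 - integral {0..T} ?m" by simp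
    then have "integral {0..T} ?m \<le> ?m 0 + T * C1" using m0[of T] by linarith
    also have "\<dots> \<le> (?m 0 + C1) * (1 + T)" using T m0[of 0] C1 by (simp add: algebra_simps)
    finally show "integral {0..T} ?m \<le> (?m 0 + C1) * (1 + T)" .
  qed
qed

text \<open>Integrability of \<open>P\<close> at a given time is not known beforehand. The
  truncation by \<open>q\<close> has compact support, hence an integral that is continuous in
  time.\<close>

definition PT :: "nat \<Rightarrow> real \<Rightarrow> real" where
  "PT n t = (\<integral>x. (q (real (Suc n)) x)\<^sup>2 * P x \<partial>\<mu> t)"

lemma PT_continuous: "continuous_on {0..T} (PT n)"
proof -
  have c: "continuous_on UNIV (\<lambda>x. (q (real (Suc n)) x)\<^sup>2 * P x)"
    by (intro continuous_intros continuous_P q_props) simp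
  obtain B where "\<And>x. \<bar>(q (real (Suc n)) x)\<^sup>2 * P x\<bar> \<le> B"
    using continuous_compact_support_bounded[OF c, of "real (Suc n)"] q_props(3)[of "real (Suc n)"] by auto
  then have "\<And>x. \<bar>(q (real (Suc n)) x)\<^sup>2 * P x\<bar> \<le> B * wt x ^ 0" by simp
  then show ?thesis unfolding PT_def[abs_def] by (rule continuous_integral[OF c]) (use Q_ge in simp)
qed

lemma PT_nonneg: "0 \<le> PT n t"
  unfolding PT_def by (intro Bochner_Integration.integral_nonneg) simp

lemma PT_integral:
  assumes H: "\<And>t. 0 \<le> t \<Longrightarrow> \<bar>h t\<bar> \<le> H"
  obtains C where "0 \<le> C" "\<And>T n. 0 \<le> T \<Longrightarrow> integral {0..T} (PT n) \<le> C * (1 + T)"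
proof -
  obtain C where C: "0 \<le> C" "\<And>x r. \<bar>h r\<bar> \<le> H \<Longrightarrow> s * g2 x - (b x - h r) * g1 x \<le> C - P x"
    using lyapunov by blast
  define I where "I = (\<integral>x. wt x ^ Q \<partial>\<mu> 0)"
  have I: "0 \<le> I" by (simp add: I_def)
  show thesis
  proof (rule that[of "I + C"])
    show "0 \<le> I + C" using I C by simp
    fix T :: real and n assume T: "0 \<le> T"
    have "integral {0..T} (PT n) \<le> I + C * T"
      unfolding PT_def[abs_def] I_def
      by (rule truncated_moment(2)[OF _ T C(1)])
         (use C(2) H PT_continuous[of T n, unfolded PT_def[abs_def]] in auto)
    also have "\<dots> \<le> (I + C) * (1 + T)" using T I C by (simp add: algebra_simps)
    finally show "integral {0..T} (PT n) \<le> (I + C) * (1 + T)" .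
  qed
qed

text \<open>\<open>PT n t\<close> increases with \<open>n\<close>, so a bound for infinitely many
  \<open>n\<close> is a bound for all of them; Fatou's lemma then removes the truncation.\<close>

lemma P_limit:
  assumes t: "0 \<le> t" and c: "\<exists>\<^sub>F n in sequentially. PT n t \<le> c"
  shows "integrable (\<mu> t) P" "(\<integral>x. P x \<partial>\<mu> t) \<le> c"
proof -
  have int: "integrable (\<mu> t) (\<lambda>x. (q (real (Suc n)) x)\<^sup>2 * P x)" for n
    by (rule integrable_compact_support_mu[OF t, of _ "real (Suc n)"])
       (use q_props in \<open>auto intro!: continuous_intros continuous_P\<close>)
  have mono: "PT n t \<le> PT m t" if "n \<le> m" for n m
    unfolding PT_def
  proof (intro integral_mono int mult_right_mono power_mono)
    fix x
    have "wt x ^ Q / real (Suc m) \<le> wt x ^ Q / real (Suc n)" using that by (intro divide_left_mono) auto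
    then show "q (real (Suc n)) x \<le> q (real (Suc m)) x"
      unfolding q_def by (intro max.mono diff_left_mono order_refl)
  qed (auto simp: q_def)
  have le: "PT n t \<le> c" for n
  proof -
    from c eventually_ge_at_top[of n] have "\<exists>\<^sub>F m in sequentially. PT m t \<le> c \<and> n \<le> m"
      by (rule frequently_eventually_frequently)
    then obtain m where "PT m t \<le> c" "n \<le> m" by (auto dest: frequently_ex)
    then show ?thesis using mono[of n m] by simp
  qed
  have lim: "(\<lambda>n. (q (real (Suc n)) x)\<^sup>2 * P x) \<longlonglongrightarrow> P x" for x
  proof -
    have "(\<lambda>n. 1 - wt x ^ Q / real (Suc n)) \<longlonglongrightarrow> 1" by real_asymp
    then have "(\<lambda>n. (max 0 (1 - wt x ^ Q / real (Suc n)))\<^sup>2 * P x) \<longlonglongrightarrow> (max 0 1)\<^sup>2 * P x"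
      by (intro tendsto_intros)
    then show ?thesis by (simp add: q_def)
  qed
  have "(\<integral>\<^sup>+x. ennreal (P x) \<partial>\<mu> t) = (\<integral>\<^sup>+x. liminf (\<lambda>n. ennreal ((q (real (Suc n)) x)\<^sup>2 * P x)) \<partial>\<mu> t)"
    by (intro nn_integral_cong lim_imp_Liminf[symmetric] tendsto_ennrealI lim) simp
  also have "\<dots> \<le> liminf (\<lambda>n. \<integral>\<^sup>+x. ennreal ((q (real (Suc n)) x)\<^sup>2 * P x) \<partial>\<mu> t)"
    by (rule nn_integral_liminf) (use borel_measurable_integrable[OF int] in measurable)
  also have "\<dots> \<le> ennreal c"
  proof (intro Liminf_le always_eventually allI)
    fix n
    have "(\<integral>\<^sup>+x. ennreal ((q (real (Suc n)) x)\<^sup>2 * P x) \<partial>\<mu> t) = ennreal (PT n t)"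
      unfolding PT_def by (rule nn_integral_eq_integral[OF int]) simp
    then show "(\<integral>\<^sup>+x. ennreal ((q (real (Suc n)) x)\<^sup>2 * P x) \<partial>\<mu> t) \<le> ennreal c"
      using le by (simp add: ennreal_leI)
  qed simp
  finally have fin: "(\<integral>\<^sup>+x. ennreal (P x) \<partial>\<mu> t) \<le> ennreal c" .
  show i: "integrable (\<mu> t) P"
    by (rule integrableI_nonneg)
       (use fin t continuous_P in \<open>auto intro!: cont_measurable_mu intro: le_less_trans\<close>)
  have "ennreal (\<integral>x. P x \<partial>\<mu> t) \<le> ennreal c"
    using fin nn_integral_eq_integral[OF i] by simp
  moreover have "0 \<le> c" using le[of 0] PT_nonneg[of 0 t] by simp
  ultimately show "(\<integral>x. P x \<partial>\<mu> t) \<le> c" by simp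
qed

end

section \<open>Small flux forces convergence to the Gibbs measure\<close>

text \<open>Truncated multiples of the distance to the complement increase to the indicator of an
  open subset of \<open>U\<close>, and outer regularity extends the comparison to Borel sets.
  Estimates tested with continuous functions thus become estimates of measures.\<close>

lemma emeasure_le_of_integral_le:
  fixes M N :: "real measure"
  assumes M: "finite_measure M" "sets M = sets borel" and N: "finite_measure N" "sets N = sets borel"
    and U: "open U" and A: "A \<in> sets borel" "A \<subseteq> U"
    and le: "\<And>g :: real \<Rightarrow> real. continuous_on UNIV g \<Longrightarrow> (\<And>x. 0 \<le> g x) \<Longrightarrow> (\<And>x. g x \<le> 1) \<Longrightarrow> (\<And>x. x \<notin> U \<Longrightarrow> g x = 0) \<Longrightarrow>
      (\<integral>x. g x \<partial>M) \<le> (\<integral>x. g x \<partial>N)"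
  shows "emeasure M A \<le> emeasure N A"
proof -
  interpret M: finite_measure M by fact
  interpret N: finite_measure N by fact
  have open_le: "emeasure M V \<le> emeasure N V" if V: "open V" "V \<subseteq> U" for V
  \<comment> \<open>The distance to the empty complement is zero by convention, so the whole line is
    treated separately.\<close>
  proof (cases "V = UNIV")
    case True
    have "U = UNIV" using True V by auto
    then have "(\<integral>x. 1 \<partial>M) \<le> (\<integral>x. (1 :: real) \<partial>N)" by (intro le) auto
    moreover have "space M = UNIV" "space N = UNIV"
      using sets_eq_imp_space_eq[OF M(2)] sets_eq_imp_space_eq[OF N(2)] by auto
    ultimately show ?thesis using True by (simp add: M.emeasure_eq_measure N.emeasure_eq_measure)
  next
    case False
    define g where "g n x = min 1 (real n * infdist x (- V))" for n x
    have cg: "continuous_on UNIV (g n)" for n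
      unfolding g_def[abs_def] by (intro continuous_intros)
    have g01: "0 \<le> g n x" "g n x \<le> 1" for n x by (auto simp: g_def infdist_nonneg)
    have gV: "g n x = 0" if "x \<notin> V" for n x using that by (simp add: g_def)
    have lim: "(\<lambda>n. g n x) \<longlonglongrightarrow> indicator V x" for x
    proof (cases "x \<in> V")
      case True
      have "closed (- V)" "- V \<noteq> {}" using V False by auto
      then have pos: "0 < infdist x (- V)"
        using True in_closed_iff_infdist_zero[of "- V" x] infdist_nonneg[of x "- V"] by auto
      obtain n0 where n0: "1 < real n0 * infdist x (- V)" using reals_Archimedean3[OF pos] by blast
      have "\<forall>\<^sub>F n in sequentially. 1 = g n x"
      proof (rule eventually_sequentiallyI)
        fix n assume "n0 \<le> n"
        then have "real n0 * infdist x (- V) \<le> real n * infdist x (- V)"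
          using pos by (intro mult_right_mono) auto
        then show "1 = g n x" using n0 by (simp add: g_def)
      qed
      then have "(\<lambda>n. g n x) \<longlonglongrightarrow> 1" by (rule Lim_transform_eventually[rotated]) simp
      then show ?thesis using True by simp
    qed (simp add: gV)
    have conv: "(\<lambda>n. \<integral>x. g n x \<partial>K) \<longlonglongrightarrow> measure K V" if K: "finite_measure K" "sets K = sets borel" for K
    proof -
      interpret K: finite_measure K by fact
      note [measurable_cong] = K(2)
      have [measurable]: "V \<in> sets K" using V K(2) by auto
      have "(\<lambda>n. \<integral>x. g n x \<partial>K) \<longlonglongrightarrow> (\<integral>x. indicator V x \<partial>K)"
      proof (rule integral_dominated_convergence[where w = "\<lambda>_. 1"])
        have "g n \<in> borel_measurable borel" for n using cg by (rule borel_measurable_continuous_onI)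
        then show "g n \<in> borel_measurable K" for n by measurable
      qed (use lim g01 in auto)
      then show ?thesis using sets_eq_imp_space_eq[OF K(2)] by simp
    qed
    have "(\<integral>x. g n x \<partial>M) \<le> (\<integral>x. g n x \<partial>N)" for n
      by (rule le[OF cg g01]) (use gV V in auto)
    then have "measure M V \<le> measure N V"
      by (intro LIMSEQ_le[OF conv[OF M] conv[OF N]]) auto
    then show ?thesis by (simp add: M.emeasure_eq_measure N.emeasure_eq_measure)
  qed
  have "emeasure M A \<le> (INF V\<in>{V. A \<subseteq> V \<and> open V}. emeasure N V)"
  proof (rule INF_greatest)
    fix V assume "V \<in> {V. A \<subseteq> V \<and> open V}"
    then have V: "A \<subseteq> V \<inter> U" "open (V \<inter> U)" "open V" using A U by auto
    have "emeasure M A \<le> emeasure M (V \<inter> U)" using V M by (intro emeasure_mono) auto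
    also have "\<dots> \<le> emeasure N (V \<inter> U)" using V by (intro open_le) auto
    also have "\<dots> \<le> emeasure N V" using V N by (intro emeasure_mono) auto
    finally show "emeasure M A \<le> emeasure N V" .
  qed
  also have "\<dots> = emeasure N A"
    using N.emeasure_finite by (intro outer_regular[symmetric] N A) auto
  finally show ?thesis .
qed

lemma compact_support_integrable:
  fixes f :: "real \<Rightarrow> real"
  assumes "continuous_on UNIV f" "\<And>x. R < \<bar>x\<bar> \<Longrightarrow> f x = 0"
  shows "integrable lborel f"
proof -
  have "continuous_on UNIV (\<lambda>x. f x * wt x)" by (intro continuous_intros assms)
  from continuous_compact_support_bounded[OF this, of R] assms(2)
  obtain B where B: "\<And>x. \<bar>f x * wt x\<bar> \<le> B" by auto
  show ?thesis
  proof (rule integrable_wt_bound[of f B])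
    show "f \<in> borel_measurable borel" using assms(1) by (rule borel_measurable_continuous_onI)
    show "\<bar>f x\<bar> \<le> B / wt x" for x using B[of x] by (simp add: abs_mult pos_le_divide_eq)
  qed
qed

text \<open>The primitive that vanishes at minus infinity has compact support precisely because
  \<open>f\<close> has integral zero.\<close>

lemma compact_support_antiderivative:
  fixes f :: "real \<Rightarrow> real"
  assumes f: "continuous_on UNIV f" "\<And>x. R < \<bar>x\<bar> \<Longrightarrow> f x = 0" and 0: "(\<integral>x. f x \<partial>lborel) = 0"
  obtains \<psi> where "\<And>x. (\<psi> has_real_derivative f x) (at x)" "\<And>x. R < \<bar>x\<bar> \<Longrightarrow> \<psi> x = 0"
    "\<And>x. \<bar>\<psi> x\<bar> \<le> (\<integral>x. \<bar>f x\<bar> \<partial>lborel)"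
proof -
  have fi: "integrable lborel f" by (rule compact_support_integrable[OF f])
  define \<psi> where "\<psi> x = (\<integral>y. indicator {..x} y * f y \<partial>lborel)" for x
  have i: "integrable lborel (\<lambda>y. indicator {..x} y * f y)" for x
    using integrable_mult_bounded[OF fi, of "indicator {..x}" 1] by (simp add: mult.commute indicator_def)
  show thesis
  proof (rule that[of \<psi>])
    fix x
    \<comment> \<open>This point lies to the left of both \<open>x\<close> and the support of
      \<open>f\<close>, so integrating from it amounts to integrating from minus infinity.\<close>
    define a where "a = - (\<bar>R\<bar> + 1 + \<bar>x\<bar>)"
    have eq: "integral {a..y} f = \<psi> y" for y
    proof -
      have "set_integrable lborel {a..y} f"
        by (rule borel_integrable_atLeastAtMost') (rule continuous_on_subset[OF f(1)], simp)
      then have "integral {a..y} f = (LBINT z:{a..y}. f z)" by (simp add: set_borel_integral_eq_integral)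
      also have "\<dots> = \<psi> y" unfolding set_lebesgue_integral_def \<psi>_def
      proof (rule Bochner_Integration.integral_cong[OF refl])
        fix z
        have "f z = 0" if "z < a" using that f(2)[of z] by (auto simp: a_def abs_if split: if_splits)
        then show "indicator {a..y} z *\<^sub>R f z = indicator {..y} z * f z" by (auto simp: indicator_def)
      qed
      finally show ?thesis .
    qed
    have "((\<lambda>y. integral {a..y} f) has_real_derivative f x) (at x within {a..x + 1})"
      by (rule integral_has_real_derivative) (auto intro: continuous_on_subset[OF f(1)] simp: a_def)
    then have "((\<lambda>y. integral {a..y} f) has_real_derivative f x) (at x)"
      by (simp add: at_within_Icc_at a_def)
    then show "(\<psi> has_real_derivative f x) (at x)" unfolding eq .
    show "\<bar>\<psi> x\<bar> \<le> (\<integral>x. \<bar>f x\<bar> \<partial>lborel)"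
    proof -
      have "\<bar>\<psi> x\<bar> \<le> (\<integral>y. \<bar>indicator {..x} y * f y\<bar> \<partial>lborel)" unfolding \<psi>_def by (rule integral_abs_bound)
      also have "\<dots> \<le> (\<integral>x. \<bar>f x\<bar> \<partial>lborel)"
        using i[of x] fi by (intro integral_mono integrable_abs) (auto simp: indicator_def)
      finally show ?thesis .
    qed
    assume x: "R < \<bar>x\<bar>"
    show "\<psi> x = 0"
    proof (cases "0 \<le> x")
      case True
      have "(\<lambda>y. indicator {..x} y * f y) = f"
        by (rule ext) (use x True f(2) in \<open>auto simp: indicator_def\<close>)
      then show ?thesis unfolding \<psi>_def using 0 by (simp only:)
    next
      case False
      have "(\<lambda>y. indicator {..x} y * f y) = (\<lambda>y. 0)"
        by (rule ext) (use x False f(2) in \<open>auto simp: indicator_def\<close>)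
      then show ?thesis unfolding \<psi>_def by simp
    qed
  qed
qed

text \<open>Here \<open>h\<close> is a fixed number, the limit of the mean field along the selected
  times; the deviation of the actual mean field at these times is counted as part of the
  flux.\<close>

locale gibbs =
  fixes s h :: real and W b :: "real \<Rightarrow> real"
  assumes s_pos: "0 < s"
    and W_deriv: "\<And>x. (W has_real_derivative b x) (at x)"
    and b_cont: "continuous_on UNIV b"
    and W_coercive: "\<And>K. \<exists>C. \<forall>x. K * x\<^sup>2 \<le> W x + C"
begin

section \<open>The Gibbs density\<close>

definition G :: "real \<Rightarrow> real" where "G x = exp (- (W x - h * x) / s)"
definition Z :: real where "Z = (\<integral>x. G x \<partial>lborel)"

lemma G_pos [simp]: "0 < G x" and G_nonneg [simp]: "0 \<le> G x" and G_nonzero [simp]: "G x \<noteq> 0"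
  by (auto simp: G_def)

lemma G_deriv: "(G has_real_derivative - (b x - h) / s * G x) (at x)"
  unfolding G_def[abs_def] using s_pos
  by (auto intro!: derivative_eq_intros W_deriv simp: field_simps)

lemma G_cont: "continuous_on UNIV G"
  using G_deriv by (meson DERIV_isCont continuous_at_imp_continuous_on)

lemma G_measurable [measurable]: "G \<in> borel_measurable borel"
  using G_cont by (rule borel_measurable_continuous_onI)

text \<open>Coercivity of \<open>W\<close> with factor \<open>s * (m + 1) + 1\<close> yields a
  Gaussian bound: the part \<open>s * (m + 1)\<close> beats
  \<open>wt x ^ (m + 1) \<le> exp ((m + 1) * x\<^sup>2)\<close>, and the spare
  \<open>x\<^sup>2\<close> absorbs \<open>h * x\<close>.\<close>

lemma G_decay: obtains C where "\<And>x. wt x ^ m * G x \<le> C / wt x"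
proof -
  obtain C where C: "\<And>x. (s * real (m + 1) + 1) * x\<^sup>2 \<le> W x + C" using W_coercive by blast
  show thesis
  proof (rule that[of "exp ((C + h\<^sup>2) / s)"])
    fix x
    have "0 \<le> (x - h / 2)\<^sup>2" by simp
    then have "h * x \<le> x\<^sup>2 + h\<^sup>2 / 4" by (simp add: power2_eq_square algebra_simps)
    then have "h * x \<le> x\<^sup>2 + h\<^sup>2" using zero_le_power2[of h] by linarith
    with C[of x] have "- (W x - h * x) \<le> (C + h\<^sup>2) - s * (real (m + 1) * x\<^sup>2)"
      by (simp add: algebra_simps)
    then have "- (W x - h * x) / s \<le> ((C + h\<^sup>2) - s * (real (m + 1) * x\<^sup>2)) / s"
      using s_pos by (intro divide_right_mono) auto
    also have "\<dots> = (C + h\<^sup>2) / s - real (m + 1) * x\<^sup>2" using s_pos by (simp add: diff_divide_distrib)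
    finally have "G x \<le> exp ((C + h\<^sup>2) / s) * exp (- (real (m + 1) * x\<^sup>2))"
      unfolding G_def by (simp add: exp_add[symmetric])
    moreover have "wt x ^ (m + 1) \<le> exp (x\<^sup>2) ^ (m + 1)"
      unfolding wt_def by (intro power_mono exp_ge_add_one_self) auto
    moreover have "exp (x\<^sup>2) ^ (m + 1) = exp (real (m + 1) * x\<^sup>2)" by (simp only: exp_of_nat_mult)
    ultimately have "wt x ^ (m + 1) * G x \<le> exp (real (m + 1) * x\<^sup>2) * (exp ((C + h\<^sup>2) / s) * exp (- (real (m + 1) * x\<^sup>2)))"
      by (intro mult_mono) auto
    also have "\<dots> = exp ((C + h\<^sup>2) / s)" by (simp add: exp_minus)
    finally show "wt x ^ m * G x \<le> exp ((C + h\<^sup>2) / s) / wt x" by (simp add: pos_le_divide_eq ac_simps)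
  qed
qed

lemma G_wt_integrable: "integrable lborel (\<lambda>x. wt x ^ m * G x)"
proof -
  obtain C where "\<And>x. wt x ^ m * G x \<le> C / wt x" by (rule G_decay)  (rule that)
  then show ?thesis by (intro integrable_wt_bound[where C = C]) (auto simp: abs_mult)
qed

lemma G_integrable: "integrable lborel G"
  using G_wt_integrable[of 0] by simp

lemma G_interval_pos: "0 < R \<Longrightarrow> 0 < (\<integral>x. indicator {-R<..<R} x * G x \<partial>lborel)"
proof -
  assume R: "0 < R"
  obtain z where z: "z \<in> {-R..R}" "\<And>x. x \<in> {-R..R} \<Longrightarrow> G z \<le> G x"
    using continuous_attains_inf[of "{-R..R}" G] continuous_on_subset[OF G_cont] R by auto
  have "(\<integral>x. indicator {-R<..<R} x * G z \<partial>lborel) \<le> (\<integral>x. indicator {-R<..<R} x * G x \<partial>lborel)"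
  proof (rule integral_mono)
    show "integrable lborel (\<lambda>x. indicator {-R<..<R} x * G x)"
      using integrable_mult_indicator[OF _ G_integrable, of "{-R<..<R}"] by simp
    show "indicator {-R<..<R} x * G z \<le> indicator {-R<..<R} x * G x" for x
      using z(2)[of x] by (auto simp: indicator_def)
    show "integrable lborel (\<lambda>x. indicator {-R<..<R} x * G z)"
      by (intro integrable_mult_left integrable_real_indicator) (use R in auto)
  qed
  moreover have "(\<integral>x. indicator {-R<..<R} x * G z \<partial>lborel) = 2 * R * G z" using R by simp
  moreover have "0 < 2 * R * G z" using R by simp
  ultimately show ?thesis by linarith
qed

lemma Z_pos: "0 < Z"
proof -
  have "(\<integral>x. indicator {-1<..<1} x * G x \<partial>lborel) \<le> Z"
    unfolding Z_def using integrable_mult_indicator[OF _ G_integrable, of "{-1<..<1}"] G_integrable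
    by (intro integral_mono) (auto simp: indicator_def)
  then show ?thesis using G_interval_pos[of 1] by simp
qed

definition gibbs_measure :: "real measure" where
  "gibbs_measure = density lborel (\<lambda>x. ennreal (G x / Z))"

lemma gibbs_density: "is_density (\<lambda>x. G x / Z) gibbs_measure"
  unfolding is_density_def gibbs_measure_def using Z_pos by (auto simp: less_imp_le)

lemma gibbs_integral:
  assumes [measurable]: "f \<in> borel_measurable borel"
  shows "(\<integral>x. f x \<partial>gibbs_measure) = (\<integral>x. f x * (G x / Z) \<partial>lborel)"
    "integrable gibbs_measure f \<longleftrightarrow> integrable lborel (\<lambda>x. f x * (G x / Z))"
  unfolding gibbs_measure_def using Z_pos
  by (auto simp: integral_density integrable_density mult.commute less_imp_le)

lemma gibbs_prob: "probability_on_reals gibbs_measure"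
proof -
  have i: "integrable lborel (\<lambda>x. G x / Z)" using G_integrable by simp
  have "emeasure gibbs_measure (space gibbs_measure) = (\<integral>\<^sup>+x. ennreal (G x / Z) \<partial>lborel)"
    unfolding gibbs_measure_def by (subst emeasure_density) (auto intro!: nn_integral_cong)
  also have "\<dots> = ennreal (\<integral>x. G x / Z \<partial>lborel)"
    using i Z_pos by (intro nn_integral_eq_integral) (auto simp: less_imp_le)
  also have "(\<integral>x. G x / Z \<partial>lborel) = 1" using Z_pos by (simp add: Z_def)
  finally have "emeasure gibbs_measure (space gibbs_measure) = 1" by simp
  then have "prob_space gibbs_measure" by (rule prob_spaceI)
  then show ?thesis by (simp add: probability_on_reals_def gibbs_measure_def)
qed

text \<open>The integrand times \<open>G\<close> is the derivative of
  \<open>s * \<phi>1 * G\<close>.\<close>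

lemma gibbs_stationary:
  assumes d: "\<And>x. (\<phi>1 has_real_derivative \<phi>2 x) (at x)" and c: "continuous_on UNIV \<phi>2"
    and supp: "\<And>x. R < \<bar>x\<bar> \<Longrightarrow> \<phi>1 x = 0" "\<And>x. R < \<bar>x\<bar> \<Longrightarrow> \<phi>2 x = 0"
  shows "(\<integral>x. s * \<phi>2 x - (b x - h) * \<phi>1 x \<partial>gibbs_measure) = 0"
proof -
  have c1: "continuous_on UNIV \<phi>1" using d by (meson DERIV_isCont continuous_at_imp_continuous_on)
  have m: "(\<lambda>x. s * \<phi>2 x - (b x - h) * \<phi>1 x) \<in> borel_measurable borel"
    by (intro borel_measurable_continuous_onI continuous_intros c c1 b_cont)
  let ?f = "\<lambda>x. s / Z * (\<phi>1 x * G x)" and ?f' = "\<lambda>x. (s * \<phi>2 x - (b x - h) * \<phi>1 x) * (G x / Z)"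
  have "continuous_on UNIV (\<lambda>x. ?f x * wt x)" by (intro continuous_intros c1 G_cont)
  from continuous_compact_support_bounded[OF this, of R] supp
  obtain B where B: "\<And>x. \<bar>?f x * wt x\<bar> \<le> B" by auto
  have "(\<integral>x. ?f' x \<partial>lborel) = 0"
  proof (rule integral_deriv_eq_0[of ?f])
    show "(?f has_real_derivative ?f' x) (at x)" for x
    proof -
      have "s / Z * (\<phi>2 x * G x + - (b x - h) / s * G x * \<phi>1 x) = ?f' x"
        using s_pos Z_pos by (simp add: field_simps)
      then show ?thesis using DERIV_cmult[OF DERIV_mult[OF d[of x] G_deriv[of x]], of "s / Z"] by (simp only:)
    qed
    show cf: "continuous_on UNIV ?f'" using Z_pos by (intro continuous_intros c c1 b_cont G_cont) auto
    show "integrable lborel ?f'" by (rule compact_support_integrable[OF cf, of R]) (use supp in simp)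
    show "\<bar>?f x\<bar> \<le> B / wt x" for x
      unfolding pos_le_divide_eq[OF wt_pos] using B[of x] by (simp add: abs_mult)
  qed
  then show ?thesis using gibbs_integral(1)[OF m] by simp
qed

text \<open>The dual form of the statement that the flux of \<open>M\<close> has total variation at
  most \<open>\<delta>\<close>; no density of \<open>M\<close> is presupposed.\<close>

definition small_flux :: "real measure \<Rightarrow> real \<Rightarrow> bool" where
  "small_flux M \<delta> \<longleftrightarrow> prob_space M \<and> sets M = sets borel \<and> 0 \<le> \<delta> \<and>
    (\<forall>\<phi> \<phi>1 R A. (\<forall>x. (\<phi> has_real_derivative \<phi>1 x) (at x)) \<longrightarrow> continuous_on UNIV \<phi>1 \<longrightarrow>
      (\<forall>x. R < \<bar>x\<bar> \<longrightarrow> \<phi> x = 0 \<and> \<phi>1 x = 0) \<longrightarrow> (\<forall>x. \<bar>\<phi> x\<bar> \<le> A) \<longrightarrow>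
      \<bar>\<integral>x. s * \<phi>1 x - (b x - h) * \<phi> x \<partial>M\<bar> \<le> A * \<delta>)"

text \<open>Testing with \<open>\<psi> / G\<close>, where \<open>\<psi>\<close> is an antiderivative of \<open>f\<close>, turns the flux into \<open>s f / G\<close>.\<close>

lemma small_flux_mean_zero:
  assumes sf: "small_flux M \<delta>" and f: "continuous_on UNIV f" "\<And>x. R < \<bar>x\<bar> \<Longrightarrow> f x = 0"
    and 0: "(\<integral>x. f x \<partial>lborel) = 0" and \<Gamma>: "0 \<le> \<Gamma>" "\<And>x. \<bar>x\<bar> \<le> R \<Longrightarrow> 1 / G x \<le> \<Gamma>"
  shows "s * \<bar>\<integral>x. f x / G x \<partial>M\<bar> \<le> \<Gamma> * (\<integral>x. \<bar>f x\<bar> \<partial>lborel) * \<delta>"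
proof -
  obtain \<psi> where \<psi>: "\<And>x. (\<psi> has_real_derivative f x) (at x)" "\<And>x. R < \<bar>x\<bar> \<Longrightarrow> \<psi> x = 0"
    "\<And>x. \<bar>\<psi> x\<bar> \<le> (\<integral>x. \<bar>f x\<bar> \<partial>lborel)"
    by (rule compact_support_antiderivative[OF f 0]) (auto intro: that)
  have c\<psi>: "continuous_on UNIV \<psi>" using \<psi>(1) by (meson DERIV_isCont continuous_at_imp_continuous_on)
  define \<phi> where "\<phi> x = \<psi> x / G x" for x
  define \<phi>1 where "\<phi>1 x = f x / G x + \<psi> x * (b x - h) / (s * G x)" for x
  have d: "(\<phi> has_real_derivative \<phi>1 x) (at x)" for x
  proof -
    have "(\<phi> has_real_derivative (f x * G x - \<psi> x * (- (b x - h) / s * G x)) / (G x * G x)) (at x)"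
      unfolding \<phi>_def[abs_def] by (rule DERIV_divide[OF \<psi>(1) G_deriv]) simp
    moreover have "(f x * G x - \<psi> x * (- (b x - h) / s * G x)) / (G x * G x) = \<phi>1 x"
      unfolding \<phi>1_def using s_pos by (simp add: field_simps)
    ultimately show ?thesis by simp
  qed
  have c1: "continuous_on UNIV \<phi>1" unfolding \<phi>1_def[abs_def] using s_pos
    by (intro continuous_intros f c\<psi> b_cont G_cont) auto
  have \<phi>b: "\<bar>\<phi> x\<bar> \<le> \<Gamma> * (\<integral>x. \<bar>f x\<bar> \<partial>lborel)" for x
  proof (cases "\<bar>x\<bar> \<le> R")
    case True
    have "\<bar>\<phi> x\<bar> = (1 / G x) * \<bar>\<psi> x\<bar>" by (simp add: \<phi>_def abs_divide)
    also have "\<dots> \<le> \<Gamma> * (\<integral>x. \<bar>f x\<bar> \<partial>lborel)" using \<Gamma> True \<psi>(3) by (intro mult_mono) auto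
    finally show ?thesis .
  next
    case False
    then show ?thesis using \<psi>(2) \<Gamma> by (simp add: \<phi>_def)
  qed
  have eq: "s * \<phi>1 x - (b x - h) * \<phi> x = s * (f x / G x)" for x
    unfolding \<phi>1_def \<phi>_def using s_pos by (simp add: field_simps)
  have "\<bar>\<integral>x. s * \<phi>1 x - (b x - h) * \<phi> x \<partial>M\<bar> \<le> (\<Gamma> * (\<integral>x. \<bar>f x\<bar> \<partial>lborel)) * \<delta>"
  proof -
    have "\<forall>x. R < \<bar>x\<bar> \<longrightarrow> \<phi> x = 0 \<and> \<phi>1 x = 0" using \<psi>(2) f(2) by (simp add: \<phi>_def \<phi>1_def)
    with sf d c1 \<phi>b show ?thesis unfolding small_flux_def by blast
  qed
  then show ?thesis unfolding eq integral_mult_right_zero abs_mult using s_pos by simp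
qed

section \<open>Comparison of a measure of small flux with multiples of the Gibbs density\<close>

definition hat :: "real \<Rightarrow> real" where "hat x = max 0 (1 - \<bar>x\<bar>)"
definition hat_mass :: real where "hat_mass = (\<integral>x. hat x \<partial>lborel)"
text \<open>A measure of zero flux is a multiple of the Gibbs weight \<open>G\<close>; a bump of
  integral one, divided by \<open>G\<close>, reads off this multiple.\<close>

definition level :: "real measure \<Rightarrow> real" where "level M = (\<integral>x. hat x / hat_mass / G x \<partial>M)"

lemma hat_props: "continuous_on UNIV hat" "0 \<le> hat x" "1 < \<bar>x\<bar> \<Longrightarrow> hat x = 0" "integrable lborel hat" "0 < hat_mass"
proof -
  show c: "continuous_on UNIV hat" unfolding hat_def[abs_def] by (intro continuous_intros)
  show "0 \<le> hat x" for x by (simp add: hat_def)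
  show z: "1 < \<bar>x\<bar> \<Longrightarrow> hat x = 0" for x by (simp add: hat_def)
  show i: "integrable lborel hat" by (rule compact_support_integrable[OF c z])
  have "(\<integral>x. indicator {-(1/2)..1/2::real} x * (1 / 2) \<partial>lborel) \<le> hat_mass"
    unfolding hat_mass_def
  proof (rule integral_mono[OF _ i])
    show "integrable lborel (\<lambda>x. indicator {-(1/2)..1/2::real} x * (1 / 2 :: real))"
      by (intro integrable_mult_left integrable_real_indicator) auto
  qed (auto simp: indicator_def hat_def abs_if)
  then show "0 < hat_mass" by simp
qed

text \<open>Subtracting \<open>lam\<close> times the normalised bump makes the function mean zero
  and at most doubles its L1 norm; hence the factor 2.\<close>

lemma small_flux_level:
  assumes sf: "small_flux M \<delta>" and f: "continuous_on UNIV f" "\<And>x. R < \<bar>x\<bar> \<Longrightarrow> f x = 0" "\<And>x. 0 \<le> f x"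
    and R: "1 \<le> R" and \<Gamma>: "0 \<le> \<Gamma>" "\<And>x. \<bar>x\<bar> \<le> R \<Longrightarrow> 1 / G x \<le> \<Gamma>"
  shows "\<bar>(\<integral>x. f x / G x \<partial>M) - level M * (\<integral>x. f x \<partial>lborel)\<bar> \<le> (2 * \<Gamma> * \<delta> / s) * (\<integral>x. f x \<partial>lborel)"
proof -
  interpret prob_space M using sf by (simp add: small_flux_def)
  have sM: "sets M = sets borel" using sf by (simp add: small_flux_def)
  define lam where "lam = (\<integral>x. f x \<partial>lborel)"
  have lam: "0 \<le> lam" unfolding lam_def by (intro Bochner_Integration.integral_nonneg f)
  define f' where "f' x = f x - lam * (hat x / hat_mass)" for x
  have c: "continuous_on UNIV f'" unfolding f'_def[abs_def] using hat_props(5)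
    by (intro continuous_intros f hat_props) auto
  have z: "f' x = 0" if "R < \<bar>x\<bar>" for x using that R f(2) hat_props(3)[of x] by (simp add: f'_def)
  have fi: "integrable lborel f" by (rule compact_support_integrable[OF f(1,2)])
  have hi: "integrable lborel (\<lambda>x. lam * (hat x / hat_mass))" using hat_props by simp
  have hm: "(\<integral>x. lam * (hat x / hat_mass) \<partial>lborel) = lam"
    using hat_props(5) by (simp add: hat_mass_def[symmetric])
  have int0: "(\<integral>x. f' x \<partial>lborel) = 0" unfolding f'_def using fi hi hm by (simp add: lam_def)
  have "(\<integral>x. \<bar>f' x\<bar> \<partial>lborel) \<le> (\<integral>x. f x + lam * (hat x / hat_mass) \<partial>lborel)"
  proof (rule integral_mono)
    show "integrable lborel (\<lambda>x. \<bar>f' x\<bar>)" unfolding f'_def using fi hi by auto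
    show "integrable lborel (\<lambda>x. f x + lam * (hat x / hat_mass))" using fi hi by auto
    fix x
    have "0 \<le> lam * (hat x / hat_mass)" using lam hat_props(2,5) by (simp add: less_imp_le)
    then show "\<bar>f' x\<bar> \<le> f x + lam * (hat x / hat_mass)" 
      using abs_triangle_ineq4[of "f x" "lam * (hat x / hat_mass)"] f(3)[of x]
      unfolding f'_def by (simp only: abs_of_nonneg)
  qed
  also have "\<dots> = 2 * lam" using fi hi hm by (simp add: lam_def)
  finally have L1: "(\<integral>x. \<bar>f' x\<bar> \<partial>lborel) \<le> 2 * lam" .
  have \<delta>: "0 \<le> \<delta>" using sf by (simp add: small_flux_def)
  have "s * \<bar>\<integral>x. f' x / G x \<partial>M\<bar> \<le> \<Gamma> * (\<integral>x. \<bar>f' x\<bar> \<partial>lborel) * \<delta>"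
    by (rule small_flux_mean_zero[OF sf c z int0 \<Gamma>])
  also have "\<dots> \<le> \<Gamma> * (2 * lam) * \<delta>" using L1 \<Gamma> \<delta> by (intro mult_right_mono mult_left_mono)
  finally have main: "\<bar>\<integral>x. f' x / G x \<partial>M\<bar> \<le> (2 * \<Gamma> * \<delta> / s) * lam" using s_pos by (simp add: field_simps)
  have cs: "integrable M (\<lambda>x. g x / G x)" if "continuous_on UNIV g" "\<And>x. R < \<bar>x\<bar> \<Longrightarrow> g x = 0" for g
  proof -
    have cg: "continuous_on UNIV (\<lambda>x. g x / G x)" by (intro continuous_intros that G_cont) auto
    from continuous_compact_support_bounded[OF this, of R] that(2)
    obtain B where B: "\<And>x. \<bar>g x / G x\<bar> \<le> B" by auto
    have m: "(\<lambda>x. g x / G x) \<in> borel_measurable M"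
      using borel_measurable_continuous_onI[OF cg] measurable_cong_sets[OF sM] by blast
    show ?thesis by (rule integrable_const_bound[where B = B]) (use B m in auto)
  qed
  have ci: "integrable M (\<lambda>x. f x / G x)" by (rule cs[OF f(1,2)])
  have hz: "hat x / hat_mass = 0" if "R < \<bar>x\<bar>" for x using that R hat_props(3)[of x] by simp
  have hi2: "integrable M (\<lambda>x. hat x / hat_mass / G x)"
    by (rule cs[OF _ hz]) (use hat_props in \<open>auto intro!: continuous_intros\<close>)
  have "(\<integral>x. f' x / G x \<partial>M) = (\<integral>x. f x / G x - lam * (hat x / hat_mass / G x) \<partial>M)"
    unfolding f'_def by (simp add: diff_divide_distrib)
  also have "\<dots> = (\<integral>x. f x / G x \<partial>M) - lam * level M"
    unfolding level_def Bochner_Integration.integral_diff[OF ci integrable_mult_right[OF hi2]] integral_mult_right_zero ..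
  finally show ?thesis using main by (simp add: lam_def mult.commute)
qed

lemma level_nonneg: "0 \<le> level M"
  unfolding level_def using hat_props by (intro Bochner_Integration.integral_nonneg) (simp add: less_imp_le)

definition Gset :: "real set \<Rightarrow> real" where "Gset A = (\<integral>x. indicator A x * G x \<partial>lborel)"

lemma Gset_integrable: "A \<in> sets borel \<Longrightarrow> integrable lborel (\<lambda>x. indicator A x * G x)"
  using integrable_mult_indicator[OF _ G_integrable, of A] by simp

lemma emeasure_scaled_G:
  assumes "0 \<le> c" "A \<in> sets borel"
  shows "emeasure (density lborel (\<lambda>x. ennreal (c * G x))) A = ennreal (c * Gset A)"
proof -
  have [measurable]: "A \<in> sets borel" by fact
  have "emeasure (density lborel (\<lambda>x. ennreal (c * G x))) A = (\<integral>\<^sup>+x. ennreal (c * (indicator A x * G x)) \<partial>lborel)"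
    using assms by (subst emeasure_density) (auto intro!: nn_integral_cong simp: indicator_def)
  also have "\<dots> = ennreal (\<integral>x. c * (indicator A x * G x) \<partial>lborel)"
    using assms Gset_integrable by (intro nn_integral_eq_integral) auto
  finally show ?thesis by (simp add: Gset_def)
qed

lemma finite_measure_scaled_G: "0 \<le> c \<Longrightarrow> finite_measure (density lborel (\<lambda>x. ennreal (c * G x)))"
  by (rule finite_measureI) (simp add: emeasure_scaled_G)

text \<open>With \<open>f = g * G\<close> the previous estimate says that on
  \<open>{-R<..<R}\<close> the measure lies between the multiples \<open>level M - \<kappa>\<close>
  and \<open>level M + \<kappa>\<close> of \<open>G\<close>. The error is relative to
  \<open>Gset A\<close>, which later yields absolute continuity.\<close>

lemma small_flux_set:
  assumes sf: "small_flux M \<delta>" and R: "1 \<le> R" and \<Gamma>: "0 \<le> \<Gamma>" "\<And>x. \<bar>x\<bar> \<le> R \<Longrightarrow> 1 / G x \<le> \<Gamma>"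
    and A: "A \<in> sets borel" "A \<subseteq> {-R<..<R}"
  shows "\<bar>measure M A - level M * Gset A\<bar> \<le> (2 * \<Gamma> * \<delta> / s) * Gset A"
proof -
  interpret prob_space M using sf by (simp add: small_flux_def)
  have sM: "sets M = sets borel" and \<delta>: "0 \<le> \<delta>" using sf by (auto simp: small_flux_def)
  define \<kappa> where "\<kappa> = 2 * \<Gamma> * \<delta> / s"
  have \<kappa>: "0 \<le> \<kappa>" using \<Gamma> \<delta> s_pos by (simp add: \<kappa>_def)
  have GA: "0 \<le> Gset A" unfolding Gset_def by (intro Bochner_Integration.integral_nonneg) simp
  have key: "\<bar>(\<integral>x. g x \<partial>M) - level M * (\<integral>x. g x * G x \<partial>lborel)\<bar> \<le> \<kappa> * (\<integral>x. g x * G x \<partial>lborel)"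
    if g: "continuous_on UNIV g" "\<And>x. 0 \<le> g x" "\<And>x. x \<notin> {-R<..<R} \<Longrightarrow> g x = 0" for g
  proof -
    have "g x * G x = 0" if "R < \<bar>x\<bar>" for x using that g(3)[of x] by (auto simp: abs_if split: if_splits)
    then have "\<bar>(\<integral>x. g x * G x / G x \<partial>M) - level M * (\<integral>x. g x * G x \<partial>lborel)\<bar> \<le> \<kappa> * (\<integral>x. g x * G x \<partial>lborel)"
      unfolding \<kappa>_def using g \<Gamma> by (intro small_flux_level[OF sf _ _ _ R]) (auto intro!: continuous_intros G_cont)
    then show ?thesis by simp
  qed
  have dens: "(\<integral>x. g x \<partial>density lborel (\<lambda>x. ennreal (c * G x))) = c * (\<integral>x. g x * G x \<partial>lborel)"
    if c: "0 \<le> c" and g: "continuous_on UNIV g" for c g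
  proof -
    have [measurable]: "g \<in> borel_measurable borel" using g by (rule borel_measurable_continuous_onI)
    have "(\<integral>x. g x \<partial>density lborel (\<lambda>x. ennreal (c * G x))) = (\<integral>x. c * (g x * G x) \<partial>lborel)"
      using c by (subst integral_density) (auto simp: ac_simps)
    then show ?thesis by simp
  qed
  have up: "measure M A \<le> (level M + \<kappa>) * Gset A"
  proof -
    have c: "0 \<le> level M + \<kappa>" using level_nonneg \<kappa> by simp
    have "emeasure M A \<le> emeasure (density lborel (\<lambda>x. ennreal ((level M + \<kappa>) * G x))) A"
    proof (rule emeasure_le_of_integral_le[OF finite_measure_axioms sM finite_measure_scaled_G[OF c] _ _ A])
      fix g :: "real \<Rightarrow> real"
      assume g: "continuous_on UNIV g" "\<And>x. 0 \<le> g x" "\<And>x. x \<notin> {-R<..<R} \<Longrightarrow> g x = 0"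
      show "(\<integral>x. g x \<partial>M) \<le> (\<integral>x. g x \<partial>density lborel (\<lambda>x. ennreal ((level M + \<kappa>) * G x)))"
        using key[OF g] unfolding dens[OF c g(1)] by (simp add: distrib_right)
    qed auto
    then show ?thesis unfolding emeasure_scaled_G[OF c A(1)] emeasure_eq_measure using c GA by simp
  qed
  have low: "(level M - \<kappa>) * Gset A \<le> measure M A"
  proof (cases "0 \<le> level M - \<kappa>")
    case c: True
    have "emeasure (density lborel (\<lambda>x. ennreal ((level M - \<kappa>) * G x))) A \<le> emeasure M A"
    proof (rule emeasure_le_of_integral_le[OF finite_measure_scaled_G[OF c] _ finite_measure_axioms sM _ A])
      fix g :: "real \<Rightarrow> real"
      assume g: "continuous_on UNIV g" "\<And>x. 0 \<le> g x" "\<And>x. x \<notin> {-R<..<R} \<Longrightarrow> g x = 0"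
      show "(\<integral>x. g x \<partial>density lborel (\<lambda>x. ennreal ((level M - \<kappa>) * G x))) \<le> (\<integral>x. g x \<partial>M)"
        using key[OF g] unfolding dens[OF c g(1)] by (simp add: left_diff_distrib)
    qed auto
    then show ?thesis unfolding emeasure_scaled_G[OF c A(1)] emeasure_eq_measure by simp
  next
    case False
    \<comment> \<open>A negative multiple of \<open>G\<close> is no measure to compare with, but
      then the lower bound is trivial.\<close>
    then have "(level M - \<kappa>) * Gset A \<le> 0" using GA by (intro mult_nonpos_nonneg) auto
    also have "0 \<le> measure M A" by simp
    finally show ?thesis .
  qed
  show ?thesis unfolding \<kappa>_def[symmetric] using up low
    by (simp add: abs_le_iff distrib_right left_diff_distrib)
qed

lemma inverse_G_bound:
  obtains \<Gamma> where "0 \<le> \<Gamma>" "\<And>x. \<bar>x\<bar> \<le> R \<Longrightarrow> 1 / G x \<le> \<Gamma>"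
proof -
  have "continuous_on {-R..R} (\<lambda>x. 1 / G x)"
    by (intro continuous_intros continuous_on_subset[OF G_cont]) auto
  then have "bounded ((\<lambda>x. 1 / G x) ` {-R..R})"
    by (intro compact_imp_bounded compact_continuous_image) auto
  then obtain B where B: "0 < B" "\<forall>y\<in>(\<lambda>x. 1 / G x) ` {-R..R}. norm y \<le> B" using bounded_pos by blast
  show thesis
  proof (rule that[of B])
    fix x assume "\<bar>x\<bar> \<le> R"
    then have "x \<in> {-R..R}" by auto
    then show "1 / G x \<le> B" using B(2) by auto
  qed (use B in simp)
qed

text \<open>For a Lebesgue null set \<open>Gset\<close> is zero, so the relative error in
  \<open>small_flux_set\<close> makes it a null set of \<open>M\<close> within every bounded
  interval; Radon-Nikodym provides the density.\<close>

lemma small_flux_density: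
  assumes sf: "small_flux M \<delta>"
  obtains u where "is_density u M"
proof -
  interpret prob_space M using sf by (simp add: small_flux_def)
  have sM: "sets M = sets borel" using sf by (simp add: small_flux_def)
  have ac: "absolutely_continuous lborel M"
    unfolding absolutely_continuous_def
  proof (rule subsetI)
    fix A :: "real set" assume A: "A \<in> null_sets lborel"
    then have Ab: "A \<in> sets borel" by (auto dest: null_setsD2)
    have "emeasure M (A \<inter> {- real (Suc n)<..<real (Suc n)}) = 0" for n
    proof -
      let ?A = "A \<inter> {- real (Suc n)<..<real (Suc n)}"
      obtain \<Gamma> where \<Gamma>: "0 \<le> \<Gamma>" "\<And>x. \<bar>x\<bar> \<le> real (Suc n) \<Longrightarrow> 1 / G x \<le> \<Gamma>"
        by (rule inverse_G_bound[of "real (Suc n)"]) (auto intro: that)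
      have "AE x in lborel. indicator ?A x * G x = 0"
        using AE_not_in[OF A] by eventually_elim (auto simp: indicator_def)
      then have "Gset ?A = 0" unfolding Gset_def by (intro integral_eq_zero_AE)
      then have "measure M ?A = 0"
      proof -
        have "1 \<le> real (Suc n)" "?A \<in> sets borel" "?A \<subseteq> {- real (Suc n)<..<real (Suc n)}" using Ab by auto
        from small_flux_set[OF sf this(1) \<Gamma> this(2,3)] \<open>Gset ?A = 0\<close> show ?thesis by (simp add: measure_le_0_iff)
      qed
      then show ?thesis by (simp add: emeasure_eq_measure)
    qed
    then have "emeasure M (\<Union>n. A \<inter> {- real (Suc n)<..<real (Suc n)}) = 0"
      using Ab sM by (intro emeasure_UN_eq_0) auto
    moreover have "(\<Union>n. A \<inter> {- real (Suc n)<..<real (Suc n)}) = A"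
    proof -
      have "\<exists>n. x \<in> {- real (Suc n)<..<real (Suc n)}" for x
      proof -
        obtain n where "\<bar>x\<bar> < real n" using reals_Archimedean2 by blast
        then show ?thesis by (intro exI[of _ n]) auto
      qed
      then show ?thesis by auto
    qed
    ultimately show "A \<in> null_sets M" using Ab sM by (auto simp: null_sets_def)
  qed
  obtain D where D: "D \<in> borel_measurable lborel" "AE x in lborel. RN_deriv lborel M x = ennreal (D x)" "\<And>x. 0 \<le> D x"
    using sigma_finite_measure.real_RN_deriv[OF lborel.sigma_finite_measure_axioms finite_measure_axioms ac] sM
    by (metis sets_lborel)
  have "M = density lborel (RN_deriv lborel M)"
    using sigma_finite_measure.density_RN_deriv[OF lborel.sigma_finite_measure_axioms ac] sM by simp
  also have "\<dots> = density lborel (\<lambda>x. ennreal (D x))"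
    using D by (intro density_cong) auto
  finally have "is_density D M" unfolding is_density_def using D by auto
  then show thesis by (rule that)
qed

text \<open>Taking the sets where \<open>u\<close> is above and below \<open>level M * G\<close>
  turns the setwise estimate into one of the L1 distance.\<close>

lemma small_flux_L1:
  assumes sf: "small_flux M \<delta>" and u: "is_density u M" and R: "1 \<le> R"
    and \<Gamma>: "0 \<le> \<Gamma>" "\<And>x. \<bar>x\<bar> \<le> R \<Longrightarrow> 1 / G x \<le> \<Gamma>"
  shows "integrable lborel u" 
    "(\<integral>x. indicator {-R<..<R} x * \<bar>u x - level M * G x\<bar> \<partial>lborel) \<le> (2 * \<Gamma> * \<delta> / s) * Z"
proof -
  interpret prob_space M using sf by (simp add: small_flux_def)
  have sM: "sets M = sets borel" and \<delta>: "0 \<le> \<delta>" using sf by (auto simp: small_flux_def)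
  have [measurable]: "u \<in> borel_measurable borel" and u0: "\<And>x. 0 \<le> u x" and Md: "M = density lborel (\<lambda>x. ennreal (u x))"
    using u by (auto simp: is_density_def)
  have "integrable M (\<lambda>x. 1 :: real)" by simp
  then show ui: "integrable lborel u" unfolding Md by (subst (asm) integrable_density) (auto simp: u0)
  have mu: "measure M A = (\<integral>x. indicator A x * u x \<partial>lborel)" if A: "A \<in> sets borel" for A
  proof -
    have "measure M A = (\<integral>x. indicator A x \<partial>M)" using A sM sets_eq_imp_space_eq[OF sM] by simp
    also have "\<dots> = (\<integral>x. u x *\<^sub>R indicator A x \<partial>lborel)" unfolding Md using A u0
      by (subst integral_density) auto
    finally show ?thesis by (simp add: mult.commute)
  qed
  define \<kappa> where "\<kappa> = 2 * \<Gamma> * \<delta> / s"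
  have \<kappa>: "0 \<le> \<kappa>" using \<Gamma> \<delta> s_pos by (simp add: \<kappa>_def)
  define A1 where "A1 = {x. level M * G x \<le> u x} \<inter> {-R<..<R}"
  define A2 where "A2 = {x. u x < level M * G x} \<inter> {-R<..<R}"
  have A: "A1 \<in> sets borel" "A2 \<in> sets borel" unfolding A1_def A2_def by measurable
  have iu: "integrable lborel (\<lambda>x. indicator A x * u x)" if "A \<in> sets borel" for A
    using integrable_mult_indicator[OF _ ui, of A] that by simp
  note ig = Gset_integrable
  have "(\<integral>x. indicator {-R<..<R} x * \<bar>u x - level M * G x\<bar> \<partial>lborel)
      = (\<integral>x. (indicator A1 x * u x - level M * (indicator A1 x * G x))
        - (indicator A2 x * u x - level M * (indicator A2 x * G x)) \<partial>lborel)"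
    by (intro Bochner_Integration.integral_cong) (auto simp: A1_def A2_def indicator_def)
  also have "\<dots> = (measure M A1 - level M * Gset A1) - (measure M A2 - level M * Gset A2)"
    using iu A ig by (simp add: mu Gset_def)
  also have "\<dots> \<le> \<kappa> * Gset A1 + \<kappa> * Gset A2"
    using small_flux_set[OF sf R \<Gamma> A(1)] small_flux_set[OF sf R \<Gamma> A(2)]
    unfolding \<kappa>_def[symmetric] by (auto simp: A1_def A2_def)
  also have "\<dots> = \<kappa> * (\<integral>x. indicator A1 x * G x + indicator A2 x * G x \<partial>lborel)"
    using ig A by (simp add: Gset_def distrib_left)
  also have "\<dots> \<le> \<kappa> * Z" unfolding Z_def
  proof (intro mult_left_mono integral_mono \<kappa> G_integrable Bochner_Integration.integrable_add ig A)
    show "indicator A1 x * G x + indicator A2 x * G x \<le> G x" for x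
      by (auto simp: A1_def A2_def indicator_def)
  qed
  finally show "(\<integral>x. indicator {-R<..<R} x * \<bar>u x - level M * G x\<bar> \<partial>lborel) \<le> (2 * \<Gamma> * \<delta> / s) * Z"
    by (simp add: \<kappa>_def)
qed

section \<open>Convergence in the weighted norm\<close>

lemma G_tail:
  assumes e: "0 < e"
  obtains R where "1 \<le> R" "\<And>r. R \<le> r \<Longrightarrow> (\<integral>x. indicator {x. r \<le> \<bar>x\<bar>} x * (wt x ^ m * G x) \<partial>lborel) \<le> e"
proof -
  let ?f = "\<lambda>r x. indicator {x. r \<le> \<bar>x\<bar>} x * (wt x ^ m * G x)"
  have int: "integrable lborel (?f r)" for r
    using integrable_mult_indicator[OF _ G_wt_integrable, of "{x. r \<le> \<bar>x\<bar>}"] by simp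
  have "(\<lambda>n. \<integral>x. ?f (real n) x \<partial>lborel) \<longlonglongrightarrow> (\<integral>x. 0 \<partial>(lborel :: real measure))"
  proof (rule integral_dominated_convergence[where w = "\<lambda>x. wt x ^ m * G x"])
    show "AE x in lborel. (\<lambda>n. ?f (real n) x) \<longlonglongrightarrow> 0"
    proof (rule AE_I2)
      fix x :: real
      obtain n0 where n0: "\<bar>x\<bar> < real n0" using reals_Archimedean2 by blast
      have "\<forall>\<^sub>F n in sequentially. 0 = ?f (real n) x"
        by (rule eventually_sequentiallyI[of n0]) (use n0 in \<open>auto simp: indicator_def\<close>)
      then show "(\<lambda>n. ?f (real n) x) \<longlonglongrightarrow> 0" by (rule Lim_transform_eventually[rotated]) simp
    qed
  qed (use int G_wt_integrable in \<open>auto simp: indicator_def abs_mult\<close>)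
  then have "\<forall>\<^sub>F n in sequentially. (\<integral>x. ?f (real n) x \<partial>lborel) < e"
    using e by (intro order_tendstoD) simp
  then obtain n where n: "(\<integral>x. ?f (real n) x \<partial>lborel) < e" by (auto simp: eventually_sequentially)
  show thesis
  proof (rule that[of "max 1 (real n)"])
    fix r assume r: "max 1 (real n) \<le> r"
    have "(\<integral>x. ?f r x \<partial>lborel) \<le> (\<integral>x. ?f (real n) x \<partial>lborel)"
      by (intro integral_mono int) (use r in \<open>auto simp: indicator_def\<close>)
    then show "(\<integral>x. ?f r x \<partial>lborel) \<le> e" using n by simp
  qed simp
qed

text \<open>On a large interval the densities are close to \<open>level (M k) * G\<close>, and
  outside it the weighted masses of \<open>M k\<close> and of \<open>G\<close> are uniformly small.
  As every \<open>M k\<close> has mass one, this forces \<open>level (M k)\<close> to converge to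
  \<open>1 / Z\<close>.\<close>

lemma small_flux_converges:
  fixes M :: "nat \<Rightarrow> real measure"
  assumes sf: "\<And>k. small_flux (M k) (\<delta> k)" and \<delta>: "\<delta> \<longlonglongrightarrow> 0"
    and mom: "\<And>k. integrable (M k) (\<lambda>x. wt x ^ m)"
    and tails: "\<And>e. 0 < e \<Longrightarrow> \<exists>R. \<forall>k. (\<integral>x. indicator {x. R \<le> \<bar>x\<bar>} x * wt x ^ m \<partial>M k) \<le> e"
    and us: "\<And>k. is_density (us k) (M k)"
  shows "integrable lborel (\<lambda>x. wt x ^ m * \<bar>us k x - G x / Z\<bar>)"
    "(\<lambda>k. \<integral>x. wt x ^ m * \<bar>us k x - G x / Z\<bar> \<partial>lborel) \<longlonglongrightarrow> 0"
proof -
  have prob: "prob_space (M k)" and sM: "sets (M k) = sets borel" and \<delta>0: "0 \<le> \<delta> k" for k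
    using sf by (auto simp: small_flux_def)
  have um [measurable]: "us k \<in> borel_measurable borel" and u0: "0 \<le> us k x"
    and Md: "M k = density lborel (\<lambda>x. ennreal (us k x))" for k x
    using us by (auto simp: is_density_def)
  have iu: "integrable lborel (\<lambda>x. f x * us k x)" and eu: "(\<integral>x. f x * us k x \<partial>lborel) = (\<integral>x. f x \<partial>M k)"
    if "integrable (M k) f" "f \<in> borel_measurable borel" for f k
    using that unfolding Md
    by (auto simp: integrable_density integral_density u0 mult.commute)
  have tail_i: "integrable (M k) (\<lambda>x. indicator {x. r \<le> \<bar>x\<bar>} x * wt x ^ m)" for r k
  proof -
    have "{x. r \<le> \<bar>x\<bar>} \<in> sets (M k)" unfolding sM by measurable
    from integrable_mult_indicator[OF this mom[of k]] show ?thesis by simp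
  qed
  have tails': "\<exists>R\<ge>1. \<forall>r\<ge>R. \<forall>k. (\<integral>x. indicator {x. r \<le> \<bar>x\<bar>} x * wt x ^ m \<partial>M k) \<le> e" if e: "0 < e" for e
  proof -
    obtain R where R: "\<And>k. (\<integral>x. indicator {x. R \<le> \<bar>x\<bar>} x * wt x ^ m \<partial>M k) \<le> e" using tails[OF e] by blast
    have "(\<integral>x. indicator {x. r \<le> \<bar>x\<bar>} x * wt x ^ m \<partial>M k) \<le> e" if "max 1 R \<le> r" for r k
    proof -
      have "(\<integral>x. indicator {x. r \<le> \<bar>x\<bar>} x * wt x ^ m \<partial>M k) \<le> (\<integral>x. indicator {x. R \<le> \<bar>x\<bar>} x * wt x ^ m \<partial>M k)"
        by (intro integral_mono tail_i) (use that in \<open>auto simp: indicator_def\<close>)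
      then show ?thesis using R[of k] by linarith
    qed
    then show ?thesis by (intro exI[of _ "max 1 R"]) auto
  qed
  have iG: "integrable lborel (\<lambda>x. wt x ^ m * G x / Z)" using G_wt_integrable[of m] by simp
  have iM: "integrable lborel (\<lambda>x. wt x ^ m * us k x)" for k by (rule iu[OF mom]) simp
  show int: "integrable lborel (\<lambda>x. wt x ^ m * \<bar>us k x - G x / Z\<bar>)" for k
  proof -
    have "integrable lborel (\<lambda>x. \<bar>wt x ^ m * us k x - wt x ^ m * G x / Z\<bar>)"
      using iM iG by (intro integrable_abs Bochner_Integration.integrable_diff)
    moreover have "\<bar>wt x ^ m * us k x - wt x ^ m * G x / Z\<bar> = wt x ^ m * \<bar>us k x - G x / Z\<bar>" for x
    proof -
      have "wt x ^ m * us k x - wt x ^ m * G x / Z = wt x ^ m * (us k x - G x / Z)"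
        by (simp add: right_diff_distrib)
      then show ?thesis by (simp add: abs_mult)
    qed
    ultimately show ?thesis by simp
  qed
  have \<kappa>_small: "\<forall>\<^sub>F k in sequentially. 2 * \<Gamma> * \<delta> k / s * Z < e" if "0 < e" for \<Gamma> e
  proof -
    have "(\<lambda>k. 2 * \<Gamma> * \<delta> k / s * Z) \<longlonglongrightarrow> 2 * \<Gamma> * 0 / s * Z" by (intro tendsto_intros \<delta>) (use s_pos in auto)
    then show ?thesis using that by (intro order_tendstoD) auto
  qed
  have level_lim: "\<forall>\<^sub>F k in sequentially. \<bar>level (M k) - 1 / Z\<bar> \<le> e" if e: "0 < e" for e
  proof -
    define \<gamma> where "\<gamma> = Gset {-1<..<1}"
    have \<gamma>: "0 < \<gamma>" using G_interval_pos[of 1] by (simp add: \<gamma>_def Gset_def)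
    \<comment> \<open>Three errors of size \<open>\<eta>\<close> arise: the flux, the tail of
      \<open>M k\<close> and the tail of \<open>G\<close>. Dividing by the \<open>Gset\<close> of
      the interval, which is at least \<open>\<gamma>\<close>, turns them into
      \<open>e\<close>.\<close>
    define \<eta> where "\<eta> = e * \<gamma> / 3"
    have \<eta>: "0 < \<eta>" using e \<gamma> by (simp add: \<eta>_def)
    obtain R1 where R1: "1 \<le> R1" "\<And>r k. R1 \<le> r \<Longrightarrow> (\<integral>x. indicator {x. r \<le> \<bar>x\<bar>} x * wt x ^ m \<partial>M k) \<le> \<eta>"
      using tails'[OF \<eta>] by blast
    have "0 < \<eta> * Z" using \<eta> Z_pos by simp
    then obtain R2 where R2: "1 \<le> R2"
      "\<And>r. R2 \<le> r \<Longrightarrow> (\<integral>x. indicator {x. r \<le> \<bar>x\<bar>} x * (wt x ^ 0 * G x) \<partial>lborel) \<le> \<eta> * Z"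
      by (rule G_tail[of _ 0]) (auto intro: that)
    define R where "R = max R1 R2"
    have R: "1 \<le> R" "R1 \<le> R" "R2 \<le> R" using R1 R2 by (auto simp: R_def)
    obtain \<Gamma> where \<Gamma>: "0 \<le> \<Gamma>" "\<And>x. \<bar>x\<bar> \<le> R \<Longrightarrow> 1 / G x \<le> \<Gamma>"
      by (rule inverse_G_bound[of R]) (auto intro: that)
    let ?I = "{-R<..<R}"
    have split: "indicator ?I x + indicator {x. R \<le> \<bar>x\<bar>} x = (1 :: real)" for x
      by (auto simp: indicator_def abs_if)
    have ZR: "Z - Gset ?I \<le> \<eta> * Z" "Gset ?I \<le> Z" "\<gamma> \<le> Gset ?I"
    proof -
      have t: "integrable lborel (\<lambda>x. indicator {x. R \<le> \<bar>x\<bar>} x * G x)" by (rule Gset_integrable) measurable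
      have g: "integrable lborel (\<lambda>x. indicator ?I x * G x)" by (rule Gset_integrable) simp
      have "Z = (\<integral>x. indicator ?I x * G x + indicator {x. R \<le> \<bar>x\<bar>} x * G x \<partial>lborel)"
        unfolding Z_def distrib_right[symmetric] split by simp
      also have "\<dots> = Gset ?I + (\<integral>x. indicator {x. R \<le> \<bar>x\<bar>} x * G x \<partial>lborel)" using t g by (simp add: Gset_def)
      finally show "Z - Gset ?I \<le> \<eta> * Z" using R2(2)[OF R(3)] by simp
      show "Gset ?I \<le> Z" unfolding Gset_def Z_def
        by (intro integral_mono g G_integrable) (auto simp: indicator_def)
      have g1: "integrable lborel (\<lambda>x. indicator {-1<..<1} x * G x)" by (rule Gset_integrable) simp
      show "\<gamma> \<le> Gset ?I" unfolding \<gamma>_def Gset_def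
        by (intro integral_mono g g1) (use R in \<open>auto simp: indicator_def\<close>)
    qed
    have MR: "1 - measure (M k) ?I \<le> \<eta>" "measure (M k) ?I \<le> 1" for k
    proof -
      interpret prob_space "M k" by (rule prob)
      show "measure (M k) ?I \<le> 1" by simp
      have sp: "space (M k) = UNIV" using sets_eq_imp_space_eq[OF sM] by simp
      have mI: "?I \<in> sets (M k)" "{x. R \<le> \<bar>x\<bar>} \<in> sets (M k)" unfolding sM by measurable
      have "{x. R \<le> \<bar>x\<bar>} = space (M k) - ?I" unfolding sp by (auto simp: abs_if)
      then have "1 - measure (M k) ?I = measure (M k) {x. R \<le> \<bar>x\<bar>}" using prob_compl[OF mI(1)] by simp
      also have "\<dots> = (\<integral>x. indicator {x. R \<le> \<bar>x\<bar>} x \<partial>M k)" using sp by simp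
      also have "\<dots> \<le> (\<integral>x. indicator {x. R \<le> \<bar>x\<bar>} x * wt x ^ m \<partial>M k)"
        by (intro integral_mono tail_i integrable_real_indicator mI) (auto simp: indicator_def emeasure_eq_measure)
      also have "\<dots> \<le> \<eta>" by (rule R1(2)[OF R(2)])
      finally show "1 - measure (M k) ?I \<le> \<eta>" .
    qed
    from \<kappa>_small[OF \<eta>, of \<Gamma>] show ?thesis
    proof eventually_elim
      case (elim k)
      have \<kappa>0: "0 \<le> 2 * \<Gamma> * \<delta> k / s" using \<Gamma> \<delta>0 s_pos by simp
      have "\<bar>measure (M k) ?I - level (M k) * Gset ?I\<bar> \<le> 2 * \<Gamma> * \<delta> k / s * Gset ?I"
        by (rule small_flux_set[OF sf R(1) \<Gamma>]) auto
      also have "\<dots> \<le> 2 * \<Gamma> * \<delta> k / s * Z" using ZR(2) \<kappa>0 by (rule mult_left_mono)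
      also have "\<dots> \<le> \<eta>" using elim by simp
      finally have 1: "\<bar>measure (M k) ?I - level (M k) * Gset ?I\<bar> \<le> \<eta>" .
      define g where "g = Gset ?I / Z"
      have 2: "1 - g \<le> \<eta>" "g \<le> 1" using ZR Z_pos by (auto simp: g_def field_simps)
      have "\<bar>level (M k) * Gset ?I - g\<bar> \<le> 3 * \<eta>" using 1 2 MR[of k] by (auto simp: abs_le_iff)
      then have "\<bar>(level (M k) - 1 / Z) * Gset ?I\<bar> \<le> 3 * \<eta>" by (simp add: g_def left_diff_distrib)
      then have "\<bar>level (M k) - 1 / Z\<bar> * Gset ?I \<le> e * \<gamma>" using ZR(3) \<gamma> by (simp add: abs_mult \<eta>_def)
      also have "\<dots> \<le> e * Gset ?I" using ZR(3) e by (intro mult_left_mono) auto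
      finally show ?case using ZR(3) \<gamma> by simp
    qed
  qed
  show "(\<lambda>k. \<integral>x. wt x ^ m * \<bar>us k x - G x / Z\<bar> \<partial>lborel) \<longlonglongrightarrow> 0"
  proof (rule LIMSEQ_I)
    fix e' :: real assume e': "0 < e'"
    \<comment> \<open>Four terms of size \<open>e\<close> will appear, so that their sum stays
      strictly below \<open>e'\<close>.\<close>
    define e where "e = e' / 5"
    have e: "0 < e" using e' by (simp add: e_def)
    obtain R1 where R1: "1 \<le> R1" "\<And>r k. R1 \<le> r \<Longrightarrow> (\<integral>x. indicator {x. r \<le> \<bar>x\<bar>} x * wt x ^ m \<partial>M k) \<le> e"
      using tails'[OF e] by blast
    have "0 < e * Z" using e Z_pos by simp
    then obtain R2 where R2: "1 \<le> R2"
      "\<And>r. R2 \<le> r \<Longrightarrow> (\<integral>x. indicator {x. r \<le> \<bar>x\<bar>} x * (wt x ^ m * G x) \<partial>lborel) \<le> e * Z"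
      by (rule G_tail[of _ m]) (auto intro: that)
    define R where "R = max R1 R2"
    have R: "1 \<le> R" "R1 \<le> R" "R2 \<le> R" using R1 R2 by (auto simp: R_def)
    obtain \<Gamma> where \<Gamma>: "0 \<le> \<Gamma>" "\<And>x. \<bar>x\<bar> \<le> R \<Longrightarrow> 1 / G x \<le> \<Gamma>"
      by (rule inverse_G_bound[of R]) (auto intro: that)
    define w where "w = wt R ^ m"
    have w: "1 \<le> w" by (simp add: w_def)
    \<comment> \<open>Inside the interval the weight is at most \<open>w\<close>, so the flux error
      and the error of the level are both taken smaller by this factor.\<close>
    have e2: "0 < e / w" "0 < e / (w * Z)" using e w Z_pos by auto
    from \<kappa>_small[OF e2(1), of \<Gamma>] level_lim[OF e2(2)]
    have "\<forall>\<^sub>F k in sequentially. norm ((\<integral>x. wt x ^ m * \<bar>us k x - G x / Z\<bar> \<partial>lborel) - 0) < e'"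
    proof eventually_elim
      case (elim k)
      let ?I = "{-R<..<R}" and ?T = "{x. R \<le> \<bar>x\<bar>}"
      have L1: "integrable lborel (us k)"
        "(\<integral>x. indicator ?I x * \<bar>us k x - level (M k) * G x\<bar> \<partial>lborel) \<le> 2 * \<Gamma> * \<delta> k / s * Z"
        by (rule small_flux_L1[OF sf us R(1) \<Gamma>(1)], erule \<Gamma>(2))+
      have i1: "integrable lborel (\<lambda>x. indicator ?I x * \<bar>us k x - level (M k) * G x\<bar>)"
        using integrable_mult_indicator[of ?I lborel "\<lambda>x. \<bar>us k x - level (M k) * G x\<bar>"] L1(1) G_integrable by simp
      have i2: "integrable lborel (\<lambda>x. indicator ?T x * wt x ^ m * us k x)"
        by (rule iu[OF tail_i]) measurable
      have i3: "integrable lborel (\<lambda>x. indicator ?T x * (wt x ^ m * G x))"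
        using integrable_mult_indicator[OF _ G_wt_integrable, of ?T] by simp
      let ?F = "\<lambda>x. w * (indicator ?I x * \<bar>us k x - level (M k) * G x\<bar>) + w * (\<bar>level (M k) - 1 / Z\<bar> * G x)
          + indicator ?T x * wt x ^ m * us k x + (1 / Z) * (indicator ?T x * (wt x ^ m * G x))"
      have "(\<integral>x. wt x ^ m * \<bar>us k x - G x / Z\<bar> \<partial>lborel) \<le> (\<integral>x. ?F x \<partial>lborel)"
      proof (rule integral_mono[OF int])
        show "integrable lborel ?F"
          by (intro Bochner_Integration.integrable_add integrable_mult_right i1 i2 i3 G_integrable)
        fix x
        show "wt x ^ m * \<bar>us k x - G x / Z\<bar> \<le> ?F x"
        proof (cases "x \<in> ?I")
          case True
          then have "\<bar>x\<bar>\<^sup>2 \<le> R\<^sup>2" by (intro power_mono) auto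
          then have wx: "wt x ^ m \<le> w" unfolding w_def by (intro power_mono) (simp_all add: wt_def)
          have "us k x - G x / Z = (us k x - level (M k) * G x) + (level (M k) - 1 / Z) * G x"
            by (simp add: left_diff_distrib)
          then have "\<bar>us k x - G x / Z\<bar> \<le> \<bar>us k x - level (M k) * G x\<bar> + \<bar>level (M k) - 1 / Z\<bar> * G x"
            using abs_triangle_ineq[of "us k x - level (M k) * G x" "(level (M k) - 1 / Z) * G x"]
            by (simp add: abs_mult)
          then have "wt x ^ m * \<bar>us k x - G x / Z\<bar> \<le> w * (\<bar>us k x - level (M k) * G x\<bar> + \<bar>level (M k) - 1 / Z\<bar> * G x)"
            using wx w by (intro mult_mono) auto
          then show ?thesis using True by (auto simp: distrib_left)
        next
          case False
          then have T: "x \<in> ?T" by (auto simp: abs_if)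
          have "\<bar>us k x - G x / Z\<bar> \<le> us k x + G x / Z"
            using u0[of k x] Z_pos by (simp add: abs_le_iff less_imp_le)
          then have "wt x ^ m * \<bar>us k x - G x / Z\<bar> \<le> wt x ^ m * (us k x + G x / Z)" by (intro mult_left_mono) auto
          moreover have "0 \<le> w * (\<bar>level (M k) - 1 / Z\<bar> * G x)" using w by simp
          ultimately show ?thesis using T False by (simp add: distrib_left)
        qed
      qed
      also have "\<dots> = w * (\<integral>x. indicator ?I x * \<bar>us k x - level (M k) * G x\<bar> \<partial>lborel) + w * (\<bar>level (M k) - 1 / Z\<bar> * Z)
          + (\<integral>x. indicator ?T x * wt x ^ m \<partial>M k) + (1 / Z) * (\<integral>x. indicator ?T x * (wt x ^ m * G x) \<partial>lborel)"
        unfolding eu[OF tail_i, symmetric, simplified] 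
        by (subst Bochner_Integration.integral_add Bochner_Integration.integral_add
            | intro Bochner_Integration.integrable_add integrable_mult_right i1 i2 i3 G_integrable
            | simp only: integral_mult_right_zero Z_def)+
      also have "\<dots> \<le> w * (e / w) + w * (e / (w * Z) * Z) + e + (1 / Z) * (e * Z)"
        using w elim Z_pos L1(2) R1(2)[OF R(2)] R2(2)[OF R(3)]
        by (intro add_mono mult_left_mono mult_right_mono) auto
      also have "\<dots> = 4 * e" using w Z_pos by simp
      also have "\<dots> < e'" using e' by (simp add: e_def)
      finally have "(\<integral>x. wt x ^ m * \<bar>us k x - G x / Z\<bar> \<partial>lborel) < e'" .
      moreover have "0 \<le> (\<integral>x. wt x ^ m * \<bar>us k x - G x / Z\<bar> \<partial>lborel)" by simp
      ultimately show ?case by simp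
    qed
    then show "\<exists>no. \<forall>n\<ge>no. norm ((\<integral>x. wt x ^ m * \<bar>us n x - G x / Z\<bar> \<partial>lborel) - 0) < e'"
      by (simp add: eventually_sequentially)
  qed
qed

end

section \<open>The coupled system\<close>

text \<open>Otherwise \<open>min (f n t) c\<close> tends to \<open>c\<close> at every
  \<open>t\<close>, and dominated convergence makes the integrals tend to
  \<open>c * (b - a)\<close>, which exceeds \<open>B\<close>. This is Fatou's lemma in a form that
  produces one time for infinitely many \<open>n\<close>.\<close>

lemma frequently_small_at_some_time:
  fixes f :: "nat \<Rightarrow> real \<Rightarrow> real"
  assumes ab: "a < b" and cont: "\<And>n. continuous_on {a..b} (f n)"
    and nonneg: "\<And>n t. t \<in> {a..b} \<Longrightarrow> 0 \<le> f n t"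
    and B: "\<forall>\<^sub>F n in sequentially. integral {a..b} (f n) \<le> B" "B < c * (b - a)" and c: "0 \<le> c"
  obtains t where "t \<in> {a..b}" "\<exists>\<^sub>F n in sequentially. f n t \<le> c"
proof (rule ccontr)
  assume "\<not> thesis"
  with that have large: "\<forall>\<^sub>F n in sequentially. c < f n t" if "t \<in> {a..b}" for t
    using \<open>t \<in> {a..b}\<close> unfolding frequently_def by (auto simp: not_le)
  have ci: "(\<lambda>t. min (f n t) c) integrable_on {a..b}" "f n integrable_on {a..b}" for n
    by (intro integrable_continuous_real continuous_intros cont)+
  have "(\<lambda>n. integral {a..b} (\<lambda>t. min (f n t) c)) \<longlonglongrightarrow> integral {a..b} (\<lambda>t. c)"
  proof (rule dominated_convergence(2)[where h = "\<lambda>t. c"])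
    show "(\<lambda>n. min (f n t) c) \<longlonglongrightarrow> c" if "t \<in> {a..b}" for t
    proof (rule Lim_transform_eventually[rotated])
      show "\<forall>\<^sub>F n in sequentially. c = min (f n t) c" using large[OF that] by eventually_elim simp
    qed simp
    show "norm (min (f n t) c) \<le> c" if "t \<in> {a..b}" for n t using nonneg[OF that, of n] c by simp
  qed (use ci in auto)
  moreover have "\<forall>\<^sub>F n in sequentially. integral {a..b} (\<lambda>t. min (f n t) c) \<le> B"
    using B(1)
  proof eventually_elim
    case (elim n)
    have "integral {a..b} (\<lambda>t. min (f n t) c) \<le> integral {a..b} (f n)" by (intro integral_le ci) simp
    with elim show ?case by simp
  qed
  ultimately have "integral {a..b} (\<lambda>t. c) \<le> B" by (rule tendsto_upperbound) simp
  then show False using ab B(2) by (simp add: mult.commute)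
qed

lemma common_convergent_subsequence:
  fixes x :: "'i \<Rightarrow> nat \<Rightarrow> real"
  assumes "finite I" "\<And>i n. i \<in> I \<Longrightarrow> \<bar>x i n\<bar> \<le> H"
  shows "\<exists>r l. strict_mono r \<and> (\<forall>i\<in>I. (\<lambda>n. x i (r n)) \<longlonglongrightarrow> l i)"
  using assms
proof (induction I)
  case empty
  have "strict_mono (id :: nat \<Rightarrow> nat)" by (simp add: strict_mono_def)
  then show ?case by blast
next
  case (insert j I)
  then have "\<exists>r l. strict_mono r \<and> (\<forall>i\<in>I. (\<lambda>n. x i (r n)) \<longlonglongrightarrow> l i)" by auto
  then obtain r l where r: "strict_mono r" "\<And>i. i \<in> I \<Longrightarrow> (\<lambda>n. x i (r n)) \<longlonglongrightarrow> l i" by blast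
  have "bounded (range (\<lambda>n. x j (r n)))" using insert.prems by (auto simp: bounded_iff)
  then obtain l' r' where r': "strict_mono r'" "((\<lambda>n. x j (r n)) \<circ> r') \<longlonglongrightarrow> l'"
    using bounded_imp_convergent_subsequence by blast
  have "(\<lambda>n. x i ((r \<circ> r') n)) \<longlonglongrightarrow> (l(j := l')) i" if "i \<in> insert j I" for i
  proof (cases "i = j")
    case True
    then show ?thesis using r'(2) by (simp add: o_def)
  next
    case False
    then have "(\<lambda>n. x i (r n)) \<longlonglongrightarrow> l i" using r(2) that by auto
    from LIMSEQ_subseq_LIMSEQ[OF this r'(1)] False show ?thesis by (simp add: o_def)
  qed
  moreover have "strict_mono (r \<circ> r')" using r(1) r'(1) by (rule strict_mono_o)
  ultimately show ?case by blast
qed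

locale fp_system =
  fixes M p Q :: nat and s Cb a :: "nat \<Rightarrow> real" and W b :: "nat \<Rightarrow> real \<Rightarrow> real"
    and \<alpha> :: "nat \<Rightarrow> nat \<Rightarrow> real" and \<mu> :: "real \<Rightarrow> nat \<Rightarrow> real measure" and m h :: "nat \<Rightarrow> real \<Rightarrow> real"
  assumes m_eq: "\<And>j t. m j t = (\<integral>x. x \<partial>\<mu> t j)"
    and h_eq: "\<And>i t. h i t = (\<Sum>j = 1..M. a j * \<alpha> i j * m j t)"
    and fp: "\<And>i. i \<in> {1..M} \<Longrightarrow> weak_fp_cont (s i) (Cb i) (W i) (b i) (h i) (\<lambda>t. \<mu> t i) p Q"
    and a: "\<And>i. i \<in> {1..M} \<Longrightarrow> 0 \<le> a i" "(\<Sum>i = 1..M. a i) = 1"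
    and sym: "\<And>i j. i \<in> {1..M} \<Longrightarrow> j \<in> {1..M} \<Longrightarrow> \<alpha> i j = \<alpha> j i"
    and entropy: "\<And>i. i \<in> {1..M} \<Longrightarrow> finite_entropy (\<mu> 0 i)"
begin

definition md :: "nat \<Rightarrow> real \<Rightarrow> real" where "md i = weak_fp_cont.mdot (b i) (h i) (\<lambda>t. \<mu> t i)"
definition D :: "nat \<Rightarrow> nat \<Rightarrow> real \<Rightarrow> real" where
  "D i = weak_fp_cont.diss (s i) (b i) (h i) (\<lambda>t. \<mu> t i) p"
definition PP :: "nat \<Rightarrow> nat \<Rightarrow> real \<Rightarrow> real" where "PP i = weak_fp_cont.PT (b i) (\<lambda>t. \<mu> t i) Q"
definition m2 :: "nat \<Rightarrow> real \<Rightarrow> real" where "m2 i t = (\<integral>x. x\<^sup>2 \<partial>\<mu> t i)"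
definition \<Lambda> :: real where "\<Lambda> = 1 + (\<Sum>i = 1..M. \<Sum>j = 1..M. \<bar>\<alpha> i j\<bar>)"

lemma \<Lambda>: "1 \<le> \<Lambda>" "i \<in> {1..M} \<Longrightarrow> j \<in> {1..M} \<Longrightarrow> \<bar>\<alpha> i j\<bar> \<le> \<Lambda>"
proof -
  show "1 \<le> \<Lambda>" unfolding \<Lambda>_def by (simp add: sum_nonneg)
  assume i: "i \<in> {1..M}" and j: "j \<in> {1..M}"
  have "\<bar>\<alpha> i j\<bar> \<le> (\<Sum>j = 1..M. \<bar>\<alpha> i j\<bar>)" using j by (intro member_le_sum) auto
  also have "\<dots> \<le> (\<Sum>i = 1..M. \<Sum>j = 1..M. \<bar>\<alpha> i j\<bar>)"
    using i by (intro member_le_sum[of i "{1..M}" "\<lambda>i. \<Sum>j = 1..M. \<bar>\<alpha> i j\<bar>"]) (auto intro: sum_nonneg)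
  finally show "\<bar>\<alpha> i j\<bar> \<le> \<Lambda>" by (simp add: \<Lambda>_def)
qed

lemma props:
  assumes i: "i \<in> {1..M}"
  shows "continuous_on {0..T} (h i)" "continuous_on {0..T} (md i)" "continuous_on {0..T} (m i)"
    "continuous_on {0..T} (D i n)" "0 \<le> D i n t" "0 \<le> t \<Longrightarrow> (md i t)\<^sup>2 \<le> D i n t"
    "continuous_on {0..T} (PP i n)" "0 \<le> PP i n t"
    "t \<in> {0..T} \<Longrightarrow> (m i has_real_derivative md i t) (at t within {0..T})"
    "0 \<le> t \<Longrightarrow> (m i t)\<^sup>2 \<le> m2 i t" "continuous_on {0..T} (m2 i)"
proof -
  interpret C: weak_fp_cont "s i" "Cb i" "W i" "b i" "h i" "\<lambda>t. \<mu> t i" p Q by (rule fp[OF i])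
  have mf: "m i = (\<lambda>t. \<integral>x. x \<partial>\<mu> t i)" by (rule ext) (rule m_eq)
  show "continuous_on {0..T} (h i)" by (rule C.h_cont)
  show "continuous_on {0..T} (md i)" unfolding md_def by (rule C.mdot_continuous)
  show "continuous_on {0..T} (D i n)" "0 \<le> D i n t" "0 \<le> t \<Longrightarrow> (md i t)\<^sup>2 \<le> D i n t"
    unfolding D_def md_def by (rule C.diss_props, assumption?)+
  show "continuous_on {0..T} (PP i n)" "0 \<le> PP i n t"
    unfolding PP_def by (rule C.PT_continuous C.PT_nonneg)+
  show "t \<in> {0..T} \<Longrightarrow> (m i has_real_derivative md i t) (at t within {0..T})" for t
    unfolding md_def mf by (rule C.mean_derivative)
  then show "continuous_on {0..T} (m i)"
    by (meson DERIV_continuous continuous_on_eq_continuous_within)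
  show "0 \<le> t \<Longrightarrow> (m i t)\<^sup>2 \<le> m2 i t" unfolding m2_def m_eq by (rule C.mean_square_le)
  show "continuous_on {0..T} (m2 i)" unfolding m2_def[abs_def] by (rule C.second_moment_continuous)
qed

text \<open>Jensen's inequality for the probability weights \<open>a i\<close>, obtained from a
  nonnegative variance.\<close>

lemma weighted_square:
  fixes x :: "nat \<Rightarrow> real"
  shows "(\<Sum>i = 1..M. a i * x i)\<^sup>2 \<le> (\<Sum>i = 1..M. a i * (x i)\<^sup>2)"
proof -
  define A where "A = (\<Sum>i = 1..M. a i * x i)"
  have "0 \<le> (\<Sum>i = 1..M. a i * (x i - A)\<^sup>2)" using a by (intro sum_nonneg) auto
  also have "\<dots> = (\<Sum>i = 1..M. a i * (x i)\<^sup>2 - 2 * A * (a i * x i) + A\<^sup>2 * a i)"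
    by (intro sum.cong refl) (simp add: power2_eq_square algebra_simps)
  also have "\<dots> = (\<Sum>i = 1..M. a i * (x i)\<^sup>2) - A\<^sup>2"
    unfolding sum.distrib sum_subtractf sum_distrib_left[symmetric] a(2) A_def[symmetric]
    by (simp add: power2_eq_square)
  finally show ?thesis by (simp add: A_def)
qed

lemma coupling_bound:
  fixes x :: "nat \<Rightarrow> real"
  assumes i: "i \<in> {1..M}"
  shows "(\<Sum>j = 1..M. a j * \<alpha> i j * x j)\<^sup>2 \<le> \<Lambda>\<^sup>2 * (\<Sum>j = 1..M. a j * (x j)\<^sup>2)"
proof -
  have "\<bar>\<Sum>j = 1..M. a j * \<alpha> i j * x j\<bar> \<le> (\<Sum>j = 1..M. \<bar>a j * \<alpha> i j * x j\<bar>)" by (rule sum_abs)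
  also have "\<dots> \<le> (\<Sum>j = 1..M. \<Lambda> * (a j * \<bar>x j\<bar>))"
  proof (rule sum_mono)
    fix j assume j: "j \<in> {1..M}"
    have "\<bar>\<alpha> i j\<bar> * (a j * \<bar>x j\<bar>) \<le> \<Lambda> * (a j * \<bar>x j\<bar>)"
      using \<Lambda>(2)[OF i j] a(1)[OF j] by (intro mult_right_mono) auto
    then show "\<bar>a j * \<alpha> i j * x j\<bar> \<le> \<Lambda> * (a j * \<bar>x j\<bar>)" using a(1)[OF j] by (simp add: abs_mult ac_simps)
  qed
  finally have "\<bar>\<Sum>j = 1..M. a j * \<alpha> i j * x j\<bar> \<le> \<Lambda> * (\<Sum>j = 1..M. a j * \<bar>x j\<bar>)"
    by (simp add: sum_distrib_left)
  then have "\<bar>\<Sum>j = 1..M. a j * \<alpha> i j * x j\<bar>\<^sup>2 \<le> (\<Lambda> * (\<Sum>j = 1..M. a j * \<bar>x j\<bar>))\<^sup>2"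
    by (rule power_mono) simp
  also have "\<dots> = \<Lambda>\<^sup>2 * (\<Sum>j = 1..M. a j * \<bar>x j\<bar>)\<^sup>2" by (simp add: power_mult_distrib)
  also have "\<dots> \<le> \<Lambda>\<^sup>2 * (\<Sum>j = 1..M. a j * \<bar>x j\<bar>\<^sup>2)" by (intro mult_left_mono weighted_square) simp
  finally show ?thesis by simp
qed

section \<open>The free energy of the system\<close>

definition interaction :: "real \<Rightarrow> real" where "interaction t = (\<Sum>i = 1..M. a i * h i t * m i t) / 2"

text \<open>By symmetry of \<open>\<alpha>\<close> the two sums from the product rule agree after
  exchanging indices, and the factor \<open>1 / 2\<close> disappears. What remains is the total work
  of the mean fields in the energy estimates.\<close>

lemma interaction_derivative:
  assumes t: "t \<in> {0..T}"
  shows "(interaction has_real_derivative (\<Sum>i = 1..M. a i * h i t * md i t)) (at t within {0..T})"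
proof -
  have hd: "(h i has_real_derivative (\<Sum>j = 1..M. a j * \<alpha> i j * md j t)) (at t within {0..T})" for i
  proof -
    have "h i = (\<lambda>t. \<Sum>j = 1..M. a j * \<alpha> i j * m j t)" by (rule ext) (rule h_eq)
    then show ?thesis by (simp only:) (intro DERIV_sum DERIV_cmult props(9) t)
  qed
  have "(interaction has_real_derivative (\<Sum>i = 1..M. a i * h i t * md i t +
      a i * (\<Sum>j = 1..M. a j * \<alpha> i j * md j t) * m i t) / 2) (at t within {0..T})"
    unfolding interaction_def[abs_def]
    by (intro DERIV_cdivide DERIV_sum DERIV_mult' DERIV_cmult hd props(9) t)
  moreover have "(\<Sum>i = 1..M. a i * (\<Sum>j = 1..M. a j * \<alpha> i j * md j t) * m i t) = (\<Sum>i = 1..M. a i * h i t * md i t)"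
  proof -
    have "(\<Sum>i = 1..M. a i * (\<Sum>j = 1..M. a j * \<alpha> i j * md j t) * m i t)
        = (\<Sum>i = 1..M. \<Sum>j = 1..M. a i * a j * \<alpha> i j * md j t * m i t)"
      by (simp add: sum_distrib_left sum_distrib_right ac_simps)
    also have "\<dots> = (\<Sum>j = 1..M. \<Sum>i = 1..M. a i * a j * \<alpha> i j * md j t * m i t)" by (rule sum.swap)
    also have "\<dots> = (\<Sum>j = 1..M. \<Sum>i = 1..M. a j * (a i * \<alpha> j i * m i t) * md j t)"
      using sym by (intro sum.cong refl) (simp add: ac_simps)
    also have "\<dots> = (\<Sum>i = 1..M. a i * h i t * md i t)"
      unfolding h_eq by (simp add: sum_distrib_left sum_distrib_right)
    finally show ?thesis .
  qed
  ultimately show ?thesis by (simp add: sum.distrib)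
qed

text \<open>The coefficient is half of the \<open>\<Lambda>\<close> with which second moments will
  enter the energy estimates, so the interaction can be absorbed and half of the moments
  remains.\<close>

lemma interaction_bound: "interaction t \<le> \<Lambda> * (\<Sum>i = 1..M. a i * (m i t)\<^sup>2) / 2"
proof -
  define q where "q = (\<Sum>i = 1..M. a i * (m i t)\<^sup>2)"
  have q: "0 \<le> q" unfolding q_def using a by (intro sum_nonneg) auto
  have hq: "\<bar>h i t\<bar> \<le> \<Lambda> * sqrt q" if i: "i \<in> {1..M}" for i
  proof -
    have "(h i t)\<^sup>2 \<le> (\<Lambda> * sqrt q)\<^sup>2"
      unfolding h_eq using coupling_bound[OF i, of "\<lambda>j. m j t"] q by (simp add: power_mult_distrib q_def)
    then show ?thesis using \<Lambda>(1) q by (simp add: abs_le_square_iff[symmetric] abs_mult)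
  qed
  have "(\<Sum>i = 1..M. a i * h i t * m i t) \<le> (\<Sum>i = 1..M. \<Lambda> * sqrt q * (a i * \<bar>m i t\<bar>))"
  proof (rule sum_mono)
    fix i assume i: "i \<in> {1..M}"
    have "h i t * m i t \<le> \<bar>h i t\<bar> * \<bar>m i t\<bar>" by (metis abs_ge_self abs_mult)
    also have "\<dots> \<le> \<Lambda> * sqrt q * \<bar>m i t\<bar>" by (intro mult_right_mono hq i) simp
    finally have "a i * (h i t * m i t) \<le> a i * (\<Lambda> * sqrt q * \<bar>m i t\<bar>)" using a(1)[OF i] by (intro mult_left_mono)
    then show "a i * h i t * m i t \<le> \<Lambda> * sqrt q * (a i * \<bar>m i t\<bar>)" by (simp add: ac_simps)
  qed
  also have "\<dots> = \<Lambda> * sqrt q * (\<Sum>i = 1..M. a i * \<bar>m i t\<bar>)" by (simp add: sum_distrib_left)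
  also have "\<dots> \<le> \<Lambda> * sqrt q * sqrt q"
  proof (intro mult_left_mono real_le_rsqrt)
    show "(\<Sum>i = 1..M. a i * \<bar>m i t\<bar>)\<^sup>2 \<le> q" using weighted_square[of "\<lambda>i. \<bar>m i t\<bar>"] by (simp add: q_def)
  qed (use \<Lambda>(1) q in simp)
  also have "\<dots> = \<Lambda> * q" using q by simp
  finally show ?thesis by (simp add: interaction_def q_def)
qed

text \<open>The free energy of the system is a Lyapunov function: weighting the energy estimates with
  \<open>a i\<close> turns the work of the mean field into the increment of \<open>interaction\<close>.\<close>

lemma free_energy_bound:
  obtains C where "\<And>T. 0 \<le> T \<Longrightarrow> (\<Sum>i = 1..M. a i * (m i T)\<^sup>2) \<le> C"
    "\<And>T. 0 \<le> T \<Longrightarrow> integral {0..T} (\<lambda>t. \<Sum>i = 1..M. a i * (md i t)\<^sup>2) \<le> C"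
proof -
  have "\<forall>i\<in>{1..M}. \<exists>C. \<forall>T\<ge>0. \<forall>e>0. \<forall>\<^sub>F n in sequentially.
    \<Lambda> * m2 i T + integral {0..T} (D i n) / 2 \<le> C + integral {0..T} (\<lambda>t. h i t * md i t) + e"
  proof
    fix i assume i: "i \<in> {1..M}"
    interpret C: weak_fp_cont "s i" "Cb i" "W i" "b i" "h i" "\<lambda>t. \<mu> t i" p Q by (rule fp[OF i])
    show "\<exists>C. \<forall>T\<ge>0. \<forall>e>0. \<forall>\<^sub>F n in sequentially.
      \<Lambda> * m2 i T + integral {0..T} (D i n) / 2 \<le> C + integral {0..T} (\<lambda>t. h i t * md i t) + e"
    \<comment> \<open>The factor \<open>\<Lambda>\<close> is chosen so that second moments outweigh
      the interaction energy.\<close>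
    proof (rule C.energy_estimate[OF entropy[OF i], of \<Lambda>])
      show "0 \<le> \<Lambda>" using \<Lambda>(1) by simp
    qed (auto simp: D_def md_def m2_def)
  qed
  from bchoice[OF this] obtain E where E: "\<And>i T e. i \<in> {1..M} \<Longrightarrow> 0 \<le> T \<Longrightarrow> 0 < e \<Longrightarrow> \<forall>\<^sub>F n in sequentially.
    \<Lambda> * m2 i T + integral {0..T} (D i n) / 2 \<le> E i + integral {0..T} (\<lambda>t. h i t * md i t) + e" by blast
  define C' where "C' = (\<Sum>i = 1..M. a i * (E i + 1)) - interaction 0"
  have main: "\<Lambda> * (\<Sum>i = 1..M. a i * (m i T)\<^sup>2) / 2 + integral {0..T} (\<lambda>t. \<Sum>i = 1..M. a i * (md i t)\<^sup>2) / 2 \<le> C'"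
    if T: "0 \<le> T" for T
  proof -
    have "\<forall>\<^sub>F n in sequentially. \<forall>i\<in>{1..M}.
        \<Lambda> * m2 i T + integral {0..T} (D i n) / 2 \<le> E i + integral {0..T} (\<lambda>t. h i t * md i t) + 1"
      using E[OF _ T, of _ 1] by (intro eventually_ball_finite) auto
    then obtain n where n: "\<And>i. i \<in> {1..M} \<Longrightarrow>
        \<Lambda> * m2 i T + integral {0..T} (D i n) / 2 \<le> E i + integral {0..T} (\<lambda>t. h i t * md i t) + 1"
      using eventually_happens'[OF sequentially_bot] by blast
    have ihm: "(\<lambda>t. h i t * md i t) integrable_on {0..T}" "(\<lambda>t. (md i t)\<^sup>2) integrable_on {0..T}"
      "D i n integrable_on {0..T}" if "i \<in> {1..M}" for i
      using that by (intro integrable_continuous_real continuous_intros props; simp)+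
    have hi: "((\<lambda>t. \<Sum>i = 1..M. a i * h i t * md i t) has_integral (interaction T - interaction 0)) {0..T}"
      by (rule fundamental_theorem_of_calculus[OF T])
         (use interaction_derivative in \<open>simp add: has_real_derivative_iff_has_vector_derivative\<close>)
    have "((\<lambda>t. \<Sum>i = 1..M. a i * (h i t * md i t)) has_integral
        (\<Sum>i = 1..M. a i * integral {0..T} (\<lambda>t. h i t * md i t))) {0..T}"
      by (intro has_integral_sum has_integral_mult_right integrable_integral ihm) auto
    then have work: "(\<Sum>i = 1..M. a i * integral {0..T} (\<lambda>t. h i t * md i t)) = interaction T - interaction 0"
      using hi by (intro has_integral_unique[of "\<lambda>t. \<Sum>i = 1..M. a i * (h i t * md i t)"]) (auto simp: mult.assoc)
    have md2: "integral {0..T} (\<lambda>t. \<Sum>i = 1..M. a i * (md i t)\<^sup>2) = (\<Sum>i = 1..M. a i * integral {0..T} (\<lambda>t. (md i t)\<^sup>2))"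
      by (rule integral_unique) (intro has_integral_sum has_integral_mult_right integrable_integral ihm, auto)
    have "(\<Sum>i = 1..M. a i * (\<Lambda> * (m i T)\<^sup>2 + integral {0..T} (\<lambda>t. (md i t)\<^sup>2) / 2))
        \<le> (\<Sum>i = 1..M. a i * (E i + 1 + integral {0..T} (\<lambda>t. h i t * md i t)))"
    proof (intro sum_mono mult_left_mono a)
      fix i assume i: "i \<in> {1..M}"
      have "\<Lambda> * (m i T)\<^sup>2 \<le> \<Lambda> * m2 i T" using props(10)[OF i T] \<Lambda>(1) by (intro mult_left_mono) auto
      moreover have "integral {0..T} (\<lambda>t. (md i t)\<^sup>2) \<le> integral {0..T} (D i n)"
        by (intro integral_le ihm i) (use props(6)[OF i] in auto)
      ultimately show "\<Lambda> * (m i T)\<^sup>2 + integral {0..T} (\<lambda>t. (md i t)\<^sup>2) / 2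
          \<le> E i + 1 + integral {0..T} (\<lambda>t. h i t * md i t)" using n[OF i] by linarith
    qed
    also have "\<dots> = (\<Sum>i = 1..M. a i * (E i + 1)) + (\<Sum>i = 1..M. a i * integral {0..T} (\<lambda>t. h i t * md i t))"
      by (simp add: sum.distrib[symmetric] distrib_left)
    also have "\<dots> = C' + interaction T" unfolding C'_def work by simp
    also have "\<dots> \<le> C' + \<Lambda> * (\<Sum>i = 1..M. a i * (m i T)\<^sup>2) / 2" using interaction_bound by simp
    finally have "(\<Sum>i = 1..M. a i * (\<Lambda> * (m i T)\<^sup>2 + integral {0..T} (\<lambda>t. (md i t)\<^sup>2) / 2))
        \<le> C' + \<Lambda> * (\<Sum>i = 1..M. a i * (m i T)\<^sup>2) / 2" .
    moreover have "(\<Sum>i = 1..M. a i * (\<Lambda> * (m i T)\<^sup>2 + integral {0..T} (\<lambda>t. (md i t)\<^sup>2) / 2))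
        = \<Lambda> * (\<Sum>i = 1..M. a i * (m i T)\<^sup>2) + integral {0..T} (\<lambda>t. \<Sum>i = 1..M. a i * (md i t)\<^sup>2) / 2"
      unfolding md2 by (simp add: distrib_left sum.distrib sum_distrib_left sum_divide_distrib ac_simps)
    ultimately show ?thesis by simp
  qed
  show thesis
  proof (rule that[of "2 * C'"])
    fix T :: real assume T: "0 \<le> T"
    have q: "0 \<le> (\<Sum>i = 1..M. a i * (m i T)\<^sup>2)" using a by (intro sum_nonneg) auto
    have c: "continuous_on {0..T} (\<lambda>t. \<Sum>i = 1..M. a i * (md i t)\<^sup>2)" by (intro continuous_intros props)
    have d: "0 \<le> integral {0..T} (\<lambda>t. \<Sum>i = 1..M. a i * (md i t)\<^sup>2)"
      using a by (intro integral_nonneg integrable_continuous_real c) (auto intro: sum_nonneg)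
    have "1 * (\<Sum>i = 1..M. a i * (m i T)\<^sup>2) \<le> \<Lambda> * (\<Sum>i = 1..M. a i * (m i T)\<^sup>2)"
      using \<Lambda>(1) q by (intro mult_right_mono) auto
    then show "(\<Sum>i = 1..M. a i * (m i T)\<^sup>2) \<le> 2 * C'"
      "integral {0..T} (\<lambda>t. \<Sum>i = 1..M. a i * (md i t)\<^sup>2) \<le> 2 * C'"
      using main[OF T] q d by linarith+
  qed
qed

text \<open>Both bounds hold for every component, including those of weight zero, because
  \<open>h i\<close> and its derivative involve the means only through the weights
  \<open>a j\<close>.\<close>

lemma mean_field_bound:
  obtains H where "0 \<le> H" "\<And>i t. i \<in> {1..M} \<Longrightarrow> 0 \<le> t \<Longrightarrow> \<bar>h i t\<bar> \<le> H"
    "\<And>i T. i \<in> {1..M} \<Longrightarrow> 0 \<le> T \<Longrightarrow> integral {0..T} (\<lambda>t. (\<Sum>j = 1..M. a j * \<alpha> i j * md j t)\<^sup>2) \<le> H"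
proof -
  obtain C where C: "\<And>T. 0 \<le> T \<Longrightarrow> (\<Sum>i = 1..M. a i * (m i T)\<^sup>2) \<le> C"
    "\<And>T. 0 \<le> T \<Longrightarrow> integral {0..T} (\<lambda>t. \<Sum>i = 1..M. a i * (md i t)\<^sup>2) \<le> C"
    using free_energy_bound by blast
  have C0: "0 \<le> C" using C(2)[of 0] by simp
  \<comment> \<open>The added one gives \<open>H \<ge> 1\<close>, so that
    \<open>(h i t)\<^sup>2 \<le> H\<close> implies the bound by \<open>H\<close> itself.\<close>
  define H where "H = \<Lambda>\<^sup>2 * C + 1"
  have H: "1 \<le> H" using C0 by (simp add: H_def)
  show thesis
  proof (rule that[of H])
    show "0 \<le> H" using H by simp
    fix i assume i: "i \<in> {1..M}"
    show "\<bar>h i t\<bar> \<le> H" if t: "0 \<le> t" for t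
    proof -
      have "(h i t)\<^sup>2 \<le> \<Lambda>\<^sup>2 * (\<Sum>j = 1..M. a j * (m j t)\<^sup>2)" unfolding h_eq by (rule coupling_bound[OF i])
      also have "\<dots> \<le> \<Lambda>\<^sup>2 * C" using C(1)[OF t] by (intro mult_left_mono) auto
      also have "\<dots> \<le> H * 1" by (simp add: H_def)
      also have "\<dots> \<le> H * H" using H by (intro mult_left_mono) auto
      finally show ?thesis using H by (simp add: abs_le_square_iff[symmetric] power2_eq_square[symmetric])
    qed
    fix T :: real assume T: "0 \<le> T"
    have "integral {0..T} (\<lambda>t. (\<Sum>j = 1..M. a j * \<alpha> i j * md j t)\<^sup>2) \<le> integral {0..T} (\<lambda>t. \<Lambda>\<^sup>2 * (\<Sum>j = 1..M. a j * (md j t)\<^sup>2))"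
      by (intro integral_le integrable_continuous_real continuous_intros props coupling_bound i) 
    also have "\<dots> \<le> \<Lambda>\<^sup>2 * C" using C(2)[OF T] by (simp add: mult_left_mono)
    also have "\<dots> \<le> H" by (simp add: H_def)
    finally show "integral {0..T} (\<lambda>t. (\<Sum>j = 1..M. a j * \<alpha> i j * md j t)\<^sup>2) \<le> H" .
  qed
qed

text \<open>The weights \<open>a i\<close> may vanish, so the dissipation of a single component need not be integrable
  in time; but it is \<open>o(T)\<close>, because the mean field driving it has a square integrable derivative.\<close>

lemma dissipation_sublinear:
  assumes i: "i \<in> {1..M}"
  obtains C where "\<And>l T. 0 < l \<Longrightarrow> 0 \<le> T \<Longrightarrow> \<forall>\<^sub>F n in sequentially. integral {0..T} (D i n) \<le> C * (1 + l * (1 + T) + 1 / l)"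
proof -
  interpret C: weak_fp_cont "s i" "Cb i" "W i" "b i" "h i" "\<lambda>t. \<mu> t i" p Q by (rule fp[OF i])
  obtain H where H: "0 \<le> H" "\<And>t. 0 \<le> t \<Longrightarrow> \<bar>h i t\<bar> \<le> H"
    "\<And>T. 0 \<le> T \<Longrightarrow> integral {0..T} (\<lambda>t. (\<Sum>j = 1..M. a j * \<alpha> i j * md j t)\<^sup>2) \<le> H"
  proof (rule mean_field_bound)
    fix H assume H: "0 \<le> H" "\<And>i t. i \<in> {1..M} \<Longrightarrow> 0 \<le> t \<Longrightarrow> \<bar>h i t\<bar> \<le> H"
      "\<And>i T. i \<in> {1..M} \<Longrightarrow> 0 \<le> T \<Longrightarrow> integral {0..T} (\<lambda>t. (\<Sum>j = 1..M. a j * \<alpha> i j * md j t)\<^sup>2) \<le> H"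
    show thesis by (rule that[OF H(1) H(2)[OF i] H(3)[OF i]])
  qed
  obtain C2 where C2: "0 \<le> C2" "\<And>T. 0 \<le> T \<Longrightarrow> integral {0..T} (m2 i) \<le> C2 * (1 + T)"
    using C.second_moment_integral[of H] H(2) unfolding m2_def[abs_def] by metis
  \<comment> \<open>With factor 1 the second moment at time \<open>T\<close> on the left will absorb
    the boundary term \<open>h i T * m i T\<close> of the integration by parts.\<close>
  obtain E where E: "\<And>T e. 0 \<le> T \<Longrightarrow> 0 < e \<Longrightarrow> \<forall>\<^sub>F n in sequentially.
      1 * m2 i T + integral {0..T} (D i n) / 2 \<le> E + integral {0..T} (\<lambda>t. h i t * md i t) + e"
    using C.energy_estimate[OF entropy[OF i], of 1] unfolding m2_def D_def md_def by auto
  define K where "K = \<bar>E\<bar> + 1 + H\<^sup>2 + \<bar>h i 0 * m i 0\<bar>"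
  have K: "0 \<le> K" by (simp add: K_def)
  define hd where "hd t = (\<Sum>j = 1..M. a j * \<alpha> i j * md j t)" for t
  have chd: "continuous_on {0..T} hd" for T unfolding hd_def[abs_def] by (intro continuous_intros props)
  show thesis
  proof (rule that[of "2 * (K + C2 + H)"])
    fix l T :: real assume l: "0 < l" and T: "0 \<le> T"
    have ib: "(\<lambda>t. h i t * md i t) integrable_on {0..T}" "(\<lambda>t. hd t * m i t) integrable_on {0..T}"
      "(\<lambda>t. l * m2 i t + (hd t)\<^sup>2 / l) integrable_on {0..T}" "m2 i integrable_on {0..T}" "(\<lambda>t. (hd t)\<^sup>2) integrable_on {0..T}"
      using l by (intro integrable_continuous_real continuous_intros props i chd; simp)+
    have "((\<lambda>t. h i t * m i t) has_real_derivative h i t * md i t + hd t * m i t) (at t within {0..T})"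
      if t: "t \<in> {0..T}" for t
    proof -
      have "(h i has_real_derivative hd t) (at t within {0..T})"
      proof -
        have "h i = (\<lambda>t. \<Sum>j = 1..M. a j * \<alpha> i j * m j t)" by (rule ext) (rule h_eq)
        then show ?thesis unfolding hd_def by (simp only:) (intro DERIV_sum DERIV_cmult props(9) t)
      qed
      from DERIV_mult'[OF this props(9)[OF i t]] show ?thesis .
    qed
    then have "((\<lambda>t. h i t * md i t + hd t * m i t) has_integral (h i T * m i T - h i 0 * m i 0)) {0..T}"
      by (intro fundamental_theorem_of_calculus T) (simp add: has_real_derivative_iff_has_vector_derivative)
    moreover have "((\<lambda>t. h i t * md i t + hd t * m i t) has_integral
        (integral {0..T} (\<lambda>t. h i t * md i t) + integral {0..T} (\<lambda>t. hd t * m i t))) {0..T}"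
      by (intro has_integral_add integrable_integral ib)
    \<comment> \<open>Integration by parts in time replaces \<open>md i\<close>, whose square
      integral is not controlled by the free energy when \<open>a i = 0\<close>, by the derivative
      \<open>hd\<close> of the mean field.\<close>
    ultimately have parts: "integral {0..T} (\<lambda>t. h i t * md i t) + integral {0..T} (\<lambda>t. hd t * m i t) = h i T * m i T - h i 0 * m i 0"
      by (rule has_integral_unique[symmetric])
    have "- integral {0..T} (\<lambda>t. hd t * m i t) = integral {0..T} (\<lambda>t. - (hd t * m i t))" by simp
    also have "\<dots> \<le> integral {0..T} (\<lambda>t. l * m2 i t + (hd t)\<^sup>2 / l)"
    proof (rule integral_le[OF integrable_neg[OF ib(2)] ib(3)])
      fix t assume t: "t \<in> {0..T}"
      \<comment> \<open>Young's inequality with the free parameter \<open>l\<close>: the second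
        moment will contribute a multiple of \<open>l * (1 + T)\<close>, small compared with
        \<open>T\<close> for small \<open>l\<close>, and the derivative of the mean field a multiple
        of \<open>1 / l\<close>.\<close>
      have "0 \<le> (l * m i t + hd t)\<^sup>2 / l" using l by simp
      also have "\<dots> = l * (m i t)\<^sup>2 + 2 * (hd t * m i t) + (hd t)\<^sup>2 / l"
        using l by (simp add: field_simps power2_eq_square)
      finally have 1: "- 2 * (hd t * m i t) \<le> l * (m i t)\<^sup>2 + (hd t)\<^sup>2 / l" by simp
      have "0 \<le> l * (m i t)\<^sup>2 + (hd t)\<^sup>2 / l" using l by simp
      moreover have "l * (m i t)\<^sup>2 \<le> l * m2 i t" using props(10)[OF i, of t] t l by (intro mult_left_mono) auto
      ultimately show "- (hd t * m i t) \<le> l * m2 i t + (hd t)\<^sup>2 / l" using 1 by linarith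
    qed
    also have "\<dots> = l * integral {0..T} (m2 i) + integral {0..T} (\<lambda>t. (hd t)\<^sup>2) / l"
      by (rule integral_unique) (intro has_integral_add has_integral_mult_right has_integral_divide integrable_integral ib)
    also have "\<dots> \<le> l * (C2 * (1 + T)) + H / l"
      using l C2(2)[OF T] H(3)[OF T] unfolding hd_def by (intro add_mono mult_left_mono divide_right_mono) auto
    finally have cross: "- integral {0..T} (\<lambda>t. hd t * m i t) \<le> l * (C2 * (1 + T)) + H / l" .
    have "h i T * m i T \<le> m2 i T + H\<^sup>2"
    proof -
      have "0 \<le> (h i T - m i T)\<^sup>2" by simp
      then have "2 * (h i T * m i T) \<le> (h i T)\<^sup>2 + (m i T)\<^sup>2" by (simp add: power2_eq_square algebra_simps)
      moreover have "(h i T)\<^sup>2 \<le> H\<^sup>2" using H(1) H(2)[OF T] by (simp add: abs_le_square_iff[symmetric])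
      ultimately show ?thesis using props(10)[OF i T] zero_le_power2[of "m i T"] zero_le_power2[of H] by linarith
    qed
    then have work: "integral {0..T} (\<lambda>t. h i t * md i t) \<le> m2 i T + H\<^sup>2 + \<bar>h i 0 * m i 0\<bar> + l * (C2 * (1 + T)) + H / l"
      using parts cross by linarith
    have lT: "0 \<le> l * (1 + T)" "0 \<le> 1 / l" using l T by auto
    from E[OF T zero_less_one] show "\<forall>\<^sub>F n in sequentially. integral {0..T} (D i n) \<le> 2 * (K + C2 + H) * (1 + l * (1 + T) + 1 / l)"
    proof (rule eventually_mono)
      fix n assume "1 * m2 i T + integral {0..T} (D i n) / 2 \<le> E + integral {0..T} (\<lambda>t. h i t * md i t) + 1"
      then have "integral {0..T} (D i n) / 2 \<le> K * 1 + C2 * (l * (1 + T)) + H * (1 / l)"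
      proof -
        define X Y where "X = C2 * (l * (1 + T))" and "Y = H * (1 / l)"
        have "l * (C2 * (1 + T)) = X" "H / l = Y" by (simp_all add: X_def Y_def)
        then have "integral {0..T} (\<lambda>t. h i t * md i t) \<le> m2 i T + H\<^sup>2 + \<bar>h i 0 * m i 0\<bar> + X + Y"
          using work by simp
        then show ?thesis unfolding X_def[symmetric] Y_def[symmetric] K_def mult_1_right
          using \<open>1 * m2 i T + integral {0..T} (D i n) / 2 \<le> E + integral {0..T} (\<lambda>t. h i t * md i t) + 1\<close>
            abs_ge_self[of E] by linarith
      qed
      also have "\<dots> \<le> (K + C2 + H) * (1 + l * (1 + T) + 1 / l)"
      proof -
        have "K * 1 \<le> K * (1 + l * (1 + T) + 1 / l)" using lT K by (intro mult_left_mono) auto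
        moreover have "C2 * (l * (1 + T)) \<le> C2 * (1 + l * (1 + T) + 1 / l)" using lT C2 by (intro mult_left_mono) auto
        moreover have "H * (1 / l) \<le> H * (1 + l * (1 + T) + 1 / l)" using lT H by (intro mult_left_mono) auto
        ultimately show ?thesis by (simp add: distrib_right)
      qed
      finally show "integral {0..T} (D i n) \<le> 2 * (K + C2 + H) * (1 + l * (1 + T) + 1 / l)"
        unfolding mult.assoc by linarith
    qed
  qed
qed

end

section \<open>Choice of the times and passage to the limit\<close>

context fp_system begin

text \<open>One nonnegative function collects all requirements: the sum over the components of a
  large multiple of the dissipation and of the truncated \<open>P\<close>. Because the dissipation
  is sublinear, the large factor does not enter the linear growth of the integral when
  \<open>T\<close> is large enough; hence the function is moderate at some time in
  \<open>{T / 2..T}\<close>.\<close>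

lemma good_times:
  obtains c where "0 < c" "\<And>k. \<exists>t\<ge>real k. \<forall>i\<in>{1..M}. \<exists>\<^sub>F n in sequentially. D i n t \<le> 1 / real (Suc k) \<and> PP i n t \<le> c"
proof -
  obtain H where H: "0 \<le> H" "\<And>i t. i \<in> {1..M} \<Longrightarrow> 0 \<le> t \<Longrightarrow> \<bar>h i t\<bar> \<le> H"
  proof (rule mean_field_bound)
    fix H assume H: "0 \<le> H" "\<And>i t. i \<in> {1..M} \<Longrightarrow> 0 \<le> t \<Longrightarrow> \<bar>h i t\<bar> \<le> H"
    show thesis by (rule that[OF H])
  qed
  have "\<forall>i\<in>{1..M}. \<exists>C. 0 \<le> C \<and> (\<forall>T\<ge>0. \<forall>n. integral {0..T} (PP i n) \<le> C * (1 + T))"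
  proof
    fix i assume i: "i \<in> {1..M}"
    interpret C: weak_fp_cont "s i" "Cb i" "W i" "b i" "h i" "\<lambda>t. \<mu> t i" p Q by (rule fp[OF i])
    show "\<exists>C. 0 \<le> C \<and> (\<forall>T\<ge>0. \<forall>n. integral {0..T} (PP i n) \<le> C * (1 + T))"
      unfolding PP_def by (rule C.PT_integral[OF H(2)[OF i]]) blast+
  qed
  from bchoice[OF this] obtain Cp where Cp: "\<And>i. i \<in> {1..M} \<Longrightarrow> 0 \<le> Cp i"
    "\<And>i T n. i \<in> {1..M} \<Longrightarrow> 0 \<le> T \<Longrightarrow> integral {0..T} (PP i n) \<le> Cp i * (1 + T)" by blast
  have "\<forall>i\<in>{1..M}. \<exists>C. \<forall>l>0. \<forall>T\<ge>0. \<forall>\<^sub>F n in sequentially. integral {0..T} (D i n) \<le> C * (1 + l * (1 + T) + 1 / l)"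
  proof
    fix i assume i: "i \<in> {1..M}"
    show "\<exists>C. \<forall>l>0. \<forall>T\<ge>0. \<forall>\<^sub>F n in sequentially. integral {0..T} (D i n) \<le> C * (1 + l * (1 + T) + 1 / l)"
      by (rule dissipation_sublinear[OF i]) blast
  qed
  from bchoice[OF this] obtain Cd where Cd: "\<And>i l T. i \<in> {1..M} \<Longrightarrow> 0 < l \<Longrightarrow> 0 \<le> T \<Longrightarrow>
      \<forall>\<^sub>F n in sequentially. integral {0..T} (D i n) \<le> Cd i * (1 + l * (1 + T) + 1 / l)" by blast
  define cp where "cp = (\<Sum>i = 1..M. Cp i)"
  define cd where "cd = (\<Sum>i = 1..M. \<bar>Cd i\<bar>) + 1"
  have cp: "0 \<le> cp" unfolding cp_def by (rule sum_nonneg) (rule Cp(1))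
  have cd: "1 \<le> cd" by (simp add: cd_def sum_nonneg)
  \<comment> \<open>The interval \<open>{T / 2..T}\<close> turns this into
    \<open>c * (T / 2) = (2 * cp + 2) * T\<close>, above the bound
    \<open>(5 / 4 + 2 * cp) * T\<close> shown for the integral.\<close>
  define c where "c = 4 * cp + 4"
  have c: "0 < c" using cp by (simp add: c_def)
  show thesis
  proof (rule that[OF c])
    fix k :: nat
    \<comment> \<open>With this factor a total of at most \<open>c\<close> forces
      \<open>D i n t \<le> 1 / real (Suc k)\<close>.\<close>
    define X where "X = c * real (Suc k)"
    have X: "0 < X" using c by (simp add: X_def)
    \<comment> \<open>This makes the part of the dissipation proportional to \<open>T\<close> equal
      to \<open>T / 8\<close> after multiplication by \<open>X * cd\<close>; the remaining part is
      brought below \<open>T / 8\<close> by the choice of \<open>T\<close>.\<close>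
    define l where "l = 1 / (8 * cd * X)"
    have l: "0 < l" using cd X by (simp add: l_def)
    define T where "T = max (2 * real k + 2) (max (8 * cd * X * (1 + l + 1 / l)) (1 + 8 * cp))"
    have T: "2 * real k + 2 \<le> T" "8 * cd * X * (1 + l + 1 / l) \<le> T" "1 + 8 * cp \<le> T" by (auto simp: T_def)
    have T0: "0 < T" using T(1) by (smt (verit) of_nat_0_le_iff)
    define f where "f n t = (\<Sum>i = 1..M. X * D i n t + PP i n t)" for n t
    have cf: "continuous_on {a..b} (\<lambda>t. X * D i n t + PP i n t)" if "0 \<le> a" "i \<in> {1..M}" for a b i n
    proof (rule continuous_on_subset)
      show "continuous_on {0..b} (\<lambda>t. X * D i n t + PP i n t)" by (intro continuous_intros props that)
    qed (use that in auto)
    have fi: "(f n has_integral (\<Sum>i = 1..M. X * integral {0..T} (D i n) + integral {0..T} (PP i n))) {0..T}" for n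
      unfolding f_def[abs_def]
      by (intro has_integral_sum has_integral_add has_integral_mult_right integrable_integral
          integrable_continuous_real props) auto
    have f0: "0 \<le> X * D i n t + PP i n t" if "i \<in> {1..M}" for i n t using props(5,8)[OF that] X by simp
    have fn0: "0 \<le> f n t" for n t unfolding f_def by (intro sum_nonneg f0)
    have cfn: "continuous_on {a..b} (f n)" if "0 \<le> a" for a b n
      unfolding f_def[abs_def] by (intro continuous_on_sum cf that)
    have "\<forall>\<^sub>F n in sequentially. \<forall>i\<in>{1..M}. integral {0..T} (D i n) \<le> Cd i * (1 + l * (1 + T) + 1 / l)"
      using Cd[OF _ l, of _ T] T0 by (intro eventually_ball_finite) auto
    then have "\<forall>\<^sub>F n in sequentially. integral {T / 2..T} (f n) \<le> (5 / 4 + 2 * cp) * T"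
    proof eventually_elim
      case (elim n)
      have w: "0 \<le> 1 + l * (1 + T) + 1 / l" using l T0 by simp
      have "integral {T / 2..T} (f n) \<le> integral {0..T} (f n)"
        using T0 fn0 by (intro integral_subset_le integrable_continuous_real cfn) auto
      also have "\<dots> = (\<Sum>i = 1..M. X * integral {0..T} (D i n) + integral {0..T} (PP i n))"
        by (rule integral_unique[OF fi])
      also have "\<dots> \<le> (\<Sum>i = 1..M. X * (\<bar>Cd i\<bar> * (1 + l * (1 + T) + 1 / l)) + Cp i * (1 + T))"
      proof (intro sum_mono add_mono mult_left_mono)
        fix i assume i: "i \<in> {1..M}"
        have "Cd i * (1 + l * (1 + T) + 1 / l) \<le> \<bar>Cd i\<bar> * (1 + l * (1 + T) + 1 / l)"
          using w by (intro mult_right_mono) auto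
        then show "integral {0..T} (D i n) \<le> \<bar>Cd i\<bar> * (1 + l * (1 + T) + 1 / l)" using elim i by fastforce
        show "integral {0..T} (PP i n) \<le> Cp i * (1 + T)" using Cp(2)[OF i] T0 by simp
      qed (use X in simp)
      also have "\<dots> = X * (cd - 1) * (1 + l * (1 + T) + 1 / l) + cp * (1 + T)"
        by (simp add: sum.distrib sum_distrib_left sum_distrib_right cd_def cp_def ac_simps)
      also have "\<dots> \<le> X * cd * (1 + l * (1 + T) + 1 / l) + cp * (T + T)"
      proof (rule add_mono)
        show "X * (cd - 1) * (1 + l * (1 + T) + 1 / l) \<le> X * cd * (1 + l * (1 + T) + 1 / l)"
          using X by (intro mult_right_mono mult_left_mono w) auto
        show "cp * (1 + T) \<le> cp * (T + T)" by (rule mult_left_mono[OF _ cp]) (use T(3) cp in simp)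
      qed
      also have "X * cd * (1 + l * (1 + T) + 1 / l) = X * cd * (1 + l + 1 / l) + X * cd * l * T"
        by (simp add: algebra_simps)
      also have "X * cd * l * T = T / 8" using X cd by (simp add: l_def)
      also have "X * cd * (1 + l + 1 / l) \<le> T / 8" using T(2) by (simp add: ac_simps)
      finally show ?case using T0 by (simp add: algebra_simps)
    qed
    moreover have "(5 / 4 + 2 * cp) * T < c * (T - T / 2)" using T0 by (simp add: c_def algebra_simps)
    ultimately obtain t where t: "t \<in> {T / 2..T}" "\<exists>\<^sub>F n in sequentially. f n t \<le> c"
      using frequently_small_at_some_time[of "T / 2" T f "(5 / 4 + 2 * cp) * T" c] T0 cfn fn0 c by auto
    show "\<exists>t\<ge>real k. \<forall>i\<in>{1..M}. \<exists>\<^sub>F n in sequentially. D i n t \<le> 1 / real (Suc k) \<and> PP i n t \<le> c"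
    proof (intro exI[of _ t] conjI ballI)
      show "real k \<le> t" using t T(1) by simp
      fix i assume i: "i \<in> {1..M}"
      show "\<exists>\<^sub>F n in sequentially. D i n t \<le> 1 / real (Suc k) \<and> PP i n t \<le> c"
      proof (rule frequently_elim1[OF t(2)])
        fix n assume "f n t \<le> c"
        moreover have "X * D i n t + PP i n t \<le> f n t"
          unfolding f_def using i by (intro member_le_sum[of i _ "\<lambda>i. X * D i n t + PP i n t"] f0) auto
        ultimately have le: "X * D i n t + PP i n t \<le> c" by simp
        have "0 \<le> X * D i n t" using X props(5)[OF i] by simp
        then have 1: "PP i n t \<le> c" using le by linarith
        have "X * D i n t \<le> c" using le props(8)[OF i, of n t] by linarith
        then have "c * (real (Suc k) * D i n t) \<le> c * 1" by (simp only: X_def mult.assoc mult_1_right)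
        then have "real (Suc k) * D i n t \<le> 1" using c by (simp only: mult_le_cancel_left_pos)
        then have "D i n t \<le> 1 / real (Suc k)" by (simp add: field_simps)
        then show "D i n t \<le> 1 / real (Suc k) \<and> PP i n t \<le> c" using 1 by simp
      qed
    qed
  qed
qed

text \<open>The Gibbs measures stay hidden: only their densities, the self-consistency of
  \<open>hs\<close> and the stationary equation with the mean field frozen at \<open>hs\<close> are
  exported, which is what the final statement asks for.\<close>

lemma convergence_along_times:
  obtains t :: "nat \<Rightarrow> real" and \<nu> :: "nat \<Rightarrow> real measure" and hs :: "nat \<Rightarrow> real" and us :: "nat \<Rightarrow> nat \<Rightarrow> real \<Rightarrow> real"
    and v :: "nat \<Rightarrow> real \<Rightarrow> real"
  where "\<And>k. 0 \<le> t k" "filterlim t at_top sequentially"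
    "\<And>i k. i \<in> {1..M} \<Longrightarrow> is_density (us i k) (\<mu> (t k) i)"
    "\<And>i. i \<in> {1..M} \<Longrightarrow> is_density (v i) (\<nu> i)"
    "\<And>i k. i \<in> {1..M} \<Longrightarrow> integrable lborel (\<lambda>x. wt x ^ Q * \<bar>us i k x - v i x\<bar>)"
    "\<And>i. i \<in> {1..M} \<Longrightarrow> (\<lambda>k. \<integral>x. wt x ^ Q * \<bar>us i k x - v i x\<bar> \<partial>lborel) \<longlonglongrightarrow> 0"
    "\<And>i. i \<in> {1..M} \<Longrightarrow> probability_on_reals (\<nu> i)"
    "\<And>i. i \<in> {1..M} \<Longrightarrow> integrable (\<nu> i) (\<lambda>x. \<bar>x\<bar>)"
    "\<And>i. i \<in> {1..M} \<Longrightarrow> hs i = (\<Sum>j = 1..M. a j * \<alpha> i j * (\<integral>x. x \<partial>\<nu> j))"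
    "\<And>i \<phi>1 \<phi>2 R. i \<in> {1..M} \<Longrightarrow> (\<And>x. (\<phi>1 has_real_derivative \<phi>2 x) (at x)) \<Longrightarrow> continuous_on UNIV \<phi>2 \<Longrightarrow>
      (\<And>x. R < \<bar>x\<bar> \<Longrightarrow> \<phi>1 x = 0) \<Longrightarrow> (\<And>x. R < \<bar>x\<bar> \<Longrightarrow> \<phi>2 x = 0) \<Longrightarrow>
      (\<integral>x. s i * \<phi>2 x - (b i x - hs i) * \<phi>1 x \<partial>\<nu> i) = 0"
proof -
  obtain c where c: "0 < c" and "\<And>k. \<exists>t\<ge>real k. \<forall>i\<in>{1..M}. \<exists>\<^sub>F n in sequentially. D i n t \<le> 1 / real (Suc k) \<and> PP i n t \<le> c"
    using good_times by blast
  then have "\<exists>t0. \<forall>k. real k \<le> t0 k \<and> (\<forall>i\<in>{1..M}. \<exists>\<^sub>F n in sequentially. D i n (t0 k) \<le> 1 / real (Suc k) \<and> PP i n (t0 k) \<le> c)"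
    by (intro choice) blast
  then obtain t0 where t0: "\<And>k. real k \<le> t0 k"
    "\<And>k i. i \<in> {1..M} \<Longrightarrow> \<exists>\<^sub>F n in sequentially. D i n (t0 k) \<le> 1 / real (Suc k) \<and> PP i n (t0 k) \<le> c" by blast
  obtain H where H: "\<And>i t. i \<in> {1..M} \<Longrightarrow> 0 \<le> t \<Longrightarrow> \<bar>h i t\<bar> \<le> H"
  proof (rule mean_field_bound)
    fix H assume H: "\<And>i t. i \<in> {1..M} \<Longrightarrow> 0 \<le> t \<Longrightarrow> \<bar>h i t\<bar> \<le> H"
    show thesis by (rule that[OF H])
  qed
  have t00: "0 \<le> t0 k" for k using t0(1)[of k] by (meson of_nat_0_le_iff order_trans)
  \<comment> \<open>At each time the mean fields are finitely many bounded numbers, so compactness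
    provides limits along a common subsequence.\<close>
  have "\<exists>r l. strict_mono r \<and> (\<forall>i\<in>{1..M}. (\<lambda>n. h i (t0 (r n))) \<longlonglongrightarrow> l i)"
    by (rule common_convergent_subsequence[of _ "\<lambda>i n. h i (t0 n)" H]) (use H t00 in auto)
  then obtain r hs where r: "strict_mono r" and hs: "\<And>i. i \<in> {1..M} \<Longrightarrow> (\<lambda>n. h i (t0 (r n))) \<longlonglongrightarrow> hs i" by blast
  define t where "t k = t0 (r k)" for k
  have tk: "real k \<le> t k" for k
    using t0(1)[of "r k"] seq_suble[OF r, of k] unfolding t_def by (meson of_nat_le_iff order_trans)
  have t_nonneg: "0 \<le> t k" for k unfolding t_def by (rule t00)
  have tlim: "filterlim t at_top sequentially"
    by (rule filterlim_at_top_mono[OF filterlim_real_sequentially]) (use tk in auto)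
  define \<nu> where "\<nu> i = gibbs.gibbs_measure (s i) (hs i) (W i)" for i
  define v where "v i x = gibbs.G (s i) (hs i) (W i) x / gibbs.Z (s i) (hs i) (W i)" for i x
  have gibbs: "gibbs (s i) (W i) (b i)" if i: "i \<in> {1..M}" for i
  proof -
    interpret C: weak_fp_cont "s i" "Cb i" "W i" "b i" "h i" "\<lambda>t. \<mu> t i" p Q by (rule fp[OF i])
    show ?thesis
    proof
      show "\<exists>C. \<forall>x. K * x\<^sup>2 \<le> W i x + C" for K by (rule C.W_coercive[of K]) blast
    qed (rule C.s_pos C.W_deriv C.b_cont)+
  qed
  have Q1: "1 \<le> Q" if i: "i \<in> {1..M}" for i
  proof -
    interpret C: weak_fp_cont "s i" "Cb i" "W i" "b i" "h i" "\<lambda>t. \<mu> t i" p Q by (rule fp[OF i])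
    show ?thesis using C.Q_ge by simp
  qed
  have "\<forall>i\<in>{1..M}. \<exists>us. (\<forall>k. is_density (us k) (\<mu> (t k) i)) \<and>
      (\<forall>k. integrable lborel (\<lambda>x. wt x ^ Q * \<bar>us k x - v i x\<bar>)) \<and>
      (\<lambda>k. \<integral>x. wt x ^ Q * \<bar>us k x - v i x\<bar> \<partial>lborel) \<longlonglongrightarrow> 0"
  proof
    fix i assume i: "i \<in> {1..M}"
    interpret C: weak_fp_cont "s i" "Cb i" "W i" "b i" "h i" "\<lambda>t. \<mu> t i" p Q by (rule fp[OF i])
    interpret Gb: gibbs "s i" "hs i" "W i" "b i" by (rule gibbs[OF i])
    \<comment> \<open>The first summand bounds the flux taken with the mean field at time
      \<open>t k\<close>, the second is the cost of replacing this mean field by its limit.\<close>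
    define \<delta> where "\<delta> k = sqrt (1 / real (Suc (r k))) + \<bar>h i (t k) - hs i\<bar>" for k
    have freq: "\<exists>\<^sub>F n in sequentially. D i n (t k) \<le> 1 / real (Suc (r k))" "\<exists>\<^sub>F n in sequentially. PP i n (t k) \<le> c" for k
      using t0(2)[OF i, of "r k"] unfolding t_def by (auto elim: frequently_elim1)
    have sf: "Gb.small_flux (\<mu> (t k) i) (\<delta> k)" for k
      unfolding Gb.small_flux_def
    proof (intro conjI allI impI)
      interpret prob_space "\<mu> (t k) i" by (rule C.prob[OF t_nonneg])
      show "prob_space (\<mu> (t k) i)" by (rule C.prob[OF t_nonneg])
      show "sets (\<mu> (t k) i) = sets borel" by (rule C.sets_mu[OF t_nonneg])
      show "0 \<le> \<delta> k" by (simp add: \<delta>_def)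
      fix \<phi> \<phi>1 :: "real \<Rightarrow> real" and R A :: real
      assume d: "\<forall>x. (\<phi> has_real_derivative \<phi>1 x) (at x)" and c1: "continuous_on UNIV \<phi>1"
        and supp: "\<forall>x. R < \<bar>x\<bar> \<longrightarrow> \<phi> x = 0 \<and> \<phi>1 x = 0" and A: "\<forall>x. \<bar>\<phi> x\<bar> \<le> A"
      have c0: "continuous_on UNIV \<phi>" using d by (meson DERIV_isCont continuous_at_imp_continuous_on)
      have flux: "\<bar>\<integral>x. s i * \<phi>1 x - (b i x - h i (t k)) * \<phi> x \<partial>\<mu> (t k) i\<bar> \<le> A * sqrt (1 / real (Suc (r k)))"
        by (rule C.flux_duality_limit[OF t_nonneg, of \<phi> \<phi>1 R])
           (use d c1 supp A freq(1)[of k, unfolded D_def] in auto)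
      have i1: "integrable (\<mu> (t k) i) (\<lambda>x. s i * \<phi>1 x - (b i x - h i (t k)) * \<phi> x)"
        by (rule C.integrable_compact_support_mu[OF t_nonneg, of _ R])
           (use supp in \<open>auto intro!: continuous_intros c0 c1 C.b_cont\<close>)
      have i2: "integrable (\<mu> (t k) i) \<phi>"
        by (rule C.integrable_compact_support_mu[OF t_nonneg c0, of R]) (use supp in auto)
      have "(\<integral>x. s i * \<phi>1 x - (b i x - hs i) * \<phi> x \<partial>\<mu> (t k) i)
          = (\<integral>x. (s i * \<phi>1 x - (b i x - h i (t k)) * \<phi> x) + (hs i - h i (t k)) * \<phi> x \<partial>\<mu> (t k) i)"
        by (intro Bochner_Integration.integral_cong refl) (simp add: algebra_simps)
      also have "\<dots> = (\<integral>x. s i * \<phi>1 x - (b i x - h i (t k)) * \<phi> x \<partial>\<mu> (t k) i) + (hs i - h i (t k)) * (\<integral>x. \<phi> x \<partial>\<mu> (t k) i)"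
        using i1 i2 by simp
      finally have eq: "(\<integral>x. s i * \<phi>1 x - (b i x - hs i) * \<phi> x \<partial>\<mu> (t k) i)
        = (\<integral>x. s i * \<phi>1 x - (b i x - h i (t k)) * \<phi> x \<partial>\<mu> (t k) i) + (hs i - h i (t k)) * (\<integral>x. \<phi> x \<partial>\<mu> (t k) i)" .
      have "\<bar>\<integral>x. \<phi> x \<partial>\<mu> (t k) i\<bar> \<le> (\<integral>x. \<bar>\<phi> x\<bar> \<partial>\<mu> (t k) i)" by (rule integral_abs_bound)
      also have "\<dots> \<le> (\<integral>x. A \<partial>\<mu> (t k) i)" using i2 A by (intro integral_mono) auto
      also have "\<dots> = A" by (simp add: prob_space)
      finally have "\<bar>hs i - h i (t k)\<bar> * \<bar>\<integral>x. \<phi> x \<partial>\<mu> (t k) i\<bar> \<le> \<bar>hs i - h i (t k)\<bar> * A"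
        by (rule mult_left_mono) simp
      then have "\<bar>(hs i - h i (t k)) * (\<integral>x. \<phi> x \<partial>\<mu> (t k) i)\<bar> \<le> A * \<bar>h i (t k) - hs i\<bar>"
        by (simp add: abs_mult abs_minus_commute mult.commute)
      then show "\<bar>\<integral>x. s i * \<phi>1 x - (b i x - hs i) * \<phi> x \<partial>\<mu> (t k) i\<bar> \<le> A * \<delta> k"
        unfolding eq \<delta>_def distrib_left using flux by linarith
    qed
    have \<delta>0: "\<delta> \<longlonglongrightarrow> 0"
    proof -
      have "(\<lambda>n. sqrt (1 / real (Suc n))) \<longlonglongrightarrow> 0" by real_asymp
      from LIMSEQ_subseq_LIMSEQ[OF this r] have 1: "(\<lambda>k. sqrt (1 / real (Suc (r k)))) \<longlonglongrightarrow> 0" by (simp add: o_def)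
      have "(\<lambda>k. \<bar>h i (t k) - hs i\<bar>) \<longlonglongrightarrow> \<bar>hs i - hs i\<bar>"
        using hs[OF i] unfolding t_def by (intro tendsto_intros)
      from tendsto_add[OF 1 this] show ?thesis by (simp add: \<delta>_def[abs_def])
    qed
    have mom: "integrable (\<mu> (t k) i) (\<lambda>x. wt x ^ Q)" for k
      by (rule C.integrable_growth[OF t_nonneg, of _ 1 Q]) auto
    have Pk: "integrable (\<mu> (t k) i) C.P" "(\<integral>x. C.P x \<partial>\<mu> (t k) i) \<le> c" for k
      using C.P_limit[OF t_nonneg freq(2)[unfolded PP_def]] by auto
    \<comment> \<open>A bounded integral of the superlinear function \<open>P\<close> makes
      \<open>wt x ^ Q\<close> uniformly integrable, as in the criterion of de la Vallee
      Poussin.\<close>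
    have tails: "\<exists>R. \<forall>k. (\<integral>x. indicator {x. R \<le> \<bar>x\<bar>} x * wt x ^ Q \<partial>\<mu> (t k) i) \<le> e" if e: "0 < e" for e
    proof -
      obtain K where K: "0 \<le> K" "\<And>x. (c / e + 1) * wt x ^ Q \<le> C.P x + K"
        using C.P_superlinear[of "c / e + 1"] by metis
      \<comment> \<open>The additive constant \<open>K\<close> doubles as the radius: for
        \<open>\<bar>x\<bar> \<ge> K\<close> it is at most \<open>wt x ^ Q\<close> and is absorbed
        by the added one in \<open>c / e + 1\<close>.\<close>
      have "(\<integral>x. indicator {x. K \<le> \<bar>x\<bar>} x * wt x ^ Q \<partial>\<mu> (t k) i) \<le> e" for k
      proof -
        have pt: "indicator {x. K \<le> \<bar>x\<bar>} x * wt x ^ Q \<le> (e / c) * C.P x" for x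
        proof (cases "K \<le> \<bar>x\<bar>")
          case True
          have "K \<le> wt x ^ 1" using True abs_le_wt[of x] by simp
          also have "\<dots> \<le> wt x ^ Q" by (rule wt_pow_mono) (rule Q1[OF i])
          finally have "c / e * wt x ^ Q \<le> C.P x" using K(2)[of x] by (simp add: distrib_right)
          then have "(e / c) * (c / e * wt x ^ Q) \<le> (e / c) * C.P x" using e c by (intro mult_left_mono) auto
          then show ?thesis using True e c by simp
        qed (use e c in simp)
        have "{x. K \<le> \<bar>x\<bar>} \<in> sets (\<mu> (t k) i)" unfolding C.sets_mu[OF t_nonneg] by measurable
        from integrable_mult_indicator[OF this mom[of k]]
        have "(\<integral>x. indicator {x. K \<le> \<bar>x\<bar>} x * wt x ^ Q \<partial>\<mu> (t k) i) \<le> (\<integral>x. (e / c) * C.P x \<partial>\<mu> (t k) i)"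
          using Pk by (intro integral_mono pt) auto
        also have "\<dots> = (e / c) * (\<integral>x. C.P x \<partial>\<mu> (t k) i)" by simp
        also have "\<dots> \<le> (e / c) * c" using Pk(2) e c by (intro mult_left_mono) auto
        finally show ?thesis using c by simp
      qed
      then show ?thesis by blast
    qed
    have "\<forall>k. \<exists>u. is_density u (\<mu> (t k) i)" using Gb.small_flux_density[OF sf] by blast
    from choice[OF this] obtain us where us: "\<And>k. is_density (us k) (\<mu> (t k) i)" by blast
    show "\<exists>us. (\<forall>k. is_density (us k) (\<mu> (t k) i)) \<and>
      (\<forall>k. integrable lborel (\<lambda>x. wt x ^ Q * \<bar>us k x - v i x\<bar>)) \<and>
      (\<lambda>k. \<integral>x. wt x ^ Q * \<bar>us k x - v i x\<bar> \<partial>lborel) \<longlonglongrightarrow> 0"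
      using us Gb.small_flux_converges[OF sf \<delta>0 mom tails us] unfolding v_def by blast
  qed
  from bchoice[OF this] obtain us where us: "\<And>i k. i \<in> {1..M} \<Longrightarrow> is_density (us i k) (\<mu> (t k) i)"
    "\<And>i k. i \<in> {1..M} \<Longrightarrow> integrable lborel (\<lambda>x. wt x ^ Q * \<bar>us i k x - v i x\<bar>)"
    "\<And>i. i \<in> {1..M} \<Longrightarrow> (\<lambda>k. \<integral>x. wt x ^ Q * \<bar>us i k x - v i x\<bar> \<partial>lborel) \<longlonglongrightarrow> 0" by blast
  have \<nu>props: "is_density (v i) (\<nu> i)" "probability_on_reals (\<nu> i)" "integrable (\<nu> i) (\<lambda>x. \<bar>x\<bar>)"
    "(\<integral>x. x \<partial>\<nu> i) = (\<integral>x. x * v i x \<partial>lborel)" "integrable lborel (\<lambda>x. x * v i x)" if i: "i \<in> {1..M}" for i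
  proof -
    interpret Gb: gibbs "s i" "hs i" "W i" "b i" by (rule gibbs[OF i])
    have v: "v i = (\<lambda>x. Gb.G x / Gb.Z)" by (rule ext) (simp add: v_def)
    have \<nu>: "\<nu> i = Gb.gibbs_measure" by (simp add: \<nu>_def)
    show "is_density (v i) (\<nu> i)" unfolding v \<nu> by (rule Gb.gibbs_density)
    show "probability_on_reals (\<nu> i)" unfolding \<nu> by (rule Gb.gibbs_prob)
    have w: "integrable lborel (\<lambda>x. wt x ^ 1 * Gb.G x / Gb.Z)" using Gb.G_wt_integrable[of 1] by simp
    show "integrable lborel (\<lambda>x. x * v i x)" unfolding v
    proof (rule Bochner_Integration.integrable_bound[OF w])
      show "AE x in lborel. norm (x * (Gb.G x / Gb.Z)) \<le> norm (wt x ^ 1 * Gb.G x / Gb.Z)"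
        using abs_le_wt Gb.Z_pos by (intro AE_I2) (simp add: abs_mult divide_right_mono mult_right_mono)
    qed simp
    then show "integrable (\<nu> i) (\<lambda>x. \<bar>x\<bar>)"
      unfolding \<nu> using Gb.gibbs_integral(2)[of "\<lambda>x. x"] by (simp add: v)
    show "(\<integral>x. x \<partial>\<nu> i) = (\<integral>x. x * v i x \<partial>lborel)"
      unfolding \<nu> v by (rule Gb.gibbs_integral(1)) simp
  qed
  have mlim: "(\<lambda>k. m i (t k)) \<longlonglongrightarrow> (\<integral>x. x \<partial>\<nu> i)" if i: "i \<in> {1..M}" for i
  proof (rule Lim_null[THEN iffD2], rule Lim_null_comparison[OF _ us(3)[OF i]], rule always_eventually, rule allI)
    fix k
    interpret C: weak_fp_cont "s i" "Cb i" "W i" "b i" "h i" "\<lambda>t. \<mu> t i" p Q by (rule fp[OF i])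
    have dens: "us i k \<in> borel_measurable borel" "\<And>x. 0 \<le> us i k x" "\<mu> (t k) i = density lborel (\<lambda>x. ennreal (us i k x))"
      using us(1)[OF i, of k] by (auto simp: is_density_def)
    have "integrable (\<mu> (t k) i) (\<lambda>x. x)"
      by (rule C.integrable_growth[OF t_nonneg, of _ 1 1]) (use abs_le_wt Q1[OF i] in auto)
    then have iu: "integrable lborel (\<lambda>x. x * us i k x)"
      using dens unfolding dens(3) by (subst (asm) integrable_density) (auto simp: mult.commute)
    have mu: "m i (t k) = (\<integral>x. x * us i k x \<partial>lborel)"
      unfolding m_eq dens(3) using dens by (subst integral_density) (auto simp: mult.commute)
    have "norm (m i (t k) - (\<integral>x. x \<partial>\<nu> i)) = \<bar>\<integral>x. x * us i k x - x * v i x \<partial>lborel\<bar>"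
      using iu \<nu>props(4,5)[OF i] mu by simp
    also have "\<dots> \<le> (\<integral>x. \<bar>x * us i k x - x * v i x\<bar> \<partial>lborel)" by (rule integral_abs_bound)
    also have "\<dots> \<le> (\<integral>x. wt x ^ Q * \<bar>us i k x - v i x\<bar> \<partial>lborel)"
    proof (rule integral_mono)
      show "integrable lborel (\<lambda>x. \<bar>x * us i k x - x * v i x\<bar>)"
        using iu \<nu>props(5)[OF i] by (intro integrable_abs Bochner_Integration.integrable_diff)
      show "integrable lborel (\<lambda>x. wt x ^ Q * \<bar>us i k x - v i x\<bar>)" by (rule us(2)[OF i])
      fix x
      have "\<bar>x\<bar> \<le> wt x ^ 1" using abs_le_wt by simp
      also have "\<dots> \<le> wt x ^ Q" by (rule wt_pow_mono) (rule Q1[OF i])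
      finally have "\<bar>x\<bar> * \<bar>us i k x - v i x\<bar> \<le> wt x ^ Q * \<bar>us i k x - v i x\<bar>" by (rule mult_right_mono) simp
      then show "\<bar>x * us i k x - x * v i x\<bar> \<le> wt x ^ Q * \<bar>us i k x - v i x\<bar>"
        by (simp add: abs_mult[symmetric] right_diff_distrib)
    qed
    finally show "norm (m i (t k) - (\<integral>x. x \<partial>\<nu> i)) \<le> (\<integral>x. wt x ^ Q * \<bar>us i k x - v i x\<bar> \<partial>lborel)" .
  qed
  have hs_eq: "hs i = (\<Sum>j = 1..M. a j * \<alpha> i j * (\<integral>x. x \<partial>\<nu> j))" if i: "i \<in> {1..M}" for i
  proof (rule LIMSEQ_unique)
    show "(\<lambda>k. h i (t k)) \<longlonglongrightarrow> hs i" using hs[OF i] by (simp add: t_def)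
    show "(\<lambda>k. h i (t k)) \<longlonglongrightarrow> (\<Sum>j = 1..M. a j * \<alpha> i j * (\<integral>x. x \<partial>\<nu> j))"
      unfolding h_eq by (intro tendsto_sum tendsto_mult_left mlim)
  qed
  have stat: "(\<integral>x. s i * \<phi>2 x - (b i x - hs i) * \<phi>1 x \<partial>\<nu> i) = 0"
    if i: "i \<in> {1..M}" and "\<And>x. (\<phi>1 has_real_derivative \<phi>2 x) (at x)" "continuous_on UNIV \<phi>2"
      "\<And>x. R < \<bar>x\<bar> \<Longrightarrow> \<phi>1 x = 0" "\<And>x. R < \<bar>x\<bar> \<Longrightarrow> \<phi>2 x = 0" for i \<phi>1 \<phi>2 R
  proof -
    interpret Gb: gibbs "s i" "hs i" "W i" "b i" by (rule gibbs[OF i])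
    show ?thesis unfolding \<nu>_def by (rule Gb.gibbs_stationary[of \<phi>1 \<phi>2 R]) (use that in auto)
  qed
  show thesis
    by (rule that[of t us v \<nu> hs]) (fact t_nonneg tlim us \<nu>props hs_eq stat)+
qed

end

section \<open>The theorem\<close>

text \<open>Outside a compact set \<open>v x - (K + 1) * x\<close> is nondecreasing, so on either
  side \<open>v x\<close> lies beyond \<open>(K + 1) * x\<close> up to a constant; the spare
  multiple of \<open>x\<close> absorbs this constant for large \<open>\<bar>x\<bar>\<close>.\<close>

lemma coercive_of_derivative_at_top:
  fixes v v' :: "real \<Rightarrow> real"
  assumes d: "\<And>x. (v has_real_derivative v' x) (at x)" and lim: "filterlim v' at_top at_infinity"
  shows "\<exists>R. \<forall>x. R \<le> \<bar>x\<bar> \<longrightarrow> K * x\<^sup>2 \<le> x * v x"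
proof -
  have "\<forall>\<^sub>F x in at_infinity. K + 1 \<le> v' x" using lim by (simp add: filterlim_at_top)
  then obtain R0 where R0: "\<And>x. R0 \<le> \<bar>x\<bar> \<Longrightarrow> K + 1 \<le> v' x" by (auto simp: eventually_at_infinity)
  define R where "R = max R0 1"
  have R: "1 \<le> R" "\<And>x. R \<le> \<bar>x\<bar> \<Longrightarrow> K + 1 \<le> v' x" using R0 by (auto simp: R_def)
  define g where "g x = v x - (K + 1) * x" for x
  have dg: "(g has_real_derivative v' x - (K + 1)) (at x)" for x
    unfolding g_def[abs_def] by (auto intro!: derivative_eq_intros d)
  have up: "g R \<le> g x" if "R \<le> x" for x
  proof (rule DERIV_nonneg_imp_nondecreasing[OF that])
    fix y assume "R \<le> y" "y \<le> x"
    then have "K + 1 \<le> v' y" using R(1) by (intro R(2)) simp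
    with dg[of y] show "\<exists>D. (g has_real_derivative D) (at y) \<and> 0 \<le> D" by fastforce
  qed
  have low: "g x \<le> g (- R)" if "x \<le> - R" for x
  proof (rule DERIV_nonneg_imp_nondecreasing[OF that])
    fix y assume "x \<le> y" "y \<le> - R"
    then have "K + 1 \<le> v' y" using R(1) by (intro R(2)) simp
    with dg[of y] show "\<exists>D. (g has_real_derivative D) (at y) \<and> 0 \<le> D" by fastforce
  qed
  define R' where "R' = R + \<bar>g R\<bar> + \<bar>g (- R)\<bar>"
  have "K * x\<^sup>2 \<le> x * v x" if x: "R' \<le> \<bar>x\<bar>" for x
  proof -
    have eq: "x * v x - K * x\<^sup>2 = x * (x + g x)" by (simp add: g_def power2_eq_square algebra_simps)
    have "0 \<le> x * (x + g x)"
    proof (cases "0 \<le> x")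
      case True
      have "R \<le> x" "- g R \<le> x" using x True R(1) unfolding R'_def by linarith+
      then have "0 \<le> x + g x" using up[of x] by linarith
      with True show ?thesis by simp
    next
      case False
      have "x \<le> - R" "x \<le> - g (- R)" using x False R(1) unfolding R'_def by linarith+
      then have "x + g x \<le> 0" using low[of x] by linarith
      with False show ?thesis by (intro mult_nonpos_nonpos) auto
    qed
    then show ?thesis using eq by linarith
  qed
  then show ?thesis by blast
qed

lemma test_function_support:
  assumes "test_function \<phi>"
  obtains R where "\<And>x. R < \<bar>x\<bar> \<Longrightarrow> deriv \<phi> x = 0" "\<And>x. R < \<bar>x\<bar> \<Longrightarrow> deriv (deriv \<phi>) x = 0"
proof -
  let ?S = "closure {x. \<phi> x \<noteq> 0}"
  have "compact ?S" using assms by (simp add: test_function_def)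
  then obtain R where R: "\<forall>x\<in>?S. norm x \<le> R" using compact_imp_bounded[of ?S] unfolding bounded_iff by auto
  have out: "\<phi> x = 0" if "R < \<bar>x\<bar>" for x
  proof (rule ccontr)
    assume "\<phi> x \<noteq> 0"
    then have "x \<in> ?S" by (intro subsetD[OF closure_subset]) simp
    then show False using R that by auto
  qed
  have open_out: "open {x :: real. R < \<bar>x\<bar>}" by (intro open_Collect_less continuous_intros)
  have zero: "deriv f x = 0" if f: "\<And>x. R < \<bar>x\<bar> \<Longrightarrow> f x = 0" and x: "R < \<bar>x\<bar>" for f :: "real \<Rightarrow> real" and x
  proof (rule DERIV_imp_deriv, rule has_field_derivative_transform_within_open)
    show "((\<lambda>_. 0) has_real_derivative 0) (at x)" by simp
    show "open {x :: real. R < \<bar>x\<bar>}" by (rule open_out)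
  qed (use f x in auto)
  have 1: "deriv \<phi> x = 0" if "R < \<bar>x\<bar>" for x using zero[OF out that] .
  have 2: "deriv (deriv \<phi>) x = 0" if "R < \<bar>x\<bar>" for x using zero[OF 1 that] .
  show thesis by (rule that[OF 1 2])
qed

text \<open>The derivative of a quadratic interaction is linear, so convolution sees a probability
  measure through its mean only. The part linear in \<open>x\<close> can then be merged with the
  potential.\<close>

lemma drift_quadratic:
  assumes F: "\<And>j x. j \<in> {1..M} \<Longrightarrow> F i j x = \<alpha> i j / 2 * x\<^sup>2"
    and \<nu>: "\<And>j. j \<in> {1..M} \<Longrightarrow> probability_on_reals (\<nu> j)" "\<And>j. j \<in> {1..M} \<Longrightarrow> integrable (\<nu> j) (\<lambda>x. \<bar>x\<bar>)"
  shows "drift M a V F \<nu> i x = deriv (V i) x + (\<Sum>j = 1..M. a j * \<alpha> i j) * x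
    - (\<Sum>j = 1..M. a j * \<alpha> i j * (\<integral>y. y \<partial>\<nu> j))"
proof -
  have "a j * convolve (deriv (F i j)) (\<nu> j) x = a j * \<alpha> i j * x - a j * \<alpha> i j * (\<integral>y. y \<partial>\<nu> j)"
    if j: "j \<in> {1..M}" for j
  proof -
    interpret prob_space "\<nu> j" using \<nu>(1)[OF j] by (simp add: probability_on_reals_def)
    have sets: "sets (\<nu> j) = sets borel" using \<nu>(1)[OF j] by (simp add: probability_on_reals_def)
    note [measurable_cong] = sets
    have "(\<lambda>y :: real. y) \<in> borel_measurable (\<nu> j)" by measurable
    then have int: "integrable (\<nu> j) (\<lambda>y. y)" by (rule Bochner_Integration.integrable_bound[OF \<nu>(2)[OF j]]) simp
    have Fj: "F i j = (\<lambda>x. \<alpha> i j / 2 * x\<^sup>2)" by (rule ext) (rule F[OF j])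
    have "deriv (F i j) z = \<alpha> i j * z" for z
      unfolding Fj by (rule DERIV_imp_deriv) (auto intro!: derivative_eq_intros)
    then have "convolve (deriv (F i j)) (\<nu> j) x = (\<integral>y. \<alpha> i j * x - \<alpha> i j * y \<partial>\<nu> j)"
      by (simp add: convolve_def right_diff_distrib)
    also have "\<dots> = \<alpha> i j * x - \<alpha> i j * (\<integral>y. y \<partial>\<nu> j)" using int by (simp add: prob_space)
    finally show ?thesis by (simp add: right_diff_distrib)
  qed
  then have "(\<Sum>j = 1..M. a j * convolve (deriv (F i j)) (\<nu> j) x)
      = (\<Sum>j = 1..M. a j * \<alpha> i j * x - a j * \<alpha> i j * (\<integral>y. y \<partial>\<nu> j))"
    by (rule sum.cong[OF refl])
  then show ?thesis unfolding drift_def by (simp only: sum_subtractf sum_distrib_right)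
qed

lemma weighted_norm_le:
  assumes "integrable lborel (\<lambda>x. wt x ^ (4 * p\<^sup>2) * \<bar>f x\<bar>)"
  shows "weighted_norm p f \<le> ennreal (2 * (\<integral>x. wt x ^ (4 * p\<^sup>2) * \<bar>f x\<bar> \<partial>lborel))"
proof -
  have "(1 + \<bar>x\<bar> ^ (8 * p\<^sup>2)) * \<bar>f x\<bar> \<le> 2 * (wt x ^ (4 * p\<^sup>2) * \<bar>f x\<bar>)" for x
  proof -
    have "\<bar>x\<bar> ^ (8 * p\<^sup>2) = (x\<^sup>2) ^ (4 * p\<^sup>2)" by (simp add: power_mult[symmetric] power_even_abs)
    also have "\<dots> \<le> wt x ^ (4 * p\<^sup>2)" by (intro power_mono square_le_wt) simp
    finally have "1 + \<bar>x\<bar> ^ (8 * p\<^sup>2) \<le> 2 * wt x ^ (4 * p\<^sup>2)" using wt_pow_ge_1[of x "4 * p\<^sup>2"] by linarith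
    then show ?thesis using mult_right_mono[of _ _ "\<bar>f x\<bar>"] by fastforce
  qed
  then have "weighted_norm p f \<le> (\<integral>\<^sup>+x. ennreal (2 * (wt x ^ (4 * p\<^sup>2) * \<bar>f x\<bar>)) \<partial>lborel)"
    unfolding weighted_norm_def by (intro nn_integral_mono ennreal_leI)
  also have "\<dots> = ennreal (\<integral>x. 2 * (wt x ^ (4 * p\<^sup>2) * \<bar>f x\<bar>) \<partial>lborel)"
    using assms by (intro nn_integral_eq_integral integrable_mult_right) auto
  finally show ?thesis by simp
qed

theorem proposition5p7:
  fixes M p :: nat
    and \<sigma> a :: "nat \<Rightarrow> real"
    and V :: "nat \<Rightarrow> real \<Rightarrow> real"
    and F :: "nat \<Rightarrow> nat \<Rightarrow> real \<Rightarrow> real"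
    and \<alpha> :: "nat \<Rightarrow> nat \<Rightarrow> real"
    and C :: real
    and \<mu> :: "real \<Rightarrow> nat \<Rightarrow> real measure"
  assumes M: "M \<ge> 1"
    and sigma: "\<And>i. i \<in> {1..M} \<Longrightarrow> \<sigma> i > 0"
    and a: "\<And>i. i \<in> {1..M} \<Longrightarrow> a i \<in> {0..1}" "(\<Sum>i = 1..M. a i) = 1"
    and H1: "\<And>i. i \<in> {1..M} \<Longrightarrow> C2 (V i)"
    and H2: "\<And>i. i \<in> {1..M} \<Longrightarrow> filterlim (deriv (deriv (V i))) at_top at_infinity"
    and H3: "p \<ge> 2" "C > 0"
      "\<And>x. (\<Sum>i = 1..M. \<bar>deriv (V i) x\<bar>) \<le> C * (1 + \<bar>x\<bar> ^ (2 * p - 1))"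
    and F: "\<And>i j x. i \<in> {1..M} \<Longrightarrow> j \<in> {1..M} \<Longrightarrow> F i j x = \<alpha> i j / 2 * x\<^sup>2"
    and alpha_sym: "\<And>i j. i \<in> {1..M} \<Longrightarrow> j \<in> {1..M} \<Longrightarrow> \<alpha> i j = \<alpha> j i"
    and alpha_pos: "\<And>i. i \<in> {1..M} \<Longrightarrow> \<alpha> i i > 0"
    and initial_ac: "\<And>i. i \<in> {1..M} \<Longrightarrow> absolutely_continuous lborel (\<mu> 0 i)"
    and initial_entropy: "\<And>i. i \<in> {1..M} \<Longrightarrow> finite_entropy (\<mu> 0 i)"
    and initial_moments: "\<And>i. i \<in> {1..M} \<Longrightarrow> integrable (\<mu> 0 i) (\<lambda>x. \<bar>x\<bar> ^ (8 * p\<^sup>2))"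
    and solution: "solution M \<sigma> a V F \<mu>"
  shows "\<exists>(\<nu> :: nat \<Rightarrow> real measure) (t :: nat \<Rightarrow> real).
           stationary_state M \<sigma> a V F \<nu> \<and>
           (\<forall>k. t k \<ge> 0) \<and> filterlim t at_top sequentially \<and>
           (\<forall>l\<in>{1..M}. converges_weakly p (\<lambda>k. \<mu> (t k) l) (\<nu> l))"
proof -
  \<comment> \<open>Twice this exponent is the order \<open>8 * p\<^sup>2\<close> of the available
    moments, since \<open>wt\<close> is quadratic; \<open>4 * p + 4 \<le> Q\<close> holds from
    \<open>p = 2\<close> on.\<close>
  define Q where "Q = 4 * p\<^sup>2"
  define s where "s i = (\<sigma> i)\<^sup>2 / 2" for i
  define \<kappa> where "\<kappa> i = (\<Sum>j = 1..M. a j * \<alpha> i j)" for i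
  \<comment> \<open>The part of the interaction drift that is linear in \<open>x\<close> is merged
    into the potential. As the second derivative of \<open>V i\<close> tends to infinity, a
    coefficient \<open>\<kappa> i\<close> of either sign leaves \<open>b i\<close> coercive.\<close>
  define W where "W i x = V i x + \<kappa> i / 2 * x\<^sup>2" for i x
  define b where "b i x = deriv (V i) x + \<kappa> i * x" for i x
  define m where "m j t = (\<integral>x. x \<partial>\<mu> t j)" for j t
  define h where "h i t = (\<Sum>j = 1..M. a j * \<alpha> i j * m j t)" for i t
  \<comment> \<open>The factor 2 comes from
    \<open>1 + \<bar>x\<bar> ^ (2 * p - 1) \<le> 2 * wt x ^ p\<close>, the second summand from the
    linear part.\<close>
  define Cb where "Cb i = 2 * C + \<bar>\<kappa> i\<bar>" for i
  have sol_prob: "probability_on_reals (\<mu> t i)" if "0 \<le> t" "i \<in> {1..M}" for t i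
    using solution that unfolding solution_def by blast
  have sol_bound: "\<exists>B. \<forall>t\<in>{0..T}. \<forall>i\<in>{1..M}. integrable (\<mu> t i) (\<lambda>x. \<bar>x\<bar>) \<and> (\<integral>x. \<bar>x\<bar> \<partial>\<mu> t i) \<le> B" if "0 \<le> T" for T
    using solution that unfolding solution_def by blast
  have sol_int: "integrable (\<mu> t i) (\<lambda>x. \<bar>x\<bar>)" if "0 \<le> t" "i \<in> {1..M}" for t i
    using sol_bound[OF that(1)] that by auto
  have drift_b: "drift M a V F (\<mu> t) i x = b i x - h i t" if t: "0 \<le> t" and i: "i \<in> {1..M}" for t i x
    using drift_quadratic[of M F i \<alpha> "\<mu> t" a V x] F[OF i] sol_prob[OF t] sol_int[OF t]
    by (simp add: b_def h_def m_def \<kappa>_def)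
  have wfp: "weak_fp (s i) (Cb i) (W i) (b i) (h i) (\<lambda>t. \<mu> t i) p Q" if i: "i \<in> {1..M}" for i
  proof (rule weak_fp.intro)
    have V1: "(V i has_real_derivative deriv (V i) x) (at x)"
      and V2: "(deriv (V i) has_real_derivative deriv (deriv (V i)) x) (at x)" for x
      using H1[OF i] unfolding C2_def by (auto simp: DERIV_deriv_iff_real_differentiable)
    show "0 < s i" using sigma[OF i] by (simp add: s_def)
    show "(W i has_real_derivative b i x) (at x)" for x
      unfolding W_def[abs_def] b_def by (auto intro!: derivative_eq_intros V1)
    show "continuous_on UNIV (b i)" unfolding b_def[abs_def]
      by (intro continuous_intros) (meson V2 DERIV_isCont continuous_at_imp_continuous_on)
    show "\<bar>b i x\<bar> \<le> Cb i * wt x ^ p" for x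
    proof -
      have pp: "p = Suc (p - 1)" using H3(1) by simp
      have "\<bar>x\<bar> ^ (2 * p - 1) = \<bar>x\<bar> * (x\<^sup>2) ^ (p - 1)"
      proof -
        have "2 * p - 1 = Suc (2 * (p - 1))" using H3(1) by simp
        then show ?thesis by (simp only: power_Suc power_mult power2_abs)
      qed
      also have "\<dots> \<le> wt x * wt x ^ (p - 1)" by (intro mult_mono abs_le_wt power_mono square_le_wt) auto
      also have "\<dots> = wt x ^ p" by (subst (2) pp) simp
      finally have "1 + \<bar>x\<bar> ^ (2 * p - 1) \<le> 2 * wt x ^ p" using wt_pow_ge_1[of x p] by linarith
      then have "C * (1 + \<bar>x\<bar> ^ (2 * p - 1)) \<le> C * (2 * wt x ^ p)" using H3(2) by (intro mult_left_mono) auto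
      moreover have "\<bar>deriv (V i) x\<bar> \<le> (\<Sum>i = 1..M. \<bar>deriv (V i) x\<bar>)"
        using i by (intro member_le_sum[of i _ "\<lambda>i. \<bar>deriv (V i) x\<bar>"]) auto
      ultimately have 1: "\<bar>deriv (V i) x\<bar> \<le> 2 * C * wt x ^ p" using H3(3)[of x] by simp
      have "\<bar>x\<bar> \<le> wt x ^ 1" using abs_le_wt by simp
      also have "\<dots> \<le> wt x ^ p" by (rule wt_pow_mono) (use H3(1) in simp)
      finally have "\<bar>\<kappa> i * x\<bar> \<le> \<bar>\<kappa> i\<bar> * wt x ^ p" unfolding abs_mult by (rule mult_left_mono) simp
      with 1 show ?thesis unfolding b_def Cb_def distrib_right by linarith
    qed
    show "\<exists>R. \<forall>x. R \<le> \<bar>x\<bar> \<longrightarrow> K * x\<^sup>2 \<le> x * b i x" for K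
    proof -
      obtain R where R: "\<And>x. R \<le> \<bar>x\<bar> \<Longrightarrow> (K - \<kappa> i) * x\<^sup>2 \<le> x * deriv (V i) x"
        using coercive_of_derivative_at_top[OF V2 H2[OF i], of "K - \<kappa> i"] by blast
      have "K * x\<^sup>2 \<le> x * b i x" if "R \<le> \<bar>x\<bar>" for x
        using R[OF that] by (simp add: b_def power2_eq_square algebra_simps)
      then show ?thesis by blast
    qed
    show "4 * p + 4 \<le> Q"
    proof -
      have "p * 2 \<le> p * p" using H3(1) by (intro mult_left_mono) auto
      then show ?thesis using H3(1) unfolding Q_def power2_eq_square by linarith
    qed
    show "prob_space (\<mu> t i)" "sets (\<mu> t i) = sets borel" if "0 \<le> t" for t
      using sol_prob[OF that i] by (auto simp: probability_on_reals_def)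
    show "integrable (\<mu> 0 i) (\<lambda>x. wt x ^ Q)"
    proof -
      interpret prob_space "\<mu> 0 i" using sol_prob[OF order_refl i] by (simp add: probability_on_reals_def)
      have sets: "sets (\<mu> 0 i) = sets borel" using sol_prob[OF order_refl i] by (simp add: probability_on_reals_def)
      note [measurable_cong] = sets
      have "integrable (\<mu> 0 i) (\<lambda>x. 2 ^ Q * (1 + \<bar>x\<bar> ^ (8 * p\<^sup>2)))" using initial_moments[OF i] by simp
      then show ?thesis
      proof (rule Bochner_Integration.integrable_bound)
        have "wt x ^ Q \<le> 2 ^ Q * (1 + \<bar>x\<bar> ^ (8 * p\<^sup>2))" for x
        proof -
          have "wt x ^ Q \<le> (2 * max 1 (x\<^sup>2)) ^ Q" by (intro power_mono) (auto simp: wt_def max_def)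
          also have "\<dots> = 2 ^ Q * (max 1 (x\<^sup>2)) ^ Q" by (simp add: power_mult_distrib)
          also have "(max 1 (x\<^sup>2)) ^ Q \<le> 1 + (x\<^sup>2) ^ Q" by (simp add: max_def)
          also have "(x\<^sup>2) ^ Q = \<bar>x\<bar> ^ (8 * p\<^sup>2)" by (simp add: Q_def power_mult[symmetric] power_even_abs)
          finally show ?thesis by simp
        qed
        then show "AE x in \<mu> 0 i. norm (wt x ^ Q) \<le> norm (2 ^ Q * (1 + \<bar>x\<bar> ^ (8 * p\<^sup>2)))"
          by (intro AE_I2) (simp add: abs_mult)
      qed measurable
    qed
    show "\<exists>H. \<forall>t\<in>{0..T}. \<bar>h i t\<bar> \<le> H" for T
    proof (cases "0 \<le> T")
      case True
      from sol_bound[OF this] obtain B where B: "\<And>t j. t \<in> {0..T} \<Longrightarrow> j \<in> {1..M} \<Longrightarrow> (\<integral>x. \<bar>x\<bar> \<partial>\<mu> t j) \<le> B" by blast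
      have "\<bar>h i t\<bar> \<le> (\<Sum>j = 1..M. \<bar>a j * \<alpha> i j\<bar> * B)" if t: "t \<in> {0..T}" for t
      proof -
        have "\<bar>h i t\<bar> \<le> (\<Sum>j = 1..M. \<bar>a j * \<alpha> i j * m j t\<bar>)" unfolding h_def by (rule sum_abs)
        also have "\<dots> \<le> (\<Sum>j = 1..M. \<bar>a j * \<alpha> i j\<bar> * B)"
        proof (rule sum_mono)
          fix j assume j: "j \<in> {1..M}"
          have "\<bar>m j t\<bar> \<le> B" unfolding m_def using integral_abs_bound B[OF t j] by (rule order_trans)
          then show "\<bar>a j * \<alpha> i j * m j t\<bar> \<le> \<bar>a j * \<alpha> i j\<bar> * B"
            unfolding abs_mult[of "a j * \<alpha> i j"] by (rule mult_left_mono) simp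
        qed
        finally show ?thesis .
      qed
      then show ?thesis by blast
    qed auto
    fix \<phi> :: "real \<Rightarrow> real" and t :: real
    assume \<phi>: "test_function \<phi>" and t: "0 \<le> t"
    have rhs: "weak_rhs M \<sigma> a V F (\<mu> r) i \<phi> = (\<integral>x. s i * deriv (deriv \<phi>) x - (b i x - h i r) * deriv \<phi> x \<partial>\<mu> r i)"
      if "r \<in> {0..t}" for r
      using that i by (simp add: weak_rhs_def drift_b s_def)
    have sol: "set_integrable lborel {0..t} (\<lambda>r. weak_rhs M \<sigma> a V F (\<mu> r) i \<phi>)"
      "(\<integral>x. \<phi> x \<partial>\<mu> t i) = (\<integral>x. \<phi> x \<partial>\<mu> 0 i) + (LBINT r:{0..t}. weak_rhs M \<sigma> a V F (\<mu> r) i \<phi>)"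
      using solution \<phi> t i unfolding solution_def by blast+
    have 1: "set_integrable lborel {0..t} (\<lambda>r. \<integral>x. s i * deriv (deriv \<phi>) x - (b i x - h i r) * deriv \<phi> x \<partial>\<mu> r i)"
      using sol(1) by (rule iffD1[OF set_integrable_cong[OF refl refl rhs], rotated])
    have 2: "(LBINT r:{0..t}. weak_rhs M \<sigma> a V F (\<mu> r) i \<phi>)
        = (LBINT r:{0..t}. \<integral>x. s i * deriv (deriv \<phi>) x - (b i x - h i r) * deriv \<phi> x \<partial>\<mu> r i)"
      by (rule set_lebesgue_integral_cong) (use rhs in auto)
    show "set_integrable lborel {0..t} (\<lambda>r. \<integral>x. s i * deriv (deriv \<phi>) x - (b i x - h i r) * deriv \<phi> x \<partial>\<mu> r i) \<and>
        (\<integral>x. \<phi> x \<partial>\<mu> t i) = (\<integral>x. \<phi> x \<partial>\<mu> 0 i)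
          + (LBINT r:{0..t}. \<integral>x. s i * deriv (deriv \<phi>) x - (b i x - h i r) * deriv \<phi> x \<partial>\<mu> r i)"
      using 1 sol(2) unfolding 2 by blast
  qed
  \<comment> \<open>Continuity of the means follows from \<open>weak_fp\<close> and supplies the
    continuous mean field required by \<open>weak_fp_cont\<close>.\<close>
  have m_cont: "continuous_on {0..T} (m j)" if j: "j \<in> {1..M}" for j T
  proof -
    interpret C: weak_fp "s j" "Cb j" "W j" "b j" "h j" "\<lambda>t. \<mu> t j" p Q by (rule wfp[OF j])
    show ?thesis unfolding m_def[abs_def]
      by (rule C.continuous_integral[where C = 1 and k = 1]) (use abs_le_wt C.Q_ge in auto)
  qed
  have fps: "fp_system M p Q s Cb a W b \<alpha> \<mu> m h"
  proof (rule fp_system.intro)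
    show "weak_fp_cont (s i) (Cb i) (W i) (b i) (h i) (\<lambda>t. \<mu> t i) p Q" if i: "i \<in> {1..M}" for i
      by (intro weak_fp_cont.intro weak_fp_cont_axioms.intro wfp i)
         (unfold h_def[abs_def], intro continuous_intros m_cont)
  qed (use a alpha_sym initial_entropy in \<open>auto simp: m_def h_def\<close>)
  interpret fp_system M p Q s Cb a W b \<alpha> \<mu> m h by (rule fps)
  show ?thesis
  proof (rule convergence_along_times)
    fix t :: "nat \<Rightarrow> real" and \<nu> :: "nat \<Rightarrow> real measure" and hs :: "nat \<Rightarrow> real"
      and us :: "nat \<Rightarrow> nat \<Rightarrow> real \<Rightarrow> real" and v :: "nat \<Rightarrow> real \<Rightarrow> real"
    assume t: "\<And>k. 0 \<le> t k" "filterlim t at_top sequentially"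
      and us: "\<And>i k. i \<in> {1..M} \<Longrightarrow> is_density (us i k) (\<mu> (t k) i)"
      and v: "\<And>i. i \<in> {1..M} \<Longrightarrow> is_density (v i) (\<nu> i)"
      and int: "\<And>i k. i \<in> {1..M} \<Longrightarrow> integrable lborel (\<lambda>x. wt x ^ Q * \<bar>us i k x - v i x\<bar>)"
      and lim: "\<And>i. i \<in> {1..M} \<Longrightarrow> (\<lambda>k. \<integral>x. wt x ^ Q * \<bar>us i k x - v i x\<bar> \<partial>lborel) \<longlonglongrightarrow> 0"
      and \<nu>: "\<And>i. i \<in> {1..M} \<Longrightarrow> probability_on_reals (\<nu> i)" "\<And>i. i \<in> {1..M} \<Longrightarrow> integrable (\<nu> i) (\<lambda>x. \<bar>x\<bar>)"
      and hs: "\<And>i. i \<in> {1..M} \<Longrightarrow> hs i = (\<Sum>j = 1..M. a j * \<alpha> i j * (\<integral>x. x \<partial>\<nu> j))"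
      and stat: "\<And>i \<phi>1 \<phi>2 R. i \<in> {1..M} \<Longrightarrow> (\<And>x. (\<phi>1 has_real_derivative \<phi>2 x) (at x)) \<Longrightarrow> continuous_on UNIV \<phi>2 \<Longrightarrow>
        (\<And>x. R < \<bar>x\<bar> \<Longrightarrow> \<phi>1 x = 0) \<Longrightarrow> (\<And>x. R < \<bar>x\<bar> \<Longrightarrow> \<phi>2 x = 0) \<Longrightarrow>
        (\<integral>x. s i * \<phi>2 x - (b i x - hs i) * \<phi>1 x \<partial>\<nu> i) = 0"
    have "stationary_state M \<sigma> a V F \<nu>"
      unfolding stationary_state_def
    proof (intro conjI ballI allI impI)
      fix i \<phi> assume i: "i \<in> {1..M}" and \<phi>: "test_function \<phi>"
      obtain R where R: "\<And>x. R < \<bar>x\<bar> \<Longrightarrow> deriv \<phi> x = 0" "\<And>x. R < \<bar>x\<bar> \<Longrightarrow> deriv (deriv \<phi>) x = 0"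
        using test_function_support[OF \<phi>] by blast
      have d: "(deriv \<phi> has_real_derivative deriv (deriv \<phi>) x) (at x)" for x
        using \<phi> unfolding test_function_def C2_def by (auto simp: DERIV_deriv_iff_real_differentiable)
      have c: "continuous_on UNIV (deriv (deriv \<phi>))" using \<phi> by (simp add: test_function_def C2_def)
      have "drift M a V F \<nu> i x = b i x - hs i" for x
        using drift_quadratic[of M F i \<alpha> \<nu> a V x] F[OF i] \<nu> by (simp add: b_def hs[OF i] \<kappa>_def)
      then show "weak_rhs M \<sigma> a V F \<nu> i \<phi> = 0"
        using stat[OF i d c R] by (simp add: weak_rhs_def s_def)
    qed (use \<nu> in auto)
    moreover have "converges_weakly p (\<lambda>k. \<mu> (t k) l) (\<nu> l)" if l: "l \<in> {1..M}" for l
      unfolding converges_weakly_def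
    proof (intro exI conjI allI)
      show "is_density (us l k) (\<mu> (t k) l)" for k by (rule us[OF l])
      show "is_density (v l) (\<nu> l)" by (rule v[OF l])
      have "(\<lambda>k. ennreal (2 * (\<integral>x. wt x ^ Q * \<bar>us l k x - v l x\<bar> \<partial>lborel))) \<longlonglongrightarrow> ennreal (2 * 0)"
        by (intro tendsto_ennrealI tendsto_mult_left lim l)
      then have "(\<lambda>k. ennreal (2 * (\<integral>x. wt x ^ Q * \<bar>us l k x - v l x\<bar> \<partial>lborel))) \<longlonglongrightarrow> 0" by simp
      then show "(\<lambda>k. weighted_norm p (\<lambda>x. us l k x - v l x)) \<longlonglongrightarrow> 0"
        by (rule tendsto_sandwich[OF _ _ tendsto_const, rotated 2])
           (use weighted_norm_le int[OF l] in \<open>auto simp: Q_def\<close>)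
    qed
    ultimately show ?thesis using t by blast
  qed
qed

end
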